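(* Let $A,B>0$ and let $a_1,a_2,b$ be the spectral functions associated with initial data $u_0$ (see context). Suppose that they satisfy the assumptions of one of the following cases: Case I: $a_1$ has in $\overline{\mathbb{C}^+}\setminus\{-B,B\}$ exactly two zeros, which are simple and purely imaginary, at $k=\mathrm{i}k_1$, $k=\mathrm{i}k_2$, $0<k_1<k_2$, and $a_2$ has no zeros in $\overline{\mathbb{C}^-}$; Case II: $a_1$ has in $\overline{\mathbb{C}^+}\setminus\{-B,B\}$ exactly two zeros, which are simple, at $k=p_1$, $k=-\bar p_1$, $\operatorname{Re}p_1<0$, $\operatorname{Im}p_1>0$, and $a_2$ has no zeros in $\overline{\mathbb{C}^-}$; Case III: $a_1$ has in $\overline{\mathbb{C}^+}\setminus\{-B,B\}$ exactly one zero, which is double, at $k=\mathrm{i}\ell_1$, $\ell_1>0$, and $a_2$ has no zeros in $\overline{\mathbb{C}^-}$. Define $$\varphi_1=\frac1{\pi\mathrm{i}}\,\mathrm{v.p.}\int_{-\infty}^{\infty}\frac{\log\left[\left(\frac{\zeta^2-B^2}{\zeta^2+1}\right)^2(1-b^2(\zeta))\right]}{\zeta-B}\,d\zeta,\qquad e^{\mathrm{i}\varphi_2}=\frac{(B+\mathrm{i})^4}{(B^2+1)^2}e^{\mathrm{i}\operatorname{Im}\varphi_1},\quad\varphi_2\in[0,2\pi),$$ $$d_1=\frac A8\sqrt{2(1-\cos\varphi_2)}\,e^{-\operatorname{Re}\frac{\varphi_1}2},\qquad d_2=d_1^2-B^2+\frac{\sqrt2AB\,e^{-\operatorname{Re}\frac{\varphi_1}2}}{4\sqrt{1-\cos\varphi_2}}\sin\varphi_2\quad\text{for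 }\varphi_2\ne0,$$ $$\varphi(k)=\frac1{2\pi\mathrm{i}}\int_{-\infty}^\infty\frac{\log\left[\left(\frac{\zeta^2-B^2}{\zeta^2+1}\right)^2(1-b^2(\zeta))\right]}{\zeta-k}\,d\zeta,\quad k\in\mathbb{C}\setminus\mathbb{R}.$$ Then: (i) $\varphi_2\ne0$ in Cases I-III; equivalently, $4\arg(B+\mathrm{i})+\operatorname{Im}\varphi_1\ne2\pi n$ for all $n\in\mathbb{Z}$; (ii) $0<d_2<d_1^2$ in Case I, $d_2<0$ in Case II, $d_2=0$ in Case III; (iii) the zeros of $a_1$ are $k_j=d_1+(-1)^j\sqrt{d_2}$, $j=1,2$, in Case I; $p_1=-\sqrt{-d_2}+\mathrm{i}d_1$ in Case II; $\ell_1=d_1$ in Case III; (iv) for $k\in\mathbb{C}^+$ (formulas for $a_1$) and $k\in\mathbb{C}^-$ (formulas for $a_2$): Case I: $a_1(k)=\frac{(k-\mathrm{i}k_1)(k-\mathrm{i}k_2)(k+\mathrm{i})^2}{(k^2-B^2)^2}e^{\varphi(k)}$, $a_2(k)=\frac{(k-\mathrm{i})^2}{(k-\mathrm{i}k_1)(k-\mathrm{i}k_2)}e^{-\varphi(k)}$; Case II: $a_1(k)=\frac{(k-p_1)(k+\bar p_1)(k+\mathrm{i})^2}{(k^2-B^2)^2}e^{\varphi(k)}$, $a_2(k)=\frac{(k-\mathrm{i})^2}{(k-p_1)(k+\bar p_1)}e^{-\varphi(k)}$; Case III: $a_1(k)=\frac{(k-\mathrm{i}\ell_1)^2(k+\mathrm{i})^2}{(k^2-B^2)^2}e^{\varphi(k)}$,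 $a_2(k)=\frac{(k-\mathrm{i})^2}{(k-\mathrm{i}\ell_1)^2}e^{-\varphi(k)}$.
   Context: Notation: $\mathbb{C}^\pm=\{\pm\operatorname{Im}k>0\}$, $\overline{\mathbb{C}^\pm}=\{\pm\operatorname{Im}k\ge0\}$; $X^{(i)}$ is the $i$-th column of $X$; $\sigma_3=\operatorname{diag}(1,-1)$; v.p. is the Cauchy principal value; the logarithm is the branch continuous on $\mathbb{R}$ that tends to $0$ at infinity (its argument extends to a continuous nonvanishing function on $\mathbb{R}$). Spectral functions. The initial data $u_0:\mathbb{R}\to\mathbb{R}$ satisfies $xu_0(x)\in L^1(-\infty,a)$, $u_0(x)-A\cos2Bx\in L^1(a,\infty)$ for all $a\in\mathbb{R}$. Put $U(x)=\begin{pmatrix}0&u_0(x)\\-u_0(-x)&0\end{pmatrix}$, $U_+(x)=\begin{pmatrix}0&A\cos2Bx\\0&0\end{pmatrix}$, $U_-(x)=\begin{pmatrix}0&0\\-A\cos2Bx&0\end{pmatrix}$, $$N_+(x,k)=\begin{pmatrix}1&-\frac{A(B\sin2Bx+\mathrm{i}k\cos2Bx)}{2(k^2-B^2)}\\0&1\end{pmatrix},\quad N_-(x,k)=\begin{pmatrix}1&0\\\frac{A(B\sin2Bx-\mathrm{i}k\cos2Bx)}{2(k^2-B^2)}&1\end{pmatrix},$$ $G_\pm(x,y,k)=N_\pm(x,k)e^{\mathrm{i}k(y-x)\sigma_3}N_\pm^{-1}(y,k)$, and let $\Psi_1,\Psi_2$ solve $$\Psi_1(x,k)=N_-(x,k)+\int_{-\infty}^xG_-(x,y,k)(U-U_-)(y)\Psi_1(y,k)e^{\mathrm{i}k(x-y)\sigma_3}dy,$$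 $$\Psi_2(x,k)=N_+(x,k)-\int_x^\infty G_+(x,y,k)(U-U_+)(y)\Psi_2(y,k)e^{\mathrm{i}k(x-y)\sigma_3}dy,$$ read column by column ($\Psi_1^{(1)},\Psi_2^{(2)}$ for $k\in\overline{\mathbb{C}^+}\setminus\{\pm B\}$; $\Psi_1^{(2)},\Psi_2^{(1)}$ for $k\in\overline{\mathbb{C}^-}$). Then $a_1(k)=\det(\Psi_1^{(1)},\Psi_2^{(2)})(0,k)$, $k\in\overline{\mathbb{C}^+}\setminus\{\pm B\}$; $a_2(k)=\det(\Psi_2^{(1)},\Psi_1^{(2)})(0,k)$, $k\in\overline{\mathbb{C}^-}$; $b(k)=\det(\Psi_2^{(1)},\Psi_1^{(1)})(0,k)$, $k\in\mathbb{R}\setminus\{\pm B\}$. *)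

theory Defs
  imports "HOL-Complex_Analysis.Complex_Analysis"
begin

definition admissible_data :: "real \<Rightarrow> real \<Rightarrow> (real \<Rightarrow> real) \<Rightarrow> bool" where
  "admissible_data A B u0 \<longleftrightarrow>
     (\<forall>a. (\<lambda>x. x * u0 x) absolutely_integrable_on {..<a} \<and>
          (\<lambda>x. u0 x - A * cos (2 * B * x)) absolutely_integrable_on {a<..})"

definition mat2 :: "complex \<Rightarrow> complex \<Rightarrow> complex \<Rightarrow> complex \<Rightarrow> complex^2^2" where
  "mat2 p q r s = vector [vector [p, q], vector [r, s]]"

definition U_mat :: "(real \<Rightarrow> real) \<Rightarrow> real \<Rightarrow> complex^2^2" where
  "U_mat u0 x = mat2 0 (u0 x) (- u0 (- x)) 0"

definition U_plus :: "real \<Rightarrow> real \<Rightarrow> real \<Rightarrow> complex^2^2" where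
  "U_plus A B x = mat2 0 (A * cos (2 * B * x)) 0 0"

definition U_minus :: "real \<Rightarrow> real \<Rightarrow> real \<Rightarrow> complex^2^2" where
  "U_minus A B x = mat2 0 0 (- A * cos (2 * B * x)) 0"

definition N_plus :: "real \<Rightarrow> real \<Rightarrow> real \<Rightarrow> complex \<Rightarrow> complex^2^2" where
  "N_plus A B x k =
     mat2 1 (- (of_real A * (of_real (B * sin (2 * B * x)) + \<i> * k * of_real (cos (2 * B * x)))
                / (2 * (k^2 - (of_real B)^2))))
          0 1"

definition N_minus :: "real \<Rightarrow> real \<Rightarrow> real \<Rightarrow> complex \<Rightarrow> complex^2^2" where
  "N_minus A B x k =
     mat2 1 0
          (of_real A * (of_real (B * sin (2 * B * x)) - \<i> * k * of_real (cos (2 * B * x)))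
             / (2 * (k^2 - (of_real B)^2))) 1"

(* exp_sigma3 z is the matrix exponential of z * sigma_3 with sigma_3 = diag(1,-1). *)
definition exp_sigma3 :: "complex \<Rightarrow> complex^2^2" where
  "exp_sigma3 z = mat2 (exp z) 0 0 (exp (- z))"

(* N_plus and N_minus have poles at k = B and k = -B, but in the kernels below these
   singularities are removable; there the kernels take their limit values.  This is what gives
   the second column of Psi_1 and the first column of Psi_2 a meaning at k = B and k = -B. *)
definition G_ext ::
    "real \<Rightarrow> (real \<Rightarrow> complex \<Rightarrow> complex^2^2) \<Rightarrow> real \<Rightarrow> real \<Rightarrow> complex \<Rightarrow> complex^2^2" where
  "G_ext B N x y k =
     (let G = (\<lambda>z. N x z ** exp_sigma3 (\<i> * z * of_real (y - x)) ** matrix_inv (N y z))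
      in if k = of_real B \<or> k = - of_real B then Lim (at k) G else G k)"

definition G_plus :: "real \<Rightarrow> real \<Rightarrow> real \<Rightarrow> real \<Rightarrow> complex \<Rightarrow> complex^2^2" where
  "G_plus A B = G_ext B (N_plus A B)"

definition G_minus :: "real \<Rightarrow> real \<Rightarrow> real \<Rightarrow> real \<Rightarrow> complex \<Rightarrow> complex^2^2" where
  "G_minus A B = G_ext B (N_minus A B)"

definition integrand1 ::
    "real \<Rightarrow> real \<Rightarrow> (real \<Rightarrow> real) \<Rightarrow> (real \<Rightarrow> complex \<Rightarrow> complex^2^2) \<Rightarrow>
     real \<Rightarrow> complex \<Rightarrow> real \<Rightarrow> complex^2^2" where
  "integrand1 A B u0 \<Psi> x k y =
     G_minus A B x y k ** (U_mat u0 y - U_minus A B y) ** \<Psi> y k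
       ** exp_sigma3 (\<i> * k * of_real (x - y))"

definition integrand2 ::
    "real \<Rightarrow> real \<Rightarrow> (real \<Rightarrow> real) \<Rightarrow> (real \<Rightarrow> complex \<Rightarrow> complex^2^2) \<Rightarrow>
     real \<Rightarrow> complex \<Rightarrow> real \<Rightarrow> complex^2^2" where
  "integrand2 A B u0 \<Psi> x k y =
     G_plus A B x y k ** (U_mat u0 y - U_plus A B y) ** \<Psi> y k
       ** exp_sigma3 (\<i> * k * of_real (x - y))"

(* The right factor exp_sigma3 is diagonal, so column j of the integrand only involves
   column j of Psi. *)
definition solves1_col ::
    "real \<Rightarrow> real \<Rightarrow> (real \<Rightarrow> real) \<Rightarrow> (real \<Rightarrow> complex \<Rightarrow> complex^2^2) \<Rightarrow> 2 \<Rightarrow> complex \<Rightarrow> bool" where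
  "solves1_col A B u0 \<Psi> j k \<longleftrightarrow>
     (\<forall>x. (\<lambda>y. column j (integrand1 A B u0 \<Psi> x k y)) absolutely_integrable_on {..x} \<and>
          column j (\<Psi> x k) =
            column j (N_minus A B x k)
              + integral {..x} (\<lambda>y. column j (integrand1 A B u0 \<Psi> x k y)))"

definition solves2_col ::
    "real \<Rightarrow> real \<Rightarrow> (real \<Rightarrow> real) \<Rightarrow> (real \<Rightarrow> complex \<Rightarrow> complex^2^2) \<Rightarrow> 2 \<Rightarrow> complex \<Rightarrow> bool" where
  "solves2_col A B u0 \<Psi> j k \<longleftrightarrow>
     (\<forall>x. (\<lambda>y. column j (integrand2 A B u0 \<Psi> x k y)) absolutely_integrable_on {x..} \<and>
          column j (\<Psi> x k) =
            column j (N_plus A B x k)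
              - integral {x..} (\<lambda>y. column j (integrand2 A B u0 \<Psi> x k y)))"

definition upper_dom :: "real \<Rightarrow> complex set" where
  "upper_dom B = {k. Im k \<ge> 0} - {- of_real B, of_real B}"

definition is_Psi1 ::
    "real \<Rightarrow> real \<Rightarrow> (real \<Rightarrow> real) \<Rightarrow> (real \<Rightarrow> complex \<Rightarrow> complex^2^2) \<Rightarrow> bool" where
  "is_Psi1 A B u0 \<Psi>1 \<longleftrightarrow>
     (\<forall>k\<in>upper_dom B. solves1_col A B u0 \<Psi>1 1 k) \<and>
     (\<forall>k. Im k \<le> 0 \<longrightarrow> solves1_col A B u0 \<Psi>1 2 k)"

definition is_Psi2 ::
    "real \<Rightarrow> real \<Rightarrow> (real \<Rightarrow> real) \<Rightarrow> (real \<Rightarrow> complex \<Rightarrow> complex^2^2) \<Rightarrow> bool" where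
  "is_Psi2 A B u0 \<Psi>2 \<longleftrightarrow>
     (\<forall>k. Im k \<le> 0 \<longrightarrow> solves2_col A B u0 \<Psi>2 1 k) \<and>
     (\<forall>k\<in>upper_dom B. solves2_col A B u0 \<Psi>2 2 k)"

definition det_cols :: "complex^2 \<Rightarrow> complex^2 \<Rightarrow> complex" where
  "det_cols v w = det (transpose (vector [v, w] :: complex^2^2))"

definition spec_a1 ::
    "(real \<Rightarrow> complex \<Rightarrow> complex^2^2) \<Rightarrow> (real \<Rightarrow> complex \<Rightarrow> complex^2^2) \<Rightarrow> complex \<Rightarrow> complex" where
  "spec_a1 \<Psi>1 \<Psi>2 k = det_cols (column 1 (\<Psi>1 0 k)) (column 2 (\<Psi>2 0 k))"

definition spec_a2 ::
    "(real \<Rightarrow> complex \<Rightarrow> complex^2^2) \<Rightarrow> (real \<Rightarrow> complex \<Rightarrow> complex^2^2) \<Rightarrow> complex \<Rightarrow> complex" where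
  "spec_a2 \<Psi>1 \<Psi>2 k = det_cols (column 1 (\<Psi>2 0 k)) (column 2 (\<Psi>1 0 k))"

definition spec_b ::
    "(real \<Rightarrow> complex \<Rightarrow> complex^2^2) \<Rightarrow> (real \<Rightarrow> complex \<Rightarrow> complex^2^2) \<Rightarrow> complex \<Rightarrow> complex" where
  "spec_b \<Psi>1 \<Psi>2 k = det_cols (column 1 (\<Psi>2 0 k)) (column 1 (\<Psi>1 0 k))"

definition case_I ::
    "real \<Rightarrow> (complex \<Rightarrow> complex) \<Rightarrow> (complex \<Rightarrow> complex) \<Rightarrow> real \<Rightarrow> real \<Rightarrow> bool" where
  "case_I B a1 a2 k1 k2 \<longleftrightarrow>
     0 < k1 \<and> k1 < k2 \<and>
     {k \<in> upper_dom B. a1 k = 0} = {\<i> * of_real k1, \<i> * of_real k2} \<and>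
     zorder a1 (\<i> * of_real k1) = 1 \<and> zorder a1 (\<i> * of_real k2) = 1 \<and>
     (\<forall>k. Im k \<le> 0 \<longrightarrow> a2 k \<noteq> 0)"

definition case_II ::
    "real \<Rightarrow> (complex \<Rightarrow> complex) \<Rightarrow> (complex \<Rightarrow> complex) \<Rightarrow> complex \<Rightarrow> bool" where
  "case_II B a1 a2 p1 \<longleftrightarrow>
     Re p1 < 0 \<and> 0 < Im p1 \<and>
     {k \<in> upper_dom B. a1 k = 0} = {p1, - cnj p1} \<and>
     zorder a1 p1 = 1 \<and> zorder a1 (- cnj p1) = 1 \<and>
     (\<forall>k. Im k \<le> 0 \<longrightarrow> a2 k \<noteq> 0)"

definition case_III ::
    "real \<Rightarrow> (complex \<Rightarrow> complex) \<Rightarrow> (complex \<Rightarrow> complex) \<Rightarrow> real \<Rightarrow> bool" where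
  "case_III B a1 a2 l1 \<longleftrightarrow>
     0 < l1 \<and>
     {k \<in> upper_dom B. a1 k = 0} = {\<i> * of_real l1} \<and>
     zorder a1 (\<i> * of_real l1) = 2 \<and>
     (\<forall>k. Im k \<le> 0 \<longrightarrow> a2 k \<noteq> 0)"

(* The branch, continuous on the whole real line (so across the points B and -B, where b is not
   defined) and tending to 0 at both ends, of the logarithm of
   ((zeta^2 - B^2) / (zeta^2 + 1))^2 * (1 - b(zeta)^2).  There is at most one such function. *)
definition log_branch :: "real \<Rightarrow> (complex \<Rightarrow> complex) \<Rightarrow> real \<Rightarrow> complex" where
  "log_branch B b =
     (THE L. continuous_on UNIV L \<and>
        (\<forall>\<zeta>. \<zeta> \<noteq> B \<and> \<zeta> \<noteq> - B \<longrightarrow>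
           exp (L \<zeta>) = of_real (((\<zeta>^2 - B^2) / (\<zeta>^2 + 1))^2) * (1 - (b (of_real \<zeta>))^2)) \<and>
        (L \<longlongrightarrow> 0) at_infinity)"

(* Integrals over the real line are limits over the symmetric intervals [-R, R]: for merely
   integrable data the logarithm above need not decay fast enough at infinity for an absolutely
   convergent integral. *)
definition line_integral :: "(real \<Rightarrow> complex) \<Rightarrow> complex" where
  "line_integral f = Lim at_top (\<lambda>R. integral {- R..R} f)"

definition pv_integral :: "real \<Rightarrow> (real \<Rightarrow> complex) \<Rightarrow> complex" where
  "pv_integral c f =
     Lim at_top (\<lambda>R. Lim (at_right 0) (\<lambda>\<epsilon>. integral {- R..c - \<epsilon>} f + integral {c + \<epsilon>..R} f))"

definition phi_1 :: "real \<Rightarrow> (complex \<Rightarrow> complex) \<Rightarrow> complex" where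
  "phi_1 B b =
     1 / (of_real pi * \<i>) * pv_integral B (\<lambda>\<zeta>. log_branch B b \<zeta> / of_real (\<zeta> - B))"

definition phi :: "real \<Rightarrow> (complex \<Rightarrow> complex) \<Rightarrow> complex \<Rightarrow> complex" where
  "phi B b k =
     1 / (2 * of_real pi * \<i>) * line_integral (\<lambda>\<zeta>. log_branch B b \<zeta> / (of_real \<zeta> - k))"

end

theory Submission
  imports Defs
begin

text \<open>
  Reflection \<open>x \<mapsto> - x\<close> with exchange of components expresses \<open>\<Psi>2\<close> through \<open>\<Psi>1\<close> at \<open>x = 0\<close>, and
  \<open>det \<Psi>1 = 1\<close> gives \<open>a\<^sub>1 a\<^sub>2 = 1 - b\<^sup>2\<close> on the real line. The functions \<open>a\<^sub>2\<close> and
  \<open>(k\<^sup>2 - B\<^sup>2)\<^sup>2 a\<^sub>1\<close> are holomorphic in their half-planes and continuous up to the real line, \<open>a\<^sub>1\<close> and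
  \<open>a\<^sub>2\<close> tend to 1 at infinity, and at \<open>k = B\<close> the regularization of \<open>a\<^sub>1\<close> equals
  \<open>(A\<^sup>2 B\<^sup>2 / 4) a\<^sub>2(B)\<close>. Dividing out the zeros \<open>p\<close> and \<open>q\<close> leaves zero-free functions whose logarithms
  are given by Cauchy integrals; this is the factorization. Its boundary value at \<open>k = B\<close> determines
  \<open>((B - p) (B - q))\<^sup>2\<close> in terms of \<open>\<phi>1\<close>. The sign of the square root is fixed by
  \<open>Im ((B - p) (B - q)) < 0\<close>, and its real and imaginary parts give \<open>p q\<close> and \<open>p + q\<close>.
\<close>

text \<open>Two obstacles shape the proof. The integral equations assert only that their integrands
  are integrable, so the boundedness on which uniqueness rests has to be derived; this is delicate
  at \<open>k = B\<close> and \<open>k = - B\<close>, where the background Green function grows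
  linearly. And the data are barely integrable: one moment of \<open>u0\<close> on the left, none of
  the remainder on the right. Differentiating an exponential in \<open>k\<close> costs a factor of
  the distance, which cannot be paid up to the real line. Everything about the dependence on
  \<open>k\<close> is therefore drawn from one stability estimate of Gronwall type, applied to
  differences and second differences of solutions. The constant
  \<open>A\<^sup>2 B\<^sup>2 / 4\<close> is minus the square of \<open>- \<i> A k / 2\<close>, the
  coefficient of the singular part of the background entry at \<open>k\<^sup>2 = B\<^sup>2\<close>.
  The logarithm decays at no known rate, so its integrals over the line converge only as limits over
  symmetric intervals; closing the contour still works, since the factor \<open>1 / (w - k)\<close>
  makes the closing path contribute at most a constant times the supremum of the logarithm on
  it.\<close>

section \<open>Integrals over half-lines\<close>

text \<open>
  Applied with \<open>W\<close> the indefinite integral of a majorant, this lemma replaces absolute continuity: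
  it yields integration by parts for integrable functions without differentiating almost everywhere.
\<close>

lemma constant_of_quadratic_increments:
  fixes H :: "real \<Rightarrow> 'a::real_normed_vector" and W :: "real \<Rightarrow> real"
  assumes ab: "a \<le> b" and cont: "continuous_on {a..b} W"
    and mono: "\<And>x y. a \<le> x \<Longrightarrow> x \<le> y \<Longrightarrow> y \<le> b \<Longrightarrow> W x \<le> W y"
    and incr: "\<And>x y. a \<le> x \<Longrightarrow> x \<le> y \<Longrightarrow> y \<le> b \<Longrightarrow> norm (H y - H x) \<le> C * (W y - W x)^2"
  shows "H b = H a"
proof -
  \<comment> \<open>\<open>H\<close> is reparametrised by the values of \<open>W\<close>:
    \<open>X s\<close> is any preimage of \<open>s\<close>, and the choice is harmless because
    points with equal \<open>W\<close> have equal \<open>H\<close>. In the variable \<open>s\<close>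
    the increments are quadratic, so the derivative vanishes.\<close>
  define X where "X s = (SOME x. x \<in> {a..b} \<and> W x = s)" for s
  have X: "X s \<in> {a..b} \<and> W (X s) = s" if "s \<in> {W a..W b}" for s
  proof -
    have "\<exists>x\<ge>a. x \<le> b \<and> W x = s"
      using IVT'[of W a s b] that ab cont by auto
    then have "\<exists>x. x \<in> {a..b} \<and> W x = s" by auto
    then show ?thesis unfolding X_def by (rule someI_ex)
  qed
  have HW: "norm (H x - H y) \<le> C * (W x - W y)^2" if "x \<in> {a..b}" "y \<in> {a..b}" for x y
  proof (cases "x \<le> y")
    case True
    then show ?thesis using incr[of x y] that by (simp add: norm_minus_commute power2_commute)
  next
    case False
    then show ?thesis using incr[of y x] that by simp
  qed
  define h where "h s = H (X s)" for s
  have hq: "norm (h s - h t) \<le> C * (s - t)^2" if "s \<in> {W a..W b}" "t \<in> {W a..W b}" for s t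
    using HW[of "X s" "X t"] X[OF that(1)] X[OF that(2)] by (simp add: h_def)
  have der: "(h has_derivative (\<lambda>_. 0)) (at s within {W a..W b})" if s: "s \<in> {W a..W b}" for s
    unfolding has_derivative_within_alt
  proof (intro conjI allI impI)
    show "bounded_linear (\<lambda>_::real. 0::'a)" by (rule bounded_linear_zero)
    fix e :: real assume e: "e > 0"
    show "\<exists>d>0. \<forall>t\<in>{W a..W b}. norm (t - s) < d \<longrightarrow> norm (h t - h s - 0) \<le> e * norm (t - s)"
    proof (intro exI[of _ "e / (\<bar>C\<bar> + 1)"] conjI ballI impI)
      show "e / (\<bar>C\<bar> + 1) > 0" using e by (simp add: add_nonneg_pos)
      fix t assume t: "t \<in> {W a..W b}" and d: "norm (t - s) < e / (\<bar>C\<bar> + 1)"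
      have "(\<bar>C\<bar> + 1) * \<bar>t - s\<bar> \<le> e"
        using d by (simp add: field_simps pos_less_divide_eq add_nonneg_pos)
      then have "((\<bar>C\<bar> + 1) * \<bar>t - s\<bar>) * \<bar>t - s\<bar> \<le> e * \<bar>t - s\<bar>"
        by (intro mult_right_mono) auto
      moreover have "C * (t - s)^2 \<le> (\<bar>C\<bar> + 1) * (t - s)^2"
        by (intro mult_right_mono) auto
      moreover have "(t - s)^2 = \<bar>t - s\<bar> * \<bar>t - s\<bar>" by (simp add: power2_eq_square)
      ultimately have "C * (t - s)^2 \<le> e * \<bar>t - s\<bar>"
        by (simp add: mult.assoc)
      then show "norm (h t - h s - 0) \<le> e * norm (t - s)"
        using hq[OF t s] by simp
    qed
  qed
  have "h (W b) = h (W a)"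
    using has_derivative_zero_unique[OF _ der, of "W b" "W a"] mono[of a b] ab
    by (auto simp: convex_real_interval)
  moreover have "h (W x) = H x" if "x \<in> {a..b}" for x
  proof -
    have "W x \<in> {W a..W b}" using mono that by auto
    then show ?thesis using HW[of "X (W x)" x] X[of "W x"] that by (simp add: h_def)
  qed
  ultimately show ?thesis using ab by auto
qed

section \<open>Additivity, monotonicity and continuity of half-line integrals\<close>

lemma absint_atMost_mono:
  fixes f :: "real \<Rightarrow> 'a::euclidean_space"
  assumes "f absolutely_integrable_on {..b}" "x \<le> b"
  shows "f absolutely_integrable_on {..x}"
  by (rule set_integrable_subset[OF assms(1)]) (use assms(2) in auto)

lemma absint_Icc:
  fixes f :: "real \<Rightarrow> 'a::euclidean_space"
  assumes "f absolutely_integrable_on {..b}" "y \<le> b"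
  shows "f absolutely_integrable_on {x..y}"
  by (rule set_integrable_subset[OF assms(1)]) (use assms(2) in auto)

lemma integral_atMost_diff:
  fixes f :: "real \<Rightarrow> 'a::euclidean_space"
  assumes f: "f absolutely_integrable_on {..b}" and xy: "x \<le> y" "y \<le> b"
  shows "integral {..y} f - integral {..x} f = integral {x..y} f"
proof -
  have "integral ({..x} \<union> {x..y}) f = integral {..x} f + integral {x..y} f"
  proof (rule integral_Un)
    show "f integrable_on {..x}" "f integrable_on {x..y}"
      using absint_atMost_mono[OF f, of x] absint_Icc[OF f, of y x] xy
      by (auto intro: set_lebesgue_integral_eq_integral(1))
    have "{..x} \<inter> {x..y} = {x}" using xy by auto
    then show "negligible ({..x} \<inter> {x..y})" by simp
  qed
  moreover have "{..x} \<union> {x..y} = {..y}" using xy by auto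
  ultimately show ?thesis by simp
qed

lemma continuous_on_integral_atMost:
  fixes f :: "real \<Rightarrow> 'a::euclidean_space"
  assumes f: "f absolutely_integrable_on {..b}"
  shows "continuous_on {..b} (\<lambda>x. integral {..x} f)"
proof -
  \<comment> \<open>Cutting at \<open>min x b\<close> extends the function beyond \<open>b\<close>,
    so that the endpoint becomes an interior point of an open set and continuity can be checked
    pointwise on bounded intervals.\<close>
  have "continuous_on {..<b+1} (\<lambda>x. integral {..min x b} f)"
    unfolding continuous_on_eq_continuous_at[OF open_lessThan]
  proof
    fix x assume x: "x \<in> {..<b+1}"
    define a where "a = min x b - 1"
    have i: "f integrable_on {a..b}"
      using absint_Icc[OF f, of b a] by (auto intro: set_lebesgue_integral_eq_integral(1))
    have "continuous_on {a<..<b+1} (\<lambda>x. integral {..a} f + integral {a..min x b} f)"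
    proof (intro continuous_intros)
      show "continuous_on {a<..<b + 1} (\<lambda>x. integral {a..min x b} f)"
        by (rule continuous_on_compose2[OF indefinite_integral_continuous_1[OF i]])
           (auto intro!: continuous_intros simp: a_def)
    qed
    then have "continuous_on {a<..<b+1} (\<lambda>x. integral {..min x b} f)"
    proof (rule continuous_on_eq)
      fix y assume "y \<in> {a<..<b+1}"
      then show "integral {..a} f + integral {a..min y b} f = integral {..min y b} f"
        using integral_atMost_diff[OF f, of a "min y b"] by (simp add: a_def algebra_simps)
    qed
    then show "isCont (\<lambda>x. integral {..min x b} f) x"
      by (rule continuous_on_interior) (use x in \<open>auto simp: a_def interior_open\<close>)
  qed
  then have "continuous_on {..b} (\<lambda>x. integral {..min x b} f)"
    by (rule continuous_on_subset) auto
  then show ?thesis by (rule continuous_on_eq) auto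
qed

lemma norm_integral_atMost_le:
  fixes f :: "real \<Rightarrow> 'a::euclidean_space" and g :: "real \<Rightarrow> real"
  assumes "f absolutely_integrable_on S" "g absolutely_integrable_on S"
    and "\<And>y. y \<in> S \<Longrightarrow> norm (f y) \<le> g y"
  shows "norm (integral S f) \<le> integral S g"
  using assms by (intro integral_norm_bound_integral) (auto intro: set_lebesgue_integral_eq_integral(1))

lemma integral_mono_absint:
  fixes f g :: "real \<Rightarrow> real"
  assumes "f absolutely_integrable_on S" "g absolutely_integrable_on S"
    and "\<And>y. y \<in> S \<Longrightarrow> f y \<le> g y"
  shows "integral S f \<le> integral S g"
  using assms by (intro integral_le) (auto intro: set_lebesgue_integral_eq_integral(1))

lemma integral_atMost_mono_nonneg:
  fixes f :: "real \<Rightarrow> real"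
  assumes f: "f absolutely_integrable_on {..b}" and xy: "x \<le> y" "y \<le> b"
    and "\<And>t. t \<le> b \<Longrightarrow> 0 \<le> f t"
  shows "integral {..x} f \<le> integral {..y} f"
proof -
  have "0 \<le> integral {x..y} f"
    using absint_Icc[OF f, of y x] xy assms(4)
    by (intro integral_nonneg) (auto intro: set_lebesgue_integral_eq_integral(1))
  then show ?thesis using integral_atMost_diff[OF f xy] by simp
qed

lemma integral_atMost_tendsto_0:
  fixes f :: "real \<Rightarrow> 'a::euclidean_space"
  assumes f: "f absolutely_integrable_on {..b}"
  shows "(\<lambda>n. integral {..b - real n} f) \<longlonglongrightarrow> 0"
proof -
  define g where "g n x = (if x \<in> {..b - real n} then f x else 0)" for n x
  have absf: "f integrable_on {..b}" "(\<lambda>x. norm (f x)) integrable_on {..b}"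
    using f by (auto simp: absolutely_integrable_on_def)
  have gi: "g n integrable_on {..b}" for n
  proof -
    have "f integrable_on {..b - real n}"
      using absint_atMost_mono[OF f, of "b - real n"] by (auto intro: set_lebesgue_integral_eq_integral(1))
    moreover have "{..b - real n} = {..b - real n} \<inter> {..b}" by auto
    ultimately show ?thesis unfolding g_def using integrable_restrict_Int[of "{..b - real n}" f "{..b}"] by simp
  qed
  have "(\<lambda>n. integral {..b} (g n)) \<longlonglongrightarrow> integral {..b} (\<lambda>x. 0::'a)"
  proof (rule dominated_convergence(2)[where h = "\<lambda>x. norm (f x)"])
    show "g n integrable_on {..b}" for n by (rule gi)
    show "norm (g n x) \<le> norm (f x)" for n x by (simp add: g_def)
    fix x :: real
    obtain N :: nat where N: "b - x < real N" using reals_Archimedean2 by blast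
    have "eventually (\<lambda>n. g n x = 0) sequentially"
      by (rule eventually_sequentiallyI[of N]) (use N in \<open>auto simp: g_def\<close>)
    then show "(\<lambda>n. g n x) \<longlonglongrightarrow> 0" by (rule tendsto_eventually)
  qed (use absf in auto)
  moreover have "integral {..b} (g n) = integral {..b - real n} f" for n
  proof -
    have "{..b - real n} = {..b - real n} \<inter> {..b}" by auto
    then show ?thesis unfolding g_def using integral_restrict_Int[of "{..b}" "{..b - real n}" f] by (simp add: Int_commute)
  qed
  ultimately show ?thesis by simp
qed

section \<open>Products, integration by parts and a Gronwall inequality\<close>

lemma absint_continuous_mult:
  fixes f g :: "real \<Rightarrow> complex"
  assumes f: "continuous_on S f" and bd: "\<And>y. y \<in> S \<Longrightarrow> norm (f y) \<le> M" and S: "S \<in> sets lebesgue"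
    and g: "g absolutely_integrable_on S"
  shows "(\<lambda>y. f y * g y) absolutely_integrable_on S"
proof (rule absolutely_integrable_bounded_measurable_product[OF bilinear_times _ S _ g])
  show "f \<in> borel_measurable (lebesgue_on S)"
    by (rule continuous_imp_measurable_on_sets_lebesgue[OF f S])
  show "bounded (f ` S)" using bd by (auto simp: bounded_iff)
qed

lemma absint_continuous_mult_real:
  fixes f g :: "real \<Rightarrow> real"
  assumes f: "continuous_on S f" and bd: "\<And>y. y \<in> S \<Longrightarrow> norm (f y) \<le> M" and S: "S \<in> sets lebesgue"
    and g: "g absolutely_integrable_on S"
  shows "(\<lambda>y. f y * g y) absolutely_integrable_on S"
proof (rule absolutely_integrable_bounded_measurable_product[OF bilinear_times _ S _ g])
  show "f \<in> borel_measurable (lebesgue_on S)"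
    by (rule continuous_imp_measurable_on_sets_lebesgue[OF f S])
  show "bounded (f ` S)" using bd by (auto simp: bounded_iff)
qed

lemma absolutely_integrable_norm_real:
  fixes f :: "real \<Rightarrow> 'a::euclidean_space"
  assumes "f absolutely_integrable_on S"
  shows "(\<lambda>x. norm (f x)) absolutely_integrable_on S"
  using assms by (rule absolutely_integrable_norm[unfolded comp_def])

text \<open>Neither \<open>F\<close> nor \<open>G\<close> is differentiable in general. The defect
  \<open>H\<close>, the product minus the integral, has increments bounded by the square of the
  increment of \<open>W\<close>, the integral of both norms, so it is constant; letting the point
  tend to minus infinity evaluates it as \<open>F0 * G0\<close>.\<close>

lemma integral_by_parts_atMost:
  fixes f g :: "real \<Rightarrow> complex"
  assumes f: "f absolutely_integrable_on {..b}" and g: "g absolutely_integrable_on {..b}"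
    and F: "\<And>x. x \<le> b \<Longrightarrow> F x = F0 + integral {..x} f"
    and G: "\<And>x. x \<le> b \<Longrightarrow> G x = G0 + integral {..x} g"
  shows "(\<lambda>y. f y * G y + F y * g y) absolutely_integrable_on {..b}" (is ?int)
    and "F b * G b = F0 * G0 + integral {..b} (\<lambda>y. f y * G y + F y * g y)"
proof -
  define w where "w y = norm (f y) + norm (g y)" for y
  have fi: "(\<lambda>y. norm (f y)) absolutely_integrable_on {..b}"
    and gi: "(\<lambda>y. norm (g y)) absolutely_integrable_on {..b}"
    using f g by (auto intro: absolutely_integrable_norm_real)
  have wi: "w absolutely_integrable_on {..b}"
    unfolding w_def by (intro set_integral_add(1) fi gi)
  have w0: "0 \<le> w y" for y by (simp add: w_def)
  define W where "W x = integral {..x} w" for x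
  have Wmono: "W x \<le> W y" if "x \<le> y" "y \<le> b" for x y
    unfolding W_def using integral_atMost_mono_nonneg[OF wi that] w0 by simp
  have W0: "0 \<le> W x" if "x \<le> b" for x
    unfolding W_def using absint_atMost_mono[OF wi that] w0
    by (intro integral_nonneg) (auto intro: set_lebesgue_integral_eq_integral(1))
  have Wcont: "continuous_on {..b} W"
    unfolding W_def by (rule continuous_on_integral_atMost[OF wi])
  have Fcont: "continuous_on {..b} F"
  proof -
    have "continuous_on {..b} (\<lambda>x. F0 + integral {..x} f)"
      by (intro continuous_intros continuous_on_integral_atMost[OF f])
    then show ?thesis by (rule continuous_on_eq) (use F in auto)
  qed
  have Gcont: "continuous_on {..b} G"
  proof -
    have "continuous_on {..b} (\<lambda>x. G0 + integral {..x} g)"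
      by (intro continuous_intros continuous_on_integral_atMost[OF g])
    then show ?thesis by (rule continuous_on_eq) (use G in auto)
  qed
  have incr: "norm (integral {x..y} h) \<le> W y - W x"
    if "x \<le> y" "y \<le> b" "h = f \<or> h = g" for x y and h :: "real \<Rightarrow> complex"
  proof -
    have "h absolutely_integrable_on {..b}" using that f g by auto
    then have "norm (integral {x..y} h) \<le> integral {x..y} w"
      using absint_Icc[of b h y x] absint_Icc[OF wi, of y x] that
      by (intro norm_integral_atMost_le) (auto simp: w_def)
    then show ?thesis unfolding W_def using integral_atMost_diff[OF wi that(1,2)] by simp
  qed
  have Fincr: "F y - F x = integral {x..y} f" and Gincr: "G y - G x = integral {x..y} g"
    if "x \<le> y" "y \<le> b" for x y
    using F[of x] F[of y] G[of x] G[of y] that integral_atMost_diff[OF f that] integral_atMost_diff[OF g that]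
    by auto
  have nI: "norm (integral {..x} h) \<le> W b" if "x \<le> b" "h = f \<or> h = g" for x and h :: "real \<Rightarrow> complex"
  proof -
    have "h absolutely_integrable_on {..b}" using that f g by auto
    then have "norm (integral {..x} h) \<le> W x"
      unfolding W_def using absint_atMost_mono[of b h x] absint_atMost_mono[OF wi, of x] that
      by (intro norm_integral_atMost_le) (auto simp: w_def)
    then show ?thesis using Wmono[of x b] that by simp
  qed
  have Fbd: "norm (F x) \<le> norm F0 + W b" and Gbd: "norm (G x) \<le> norm G0 + W b" if "x \<le> b" for x
    using F[OF that] G[OF that] nI[OF that, of f] nI[OF that, of g]
      norm_triangle_ineq[of F0 "integral {..x} f"] norm_triangle_ineq[of G0 "integral {..x} g"] by auto
  have Gf: "(\<lambda>y. G y * f y) absolutely_integrable_on {..b}"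
    by (rule absint_continuous_mult[OF Gcont Gbd _ f]) auto
  have Fg: "(\<lambda>y. F y * g y) absolutely_integrable_on {..b}"
    by (rule absint_continuous_mult[OF Fcont Fbd _ g]) auto
  show int: ?int
    using set_integral_add(1)[OF Gf Fg] by (simp add: mult.commute)
  define k where "k y = f y * G y + F y * g y" for y
  have ki: "k absolutely_integrable_on {..b}" using int by (simp add: k_def[abs_def])
  define H where "H x = F x * G x - integral {..x} k" for x
  have Hincr: "norm (H y - H x) \<le> 3 * (W y - W x)^2" if xy: "x \<le> y" "y \<le> b" for x y
  proof -
    have fi': "f absolutely_integrable_on {x..y}" and gi': "g absolutely_integrable_on {x..y}"
      and ki': "k absolutely_integrable_on {x..y}" and wi': "w absolutely_integrable_on {x..y}"
      using absint_Icc f g ki wi xy by auto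
    let ?D = "W y - W x"
    have D0: "0 \<le> ?D" using Wmono xy by simp
    \<comment> \<open>With \<open>F\<close> and \<open>G\<close> frozen at the left end
      \<open>x\<close>, the first-order terms are exactly the integrals of \<open>f\<close> and
      \<open>g\<close>. What remains is a product of two increments and an integral of an increment
      against \<open>f\<close> or \<open>g\<close>, both of second order.\<close>
    have "H y - H x = F y * G y - F x * G x - integral {x..y} k"
      unfolding H_def integral_atMost_diff[OF ki xy, symmetric] by simp
    also have "\<dots> = (F y - F x) * G x + F x * (G y - G x) + (F y - F x) * (G y - G x)
        - integral {x..y} k" by (simp add: algebra_simps)
    also have "\<dots> = (F y - F x) * (G y - G x) - (integral {x..y} k - (integral {x..y} f * G x + F x * integral {x..y} g))"
      using Fincr[OF xy] Gincr[OF xy] by (simp add: algebra_simps)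
    also have "integral {x..y} k - (integral {x..y} f * G x + F x * integral {x..y} g)
       = integral {x..y} (\<lambda>t. k t - (f t * G x + F x * g t))"
    proof -
      have i: "f integrable_on {x..y}" "g integrable_on {x..y}" "k integrable_on {x..y}"
        using fi' gi' ki' by (auto intro: set_lebesgue_integral_eq_integral(1))
      have j: "(\<lambda>t. f t * G x) integrable_on {x..y}" "(\<lambda>t. F x * g t) integrable_on {x..y}"
        using i by (auto intro: integrable_on_mult_left integrable_on_mult_right)
      show ?thesis
        using integral_diff[OF i(3) integrable_add[OF j]] integral_add[OF j] by simp
    qed
    finally have eq: "H y - H x = (F y - F x) * (G y - G x)
       - integral {x..y} (\<lambda>t. k t - (f t * G x + F x * g t))" .
    have "norm (integral {x..y} (\<lambda>t. k t - (f t * G x + F x * g t))) \<le> integral {x..y} (\<lambda>t. ?D * w t)"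
    proof (rule norm_integral_atMost_le)
      show "(\<lambda>t. k t - (f t * G x + F x * g t)) absolutely_integrable_on {x..y}"
        by (intro set_integral_diff(1) set_integral_add(1) ki' set_integrable_mult_left
            set_integrable_mult_right) (auto intro: fi' gi')
      show "(\<lambda>t. ?D * w t) absolutely_integrable_on {x..y}"
        by (intro set_integrable_mult_right) (auto intro: wi')
      fix t assume t: "t \<in> {x..y}"
      have 1: "norm (G t - G x) \<le> ?D" using incr[of x t g] Gincr[of x t] t xy Wmono[of t y] by auto
      have 2: "norm (F t - F x) \<le> ?D" using incr[of x t f] Fincr[of x t] t xy Wmono[of t y] by auto
      have "k t - (f t * G x + F x * g t) = f t * (G t - G x) + (F t - F x) * g t"
        by (simp add: k_def algebra_simps)
      also have "norm \<dots> \<le> norm (f t) * ?D + ?D * norm (g t)"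
        by (intro norm_triangle_le) (auto simp: norm_mult intro!: add_mono mult_mono 1 2 D0)
      finally show "norm (k t - (f t * G x + F x * g t)) \<le> ?D * w t" by (simp add: w_def algebra_simps)
    qed
    also have "\<dots> = ?D * ?D"
      using integral_atMost_diff[OF wi xy] by (simp add: W_def)
    finally have "norm (integral {x..y} (\<lambda>t. k t - (f t * G x + F x * g t))) \<le> ?D^2"
      by (simp add: power2_eq_square)
    moreover have "norm ((F y - F x) * (G y - G x)) \<le> ?D^2"
      using incr[OF xy, of f] incr[OF xy, of g] Fincr[OF xy] Gincr[OF xy] D0
      by (simp add: norm_mult power2_eq_square mult_mono)
    ultimately have "norm (H y - H x) \<le> ?D^2 + ?D^2"
      unfolding eq by (rule norm_triangle_le_diff[OF add_mono, rotated])
    then show ?thesis by (smt (verit) zero_le_power2)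
  qed
  have const: "H b = H x" if "x \<le> b" for x
    by (rule constant_of_quadratic_increments[OF that, where W = W and C = 3])
       (use Wmono Hincr in \<open>auto intro: continuous_on_subset[OF Wcont]\<close>)
  have "(\<lambda>n. H (b - real n)) \<longlonglongrightarrow> (F0 + 0) * (G0 + 0) - 0"
  proof -
    have "(\<lambda>n. (F0 + integral {..b - real n} f) * (G0 + integral {..b - real n} g) - integral {..b - real n} k)
       \<longlonglongrightarrow> (F0 + 0) * (G0 + 0) - 0"
      by (intro tendsto_intros integral_atMost_tendsto_0 f g ki)
    then show ?thesis by (simp add: H_def F G)
  qed
  moreover have "(\<lambda>n. H (b - real n)) \<longlonglongrightarrow> H b"
    using const[of "b - real _"] by (simp add: tendsto_const)
  ultimately have "H b = F0 * G0" using LIMSEQ_unique by fastforce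
  then show "F b * G b = F0 * G0 + integral {..b} (\<lambda>y. f y * G y + F y * g y)"
    by (simp add: H_def k_def[abs_def] algebra_simps)
qed

text \<open>Formally \<open>w exp (2 W)\<close> is the derivative of \<open>exp (2 W) / 2\<close>.
  The 2 in the exponent is chosen so that integration against \<open>w\<close> returns at most half
  of the weight, the gain on which the iteration in \<open>Gronwall_atMost\<close> rests.\<close>

lemma integral_atMost_exp_weight:
  fixes w :: "real \<Rightarrow> real"
  assumes wi: "w absolutely_integrable_on {..b}" and w0: "\<And>y. y \<le> b \<Longrightarrow> 0 \<le> w y"
    and W: "\<And>x. x \<le> b \<Longrightarrow> W x = integral {..x} w"
  shows "(\<lambda>y. w y * exp (2 * W y)) absolutely_integrable_on {..b}" (is ?int)
    and "integral {..b} (\<lambda>y. w y * exp (2 * W y)) \<le> exp (2 * W b) / 2"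
proof -
  have Wmono: "W x \<le> W y" if "x \<le> y" "y \<le> b" for x y
    using integral_atMost_mono_nonneg[OF wi that] w0 W that by simp
  have Wnn: "0 \<le> W x" if "x \<le> b" for x
    unfolding W[OF that] using absint_atMost_mono[OF wi that] w0 that
    by (intro integral_nonneg) (auto intro: set_lebesgue_integral_eq_integral(1))
  have Wcont: "continuous_on {..b} W"
    by (rule continuous_on_eq[OF continuous_on_integral_atMost[OF wi]]) (simp add: W)
  have "(\<lambda>y. exp (2 * W y) * w y) absolutely_integrable_on {..b}"
    by (rule absint_continuous_mult_real[where M = "exp (2 * W b)", OF _ _ _ wi])
       (auto intro!: continuous_intros Wcont Wmono)
  then show int: ?int by (simp add: mult.commute)
  define k where "k y = w y * exp (2 * W y)" for y
  have ki: "k absolutely_integrable_on {..b}" using int by (simp add: k_def[abs_def])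
  define H where "H x = exp (2 * W x) / 2 - integral {..x} k" for x
  have Hincr: "norm (H y - H x) \<le> (2 * exp (2 * W b)) * (W y - W x)^2" if xy: "x \<le> y" "y \<le> b" for x y
  proof -
    let ?D = "W y - W x"
    have D0: "0 \<le> ?D" using Wmono xy by simp
    have wi': "w absolutely_integrable_on {x..y}" and ki': "k absolutely_integrable_on {x..y}"
      using absint_Icc wi ki xy by auto
    have iw: "integral {x..y} w = ?D" using integral_atMost_diff[OF wi xy] W xy by simp
    have up: "integral {x..y} k \<le> ?D * exp (2 * W y)"
    proof -
      have "integral {x..y} k \<le> integral {x..y} (\<lambda>t. w t * exp (2 * W y))"
        using xy wi' ki' Wmono w0 by (intro integral_mono_absint) (auto simp: k_def mult_left_mono)
      then show ?thesis using iw by simp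
    qed
    have lo: "?D * exp (2 * W x) \<le> integral {x..y} k"
    proof -
      have "integral {x..y} (\<lambda>t. w t * exp (2 * W x)) \<le> integral {x..y} k"
        using xy wi' ki' Wmono w0 by (intro integral_mono_absint) (auto simp: k_def mult_left_mono)
      then show ?thesis using iw by simp
    qed
    \<comment> \<open>Convexity of the exponential puts half of the increment of
      \<open>exp (2 W)\<close> between \<open>?D\<close> times its smaller and \<open>?D\<close>
      times its larger end value. The integral lies between the same bounds, so the two differ by at
      most the gap.\<close>
    have e1: "1 + 2 * ?D \<le> exp (2 * ?D)" by (rule exp_ge_add_one_self)
    have e2: "1 - 2 * ?D \<le> exp (- (2 * ?D))" using exp_ge_add_one_self[of "-(2 * ?D)"] by linarith
    have x1: "exp (2 * W y) = exp (2 * W x) * exp (2 * ?D)" by (simp add: exp_add[symmetric] algebra_simps)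
    have x2: "exp (2 * W x) = exp (2 * W y) * exp (- (2 * ?D))" by (simp add: exp_add[symmetric] algebra_simps)
    have b1: "exp (2 * W x) * (2 * ?D) \<le> exp (2 * W y) - exp (2 * W x)"
      using mult_left_mono[OF e1, of "exp (2 * W x)"] x1 by (simp add: algebra_simps)
    have b2: "exp (2 * W y) - exp (2 * W x) \<le> exp (2 * W y) * (2 * ?D)"
      using mult_left_mono[OF e2, of "exp (2 * W y)"] x2 by (simp add: algebra_simps)
    have Heq: "H y - H x = (exp (2 * W y) - exp (2 * W x)) / 2 - integral {x..y} k"
      unfolding H_def using integral_atMost_diff[OF ki xy] by (simp add: field_simps)
    have "\<bar>H y - H x\<bar> \<le> ?D * (exp (2 * W y) - exp (2 * W x))"
    proof -
      have "\<bar>(E - e) / 2 - I\<bar> \<le> D * (E - e)"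
        if "I \<le> D * E" "D * e \<le> I" "e * (2 * D) \<le> E - e" "E - e \<le> E * (2 * D)" for E e I D :: real
        using that by (auto intro!: abs_leI simp: field_simps)
      then show ?thesis unfolding Heq using up lo b1 b2 by blast
    qed
    also have "\<dots> \<le> ?D * (exp (2 * W y) * (2 * ?D))" by (rule mult_left_mono[OF b2 D0])
    also have "\<dots> \<le> ?D * (exp (2 * W b) * (2 * ?D))"
      using D0 Wmono[OF xy(2)] by (intro mult_left_mono mult_right_mono) auto
    finally show ?thesis by (simp add: power2_eq_square algebra_simps)
  qed
  have const: "H b = H x" if "x \<le> b" for x
    by (rule constant_of_quadratic_increments[OF that, where W = W and C = "2 * exp (2 * W b)"])
       (use Wmono Hincr in \<open>auto intro: continuous_on_subset[OF Wcont]\<close>)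
  have "(\<lambda>n. H (b - real n)) \<longlonglongrightarrow> exp (2 * 0) / 2 - 0"
  proof -
    have "(\<lambda>n. exp (2 * integral {..b - real n} w) / 2 - integral {..b - real n} k) \<longlonglongrightarrow> exp (2 * 0) / 2 - 0"
      by (intro tendsto_intros integral_atMost_tendsto_0 wi ki) auto
    then show ?thesis by (simp add: H_def W)
  qed
  moreover have "(\<lambda>n. H (b - real n)) \<longlonglongrightarrow> H b"
    using const[of "b - real _"] by (simp add: tendsto_const)
  ultimately have "H b = 1/2" using LIMSEQ_unique by fastforce
  then show "integral {..b} (\<lambda>y. w y * exp (2 * W y)) \<le> exp (2 * W b) / 2"
    by (simp add: H_def k_def[abs_def])
qed

text \<open>From \<open>D \<le> m exp (2 W)\<close> the integral inequality gives
  \<open>D \<le> (H + m / 2) exp (2 W)\<close>. Iterating this from the a priori bound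
  \<open>M\<close> converges to the fixed point \<open>2 H\<close> of
  \<open>m \<mapsto> H + m / 2\<close>, the source of the factor 2 in the conclusion.\<close>

lemma Gronwall_atMost:
  fixes w D :: "real \<Rightarrow> real"
  assumes wi: "w absolutely_integrable_on {..b}" and w0: "\<And>y. y \<le> b \<Longrightarrow> 0 \<le> w y"
    and bd: "\<And>x. x \<le> b \<Longrightarrow> D x \<le> M"
    and D: "\<And>x. x \<le> b \<Longrightarrow> (\<lambda>y. w y * D y) absolutely_integrable_on {..x}"
    and ineq: "\<And>x. x \<le> b \<Longrightarrow> D x \<le> H + integral {..x} (\<lambda>y. w y * D y)"
    and H: "0 \<le> H"
  shows "D b \<le> 2 * exp (2 * integral {..b} w) * H"
proof -
  define W where "W x = integral {..x} w" for x
  have Wnn: "0 \<le> W x" if "x \<le> b" for x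
    unfolding W_def using absint_atMost_mono[OF wi that] w0 that
    by (intro integral_nonneg) (auto intro: set_lebesgue_integral_eq_integral(1))
  have E1: "1 \<le> exp (2 * W x)" if "x \<le> b" for x using Wnn[OF that] by simp
  have wexp: "(\<lambda>y. w y * exp (2 * W y)) absolutely_integrable_on {..x}"
    "integral {..x} (\<lambda>y. w y * exp (2 * W y)) \<le> exp (2 * W x) / 2" if "x \<le> b" for x
    using integral_atMost_exp_weight[where b = x and w = w and W = W, OF absint_atMost_mono[OF wi that]] w0 that
    by (auto simp: W_def)
  have step: "D x \<le> (H + m / 2) * exp (2 * W x)"
    if m: "0 \<le> m" "\<And>y. y \<le> b \<Longrightarrow> D y \<le> m * exp (2 * W y)" and x: "x \<le> b" for m x
  proof -
    have "integral {..x} (\<lambda>y. w y * D y) \<le> integral {..x} (\<lambda>y. m * (w y * exp (2 * W y)))"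
    proof (rule integral_mono_absint)
      fix y assume "y \<in> {..x}"
      then have "y \<le> b" using x by simp
      then show "w y * D y \<le> m * (w y * exp (2 * W y))"
        using mult_left_mono[OF m(2) w0, of y] by (simp add: algebra_simps)
    qed (use D[OF x] wexp(1)[OF x] in auto)
    also have "\<dots> \<le> m * (exp (2 * W x) / 2)"
      using mult_left_mono[OF wexp(2)[OF x] m(1)] by simp
    finally have "D x \<le> H + m * (exp (2 * W x) / 2)" using ineq[OF x] by simp
    moreover have "H * 1 \<le> H * exp (2 * W x)" by (rule mult_left_mono[OF E1[OF x] H])
    ultimately show ?thesis by (simp add: algebra_simps)
  qed
  define M' where "M' = max M 0"
  have iter: "\<forall>x\<le>b. D x \<le> (2 * H + M' / 2^n) * exp (2 * W x)" for n
  proof (induction n)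
    case 0
    show ?case
    proof (intro allI impI)
      fix x assume x: "x \<le> b"
      have "D x \<le> M' * 1" using bd[OF x] by (simp add: M'_def)
      also have "\<dots> \<le> (2 * H + M' / 2^0) * exp (2 * W x)"
        using E1[OF x] H by (intro mult_mono) (auto simp: M'_def)
      finally show "D x \<le> (2 * H + M' / 2^0) * exp (2 * W x)" .
    qed
  next
    case (Suc n)
    show ?case
    proof (intro allI impI)
      fix x assume x: "x \<le> b"
      have "D x \<le> (H + (2 * H + M' / 2^n) / 2) * exp (2 * W x)"
        using step[of "2 * H + M' / 2^n" x] Suc x H by (auto simp: M'_def)
      then show "D x \<le> (2 * H + M' / 2^Suc n) * exp (2 * W x)" by (simp add: field_simps)
    qed
  qed
  have "(\<lambda>n. (2 * H + M' / 2^n) * exp (2 * W b)) \<longlonglongrightarrow> (2 * H + 0) * exp (2 * W b)"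
    by (intro tendsto_intros LIMSEQ_divide_realpow_zero) auto
  then have "D b \<le> (2 * H + 0) * exp (2 * W b)"
    by (rule tendsto_lowerbound) (use iter in auto)
  then show ?thesis by (simp add: W_def algebra_simps)
qed

section \<open>Exponential waves\<close>

text \<open>The square of the diagonal exponential: conjugation by \<open>exp_sigma3\<close> fixes
  the diagonal of a matrix and multiplies the off-diagonal entries by such a factor or its
  inverse.\<close>

definition wave :: "complex \<Rightarrow> real \<Rightarrow> complex" where
  "wave z t = exp (2 * \<i> * z * of_real t)"

lemma norm_wave: "norm (wave z t) = exp (- (2 * Im z * t))"
  by (simp add: wave_def)

lemma norm_wave_le_1: "0 \<le> Im z \<Longrightarrow> 0 \<le> t \<Longrightarrow> norm (wave z t) \<le> 1"
  by (simp add: norm_wave)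

lemma wave_add: "wave z (s + t) = wave z s * wave z t"
  by (simp add: wave_def exp_add[symmetric] algebra_simps)

lemma wave_0 [simp]: "wave z 0 = 1"
  by (simp add: wave_def)

lemma continuous_on_wave [continuous_intros]:
  "continuous_on S f \<Longrightarrow> continuous_on S (\<lambda>x. wave z (f x))"
  unfolding wave_def by (intro continuous_intros)

lemma has_field_derivative_wave:
  "((\<lambda>z. wave z t) has_field_derivative 2 * \<i> * of_real t * wave z t) (at z within S)"
  unfolding wave_def by (auto intro!: derivative_eq_intros)

text \<open>Mean value inequality on the convex set \<open>r \<le> Im z\<close>. With
  \<open>r = 0\<close> it reaches the real line at the price of the factor \<open>t\<close>; with
  \<open>r > 0\<close> the exponential absorbs that factor.\<close>

lemma norm_wave_diff:
  assumes r: "0 \<le> r" and "r \<le> Im z" "r \<le> Im z'" "0 \<le> t"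
  shows "norm (wave z t - wave z' t) \<le> 2 * t * exp (- (2 * r * t)) * norm (z - z')"
proof -
  have "norm (wave z t - wave z' t) \<le> (2 * t * exp (- (2 * r * t))) * norm (z - z')"
  proof (rule field_differentiable_bound[where S = "{z. r \<le> Im z}" and f' = "\<lambda>z. 2 * \<i> * of_real t * wave z t"])
    show "convex {z. r \<le> Im z}" by (rule convex_halfspace_Im_ge)
    fix u assume "u \<in> {z. r \<le> Im z}"
    then show "norm (2 * \<i> * of_real t * wave u t) \<le> 2 * t * exp (- (2 * r * t))"
      using assms by (simp add: norm_mult norm_wave mult_left_mono mult_right_mono)
  qed (use assms has_field_derivative_wave in auto)
  then show ?thesis .
qed

lemma mult_exp_minus_le_1: "s * exp (- s) \<le> 1" for s :: real
proof -
  have "s \<le> exp s" using exp_ge_add_one_self[of s] by linarith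
  then show ?thesis by (simp add: exp_minus field_simps)
qed

lemma power2_mult_exp_minus_le_4: "0 \<le> s \<Longrightarrow> s^2 * exp (- s) \<le> 4" for s :: real
proof -
  assume "0 \<le> s"
  then have "0 \<le> s/2 * exp (- (s/2))" by simp
  then have "(s/2 * exp (- (s/2)))^2 \<le> 1"
    using mult_exp_minus_le_1[of "s/2"] by (simp add: abs_square_le_1)
  moreover have "exp (- (s/2))^2 = exp (- s)" by (simp add: power2_eq_square exp_add[symmetric])
  ultimately show ?thesis by (simp add: power_mult_distrib power_divide)
qed

lemma norm_wave_diff_interior:
  assumes r: "0 < r" and "r \<le> Im z" "r \<le> Im z'" "0 \<le> t"
  shows "norm (wave z t - wave z' t) \<le> norm (z - z') / r"
proof -
  have "(2 * t * exp (- (2 * r * t))) * r \<le> 1"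
    using mult_exp_minus_le_1[of "2 * r * t"] by (simp add: algebra_simps)
  then have "2 * t * exp (- (2 * r * t)) \<le> 1 / r" using r by (simp add: pos_le_divide_eq)
  then have "2 * t * exp (- (2 * r * t)) * norm (z - z') \<le> 1 / r * norm (z - z')"
    by (rule mult_right_mono) simp
  with norm_wave_diff[of r z z' t] assms show ?thesis by simp
qed

text \<open>A Taylor remainder uniform in \<open>t\<close>. The margin \<open>2 * r\<close> keeps
  the disc of radius \<open>r\<close> around \<open>z\<close> inside \<open>r \<le> Im u\<close>,
  where the decay absorbs the \<open>t\<^sup>2\<close> of the second derivative. The mean value
  inequality is applied to \<open>g\<close>, the wave minus its linear part.\<close>

lemma norm_wave_remainder:
  assumes r: "0 < r" and z: "2 * r \<le> Im z" and h: "norm h \<le> r" and t: "0 \<le> t"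
  shows "norm (wave (z + h) t - wave z t - h * (2 * \<i> * of_real t * wave z t)) \<le> 4 / r^2 * norm h ^ 2"
proof -
  define g where "g u = wave u t - u * (2 * \<i> * of_real t * wave z t)" for u
  define K where "K = (2 * t)^2 * exp (- (2 * r * t)) * norm h"
  have "norm (g (z + h) - g z) \<le> K * norm ((z + h) - z)"
  proof (rule field_differentiable_bound[where S = "cball z (norm h)"
        and f' = "\<lambda>u. 2 * \<i> * of_real t * wave u t - 2 * \<i> * of_real t * wave z t"])
    show "(g has_field_derivative 2 * \<i> * of_real t * wave u t - 2 * \<i> * of_real t * wave z t)
        (at u within cball z (norm h))" for u
      unfolding g_def by (rule derivative_eq_intros has_field_derivative_wave refl | simp)+
    fix u assume u: "u \<in> cball z (norm h)"
    then have nu: "norm (u - z) \<le> norm h" by (simp add: dist_norm norm_minus_commute)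
    have "\<bar>Im (u - z)\<bar> \<le> norm (u - z)" by (rule abs_Im_le_cmod)
    then have "r \<le> Im u" using nu h z by simp
    then have "norm (wave u t - wave z t) \<le> 2 * t * exp (- (2 * r * t)) * norm (u - z)"
      using norm_wave_diff[of r u z t] r z t by simp
    also have "\<dots> \<le> 2 * t * exp (- (2 * r * t)) * norm h"
      using nu t by (intro mult_left_mono) auto
    finally have "2 * t * norm (wave u t - wave z t) \<le> 2 * t * (2 * t * exp (- (2 * r * t)) * norm h)"
      using t by (intro mult_left_mono) auto
    moreover have "norm (2 * \<i> * of_real t * wave u t - 2 * \<i> * of_real t * wave z t)
        = 2 * t * norm (wave u t - wave z t)"
      using t by (simp add: norm_mult right_diff_distrib[symmetric])
    ultimately show "norm (2 * \<i> * of_real t * wave u t - 2 * \<i> * of_real t * wave z t) \<le> K"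
      unfolding K_def by (simp only: power2_eq_square mult.assoc)
  qed (auto simp: dist_norm)
  moreover have "K \<le> 4 / r^2 * norm h"
  proof -
    have "((2 * t)^2 * exp (- (2 * r * t))) * r^2 \<le> 4"
      using power2_mult_exp_minus_le_4[of "2 * r * t"] r t by (simp add: power_mult_distrib algebra_simps)
    then have "(2 * t)^2 * exp (- (2 * r * t)) \<le> 4 / r^2" using r by (simp add: pos_le_divide_eq)
    then show ?thesis unfolding K_def by (rule mult_right_mono) simp
  qed
  ultimately have "norm (g (z + h) - g z) \<le> 4 / r^2 * norm h * norm h"
    by (smt (verit) add_diff_cancel_left' mult_right_mono norm_ge_zero)
  then show ?thesis by (simp add: g_def power2_eq_square algebra_simps)
qed

text \<open>The coefficients \<open>h'\<close>, \<open>- h\<close> and \<open>h - h'\<close>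
  annihilate both the value and the linear term of the Taylor expansion at \<open>z\<close>, so that
  only two remainders survive.\<close>

lemma norm_wave_second_difference:
  assumes r: "0 < r" and z: "2 * r \<le> Im z" and h: "norm h \<le> r" "norm h' \<le> r" and t: "0 \<le> t"
  shows "norm (h' * wave (z + h) t + (- h) * wave (z + h') t + (h - h') * wave z t)
      \<le> 4 / r^2 * (norm h * norm h' * (norm h + norm h'))"
proof -
  let ?D = "2 * \<i> * of_real t * wave z t"
  have "norm (h' * (wave (z + h) t - wave z t - h * ?D) - h * (wave (z + h') t - wave z t - h' * ?D))
     \<le> norm h' * (4 / r^2 * norm h ^ 2) + norm h * (4 / r^2 * norm h' ^ 2)"
    unfolding norm_mult[symmetric]
    by (intro norm_triangle_le_diff add_mono)
       (simp_all only: norm_mult mult_left_mono[OF norm_wave_remainder[OF r z h(1) t]]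
         mult_left_mono[OF norm_wave_remainder[OF r z h(2) t]] norm_ge_zero)
  then show ?thesis by (simp add: algebra_simps power2_eq_square)
qed

text \<open>Dividing by \<open>h * h'\<close> turns the hypothesis into a Cauchy condition on the
  difference quotients as \<open>h\<close> tends to 0. Their limit exists by completeness, so no
  candidate for the derivative has to be supplied.\<close>

lemma field_differentiable_of_second_differences:
  fixes F :: "complex \<Rightarrow> complex"
  assumes r: "0 < r"
    and est: "\<And>h h'. norm h \<le> r \<Longrightarrow> norm h' \<le> r \<Longrightarrow>
       norm (h' * (F (z + h) - F z) - h * (F (z + h') - F z)) \<le> C * (norm h * norm h' * (norm h + norm h'))"
  shows "F field_differentiable at z"
proof -
  define Q where "Q h = (F (z + h) - F z) / h" for h
  have Q: "norm (Q h - Q h') \<le> C * (norm h + norm h')"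
    if "norm h \<le> r" "norm h' \<le> r" "h \<noteq> 0" "h' \<noteq> 0" for h h'
  proof -
    have "norm (h * h') * norm (Q h - Q h') = norm (h' * (F (z + h) - F z) - h * (F (z + h') - F z))"
    proof -
      have "h * h' * (Q h - Q h') = h' * (h * Q h) - h * (h' * Q h')" by (simp add: algebra_simps)
      also have "\<dots> = h' * (F (z + h) - F z) - h * (F (z + h') - F z)" using that by (simp add: Q_def)
      finally show ?thesis by (simp only: norm_mult[symmetric])
    qed
    also have "\<dots> \<le> norm (h * h') * (C * (norm h + norm h'))"
      using est[OF that(1,2)] by (simp add: norm_mult algebra_simps)
    finally show ?thesis using that by (simp add: norm_mult)
  qed
  define s where "s n = complex_of_real (r / (real n + 1))" for n
  have s: "norm (s n) \<le> r" "s n \<noteq> 0" "norm (s n) = r / (real n + 1)" for n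
    using r by (auto simp: s_def norm_divide field_simps simp del: of_real_add)
  have s0: "(\<lambda>n. norm (s n)) \<longlonglongrightarrow> 0"
  proof -
    have "(\<lambda>n. r * inverse (real (Suc n))) \<longlonglongrightarrow> r * 0"
      by (intro tendsto_mult tendsto_const LIMSEQ_inverse_real_of_nat)
    then show ?thesis unfolding s(3) by (simp add: divide_inverse add.commute)
  qed
  have C0: "0 \<le> C"
    using Q[of "s 0" "s 0"] s r by (simp add: zero_le_mult_iff)
  have "Cauchy (\<lambda>n. Q (s n))"
  proof (rule metric_CauchyI)
    fix e :: real assume e: "e > 0"
    have "(\<lambda>n. C * norm (s n)) \<longlonglongrightarrow> C * 0" by (intro tendsto_intros s0)
    then have "eventually (\<lambda>n. C * norm (s n) < e / 2) sequentially"
      using e by (intro order_tendstoD) auto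
    then obtain N where N: "\<And>n. n \<ge> N \<Longrightarrow> C * norm (s n) < e / 2"
      by (auto simp: eventually_sequentially)
    have "dist (Q (s m)) (Q (s n)) < e" if "m \<ge> N" "n \<ge> N" for m n
      using Q[OF s(1) s(1) s(2) s(2), of m n] N[OF that(1)] N[OF that(2)]
      by (simp add: dist_norm algebra_simps)
    then show "\<exists>M. \<forall>m\<ge>M. \<forall>n\<ge>M. dist (Q (s m)) (Q (s n)) < e" by blast
  qed
  then obtain L where L: "(\<lambda>n. Q (s n)) \<longlonglongrightarrow> L" using Cauchy_convergent convergent_def by blast
  have QL: "norm (Q h - L) \<le> C * norm h" if "norm h \<le> r" "h \<noteq> 0" for h
  proof (rule LIMSEQ_le)
    show "(\<lambda>n. norm (Q h - Q (s n))) \<longlonglongrightarrow> norm (Q h - L)" by (intro tendsto_intros L)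
    show "(\<lambda>n. C * (norm h + norm (s n))) \<longlonglongrightarrow> C * norm h"
      using tendsto_mult[OF tendsto_const[of C] tendsto_add[OF tendsto_const[of "norm h"] s0]] by simp
    show "\<exists>N. \<forall>n\<ge>N. norm (Q h - Q (s n)) \<le> C * (norm h + norm (s n))"
      using Q[OF that(1) s(1) that(2) s(2)] by blast
  qed
  have "Q \<midarrow>0\<rightarrow> L"
  proof (rule LIM_zero_cancel, rule Lim_null_comparison)
    show "eventually (\<lambda>h. norm (Q h - L) \<le> C * norm h) (at 0)"
      unfolding eventually_at by (intro exI[of _ r]) (use r QL in auto)
    show "((\<lambda>h. C * norm h) \<longlongrightarrow> 0) (at 0)"
      by (intro tendsto_mult_right_zero tendsto_norm_zero tendsto_ident_at)
  qed
  then have "(F has_field_derivative L) (at z)" by (simp add: DERIV_def Q_def[abs_def])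
  then show ?thesis by (auto simp: field_differentiable_def)
qed

section \<open>A Volterra system with a spectral parameter\<close>

lemma absint_eq:
  fixes f g :: "real \<Rightarrow> 'a::euclidean_space"
  assumes "f absolutely_integrable_on S" "\<And>x. x \<in> S \<Longrightarrow> f x = g x"
  shows "g absolutely_integrable_on S"
  using assms set_integrable_cong[of lebesgue lebesgue S S f g] by auto

text \<open>The class in which the Volterra system has unique solutions. The half-line ends at 0
  because the spectral functions are read off there.\<close>

definition bdd_cont :: "(real \<Rightarrow> complex) \<Rightarrow> bool" where
  "bdd_cont u \<longleftrightarrow> continuous_on {..0} u \<and> (\<exists>M. \<forall>x\<le>0. norm (u x) \<le> M)"

lemma bdd_cont_diff: "bdd_cont u \<Longrightarrow> bdd_cont v \<Longrightarrow> bdd_cont (\<lambda>x. u x - v x)"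
  unfolding bdd_cont_def
  by (auto intro!: continuous_intros) (meson add_mono norm_triangle_le_diff)

lemma bdd_cont_cmult: "bdd_cont u \<Longrightarrow> bdd_cont (\<lambda>x. c * u x)"
  unfolding bdd_cont_def
  by (auto intro!: continuous_intros simp: norm_mult) (metis mult_left_mono norm_ge_zero)

text \<open>
  The kernels are constrained only through three-term combinations, which are dominated by the same
  combination of waves. Two terms give continuity in the spectral parameter, three terms control its
  second differences, hence holomorphy, with one moment of \<open>p\<close> and none of \<open>q\<close>.
\<close>

locale volterra =
  fixes p q :: "real \<Rightarrow> real" and A :: real
    and E12 E21 E22 :: "complex \<Rightarrow> real \<Rightarrow> real \<Rightarrow> complex"
  assumes A0: "0 \<le> A"
    and p_int: "p absolutely_integrable_on {..0}"
    and yp_int: "(\<lambda>y. y * p y) absolutely_integrable_on {..0}"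
    and q_int: "q absolutely_integrable_on {..0}"
    and comb12: "\<lbrakk>0 \<le> Im z1; 0 \<le> Im z2; 0 \<le> Im z3; y \<le> x; x \<le> 0;
        \<And>t. 0 \<le> t \<Longrightarrow> t \<le> x - y \<Longrightarrow> norm (c1 * wave z1 t + c2 * wave z2 t + c3 * wave z3 t) \<le> \<beta>\<rbrakk>
        \<Longrightarrow> norm (c1 * E12 z1 x y + c2 * E12 z2 x y + c3 * E12 z3 x y) \<le> \<beta>"
    and comb21: "\<lbrakk>0 \<le> Im z1; 0 \<le> Im z2; 0 \<le> Im z3; y \<le> x; x \<le> 0;
        \<And>t. 0 \<le> t \<Longrightarrow> t \<le> x - y \<Longrightarrow> norm (c1 * wave z1 t + c2 * wave z2 t + c3 * wave z3 t) \<le> \<beta>\<rbrakk>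
        \<Longrightarrow> norm (c1 * E21 z1 x y + c2 * E21 z2 x y + c3 * E21 z3 x y) \<le> \<beta>"
    and comb22: "\<lbrakk>0 \<le> Im z1; 0 \<le> Im z2; 0 \<le> Im z3; y \<le> x; x \<le> 0;
        \<And>t. 0 \<le> t \<Longrightarrow> t \<le> x - y \<Longrightarrow> norm (c1 * wave z1 t + c2 * wave z2 t + c3 * wave z3 t) \<le> \<beta>\<rbrakk>
        \<Longrightarrow> norm (c1 * E22 z1 x y + c2 * E22 z2 x y + c3 * E22 z3 x y) \<le> \<beta> * (A * (x - y))"
    and cont12: "0 \<le> Im z \<Longrightarrow> x \<le> 0 \<Longrightarrow> continuous_on {..x} (E12 z x)"
    and cont21: "0 \<le> Im z \<Longrightarrow> x \<le> 0 \<Longrightarrow> continuous_on {..x} (E21 z x)"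
    and cont22: "0 \<le> Im z \<Longrightarrow> x \<le> 0 \<Longrightarrow> continuous_on {..x} (E22 z x)"
begin

text \<open>One majorant for both components. The kernel \<open>E22\<close> may grow like
  \<open>A * (x - y)\<close>, which for \<open>y \<le> x \<le> 0\<close> is at most
  \<open>- A * y\<close>; this growth is charged to the first moment of \<open>p\<close>.\<close>

definition w :: "real \<Rightarrow> real" where
  "w y = \<bar>q y\<bar> + (1 - A * y) * \<bar>p y\<bar>"

definition wtot :: real where "wtot = integral {..0} w"

definition T1 :: "complex \<Rightarrow> (real \<Rightarrow> complex) \<Rightarrow> real \<Rightarrow> complex" where
  "T1 z u2 x = integral {..x} (\<lambda>y. E12 z x y * of_real (p y) * u2 y)"

definition T2 :: "complex \<Rightarrow> (real \<Rightarrow> complex) \<Rightarrow> (real \<Rightarrow> complex) \<Rightarrow> real \<Rightarrow> complex" where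
  "T2 z u1 u2 x = integral {..x} (\<lambda>y. E21 z x y * of_real (q y) * u1 y + E22 z x y * of_real (p y) * u2 y)"

definition sol :: "complex \<Rightarrow> (real \<Rightarrow> complex) \<Rightarrow> (real \<Rightarrow> complex) \<Rightarrow> (real \<Rightarrow> complex) \<Rightarrow> (real \<Rightarrow> complex) \<Rightarrow> bool" where
  "sol z f1 f2 v1 v2 \<longleftrightarrow> bdd_cont v1 \<and> bdd_cont v2 \<and>
     (\<forall>x\<le>0. v1 x = f1 x + T1 z v2 x \<and> v2 x = f2 x + T2 z v1 v2 x)"

lemma w_nonneg: "y \<le> 0 \<Longrightarrow> 0 \<le> w y"
  using mult_nonneg_nonpos[OF A0, of y] by (simp add: w_def)

lemma w_int: "w absolutely_integrable_on {..0}"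
proof -
  have "(\<lambda>y. \<bar>q y\<bar> + (\<bar>p y\<bar> + A * \<bar>y * p y\<bar>)) absolutely_integrable_on {..0}"
    using absolutely_integrable_norm_real[OF p_int] absolutely_integrable_norm_real[OF q_int]
      absolutely_integrable_norm_real[OF yp_int]
    by (intro set_integral_add(1) set_integrable_mult_right) auto
  then show ?thesis
    by (rule absint_eq) (auto simp: w_def abs_mult algebra_simps)
qed

lemma wtot_nonneg: "0 \<le> wtot"
  unfolding wtot_def using w_int w_nonneg
  by (intro integral_nonneg) (auto intro: set_lebesgue_integral_eq_integral(1))

text \<open>The combination hypotheses with coefficients 1, 0, 0 and the bound 1 for a single
  wave.\<close>

lemma kernel_bounds:
  assumes "0 \<le> Im z" "y \<le> x" "x \<le> 0"
  shows "norm (E12 z x y) \<le> 1" "norm (E21 z x y) \<le> 1" "norm (E22 z x y) \<le> A * (x - y)"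
  using comb12[of z z z y x 1 0 0 1] comb21[of z z z y x 1 0 0 1] comb22[of z z z y x 1 0 0 1]
    assms norm_wave_le_1[of z] by auto

lemma p_int_c: "(\<lambda>y. complex_of_real (p y)) absolutely_integrable_on {..0}"
  and q_int_c: "(\<lambda>y. complex_of_real (q y)) absolutely_integrable_on {..0}"
  and Ap_int_c: "(\<lambda>y. complex_of_real ((1 - A * y) * p y)) absolutely_integrable_on {..0}"
proof -
  have *: "(\<lambda>y. complex_of_real (f y)) absolutely_integrable_on {..0}"
    if "f absolutely_integrable_on {..0}" for f :: "real \<Rightarrow> real"
    using absolutely_integrable_linear[OF that bounded_linear_of_real[where 'a=complex]] by (simp add: comp_def)
  show "(\<lambda>y. complex_of_real (p y)) absolutely_integrable_on {..0}"
    "(\<lambda>y. complex_of_real (q y)) absolutely_integrable_on {..0}" using * p_int q_int by auto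
  have "(\<lambda>y. p y - A * (y * p y)) absolutely_integrable_on {..0}"
    by (intro set_integral_diff(1) set_integrable_mult_right p_int yp_int)
  from *[OF this] show "(\<lambda>y. complex_of_real ((1 - A * y) * p y)) absolutely_integrable_on {..0}"
    by (simp add: algebra_simps)
qed

lemma integrable_E12:
  assumes z: "0 \<le> Im z" and x: "x \<le> 0" and u: "bdd_cont u"
  shows "(\<lambda>y. E12 z x y * of_real (p y) * u y) absolutely_integrable_on {..x}"
proof -
  obtain M where M: "\<And>y. y \<le> 0 \<Longrightarrow> norm (u y) \<le> M" and uc: "continuous_on {..0} u"
    using u by (auto simp: bdd_cont_def)
  have "(\<lambda>y. (E12 z x y * u y) * of_real (p y)) absolutely_integrable_on {..x}"
  proof (rule absint_continuous_mult[where M = "1 * M"])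
    show "continuous_on {..x} (\<lambda>y. E12 z x y * u y)"
      using cont12[OF z x] x by (intro continuous_intros continuous_on_subset[OF uc]) auto
    show "norm (E12 z x y * u y) \<le> 1 * M" if "y \<in> {..x}" for y
      unfolding norm_mult using kernel_bounds[OF z _ x, of y] M[of y] that x by (intro mult_mono) auto
  qed (use absint_atMost_mono[OF p_int_c x] in auto)
  then show ?thesis by (simp add: mult_ac)
qed

lemma integrable_E21:
  assumes z: "0 \<le> Im z" and x: "x \<le> 0" and u: "bdd_cont u"
  shows "(\<lambda>y. E21 z x y * of_real (q y) * u y) absolutely_integrable_on {..x}"
proof -
  obtain M where M: "\<And>y. y \<le> 0 \<Longrightarrow> norm (u y) \<le> M" and uc: "continuous_on {..0} u"
    using u by (auto simp: bdd_cont_def)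
  have "(\<lambda>y. (E21 z x y * u y) * of_real (q y)) absolutely_integrable_on {..x}"
  proof (rule absint_continuous_mult[where M = "1 * M"])
    show "continuous_on {..x} (\<lambda>y. E21 z x y * u y)"
      using cont21[OF z x] x by (intro continuous_intros continuous_on_subset[OF uc]) auto
    show "norm (E21 z x y * u y) \<le> 1 * M" if "y \<in> {..x}" for y
      unfolding norm_mult using kernel_bounds[OF z _ x, of y] M[of y] that x by (intro mult_mono) auto
  qed (use absint_atMost_mono[OF q_int_c x] in auto)
  then show ?thesis by (simp add: mult_ac)
qed

text \<open>Unlike the other two kernels \<open>E22\<close> is unbounded. Dividing it by
  \<open>1 - A * y\<close> and giving that factor to \<open>p\<close> restores a bounded continuous
  multiplier of an integrable function.\<close>

lemma integrable_E22:
  assumes z: "0 \<le> Im z" and x: "x \<le> 0" and u: "bdd_cont u"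
  shows "(\<lambda>y. E22 z x y * of_real (p y) * u y) absolutely_integrable_on {..x}"
proof -
  obtain M where M: "\<And>y. y \<le> 0 \<Longrightarrow> norm (u y) \<le> M" and uc: "continuous_on {..0} u"
    using u by (auto simp: bdd_cont_def)
  have pos: "0 < 1 - A * y" if "y \<le> 0" for y
    using mult_nonneg_nonpos[OF A0 that] by simp
  have "(\<lambda>y. (E22 z x y * u y / of_real (1 - A * y)) * of_real ((1 - A * y) * p y)) absolutely_integrable_on {..x}"
  proof (rule absint_continuous_mult[where M = M])
    have "complex_of_real (1 - A * y) \<noteq> 0" if "y \<le> x" for y
      using pos[of y] that x unfolding of_real_eq_0_iff by simp
    then show "continuous_on {..x} (\<lambda>y. E22 z x y * u y / of_real (1 - A * y))"
      using cont22[OF z x] x by (intro continuous_intros continuous_on_subset[OF uc]) auto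
    show "norm (E22 z x y * u y / of_real (1 - A * y)) \<le> M" if y: "y \<in> {..x}" for y
    proof -
      have y0: "y \<le> 0" using y x by simp
      have "A * x \<le> 0" using A0 x by (simp add: mult_nonneg_nonpos)
      then have "norm (E22 z x y) \<le> 1 - A * y"
        using kernel_bounds(3)[OF z _ x, of y] y by (simp add: algebra_simps)
      then have "norm (E22 z x y) * norm (u y) \<le> (1 - A * y) * M"
        using M[OF y0] pos[OF y0] by (intro mult_mono) auto
      then show ?thesis
        using pos[OF y0] by (simp add: norm_mult norm_divide pos_divide_le_eq mult.commute del: of_real_diff of_real_mult)
    qed
  qed (use absint_atMost_mono[OF Ap_int_c x] in auto)
  moreover have "(E22 z x y * u y / of_real (1 - A * y)) * of_real ((1 - A * y) * p y) = E22 z x y * of_real (p y) * u y"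
    if "y \<in> {..x}" for y
    using pos[of y] that x by (simp del: of_real_diff)
  ultimately show ?thesis
    by (rule absint_eq) auto
qed

lemma T1_diff:
  assumes "0 \<le> Im z" "x \<le> 0" "bdd_cont u" "bdd_cont v"
  shows "T1 z (\<lambda>y. u y - v y) x = T1 z u x - T1 z v x"
proof -
  have "T1 z u x - T1 z v x = integral {..x} (\<lambda>y. E12 z x y * of_real (p y) * u y - E12 z x y * of_real (p y) * v y)"
    unfolding T1_def
    by (rule integral_diff[symmetric]) (intro set_lebesgue_integral_eq_integral(1) integrable_E12 assms)+
  then show ?thesis unfolding T1_def by (simp add: algebra_simps)
qed

lemma T2_diff:
  assumes "0 \<le> Im z" "x \<le> 0" "bdd_cont u1" "bdd_cont v1" "bdd_cont u2" "bdd_cont v2"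
  shows "T2 z (\<lambda>y. u1 y - v1 y) (\<lambda>y. u2 y - v2 y) x = T2 z u1 u2 x - T2 z v1 v2 x"
proof -
  have "T2 z u1 u2 x - T2 z v1 v2 x = integral {..x} (\<lambda>y.
     (E21 z x y * of_real (q y) * u1 y + E22 z x y * of_real (p y) * u2 y) -
     (E21 z x y * of_real (q y) * v1 y + E22 z x y * of_real (p y) * v2 y))"
    unfolding T2_def
    by (rule integral_diff[symmetric])
       (intro integrable_add set_lebesgue_integral_eq_integral(1) integrable_E21 integrable_E22 assms)+
  then show ?thesis unfolding T2_def by (simp add: algebra_simps)
qed

lemma T1_cmult: "T1 z (\<lambda>y. c * u y) x = c * T1 z u x"
  unfolding T1_def by (subst integral_mult_right[symmetric]) (simp add: mult_ac)

lemma T2_cmult: "T2 z (\<lambda>y. c * u1 y) (\<lambda>y. c * u2 y) x = c * T2 z u1 u2 x"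
  unfolding T2_def by (subst integral_mult_right[symmetric]) (simp add: algebra_simps)

text \<open>A bound on a combination of waves passes to the same combination of the integral
  operators. The bound may depend on \<open>y\<close>, because \<open>x \<le> 0\<close> confines the
  delays to \<open>t \<le> - y\<close>; this dependence is what allows continuity up to the real
  line without a further moment.\<close>

lemma comb_bound:
  assumes z: "0 \<le> Im z1" "0 \<le> Im z2" "0 \<le> Im z3" and x: "x \<le> 0"
    and u: "bdd_cont u1" "bdd_cont u2"
    and bc: "continuous_on {..0} \<beta>" and bK: "\<And>y. y \<le> 0 \<Longrightarrow> 0 \<le> \<beta> y \<and> \<beta> y \<le> K"
    and b: "\<And>y t. y \<le> 0 \<Longrightarrow> 0 \<le> t \<Longrightarrow> t \<le> - y \<Longrightarrow>
       norm (c1 * wave z1 t + c2 * wave z2 t + c3 * wave z3 t) \<le> \<beta> y"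
  shows "(\<lambda>y. \<beta> y * w y * (norm (u1 y) + norm (u2 y))) absolutely_integrable_on {..0}"
    and "norm (c1 * T1 z1 u2 x + c2 * T1 z2 u2 x + c3 * T1 z3 u2 x)
       + norm (c1 * T2 z1 u1 u2 x + c2 * T2 z2 u1 u2 x + c3 * T2 z3 u1 u2 x)
       \<le> integral {..x} (\<lambda>y. \<beta> y * w y * (norm (u1 y) + norm (u2 y)))"
proof -
  obtain M1 M2 where M: "\<And>y. y \<le> 0 \<Longrightarrow> norm (u1 y) \<le> M1" "\<And>y. y \<le> 0 \<Longrightarrow> norm (u2 y) \<le> M2"
    and uc: "continuous_on {..0} u1" "continuous_on {..0} u2"
    using u by (auto simp: bdd_cont_def)
  have i: "(\<lambda>y. (\<beta> y * norm (u y)) * f y) absolutely_integrable_on {..0}"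
    if f: "f absolutely_integrable_on {..0}" and u: "bdd_cont u" for u f
  proof -
    obtain M where M: "\<And>y. y \<le> 0 \<Longrightarrow> norm (u y) \<le> M" and uc: "continuous_on {..0} u"
      using u by (auto simp: bdd_cont_def)
    show ?thesis
    proof (rule absint_continuous_mult_real[where M = "K * M", OF _ _ _ f])
      show "continuous_on {..0} (\<lambda>y. \<beta> y * norm (u y))" by (intro continuous_intros bc uc)
      show "norm (\<beta> y * norm (u y)) \<le> K * M" if "y \<in> {..0}" for y
        using bK[of y] M[of y] that by (auto simp: abs_mult intro!: mult_mono)
    qed auto
  qed
  have "(\<lambda>y. (\<beta> y * norm (u1 y)) * w y + (\<beta> y * norm (u2 y)) * w y) absolutely_integrable_on {..0}"
    by (intro set_integral_add(1) i w_int u)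
  then show int: "(\<lambda>y. \<beta> y * w y * (norm (u1 y) + norm (u2 y))) absolutely_integrable_on {..0}"
    by (simp add: algebra_simps)
  have pabs: "(\<lambda>y. \<bar>p y\<bar>) absolutely_integrable_on {..0}" "(\<lambda>y. \<bar>q y\<bar>) absolutely_integrable_on {..0}"
    using absolutely_integrable_norm_real[OF p_int] absolutely_integrable_norm_real[OF q_int] by auto
  have ypabs: "(\<lambda>y. A * \<bar>y * p y\<bar>) absolutely_integrable_on {..0}"
    using absolutely_integrable_norm_real[OF yp_int] by (intro set_integrable_mult_right) auto
  note i1 = absint_atMost_mono[OF i[OF pabs(1) u(2)] x]
  note i2 = absint_atMost_mono[OF set_integral_add(1)[OF i[OF pabs(2) u(1)] i[OF ypabs u(2)]] x]
  have b': "norm (c1 * wave z1 t + c2 * wave z2 t + c3 * wave z3 t) \<le> \<beta> y"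
    if "y \<le> x" "0 \<le> t" "t \<le> x - y" for y t using b[of y t] that x by auto
  have t1: "norm (c1 * T1 z1 u2 x + c2 * T1 z2 u2 x + c3 * T1 z3 u2 x)
      \<le> integral {..x} (\<lambda>y. (\<beta> y * norm (u2 y)) * \<bar>p y\<bar>)"
  proof -
    have I: "(\<lambda>y. c * (E12 z x y * of_real (p y) * u2 y)) absolutely_integrable_on {..x}" if "0 \<le> Im z" for c z
      by (intro set_integrable_mult_right) (use integrable_E12[OF that x u(2)] in auto)
    note I' = I[THEN set_lebesgue_integral_eq_integral(1)]
    have "c1 * T1 z1 u2 x + c2 * T1 z2 u2 x + c3 * T1 z3 u2 x
      = integral {..x} (\<lambda>y. c1 * (E12 z1 x y * of_real (p y) * u2 y) + c2 * (E12 z2 x y * of_real (p y) * u2 y)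
           + c3 * (E12 z3 x y * of_real (p y) * u2 y))"
    proof -
      let ?k = "\<lambda>z y. E12 z x y * of_real (p y) * u2 y"
      have "integral {..x} (\<lambda>y. c1 * ?k z1 y + c2 * ?k z2 y + c3 * ?k z3 y)
         = integral {..x} (\<lambda>y. c1 * ?k z1 y + c2 * ?k z2 y) + integral {..x} (\<lambda>y. c3 * ?k z3 y)"
        by (rule integral_add) (intro integrable_add I' z)+
      also have "integral {..x} (\<lambda>y. c1 * ?k z1 y + c2 * ?k z2 y)
         = integral {..x} (\<lambda>y. c1 * ?k z1 y) + integral {..x} (\<lambda>y. c2 * ?k z2 y)"
        by (rule integral_add) (intro I' z)+
      finally show ?thesis unfolding T1_def by (simp only: integral_mult_right)
    qed
    also have "norm \<dots> \<le> integral {..x} (\<lambda>y. (\<beta> y * norm (u2 y)) * \<bar>p y\<bar>)"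
    proof (rule norm_integral_atMost_le[OF _ i1])
      show "(\<lambda>y. c1 * (E12 z1 x y * of_real (p y) * u2 y) + c2 * (E12 z2 x y * of_real (p y) * u2 y)
           + c3 * (E12 z3 x y * of_real (p y) * u2 y)) absolutely_integrable_on {..x}"
        by (intro set_integral_add(1) I z)
      fix y assume y: "y \<in> {..x}"
      have "c1 * (E12 z1 x y * of_real (p y) * u2 y) + c2 * (E12 z2 x y * of_real (p y) * u2 y)
           + c3 * (E12 z3 x y * of_real (p y) * u2 y)
         = (c1 * E12 z1 x y + c2 * E12 z2 x y + c3 * E12 z3 x y) * (u2 y * of_real (p y))"
        by (simp add: algebra_simps)
      also have "norm \<dots> = norm (c1 * E12 z1 x y + c2 * E12 z2 x y + c3 * E12 z3 x y) * (norm (u2 y) * \<bar>p y\<bar>)"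
        by (simp only: norm_mult norm_of_real)
      also have "\<dots> \<le> \<beta> y * (norm (u2 y) * \<bar>p y\<bar>)"
        by (intro mult_right_mono comb12[OF z _ x b']) (use y in auto)
      finally show "norm (c1 * (E12 z1 x y * of_real (p y) * u2 y) + c2 * (E12 z2 x y * of_real (p y) * u2 y)
           + c3 * (E12 z3 x y * of_real (p y) * u2 y)) \<le> (\<beta> y * norm (u2 y)) * \<bar>p y\<bar>" by (simp add: mult_ac)
    qed
    finally show ?thesis .
  qed
  have t2: "norm (c1 * T2 z1 u1 u2 x + c2 * T2 z2 u1 u2 x + c3 * T2 z3 u1 u2 x)
      \<le> integral {..x} (\<lambda>y. (\<beta> y * norm (u1 y)) * \<bar>q y\<bar> + (\<beta> y * norm (u2 y)) * (A * \<bar>y * p y\<bar>))"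
  proof -
    let ?k = "\<lambda>z y. E21 z x y * of_real (q y) * u1 y + E22 z x y * of_real (p y) * u2 y"
    have I: "(\<lambda>y. c * ?k z y) absolutely_integrable_on {..x}" if "0 \<le> Im z" for c z
      by (intro set_integrable_mult_right set_integral_add(1))
         (use integrable_E21[OF that x u(1)] integrable_E22[OF that x u(2)] in auto)
    note I' = I[THEN set_lebesgue_integral_eq_integral(1)]
    have eqT: "c1 * T2 z1 u1 u2 x + c2 * T2 z2 u1 u2 x + c3 * T2 z3 u1 u2 x
      = integral {..x} (\<lambda>y. c1 * ?k z1 y + c2 * ?k z2 y + c3 * ?k z3 y)"
    proof -
      have "integral {..x} (\<lambda>y. c1 * ?k z1 y + c2 * ?k z2 y + c3 * ?k z3 y)
         = integral {..x} (\<lambda>y. c1 * ?k z1 y + c2 * ?k z2 y) + integral {..x} (\<lambda>y. c3 * ?k z3 y)"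
        by (rule integral_add) (intro integrable_add I' z)+
      also have "integral {..x} (\<lambda>y. c1 * ?k z1 y + c2 * ?k z2 y)
         = integral {..x} (\<lambda>y. c1 * ?k z1 y) + integral {..x} (\<lambda>y. c2 * ?k z2 y)"
        by (rule integral_add) (intro I' z)+
      finally show ?thesis unfolding T2_def by (simp only: integral_mult_right)
    qed
    have "norm (integral {..x} (\<lambda>y. c1 * ?k z1 y + c2 * ?k z2 y + c3 * ?k z3 y))
       \<le> integral {..x} (\<lambda>y. (\<beta> y * norm (u1 y)) * \<bar>q y\<bar> + (\<beta> y * norm (u2 y)) * (A * \<bar>y * p y\<bar>))"
    proof (rule norm_integral_atMost_le[OF _ i2])
      show "(\<lambda>y. c1 * ?k z1 y + c2 * ?k z2 y + c3 * ?k z3 y) absolutely_integrable_on {..x}"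
        by (intro set_integral_add(1) I z)
      fix y assume y: "y \<in> {..x}"
      have eq: "c1 * ?k z1 y + c2 * ?k z2 y + c3 * ?k z3 y
        = (c1 * E21 z1 x y + c2 * E21 z2 x y + c3 * E21 z3 x y) * of_real (q y) * u1 y
        + (c1 * E22 z1 x y + c2 * E22 z2 x y + c3 * E22 z3 x y) * of_real (p y) * u2 y"
        by (simp add: algebra_simps)
      have "norm (c1 * ?k z1 y + c2 * ?k z2 y + c3 * ?k z3 y)
         \<le> norm (c1 * E21 z1 x y + c2 * E21 z2 x y + c3 * E21 z3 x y) * (\<bar>q y\<bar> * norm (u1 y))
          + norm (c1 * E22 z1 x y + c2 * E22 z2 x y + c3 * E22 z3 x y) * (\<bar>p y\<bar> * norm (u2 y))"
        unfolding eq by (rule order_trans[OF norm_triangle_ineq]) (simp only: norm_mult norm_of_real mult.assoc order_refl)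
      also have "\<dots> \<le> \<beta> y * (\<bar>q y\<bar> * norm (u1 y)) + \<beta> y * (A * \<bar>y\<bar>) * (\<bar>p y\<bar> * norm (u2 y))"
      proof (intro add_mono mult_right_mono)
        show "norm (c1 * E21 z1 x y + c2 * E21 z2 x y + c3 * E21 z3 x y) \<le> \<beta> y"
          by (rule comb21[OF z _ x b']) (use y in auto)
        have "norm (c1 * E22 z1 x y + c2 * E22 z2 x y + c3 * E22 z3 x y) \<le> \<beta> y * (A * (x - y))"
          by (rule comb22[OF z _ x b']) (use y in auto)
        also have "\<dots> \<le> \<beta> y * (A * \<bar>y\<bar>)"
          by (rule mult_left_mono, rule mult_left_mono) (use A0 bK[of y] y x in auto)
        finally show "norm (c1 * E22 z1 x y + c2 * E22 z2 x y + c3 * E22 z3 x y) \<le> \<beta> y * (A * \<bar>y\<bar>)" .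
      qed auto
      also have "\<dots> = (\<beta> y * norm (u1 y)) * \<bar>q y\<bar> + (\<beta> y * norm (u2 y)) * (A * \<bar>y * p y\<bar>)"
        by (simp only: abs_mult mult_ac)
      finally show "norm (c1 * ?k z1 y + c2 * ?k z2 y + c3 * ?k z3 y)
         \<le> (\<beta> y * norm (u1 y)) * \<bar>q y\<bar> + (\<beta> y * norm (u2 y)) * (A * \<bar>y * p y\<bar>)" .
    qed
    then show ?thesis by (simp only: eqT)
  qed
  have "integral {..x} (\<lambda>y. (\<beta> y * norm (u2 y)) * \<bar>p y\<bar>)
      + integral {..x} (\<lambda>y. (\<beta> y * norm (u1 y)) * \<bar>q y\<bar> + (\<beta> y * norm (u2 y)) * (A * \<bar>y * p y\<bar>))
      = integral {..x} (\<lambda>y. (\<beta> y * norm (u2 y)) * \<bar>p y\<bar>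
          + ((\<beta> y * norm (u1 y)) * \<bar>q y\<bar> + (\<beta> y * norm (u2 y)) * (A * \<bar>y * p y\<bar>)))"
    by (rule integral_add[symmetric]) (rule i1[THEN set_lebesgue_integral_eq_integral(1)] i2[THEN set_lebesgue_integral_eq_integral(1)])+
  also have "\<dots> \<le> integral {..x} (\<lambda>y. \<beta> y * w y * (norm (u1 y) + norm (u2 y)))"
  proof (rule integral_mono_absint[OF set_integral_add(1)[OF i1 i2] absint_atMost_mono[OF int x]])
    fix y assume "y \<in> {..x}"
    then have y: "y \<le> 0" using x by simp
    \<comment> \<open>Expanding \<open>w * (norm u1 + norm u2)\<close> produces the required terms
      together with these two nonnegative cross terms, which are discarded.\<close>
    have "0 \<le> \<beta> y * \<bar>q y\<bar> * norm (u2 y) + \<beta> y * ((1 - A * y) * \<bar>p y\<bar>) * norm (u1 y)"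
      using bK[OF y] mult_nonneg_nonpos[OF A0 y] by (auto intro!: add_nonneg_nonneg mult_nonneg_nonneg)
    then show "(\<beta> y * norm (u2 y)) * \<bar>p y\<bar>
          + ((\<beta> y * norm (u1 y)) * \<bar>q y\<bar> + (\<beta> y * norm (u2 y)) * (A * \<bar>y * p y\<bar>))
       \<le> \<beta> y * w y * (norm (u1 y) + norm (u2 y))"
      using y by (simp add: w_def abs_mult algebra_simps)
  qed
  finally show "norm (c1 * T1 z1 u2 x + c2 * T1 z2 u2 x + c3 * T1 z3 u2 x)
       + norm (c1 * T2 z1 u1 u2 x + c2 * T2 z2 u1 u2 x + c3 * T2 z3 u1 u2 x)
       \<le> integral {..x} (\<lambda>y. \<beta> y * w y * (norm (u1 y) + norm (u2 y)))"
    using t1 t2 by linarith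
qed

end

section \<open>A priori estimate, uniqueness and modulus of continuity\<close>

context volterra begin

definition amp :: real where "amp = 2 * exp (2 * wtot)"

lemma amp_pos: "0 < amp" by (simp add: amp_def)

text \<open>Both operators together are dominated by the integral of \<open>w\<close> times the
  pair, so Gronwall turns a bound on the residual into a bound on the pair, with a constant that
  depends neither on \<open>z\<close> nor on \<open>x\<close>. Uniqueness, continuity, holomorphy
  and the limits at infinity are all obtained by applying it to a suitable difference.\<close>

lemma stability:
  assumes z: "0 \<le> Im z" and d: "bdd_cont d1" "bdd_cont d2" and x: "x \<le> 0"
    and res: "\<And>x. x \<le> 0 \<Longrightarrow> norm (d1 x - T1 z d2 x) + norm (d2 x - T2 z d1 d2 x) \<le> H"
  shows "norm (d1 x) + norm (d2 x) \<le> amp * H"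
proof -
  let ?D = "\<lambda>y. norm (d1 y) + norm (d2 y)"
  have H0: "0 \<le> H" using res[of 0] norm_ge_zero[of "d1 0 - T1 z d2 0"] norm_ge_zero[of "d2 0 - T2 z d1 d2 0"] by linarith
  obtain M1 M2 where M: "\<And>y. y \<le> 0 \<Longrightarrow> norm (d1 y) \<le> M1" "\<And>y. y \<le> 0 \<Longrightarrow> norm (d2 y) \<le> M2"
    using d by (auto simp: bdd_cont_def)
  note cb = comb_bound[OF z z z _ d, where \<beta> = "\<lambda>_. 1" and K = 1 and ?c1.0 = 1 and ?c2.0 = 0 and ?c3.0 = 0, simplified]
  have Dint: "(\<lambda>y. w y * ?D y) absolutely_integrable_on {..0}"
    by (rule cb(1)[of 0]) (use norm_wave_le_1[OF z] in auto)
  have "?D x \<le> 2 * exp (2 * integral {..x} w) * H"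
  proof (rule Gronwall_atMost[where M = "M1 + M2"])
    show "w absolutely_integrable_on {..x}" by (rule absint_atMost_mono[OF w_int x])
    fix y assume y: "y \<le> x"
    then have y0: "y \<le> 0" using x by simp
    show "0 \<le> w y" by (rule w_nonneg[OF y0])
    show "?D y \<le> M1 + M2" using M[OF y0] by simp
    show "(\<lambda>t. w t * ?D t) absolutely_integrable_on {..y}" by (rule absint_atMost_mono[OF Dint y0])
    have "norm (T1 z d2 y) + norm (T2 z d1 d2 y) \<le> integral {..y} (\<lambda>t. w t * ?D t)"
      by (rule cb(2)[OF y0]) (use norm_wave_le_1[OF z] in auto)
    moreover have "norm (d1 y) \<le> norm (d1 y - T1 z d2 y) + norm (T1 z d2 y)"
      "norm (d2 y) \<le> norm (d2 y - T2 z d1 d2 y) + norm (T2 z d1 d2 y)"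
      using norm_triangle_sub by (simp_all add: add.commute)
    ultimately show "?D y \<le> H + integral {..y} (\<lambda>t. w t * ?D t)"
      using res[OF y0] by linarith
  qed (rule H0)
  also have "\<dots> \<le> 2 * exp (2 * wtot) * H"
    unfolding wtot_def using integral_atMost_mono_nonneg[OF w_int x order_refl] w_nonneg H0
    by (intro mult_right_mono) auto
  finally show ?thesis by (simp add: amp_def)
qed

lemma sol_unique:
  assumes z: "0 \<le> Im z" and s: "sol z f1 f2 v1 v2" "sol z f1 f2 u1 u2" and x: "x \<le> 0"
  shows "v1 x = u1 x" "v2 x = u2 x"
proof -
  have bc: "bdd_cont v1" "bdd_cont v2" "bdd_cont u1" "bdd_cont u2" using s by (auto simp: sol_def)
  have "norm (v1 x - u1 x) + norm (v2 x - u2 x) \<le> amp * 0"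
  proof (rule stability[OF z _ _ x])
    show "bdd_cont (\<lambda>x. v1 x - u1 x)" "bdd_cont (\<lambda>x. v2 x - u2 x)" by (intro bdd_cont_diff bc)+
    fix x :: real assume x: "x \<le> 0"
    show "norm (v1 x - u1 x - T1 z (\<lambda>x. v2 x - u2 x) x)
       + norm (v2 x - u2 x - T2 z (\<lambda>x. v1 x - u1 x) (\<lambda>x. v2 x - u2 x) x) \<le> 0"
      unfolding T1_diff[OF z x bc(2,4)] T2_diff[OF z x bc(1,3,2,4)]
      using s x by (simp add: sol_def)
  qed
  then have "norm (v1 x - u1 x) + norm (v2 x - u2 x) \<le> 0" by simp
  then have "norm (v1 x - u1 x) = 0 \<and> norm (v2 x - u2 x) = 0"
    using norm_ge_zero[of "v1 x - u1 x"] norm_ge_zero[of "v2 x - u2 x"] by linarith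
  then show "v1 x = u1 x" "v2 x = u2 x" by auto
qed

lemma comb_bound_bounded:
  assumes z: "0 \<le> Im z1" "0 \<le> Im z2" "0 \<le> Im z3" and x: "x \<le> 0"
    and u: "bdd_cont u1" "bdd_cont u2"
    and uM: "\<And>y. y \<le> 0 \<Longrightarrow> norm (u1 y) + norm (u2 y) \<le> M"
    and bc: "continuous_on {..0} \<beta>" and bK: "\<And>y. y \<le> 0 \<Longrightarrow> 0 \<le> \<beta> y \<and> \<beta> y \<le> K"
    and b: "\<And>y t. y \<le> 0 \<Longrightarrow> 0 \<le> t \<Longrightarrow> t \<le> - y \<Longrightarrow>
       norm (c1 * wave z1 t + c2 * wave z2 t + c3 * wave z3 t) \<le> \<beta> y"
  shows "norm (c1 * T1 z1 u2 x + c2 * T1 z2 u2 x + c3 * T1 z3 u2 x)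
       + norm (c1 * T2 z1 u1 u2 x + c2 * T2 z2 u1 u2 x + c3 * T2 z3 u1 u2 x)
       \<le> M * integral {..0} (\<lambda>y. \<beta> y * w y)"
proof -
  let ?g = "\<lambda>y. \<beta> y * w y * (norm (u1 y) + norm (u2 y))"
  note cb = comb_bound[OF z _ u bc bK b]
  have gi: "?g absolutely_integrable_on {..0}" by (rule cb(1)[of 0]) auto
  have bw: "(\<lambda>y. \<beta> y * w y) absolutely_integrable_on {..0}"
    by (rule absint_continuous_mult_real[OF bc _ _ w_int, where M = K]) (use bK in auto)
  have "norm (c1 * T1 z1 u2 x + c2 * T1 z2 u2 x + c3 * T1 z3 u2 x)
       + norm (c1 * T2 z1 u1 u2 x + c2 * T2 z2 u1 u2 x + c3 * T2 z3 u1 u2 x) \<le> integral {..x} ?g"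
    by (rule cb(2)) (use x in auto)
  also have "\<dots> \<le> integral {..0} ?g"
    by (rule integral_atMost_mono_nonneg[OF gi x]) (auto intro!: mult_nonneg_nonneg simp: bK w_nonneg)
  also have "\<dots> \<le> integral {..0} (\<lambda>y. M * (\<beta> y * w y))"
    using mult_left_mono[OF uM, of y "\<beta> y * w y" for y] bK w_nonneg
    by (intro integral_mono_absint gi set_integrable_mult_right) (use bw in \<open>auto simp: mult.commute\<close>)
  finally show ?thesis by simp
qed

text \<open>Modulus of continuity of the operators in the spectral parameter: waves whose parameters
  have distance \<open>\<delta>\<close> differ by at most \<open>2 t \<delta>\<close> and, being
  bounded by 1, by at most 2. The minimum makes \<open>2 w\<close> an integrable majorant and tends
  to 0 pointwise with \<open>\<delta>\<close>.\<close>

definition osc :: "real \<Rightarrow> real" where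
  "osc \<delta> = integral {..0} (\<lambda>y. min 2 (2 * (- y) * \<delta>) * w y)"

lemma osc_tendsto_0:
  assumes d: "\<delta> \<longlonglongrightarrow> 0" and pos: "\<And>n. 0 \<le> \<delta> n"
  shows "(\<lambda>n. osc (\<delta> n)) \<longlonglongrightarrow> 0"
proof -
  have "(\<lambda>n. integral {..0} (\<lambda>y. min 2 (2 * (- y) * \<delta> n) * w y)) \<longlonglongrightarrow> integral {..0} (\<lambda>y::real. 0::real)"
  proof (rule dominated_convergence(2)[where h = "\<lambda>y. 2 * w y"
        and f = "\<lambda>n y. min 2 (2 * (- y) * \<delta> n) * w y" and g = "\<lambda>y. 0"])
    show "(\<lambda>y. min 2 (2 * (- y) * \<delta> n) * w y) integrable_on {..0}" for n
    proof (rule set_lebesgue_integral_eq_integral(1), rule absint_continuous_mult_real[OF _ _ _ w_int, where M = 2])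
      show "continuous_on {..0} (\<lambda>y. min 2 (2 * (- y) * \<delta> n))" by (intro continuous_intros)
      show "norm (min 2 (2 * (- y) * \<delta> n)) \<le> 2" if "y \<in> {..0}" for y
        using pos[of n] that by (auto simp: mult_nonpos_nonneg abs_le_iff min_def)
    qed auto
    show "(\<lambda>y. 2 * w y) integrable_on {..0}"
      by (intro integrable_on_mult_right set_lebesgue_integral_eq_integral(1) w_int)
    show "norm (min 2 (2 * (- y) * \<delta> n) * w y) \<le> 2 * w y" if "y \<in> {..0}" for n y
    proof -
      have "\<bar>min 2 (2 * (- y) * \<delta> n)\<bar> \<le> 2"
        using pos[of n] that by (auto simp: mult_nonpos_nonneg abs_le_iff min_def)
      then have "\<bar>min 2 (2 * (- y) * \<delta> n)\<bar> * w y \<le> 2 * w y"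
        using w_nonneg[of y] that by (intro mult_right_mono) auto
      then show ?thesis using w_nonneg[of y] that by (simp add: abs_mult)
    qed
    show "(\<lambda>n. min 2 (2 * (- y) * \<delta> n) * w y) \<longlonglongrightarrow> 0" for y
    proof -
      have "(\<lambda>n. min 2 (2 * (- y) * \<delta> n) * w y) \<longlonglongrightarrow> min 2 (2 * (- y) * 0) * w y"
        by (intro tendsto_intros d)
      then show ?thesis by simp
    qed
  qed
  then show ?thesis by (simp add: osc_def)
qed

end

text \<open>Inhomogeneities quadratic in \<open>z\<close>: multiplication by
  \<open>z\<^sup>2 - B\<^sup>2\<close> turns the leading terms of the first column, 1 and the
  background entry, into polynomials of degree at most two. The second column fits with
  constants.\<close>

locale volterra_family = volterra +
  fixes a0 a1 a2 b0 b1 b2 :: "real \<Rightarrow> complex" and N :: real and v1 v2 :: "complex \<Rightarrow> real \<Rightarrow> complex"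
  assumes coeff_bounds: "x \<le> 0 \<Longrightarrow> norm (a0 x) \<le> N \<and> norm (a1 x) \<le> N \<and> norm (a2 x) \<le> N \<and>
       norm (b0 x) \<le> N \<and> norm (b1 x) \<le> N \<and> norm (b2 x) \<le> N"
    and sol: "0 \<le> Im z \<Longrightarrow> sol z (\<lambda>x. a0 x + z * a1 x + z^2 * a2 x) (\<lambda>x. b0 x + z * b1 x + z^2 * b2 x) (v1 z) (v2 z)"
begin

definition f1 :: "complex \<Rightarrow> real \<Rightarrow> complex" where "f1 z x = a0 x + z * a1 x + z^2 * a2 x"
definition f2 :: "complex \<Rightarrow> real \<Rightarrow> complex" where "f2 z x = b0 x + z * b1 x + z^2 * b2 x"

lemma N0: "0 \<le> N"
  using coeff_bounds[of 0] norm_ge_zero[of "a0 0"] by linarith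

lemma bc: "0 \<le> Im z \<Longrightarrow> bdd_cont (v1 z)" "0 \<le> Im z \<Longrightarrow> bdd_cont (v2 z)"
  using sol by (auto simp: sol_def)

lemma eq: "0 \<le> Im z \<Longrightarrow> x \<le> 0 \<Longrightarrow> v1 z x = f1 z x + T1 z (v2 z) x"
  "0 \<le> Im z \<Longrightarrow> x \<le> 0 \<Longrightarrow> v2 z x = f2 z x + T2 z (v1 z) (v2 z) x"
  using sol[of z] by (auto simp: sol_def f1_def f2_def)

definition bnd :: "real \<Rightarrow> real" where "bnd R = amp * (2 * N * (1 + R + R^2))"

lemma bnd_mono: "0 \<le> R \<Longrightarrow> R \<le> R' \<Longrightarrow> bnd R \<le> bnd R'"
  unfolding bnd_def using N0 amp_pos by (intro mult_left_mono add_mono power_mono) auto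

lemma bnd_nonneg: "0 \<le> R \<Longrightarrow> 0 \<le> bnd R"
  unfolding bnd_def using N0 amp_pos by (intro mult_nonneg_nonneg add_nonneg_nonneg) auto

lemma norm_quadratic:
  fixes a b c r s t :: complex
  assumes "norm a \<le> N" "norm b \<le> N" "norm c \<le> N"
  shows "norm (r * a + s * b + t * c) \<le> N * (norm r + norm s + norm t)"
proof -
  have "norm (r * a + s * b + t * c) \<le> norm r * norm a + norm s * norm b + norm t * norm c"
    by (intro norm_triangle_le add_mono) (auto simp: norm_mult)
  also have "\<dots> \<le> norm r * N + norm s * N + norm t * N"
    using assms by (intro add_mono mult_left_mono) auto
  finally show ?thesis by (simp add: algebra_simps)
qed

lemma v_bound:
  assumes z: "0 \<le> Im z" and x: "x \<le> 0"
  shows "norm (v1 z x) + norm (v2 z x) \<le> bnd (norm z)"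
  unfolding bnd_def
proof (rule stability[OF z bc[OF z] x])
  fix x :: real assume x: "x \<le> 0"
  have "norm (f1 z x) \<le> N * (norm (1::complex) + norm z + norm (z^2))"
    using norm_quadratic[of "a0 x" "a1 x" "a2 x" 1 z "z^2"] coeff_bounds[OF x] by (simp add: f1_def)
  moreover have "norm (f2 z x) \<le> N * (norm (1::complex) + norm z + norm (z^2))"
    using norm_quadratic[of "b0 x" "b1 x" "b2 x" 1 z "z^2"] coeff_bounds[OF x] by (simp add: f2_def)
  ultimately show "norm (v1 z x - T1 z (v2 z) x) + norm (v2 z x - T2 z (v1 z) (v2 z) x) \<le> 2 * N * (1 + norm z + (norm z)\<^sup>2)"
    using eq[OF z x] by (simp add: norm_power)
qed

text \<open>The difference of the solutions at \<open>z'\<close> and \<open>z\<close> is inserted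
  into the system at \<open>z\<close>. Its residual is the change of the inhomogeneities plus the
  change of the operators applied to the solution at \<open>z'\<close>. The bound
  \<open>\<beta>\<close> stays open: a truncated linear one serves on the closed half-plane, a
  constant one in the interior.\<close>

lemma v_diff:
  assumes z: "0 \<le> Im z" "0 \<le> Im z'" and x: "x \<le> 0"
    and bcont: "continuous_on {..0} \<beta>" and bK: "\<And>y. y \<le> 0 \<Longrightarrow> 0 \<le> \<beta> y \<and> \<beta> y \<le> K"
    and b: "\<And>y t. y \<le> 0 \<Longrightarrow> 0 \<le> t \<Longrightarrow> t \<le> - y \<Longrightarrow> norm (wave z' t - wave z t) \<le> \<beta> y"
  shows "norm (v1 z' x - v1 z x) + norm (v2 z' x - v2 z x) \<le>
     amp * (2 * N * (norm (z' - z) + norm (z'^2 - z^2)) + bnd (norm z') * integral {..0} (\<lambda>y. \<beta> y * w y))"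
proof (rule stability[OF z(1) _ _ x])
  show "bdd_cont (\<lambda>x. v1 z' x - v1 z x)" "bdd_cont (\<lambda>x. v2 z' x - v2 z x)"
    by (intro bdd_cont_diff bc z)+
  fix x :: real assume x: "x \<le> 0"
  let ?d1 = "T1 z' (v2 z') x - T1 z (v2 z') x" and ?d2 = "T2 z' (v1 z') (v2 z') x - T2 z (v1 z') (v2 z') x"
  have 1: "norm ?d1 + norm ?d2 \<le> bnd (norm z') * integral {..0} (\<lambda>y. \<beta> y * w y)"
    using comb_bound_bounded[OF z(2,1,1) x bc[OF z(2)] v_bound[OF z(2)] bcont bK, of 1 "-1" 0] b by simp
  have f: "norm (f1 z' x - f1 z x) \<le> N * (norm (z' - z) + norm (z'^2 - z^2))"
    "norm (f2 z' x - f2 z x) \<le> N * (norm (z' - z) + norm (z'^2 - z^2))"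
    using norm_quadratic[of "a0 x" "a1 x" "a2 x" 0 "z' - z" "z'^2 - z^2"]
      norm_quadratic[of "b0 x" "b1 x" "b2 x" 0 "z' - z" "z'^2 - z^2"] coeff_bounds[OF x]
    by (simp_all add: f1_def f2_def algebra_simps)
  have e1: "v1 z' x - v1 z x - T1 z (\<lambda>x. v2 z' x - v2 z x) x = (f1 z' x - f1 z x) + ?d1"
    using eq[OF z(1) x] eq[OF z(2) x] T1_diff[OF z(1) x bc(2)[OF z(2)] bc(2)[OF z(1)]] by simp
  have e2: "v2 z' x - v2 z x - T2 z (\<lambda>x. v1 z' x - v1 z x) (\<lambda>x. v2 z' x - v2 z x) x = (f2 z' x - f2 z x) + ?d2"
    using eq[OF z(1) x] eq[OF z(2) x]
      T2_diff[OF z(1) x bc(1)[OF z(2)] bc(1)[OF z(1)] bc(2)[OF z(2)] bc(2)[OF z(1)]] by simp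
  show "norm (v1 z' x - v1 z x - T1 z (\<lambda>x. v2 z' x - v2 z x) x)
     + norm (v2 z' x - v2 z x - T2 z (\<lambda>x. v1 z' x - v1 z x) (\<lambda>x. v2 z' x - v2 z x) x)
     \<le> 2 * N * (norm (z' - z) + norm (z'^2 - z^2)) + bnd (norm z') * integral {..0} (\<lambda>y. \<beta> y * w y)"
    unfolding e1 e2 using f 1 norm_triangle_ineq[of "f1 z' x - f1 z x" ?d1] norm_triangle_ineq[of "f2 z' x - f2 z x" ?d2]
    by linarith
qed

lemma v_tendsto:
  assumes z: "0 \<le> Im z" and zn: "\<And>n. 0 \<le> Im (s n)" and lim: "s \<longlonglongrightarrow> z" and x: "x \<le> 0"
  shows "(\<lambda>n. v1 (s n) x) \<longlonglongrightarrow> v1 z x" "(\<lambda>n. v2 (s n) x) \<longlonglongrightarrow> v2 z x"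
proof -
  let ?B = "\<lambda>n. amp * (2 * N * (norm (s n - z) + norm ((s n)^2 - z^2)) + bnd (norm (s n)) * osc (norm (s n - z)))"
  have dn: "(\<lambda>n. norm (s n - z)) \<longlonglongrightarrow> 0" by (rule LIM_zero[OF lim, THEN tendsto_norm_zero])
  have "?B \<longlonglongrightarrow> amp * (2 * N * (0 + norm (z^2 - z^2)) + bnd (norm z) * 0)"
    unfolding bnd_def by (intro tendsto_intros lim dn osc_tendsto_0) auto
  then have B: "?B \<longlonglongrightarrow> 0" by simp
  have est: "norm (v1 (s n) x - v1 z x) + norm (v2 (s n) x - v2 z x) \<le> ?B n" for n
    unfolding osc_def
  proof (rule v_diff[OF z zn x, where K = 2])
    show "continuous_on {..0} (\<lambda>y. min 2 (2 * (- y) * norm (s n - z)))" by (intro continuous_intros)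
    show "0 \<le> min 2 (2 * (- y) * norm (s n - z)) \<and> min 2 (2 * (- y) * norm (s n - z)) \<le> 2" if "y \<le> 0" for y
      using that by (auto simp: mult_nonpos_nonneg)
    fix y t :: real assume y: "y \<le> 0" and t: "0 \<le> t" "t \<le> - y"
    have "norm (wave (s n) t - wave z t) \<le> 2 * t * norm (s n - z)"
      using norm_wave_diff[of 0 "s n" z t] zn z t by simp
    also have "\<dots> \<le> 2 * (- y) * norm (s n - z)" using t by (intro mult_right_mono) auto
    finally have "norm (wave (s n) t - wave z t) \<le> 2 * (- y) * norm (s n - z)" .
    moreover have "norm (wave (s n) t - wave z t) \<le> 2"
      using norm_triangle_ineq4[of "wave (s n) t" "wave z t"] norm_wave_le_1[OF z t(1)] norm_wave_le_1[OF zn t(1)]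
      by (smt (verit))
    ultimately show "norm (wave (s n) t - wave z t) \<le> min 2 (2 * (- y) * norm (s n - z))" by simp
  qed
  have "(\<lambda>n. v1 (s n) x - v1 z x) \<longlonglongrightarrow> 0"
    by (rule Lim_null_comparison[OF _ B]) (use est in \<open>auto intro!: always_eventually order_trans[OF _ est]\<close>)
  then show "(\<lambda>n. v1 (s n) x) \<longlonglongrightarrow> v1 z x" by (rule LIM_zero_cancel)
  have "(\<lambda>n. v2 (s n) x - v2 z x) \<longlonglongrightarrow> 0"
    by (rule Lim_null_comparison[OF _ B]) (use est in \<open>auto intro!: always_eventually order_trans[OF _ est]\<close>)
  then show "(\<lambda>n. v2 (s n) x) \<longlonglongrightarrow> v2 z x" by (rule LIM_zero_cancel)
qed

lemma v_continuous_on: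
  assumes x: "x \<le> 0"
  shows "continuous_on {z. 0 \<le> Im z} (\<lambda>z. v1 z x)" "continuous_on {z. 0 \<le> Im z} (\<lambda>z. v2 z x)"
  unfolding continuous_on_sequentially comp_def using v_tendsto[OF _ _ _ x] by auto

lemma v_lipschitz:
  assumes r: "0 < r" and z: "2 * r \<le> Im z" and h: "norm h \<le> r" and x: "x \<le> 0"
  shows "norm (v1 (z + h) x - v1 z x) + norm (v2 (z + h) x - v2 z x)
    \<le> amp * (2 * N * (1 + 2 * norm z + r) + bnd (norm z + r) * wtot / r) * norm h"
proof -
  have "\<bar>Im h\<bar> \<le> norm h" by (rule abs_Im_le_cmod)
  then have im: "0 \<le> Im z" "0 \<le> Im (z + h)" "r \<le> Im (z + h)" "r \<le> Im z" using z h r by auto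
  have "norm (v1 (z + h) x - v1 z x) + norm (v2 (z + h) x - v2 z x)
    \<le> amp * (2 * N * (norm (z + h - z) + norm ((z + h)^2 - z^2)) + bnd (norm (z + h)) * integral {..0} (\<lambda>y. norm h / r * w y))"
    by (rule v_diff[OF im(1,2) x, where K = "norm h / r"])
       (use r norm_wave_diff_interior[OF r im(3,4)] in auto)
  also have "\<dots> \<le> amp * (2 * N * (norm h + (2 * norm z + r) * norm h) + bnd (norm z + r) * (norm h / r * wtot))"
  proof (intro mult_left_mono add_mono)
    have "(z + h)^2 - z^2 = (2 * z + h) * h" by (simp add: power2_eq_square algebra_simps)
    also have "norm \<dots> \<le> (2 * norm z + r) * norm h"
      unfolding norm_mult using h norm_triangle_ineq[of "2 * z" h] by (intro mult_right_mono) auto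
    finally show "norm ((z + h)^2 - z^2) \<le> (2 * norm z + r) * norm h" .
    show "bnd (norm (z + h)) * integral {..0} (\<lambda>y. norm h / r * w y) \<le> bnd (norm z + r) * (norm h / r * wtot)"
      unfolding integral_mult_right wtot_def[symmetric]
      using norm_triangle_ineq[of z h] h wtot_nonneg r by (intro mult_right_mono bnd_mono) auto
  qed (use N0 amp_pos in auto)
  also have "\<dots> = amp * (2 * N * (1 + 2 * norm z + r) + bnd (norm z + r) * wtot / r) * norm h"
    by (simp add: field_simps)
  finally show ?thesis .
qed

text \<open>The second difference of the solutions is inserted into the system at \<open>z\<close>,
  and its residual has to be of third order in the increments. There are three contributions: the
  quadratic coefficient of the inhomogeneity, the second difference of the operators, and a first
  difference of the operators acting on a first difference of the solutions.\<close>

lemma v_second_difference: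
  assumes r: "0 < r" and z: "2 * r \<le> Im z" and x: "x \<le> 0"
  obtains C where "\<And>h h'. norm h \<le> r \<Longrightarrow> norm h' \<le> r \<Longrightarrow>
      norm (h' * (v1 (z + h) x - v1 z x) - h * (v1 (z + h') x - v1 z x))
    + norm (h' * (v2 (z + h) x - v2 z x) - h * (v2 (z + h') x - v2 z x))
    \<le> C * (norm h * norm h' * (norm h + norm h'))"
proof
  define L where "L = amp * (2 * N * (1 + 2 * norm z + r) + bnd (norm z + r) * wtot / r)"
  define C where "C = amp * (2 * N + bnd (norm z + r) * (4 / r^2 * wtot) + L / r * wtot)"
  have L0: "0 \<le> L"
    unfolding L_def using amp_pos N0 r wtot_nonneg bnd_nonneg[of "norm z + r"]
    by (intro mult_nonneg_nonneg add_nonneg_nonneg divide_nonneg_pos) auto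
  fix h h' :: complex assume h: "norm h \<le> r" "norm h' \<le> r"
  let ?n = "norm h * norm h' * (norm h + norm h')"
  have "\<bar>Im h\<bar> \<le> norm h" "\<bar>Im h'\<bar> \<le> norm h'" by (rule abs_Im_le_cmod)+
  then have im: "0 \<le> Im z" "0 \<le> Im (z + h)" "0 \<le> Im (z + h')" "r \<le> Im (z + h')" "r \<le> Im z"
    using z h r by auto
  let ?u1 = "\<lambda>x. v1 (z + h) x - v1 (z + h') x" and ?u2 = "\<lambda>x. v2 (z + h) x - v2 (z + h') x"
  let ?e1 = "\<lambda>x. v1 (z + h) x - v1 z x" and ?e1' = "\<lambda>x. v1 (z + h') x - v1 z x"
  let ?e2 = "\<lambda>x. v2 (z + h) x - v2 z x" and ?e2' = "\<lambda>x. v2 (z + h') x - v2 z x"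
  have bcu: "bdd_cont ?u1" "bdd_cont ?u2" and bce: "bdd_cont ?e1" "bdd_cont ?e1'" "bdd_cont ?e2" "bdd_cont ?e2'"
    by (intro bdd_cont_diff bc im)+
  have u: "norm (?u1 y) + norm (?u2 y) \<le> L * (norm h + norm h')" if y: "y \<le> 0" for y
  proof -
    have "norm (?u1 y) \<le> norm (?e1 y) + norm (?e1' y)" "norm (?u2 y) \<le> norm (?e2 y) + norm (?e2' y)"
      using norm_triangle_ineq4[of "?e1 y" "?e1' y"] norm_triangle_ineq4[of "?e2 y" "?e2' y"] by auto
    then show ?thesis
      using v_lipschitz[OF r z h(1) y] v_lipschitz[OF r z h(2) y] unfolding L_def[symmetric] by (simp add: algebra_simps)
  qed
  have "norm (h' * ?e1 x - h * ?e1' x) + norm (h' * ?e2 x - h * ?e2' x)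
     \<le> amp * (2 * (?n * N) + bnd (norm z + r) * (4 / r^2 * ?n * wtot) + (L * (norm h + norm h')) * (norm h * norm h' / r * wtot))"
  proof (rule stability[OF im(1) _ _ x])
    show "bdd_cont (\<lambda>x. h' * ?e1 x - h * ?e1' x)" "bdd_cont (\<lambda>x. h' * ?e2 x - h * ?e2' x)"
      by (intro bdd_cont_diff bdd_cont_cmult bc im)+
    fix x :: real assume x: "x \<le> 0"
    \<comment> \<open>Second difference of the operators, all acting on the solution at
      \<open>z + h\<close>, so that the three-term estimate for waves applies.\<close>
    let ?A1 = "h' * T1 (z + h) (v2 (z + h)) x + (- h) * T1 (z + h') (v2 (z + h)) x + (h - h') * T1 z (v2 (z + h)) x"
    let ?A2 = "h' * T2 (z + h) (v1 (z + h)) (v2 (z + h)) x + (- h) * T2 (z + h') (v1 (z + h)) (v2 (z + h)) x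
        + (h - h') * T2 z (v1 (z + h)) (v2 (z + h)) x"
    \<comment> \<open>Compensates for using the solution at \<open>z + h\<close> where the one at
      \<open>z + h'\<close> occurs. The operators and the solutions each contribute one small
      factor, beyond the prefactor \<open>h\<close>.\<close>
    let ?B1 = "h * T1 (z + h') ?u2 x + (- h) * T1 z ?u2 x + 0 * T1 z ?u2 x"
    let ?B2 = "h * T2 (z + h') ?u1 ?u2 x + (- h) * T2 z ?u1 ?u2 x + 0 * T2 z ?u1 ?u2 x"
    have A: "norm ?A1 + norm ?A2 \<le> bnd (norm z + r) * integral {..0} (\<lambda>y. 4 / r^2 * ?n * w y)"
    proof (rule comb_bound_bounded[OF im(2,3,1) x bc[OF im(2)], where K = "4 / r^2 * ?n"])
      show "norm (v1 (z + h) y) + norm (v2 (z + h) y) \<le> bnd (norm z + r)" if "y \<le> 0" for y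
        using v_bound[OF im(2) that] h
        by (rule_tac order_trans[OF _ bnd_mono[OF norm_ge_zero norm_triangle_le]]) auto
    qed (use norm_wave_second_difference[OF r z h] r in auto)
    have B: "norm ?B1 + norm ?B2 \<le> L * (norm h + norm h') * integral {..0} (\<lambda>y. norm h * norm h' / r * w y)"
    proof (rule comb_bound_bounded[OF im(3,1,1) x bcu u, where K = "norm h * norm h' / r"])
      fix y t :: real assume "0 \<le> t"
      have "norm h * norm (wave (z + h') t - wave z t) \<le> norm h * (norm (z + h' - z) / r)"
        using norm_wave_diff_interior[OF r im(4,5) \<open>0 \<le> t\<close>] by (intro mult_left_mono) auto
      then show "norm (h * wave (z + h') t + (- h) * wave z t + 0 * wave z t) \<le> norm h * norm h' / r"
        by (simp add: norm_mult right_diff_distrib[symmetric])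
    qed (use r in auto)
    let ?F1 = "h' * (f1 (z + h) x - f1 z x) - h * (f1 (z + h') x - f1 z x)"
    let ?F2 = "h' * (f2 (z + h) x - f2 z x) - h * (f2 (z + h') x - f2 z x)"
    have F1: "?F1 = h * h' * (h - h') * a2 x" and F2: "?F2 = h * h' * (h - h') * b2 x"
      by (simp_all add: f1_def f2_def power2_eq_square algebra_simps)
    have hh: "norm (h * h' * (h - h')) \<le> ?n"
      unfolding norm_mult by (intro mult_left_mono norm_triangle_ineq4) auto
    have nF: "norm ?F1 \<le> ?n * N" "norm ?F2 \<le> ?n * N"
      unfolding F1 F2 norm_mult[of "h * h' * (h - h')"] using coeff_bounds[OF x] by (intro mult_mono hh; simp)+
    have e1: "h' * ?e1 x - h * ?e1' x - T1 z (\<lambda>x. h' * ?e2 x - h * ?e2' x) x = ?F1 + (?A1 + ?B1)"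
    proof -
      have t1: "T1 z (\<lambda>x. h' * ?e2 x - h * ?e2' x) x = h' * (T1 z (v2 (z + h)) x - T1 z (v2 z) x) - h * (T1 z (v2 (z + h')) x - T1 z (v2 z) x)"
        using T1_diff[OF im(1) x bdd_cont_cmult bdd_cont_cmult, OF bce(3,4), of h' h]
          T1_diff[OF im(1) x bc(2)[OF im(2)] bc(2)[OF im(1)]] T1_diff[OF im(1) x bc(2)[OF im(3)] bc(2)[OF im(1)]]
        by (simp only: T1_cmult)
      have t2: "T1 (z + h') ?u2 x = T1 (z + h') (v2 (z + h)) x - T1 (z + h') (v2 (z + h')) x"
        by (rule T1_diff[OF im(3) x bc(2)[OF im(2)] bc(2)[OF im(3)]])
      have t3: "T1 z ?u2 x = T1 z (v2 (z + h)) x - T1 z (v2 (z + h')) x"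
        by (rule T1_diff[OF im(1) x bc(2)[OF im(2)] bc(2)[OF im(3)]])
      show ?thesis
        unfolding t1 t2 t3 eq(1)[OF im(1) x] eq(1)[OF im(2) x] eq(1)[OF im(3) x] by (simp add: algebra_simps)
    qed
    have e2: "h' * ?e2 x - h * ?e2' x - T2 z (\<lambda>x. h' * ?e1 x - h * ?e1' x) (\<lambda>x. h' * ?e2 x - h * ?e2' x) x = ?F2 + (?A2 + ?B2)"
    proof -
      have t1: "T2 z (\<lambda>x. h' * ?e1 x - h * ?e1' x) (\<lambda>x. h' * ?e2 x - h * ?e2' x) x
         = h' * (T2 z (v1 (z + h)) (v2 (z + h)) x - T2 z (v1 z) (v2 z) x) - h * (T2 z (v1 (z + h')) (v2 (z + h')) x - T2 z (v1 z) (v2 z) x)"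
        using T2_diff[OF im(1) x bdd_cont_cmult bdd_cont_cmult bdd_cont_cmult bdd_cont_cmult, OF bce, of h' h h' h]
          T2_diff[OF im(1) x bc(1)[OF im(2)] bc(1)[OF im(1)] bc(2)[OF im(2)] bc(2)[OF im(1)]]
          T2_diff[OF im(1) x bc(1)[OF im(3)] bc(1)[OF im(1)] bc(2)[OF im(3)] bc(2)[OF im(1)]]
        by (simp only: T2_cmult)
      have t2: "T2 (z + h') ?u1 ?u2 x = T2 (z + h') (v1 (z + h)) (v2 (z + h)) x - T2 (z + h') (v1 (z + h')) (v2 (z + h')) x"
        by (rule T2_diff[OF im(3) x bc(1)[OF im(2)] bc(1)[OF im(3)] bc(2)[OF im(2)] bc(2)[OF im(3)]])
      have t3: "T2 z ?u1 ?u2 x = T2 z (v1 (z + h)) (v2 (z + h)) x - T2 z (v1 (z + h')) (v2 (z + h')) x"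
        by (rule T2_diff[OF im(1) x bc(1)[OF im(2)] bc(1)[OF im(3)] bc(2)[OF im(2)] bc(2)[OF im(3)]])
      show ?thesis
        unfolding t1 t2 t3 eq(2)[OF im(1) x] eq(2)[OF im(2) x] eq(2)[OF im(3) x] by (simp add: algebra_simps)
    qed
    have A': "norm ?A1 + norm ?A2 \<le> bnd (norm z + r) * (4 / r^2 * ?n * wtot)"
      using A unfolding integral_mult_right wtot_def[symmetric] .
    have B': "norm ?B1 + norm ?B2 \<le> (L * (norm h + norm h')) * (norm h * norm h' / r * wtot)"
      using B unfolding integral_mult_right wtot_def[symmetric] .
    have "norm (?F1 + (?A1 + ?B1)) \<le> norm ?F1 + (norm ?A1 + norm ?B1)"
      "norm (?F2 + (?A2 + ?B2)) \<le> norm ?F2 + (norm ?A2 + norm ?B2)"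
      by (intro norm_triangle_le add_left_mono norm_triangle_ineq)+
    note tri = this
    have gen: "\<lbrakk>x1 \<le> p + (k1 + l1); x2 \<le> q + (k2 + l2); k1 + k2 \<le> K; l1 + l2 \<le> L; p \<le> S; q \<le> S\<rbrakk>
       \<Longrightarrow> x1 + x2 \<le> 2 * S + K + L" for x1 x2 p q k1 k2 l1 l2 K L S :: real by linarith
    show "norm (h' * ?e1 x - h * ?e1' x - T1 z (\<lambda>x. h' * ?e2 x - h * ?e2' x) x)
       + norm (h' * ?e2 x - h * ?e2' x - T2 z (\<lambda>x. h' * ?e1 x - h * ?e1' x) (\<lambda>x. h' * ?e2 x - h * ?e2' x) x)
       \<le> 2 * (?n * N) + bnd (norm z + r) * (4 / r^2 * ?n * wtot) + (L * (norm h + norm h')) * (norm h * norm h' / r * wtot)"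
      unfolding e1 e2 by (rule gen[OF tri A' B' nF])
  qed
  also have "\<dots> = C * ?n" by (simp add: C_def algebra_simps add_divide_distrib)
  finally show "norm (h' * ?e1 x - h * ?e1' x) + norm (h' * ?e2 x - h * ?e2' x) \<le> C * ?n" .
qed

lemma v_holomorphic_on:
  assumes x: "x \<le> 0"
  shows "(\<lambda>z. v1 z x) holomorphic_on {z. 0 < Im z}" "(\<lambda>z. v2 z x) holomorphic_on {z. 0 < Im z}"
proof -
  have "(\<lambda>z. v1 z x) field_differentiable at z \<and> (\<lambda>z. v2 z x) field_differentiable at z" if "0 < Im z" for z
  proof -
    define r where "r = Im z / 2"
    have r: "0 < r" "2 * r \<le> Im z" using that by (auto simp: r_def)
    obtain C where C: "\<And>h h'. norm h \<le> r \<Longrightarrow> norm h' \<le> r \<Longrightarrow>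
      norm (h' * (v1 (z + h) x - v1 z x) - h * (v1 (z + h') x - v1 z x))
    + norm (h' * (v2 (z + h) x - v2 z x) - h * (v2 (z + h') x - v2 z x))
    \<le> C * (norm h * norm h' * (norm h + norm h'))" using v_second_difference[OF r x] by blast
    show ?thesis
      by (intro conjI; rule field_differentiable_of_second_differences[OF r(1), of _ _ C])
         (use C in \<open>smt (verit) norm_ge_zero\<close>)+
  qed
  then show "(\<lambda>z. v1 z x) holomorphic_on {z. 0 < Im z}" "(\<lambda>z. v2 z x) holomorphic_on {z. 0 < Im z}"
    by (auto simp: holomorphic_on_def intro: field_differentiable_at_within)
qed

end

section \<open>The Riemann--Lebesgue lemma\<close>

lemma has_vector_derivative_wave:
  "((\<lambda>s. wave z (c + d * s)) has_vector_derivative 2 * \<i> * z * of_real d * wave z (c + d * s)) (at s within S)"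
proof -
  have "((\<lambda>u. exp (2 * \<i> * z * (of_real c + of_real d * u))) has_field_derivative
      2 * \<i> * z * of_real d * exp (2 * \<i> * z * (of_real c + of_real d * of_real s))) (at (of_real s))"
    by (auto intro!: derivative_eq_intros)
  from has_vector_derivative_real_field[OF this, of S] show ?thesis
    by (simp add: wave_def)
qed

text \<open>The Riemann-Lebesgue property in the uniform form that \<open>stability\<close> asks
  for: the integrals must be small for all endpoints \<open>x \<le> 0\<close> and all large
  \<open>z\<close> of the closed half-plane at once.\<close>

definition RL :: "(real \<Rightarrow> real) \<Rightarrow> bool" where
  "RL h \<longleftrightarrow> h absolutely_integrable_on {..0} \<and>
     (\<forall>\<epsilon>>0. \<exists>R. \<forall>z x. 0 \<le> Im z \<longrightarrow> R \<le> norm z \<longrightarrow> x \<le> 0 \<longrightarrow>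
        norm (integral {..x} (\<lambda>y. wave z (x - y) * of_real (h y))) \<le> \<epsilon>)"

lemma absint_of_real:
  "f absolutely_integrable_on S \<Longrightarrow> (\<lambda>y. complex_of_real (f y)) absolutely_integrable_on S"
  for f :: "real \<Rightarrow> real"
  using absolutely_integrable_linear[OF _ bounded_linear_of_real[where 'a=complex]] by (simp add: comp_def)

lemma absint_wave_mult:
  assumes z: "0 \<le> Im z" and h: "h absolutely_integrable_on {..0}" and x: "x \<le> 0"
  shows "(\<lambda>y. wave z (x - y) * of_real (h y)) absolutely_integrable_on {..x}"
  by (rule absint_continuous_mult[where M = 1])
     (auto intro!: continuous_intros norm_wave_le_1 z absint_of_real absint_atMost_mono[OF h x])

text \<open>The waves have norm at most 1 on the range of integration, so an error in the mean
  changes the integral by at most that error, uniformly in \<open>x\<close> and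
  \<open>z\<close>.\<close>

lemma RL_closure:
  assumes h: "h absolutely_integrable_on {..0}"
    and approx: "\<And>\<epsilon>. \<epsilon> > 0 \<Longrightarrow> \<exists>g. RL g \<and> integral {..0} (\<lambda>y. \<bar>h y - g y\<bar>) \<le> \<epsilon>"
  shows "RL h"
  unfolding RL_def
proof (intro conjI allI impI h)
  fix \<epsilon> :: real assume "\<epsilon> > 0"
  then obtain g where g: "RL g" "integral {..0} (\<lambda>y. \<bar>h y - g y\<bar>) \<le> \<epsilon> / 2" using approx[of "\<epsilon>/2"] by auto
  then have gi: "g absolutely_integrable_on {..0}" by (simp add: RL_def)
  obtain R where R: "\<And>z x. 0 \<le> Im z \<Longrightarrow> R \<le> norm z \<Longrightarrow> x \<le> 0 \<Longrightarrow>
        norm (integral {..x} (\<lambda>y. wave z (x - y) * of_real (g y))) \<le> \<epsilon> / 2"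
    using g(1) \<open>\<epsilon> > 0\<close> unfolding RL_def by (meson half_gt_zero)
  show "\<exists>R. \<forall>z x. 0 \<le> Im z \<longrightarrow> R \<le> norm z \<longrightarrow> x \<le> 0 \<longrightarrow>
        norm (integral {..x} (\<lambda>y. wave z (x - y) * of_real (h y))) \<le> \<epsilon>"
  proof (intro exI[of _ R] allI impI)
    fix z x assume z: "0 \<le> Im z" "R \<le> norm z" and x: "x \<le> (0::real)"
    have di: "(\<lambda>y. h y - g y) absolutely_integrable_on {..0}" by (rule set_integral_diff(1)[OF h gi])
    have nd: "(\<lambda>y. \<bar>h y - g y\<bar>) absolutely_integrable_on {..0}"
      using absolutely_integrable_norm_real[OF di] by simp
    have "integral {..x} (\<lambda>y. wave z (x - y) * of_real (h y)) =
        integral {..x} (\<lambda>y. wave z (x - y) * of_real (h y - g y) + wave z (x - y) * of_real (g y))"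
      by (simp add: algebra_simps)
    also have "\<dots> = integral {..x} (\<lambda>y. wave z (x - y) * of_real (h y - g y)) + integral {..x} (\<lambda>y. wave z (x - y) * of_real (g y))"
      by (rule integral_add) (rule set_lebesgue_integral_eq_integral(1)[OF absint_wave_mult[OF z(1) _ x]], fact)+
    finally have eq: "integral {..x} (\<lambda>y. wave z (x - y) * of_real (h y)) = \<dots>" .
    have "norm (integral {..x} (\<lambda>y. wave z (x - y) * of_real (h y - g y))) \<le> integral {..x} (\<lambda>y. \<bar>h y - g y\<bar>)"
    proof (rule norm_integral_atMost_le[OF absint_wave_mult[OF z(1) di x] absint_atMost_mono[OF nd x]])
      fix y assume "y \<in> {..x}"
      then show "norm (wave z (x - y) * of_real (h y - g y)) \<le> \<bar>h y - g y\<bar>"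
        unfolding norm_mult norm_of_real using norm_wave_le_1[OF z(1), of "x - y"] by (simp add: mult_left_le_one_le)
    qed
    also have "\<dots> \<le> integral {..0} (\<lambda>y. \<bar>h y - g y\<bar>)" by (rule integral_atMost_mono_nonneg[OF nd x]) auto
    finally have "norm (integral {..x} (\<lambda>y. wave z (x - y) * of_real (h y - g y))) \<le> \<epsilon> / 2" using g(2) by simp
    then show "norm (integral {..x} (\<lambda>y. wave z (x - y) * of_real (h y))) \<le> \<epsilon>"
      unfolding eq using R[OF z x] norm_triangle_ineq[of "integral {..x} (\<lambda>y. wave z (x - y) * of_real (h y - g y))"]
      by (smt (verit) field_sum_of_halves)
  qed
qed

section \<open>From polynomials through continuous and bounded functions to integrable ones\<close>

lemma absint_cutoff:
  fixes g :: "real \<Rightarrow> real"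
  assumes "g absolutely_integrable_on {a..0}"
  shows "(\<lambda>y. if a \<le> y then g y else 0) absolutely_integrable_on {..0}"
proof -
  have "(\<lambda>y. if y \<in> {a..0} then g y else 0) absolutely_integrable_on UNIV"
    using assms unfolding absolutely_integrable_restrict_UNIV .
  then have "(\<lambda>y. if y \<in> {a..0} then g y else 0) absolutely_integrable_on {..0}"
    by (rule set_integrable_subset) auto
  then show ?thesis by (rule absint_eq) auto
qed

lemma integral_cutoff:
  fixes g :: "real \<Rightarrow> 'a::euclidean_space"
  shows "integral {..x} (\<lambda>y. if a \<le> y then g y else 0) = integral {a..x} g"
proof -
  have "integral {..x} (\<lambda>y. if a \<le> y then g y else 0) = integral {..x} (\<lambda>y. if y \<in> {a..x} then g y else 0)"
    by (rule integral_cong) auto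
  also have "\<dots> = integral ({a..x} \<inter> {..x}) g" by (rule integral_restrict_Int)
  also have "{a..x} \<inter> {..x} = {a..x}" by auto
  finally show ?thesis .
qed

text \<open>Integration by parts against the wave gains a factor \<open>1 / (2 * norm z)\<close>.
  Since \<open>x - y\<close> is nonnegative, the boundary terms and the remaining integral are
  bounded independently of \<open>x\<close> and \<open>z\<close>.\<close>

lemma RL_polynomial:
  assumes P: "real_polynomial_function P" and a: "a \<le> 0"
  shows "RL (\<lambda>y. if a \<le> y then P y else 0)"
proof -
  obtain P' where P': "real_polynomial_function P'" "\<And>x. (P has_real_derivative P' x) (at x)"
    using has_real_derivative_polynomial_function[OF P] by auto
  have cP: "continuous_on S P" "continuous_on S P'" for S
    using P P' by (auto intro: continuous_on_polymonial_function simp: real_polynomial_function_eq)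
  have "bounded (P ` {a..0})"
    by (intro compact_imp_bounded compact_continuous_image cP compact_Icc)
  then obtain M where "\<forall>x\<in>P ` {a..0}. norm x \<le> M" unfolding bounded_iff by blast
  then have M: "\<And>y. y \<in> {a..0} \<Longrightarrow> \<bar>P y\<bar> \<le> M" by auto
  have "bounded (P' ` {a..0})"
    by (intro compact_imp_bounded compact_continuous_image cP compact_Icc)
  then obtain M' where "\<forall>x\<in>P' ` {a..0}. norm x \<le> M'" unfolding bounded_iff by blast
  then have M': "\<And>y. y \<in> {a..0} \<Longrightarrow> \<bar>P' y\<bar> \<le> M'" by auto
  have M0: "0 \<le> M" "0 \<le> M'" using M[of 0] M'[of 0] a by auto
  \<comment> \<open>Two boundary terms, and the derivative over an interval of length at most
    \<open>- a\<close>.\<close>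
  define C where "C = 2 * M + M' * (- a)"
  have C0: "0 \<le> C" using M0 mult_nonneg_nonpos[OF M0(2) a] by (simp add: C_def)
  have est: "norm (integral {a..x} (\<lambda>y. wave z (x - y) * of_real (P y))) * (2 * norm z) \<le> C"
    if z: "0 \<le> Im z" and x: "x \<le> 0" for z x
  proof (cases "a \<le> x")
    case False
    then show ?thesis using C0 by simp
  next
    case True
    have "((\<lambda>y. - (2 * \<i> * z * (wave z (x - y) * of_real (P y))) + wave z (x - y) * of_real (P' y)) has_integral
        wave z (x - x) * of_real (P x) - wave z (x - a) * of_real (P a)) {a..x}"
    proof (rule fundamental_theorem_of_calculus[OF True])
      fix y
      have 1: "((\<lambda>y. complex_of_real (P y)) has_vector_derivative of_real (P' y)) (at y)"
        by (rule has_vector_derivative_of_real[OF P'(2)])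
      have 2: "((\<lambda>y. wave z (x - y)) has_vector_derivative - (2 * \<i> * z * wave z (x - y))) (at y)"
        using has_vector_derivative_wave[of z x "-1" y UNIV] by simp
      have "((\<lambda>y. wave z (x - y) * of_real (P y)) has_vector_derivative
           - (2 * \<i> * z * (wave z (x - y) * of_real (P y))) + wave z (x - y) * of_real (P' y)) (at y)"
        using has_vector_derivative_mult[OF 2 1] by (simp add: algebra_simps)
      then show "((\<lambda>y. wave z (x - y) * of_real (P y)) has_vector_derivative
           - (2 * \<i> * z * (wave z (x - y) * of_real (P y))) + wave z (x - y) * of_real (P' y)) (at y within {a..x})"
        by (rule has_vector_derivative_at_within)
    qed
    moreover have "((\<lambda>y. - (2 * \<i> * z * (wave z (x - y) * of_real (P y))) + wave z (x - y) * of_real (P' y)) has_integral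
        - (2 * \<i> * z * integral {a..x} (\<lambda>y. wave z (x - y) * of_real (P y)))
          + integral {a..x} (\<lambda>y. wave z (x - y) * of_real (P' y))) {a..x}"
      by (intro has_integral_add has_integral_neg has_integral_mult_right integrable_integral
          integrable_continuous_real continuous_intros cP)
    ultimately have "wave z (x - x) * of_real (P x) - wave z (x - a) * of_real (P a)
       = - (2 * \<i> * z * integral {a..x} (\<lambda>y. wave z (x - y) * of_real (P y)))
          + integral {a..x} (\<lambda>y. wave z (x - y) * of_real (P' y))"
      by (rule has_integral_unique)
    then have eq: "2 * \<i> * z * integral {a..x} (\<lambda>y. wave z (x - y) * of_real (P y))
      = wave z (x - a) * of_real (P a) - of_real (P x) + integral {a..x} (\<lambda>y. wave z (x - y) * of_real (P' y))"
      by (simp add: algebra_simps eq_neg_iff_add_eq_0)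
    have "norm (2 * \<i> * z * integral {a..x} (\<lambda>y. wave z (x - y) * of_real (P y))) \<le> M + M + M' * (x - a)"
      unfolding eq
    proof (intro norm_triangle_le add_mono norm_triangle_le_diff)
      show "norm (wave z (x - a) * of_real (P a)) \<le> M"
        using mult_mono[OF norm_wave_le_1[OF z, of "x - a"] M[of a]] True a M0 by (simp add: norm_mult)
      show "norm (complex_of_real (P x)) \<le> M" using M[of x] True x by simp
      show "norm (integral {a..x} (\<lambda>y. wave z (x - y) * of_real (P' y))) \<le> M' * (x - a)"
      proof (rule integral_bound[OF True])
        show "continuous_on {a..x} (\<lambda>y. wave z (x - y) * of_real (P' y))" by (intro continuous_intros cP)
        show "norm (wave z (x - y) * of_real (P' y)) \<le> M'" if "y \<in> {a..x}" for y
          using mult_mono[OF norm_wave_le_1[OF z, of "x - y"] M'[of y]] that x M0 by (simp add: norm_mult)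
      qed
    qed
    also have "\<dots> \<le> C" using mult_nonneg_nonpos[OF M0(2) x] by (simp add: C_def algebra_simps)
    finally show ?thesis by (simp add: norm_mult mult_ac)
  qed
  show ?thesis
    unfolding RL_def
  proof (intro conjI allI impI)
    show "(\<lambda>y. if a \<le> y then P y else 0) absolutely_integrable_on {..0}"
      by (rule absint_cutoff, rule absolutely_integrable_continuous_real[OF cP(1)])
    fix \<epsilon> :: real assume e: "\<epsilon> > 0"
    show "\<exists>R. \<forall>z x. 0 \<le> Im z \<longrightarrow> R \<le> norm z \<longrightarrow> x \<le> 0 \<longrightarrow>
        norm (integral {..x} (\<lambda>y. wave z (x - y) * of_real (if a \<le> y then P y else 0))) \<le> \<epsilon>"
    proof (intro exI[of _ "max 1 (C / \<epsilon>)"] allI impI)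
      fix z x assume z: "0 \<le> Im z" "max 1 (C / \<epsilon>) \<le> norm z" and x: "x \<le> (0::real)"
      have "C \<le> \<epsilon> * norm z" using z(2) e by (simp add: field_simps)
      then have "norm (integral {a..x} (\<lambda>y. wave z (x - y) * of_real (P y))) * (2 * norm z) \<le> \<epsilon> * (2 * norm z)"
        using est[OF z(1) x] C0 by linarith
      then have "norm (integral {a..x} (\<lambda>y. wave z (x - y) * of_real (P y))) \<le> \<epsilon>"
        using z(2) by (cases "z = 0") (auto simp: mult_le_cancel_right)
      moreover have "(\<lambda>y. wave z (x - y) * of_real (if a \<le> y then P y else 0)) = (\<lambda>y. if a \<le> y then wave z (x - y) * of_real (P y) else 0)"
        by auto
      ultimately show "norm (integral {..x} (\<lambda>y. wave z (x - y) * of_real (if a \<le> y then P y else 0))) \<le> \<epsilon>"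
        by (simp only: integral_cutoff)
    qed
  qed
qed

lemma RL_continuous:
  assumes g: "continuous_on {a..0} g" and a: "a \<le> 0"
  shows "RL (\<lambda>y. if a \<le> y then g y else 0)"
proof (rule RL_closure)
  show "(\<lambda>y. if a \<le> y then g y else 0) absolutely_integrable_on {..0}"
    by (rule absint_cutoff, rule absolutely_integrable_continuous_real[OF g])
  fix \<epsilon> :: real assume e: "\<epsilon> > 0"
  \<comment> \<open>The interval has length \<open>- a\<close>; the denominator \<open>1 - a\<close>
    stays positive even for \<open>a = 0\<close>.\<close>
  have e': "\<epsilon> / (1 - a) > 0" using e a by simp
  obtain P where P: "real_polynomial_function P" "\<And>y. y \<in> {a..0} \<Longrightarrow> \<bar>g y - P y\<bar> < \<epsilon> / (1 - a)"
    using Stone_Weierstrass_real_polynomial_function[OF compact_Icc g e'] by blast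
  have cP: "continuous_on {a..0} P"
    using P by (auto intro: continuous_on_polymonial_function simp: real_polynomial_function_eq)
  have "integral {..0} (\<lambda>y. \<bar>(if a \<le> y then g y else 0) - (if a \<le> y then P y else 0)\<bar>)
      = integral {..0} (\<lambda>y. if a \<le> y then \<bar>g y - P y\<bar> else 0)"
    by (rule integral_cong) auto
  also have "\<dots> = integral {a..0} (\<lambda>y. \<bar>g y - P y\<bar>)" by (rule integral_cutoff)
  also have "\<dots> \<le> integral {a..0} (\<lambda>y. \<epsilon> / (1 - a))"
    by (intro integral_le integrable_continuous_real continuous_intros g cP less_imp_le P(2))
  also have "\<dots> \<le> \<epsilon>" using a e by (simp add: field_simps)
  finally show "\<exists>f. RL f \<and> integral {..0} (\<lambda>y. \<bar>(if a \<le> y then g y else 0) - f y\<bar>) \<le> \<epsilon>"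
    using RL_polynomial[OF P(1) a] by blast
qed

text \<open>Measurability supplies continuous functions that converge outside a null set. Clipping
  them to the range from \<open>- M\<close> to \<open>M\<close> keeps the limit and provides the
  constant majorant \<open>2 * M\<close>.\<close>

lemma RL_bounded:
  assumes h: "h absolutely_integrable_on {a..0}" and a: "a \<le> 0" and M: "\<And>y. \<bar>h y\<bar> \<le> M"
  shows "RL (\<lambda>y. if a \<le> y then h y else 0)"
proof (rule RL_closure)
  show hc: "(\<lambda>y. if a \<le> y then h y else 0) absolutely_integrable_on {..0}" by (rule absint_cutoff[OF h])
  have M0: "0 \<le> M" using M[of 0] by simp
  have "h \<in> borel_measurable (lebesgue_on {a..0})"
    using h absolutely_integrable_measurable[of "{a..0}" h] by auto
  then have "h measurable_on {a..0}" by (simp add: measurable_on_iff_borel_measurable)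
  then obtain N g where N: "negligible N" and g: "\<And>n. continuous_on UNIV (g n)"
    and lim: "\<And>x. x \<notin> N \<Longrightarrow> (\<lambda>n. g n x) \<longlonglongrightarrow> (if x \<in> {a..0} then h x else 0)"
    unfolding measurable_on_def by blast
  define G where "G n y = max (- M) (min M (g n y))" for n :: nat and y
  have Gc: "continuous_on S (G n)" for S n
    unfolding G_def by (intro continuous_intros continuous_on_subset[OF g]) auto
  let ?S = "{a..0} - N"
  have spike: "integral ?S f = integral {a..0} f" for f :: "real \<Rightarrow> real"
    by (rule integral_spike_set) (use N in \<open>auto intro: negligible_subset\<close>)
  have di: "(\<lambda>y. \<bar>h y - G n y\<bar>) absolutely_integrable_on {a..0}" for n
    using absolutely_integrable_norm_real[OF set_integral_diff(1)[OF h absolutely_integrable_continuous_real[OF Gc]]] by simp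
  have "(\<lambda>n. integral ?S (\<lambda>y. \<bar>h y - G n y\<bar>)) \<longlonglongrightarrow> integral ?S (\<lambda>y. 0::real)"
  proof (rule dominated_convergence(2)[where h = "\<lambda>y. 2 * M"])
    show "(\<lambda>y. \<bar>h y - G n y\<bar>) integrable_on ?S" for n
      by (rule integrable_spike_set[OF set_lebesgue_integral_eq_integral(1)[OF di]])
         (use N in \<open>auto intro: negligible_subset\<close>)
    show "(\<lambda>y. 2 * M) integrable_on ?S"
      by (rule integrable_spike_set[OF integrable_const_ivl[of _ a 0]])
         (use N in \<open>auto intro: negligible_subset\<close>)
    show "norm \<bar>h y - G n y\<bar> \<le> 2 * M" for n y
      using M[of y] M0 by (auto simp: G_def)
    fix y assume y: "y \<in> ?S"
    have *: "(\<lambda>n. \<bar>h y - max (- M) (min M (g n y))\<bar>) \<longlonglongrightarrow> \<bar>h y - max (- M) (min M (h y))\<bar>"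
      using lim[of y] y by (intro tendsto_intros) auto
    show "(\<lambda>n. \<bar>h y - G n y\<bar>) \<longlonglongrightarrow> 0"
    proof -
      have "max (- M) (min M (h y)) = h y" using M[of y] by auto
      with * show ?thesis by (simp add: G_def)
    qed
  qed
  then have l: "(\<lambda>n. integral {a..0} (\<lambda>y. \<bar>h y - G n y\<bar>)) \<longlonglongrightarrow> 0" by (simp add: spike)
  fix \<epsilon> :: real assume e: "\<epsilon> > 0"
  obtain n where n: "integral {a..0} (\<lambda>y. \<bar>h y - G n y\<bar>) < \<epsilon>"
    using order_tendstoD(2)[OF l e] by (auto simp: eventually_sequentially)
  have "integral {..0} (\<lambda>y. \<bar>(if a \<le> y then h y else 0) - (if a \<le> y then G n y else 0)\<bar>)
      = integral {..0} (\<lambda>y. if a \<le> y then \<bar>h y - G n y\<bar> else 0)"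
    by (rule integral_cong) auto
  also have "\<dots> = integral {a..0} (\<lambda>y. \<bar>h y - G n y\<bar>)" by (rule integral_cutoff)
  finally show "\<exists>f. RL f \<and> integral {..0} (\<lambda>y. \<bar>(if a \<le> y then h y else 0) - f y\<bar>) \<le> \<epsilon>"
    using RL_continuous[OF Gc a] n by (intro exI[of _ "\<lambda>y. if a \<le> y then G n y else 0"]) auto
qed

lemma Riemann_Lebesgue_atMost:
  assumes h: "h absolutely_integrable_on {..0}"
  shows "RL h"
proof (rule RL_closure[OF h])
  \<comment> \<open>Height and range are truncated at the same level \<open>n\<close>, so that each
    \<open>K n\<close> falls under the bounded case while \<open>h - K n\<close> stays dominated by
    \<open>h\<close>.\<close>
  define H where "H n y = max (- real n) (min (real n) (h y))" for n y
  define K where "K n y = (if - real n \<le> y then H n y else 0)" for n y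
  have Hint: "H n absolutely_integrable_on {- real n..0}" for n
  proof -
    have "h absolutely_integrable_on {- real n..0}" by (rule absint_Icc[OF h]) simp
    moreover have "(\<lambda>y. c) absolutely_integrable_on {- real n..0}" for c :: real
      by (rule absolutely_integrable_continuous_real) (intro continuous_intros)
    ultimately show ?thesis unfolding H_def
      by (intro absolutely_integrable_max_1 absolutely_integrable_min_1)
  qed
  have RLK: "RL (K n)" for n
    unfolding K_def by (rule RL_bounded[OF Hint, where M = "real n"]) (auto simp: H_def)
  then have Ki: "K n absolutely_integrable_on {..0}" for n by (simp add: RL_def)
  have "(\<lambda>n. integral {..0} (\<lambda>y. \<bar>h y - K n y\<bar>)) \<longlonglongrightarrow> integral {..0} (\<lambda>y::real. 0::real)"
  proof (rule dominated_convergence(2)[where h = "\<lambda>y. \<bar>h y\<bar>"])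
    show "(\<lambda>y. \<bar>h y - K n y\<bar>) integrable_on {..0}" for n
      using absolutely_integrable_norm_real[OF set_integral_diff(1)[OF h Ki]]
      by (auto intro: set_lebesgue_integral_eq_integral(1))
    show "(\<lambda>y. \<bar>h y\<bar>) integrable_on {..0}"
      using absolutely_integrable_norm_real[OF h] by (auto intro: set_lebesgue_integral_eq_integral(1))
    show "norm \<bar>h y - K n y\<bar> \<le> \<bar>h y\<bar>" for n y by (auto simp: K_def H_def)
    fix y :: real
    obtain m :: nat where m: "max \<bar>y\<bar> \<bar>h y\<bar> \<le> real m" using real_arch_simple by blast
    have "eventually (\<lambda>n. \<bar>h y - K n y\<bar> = 0) sequentially"
      using m by (intro eventually_sequentiallyI[of m]) (auto simp: K_def H_def)
    then show "(\<lambda>n. \<bar>h y - K n y\<bar>) \<longlonglongrightarrow> 0" by (rule tendsto_eventually)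
  qed
  then have l: "(\<lambda>n. integral {..0} (\<lambda>y. \<bar>h y - K n y\<bar>)) \<longlonglongrightarrow> 0" by simp
  fix \<epsilon> :: real assume e: "\<epsilon> > 0"
  obtain n where "integral {..0} (\<lambda>y. \<bar>h y - K n y\<bar>) < \<epsilon>"
    using order_tendstoD(2)[OF l e] by (auto simp: eventually_sequentially)
  then show "\<exists>g. RL g \<and> integral {..0} (\<lambda>y. \<bar>h y - g y\<bar>) \<le> \<epsilon>" using RLK[of n] by (intro exI[of _ "K n"]) auto
qed

section \<open>Background kernels\<close>

no_notation fps_nth (infixl "$" 75)

lemma has_integral_neg_swap_reflect:
  fixes f :: "real \<Rightarrow> complex"
  assumes f: "f absolutely_integrable_on {x..}"
  shows "(\<lambda>y. f (- y)) absolutely_integrable_on {..- x}"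
    and "integral {..- x} (\<lambda>y. f (- y)) = integral {x..} f"
proof -
  have r: "(\<lambda>y. g (- y)) absolutely_integrable_on {..- x} \<and> integral {..- x} (\<lambda>y. g (- y)) = integral {x..} g"
    if "g absolutely_integrable_on {x..}" for g :: "real \<Rightarrow> real"
    using has_absolute_integral_reflect_real[of "{..- x}" "{x..}" g "integral {x..} g"] that by auto
  have R: "(\<lambda>y. Re (f y)) absolutely_integrable_on {x..}" and I: "(\<lambda>y. Im (f y)) absolutely_integrable_on {x..}"
    using absolutely_integrable_linear[OF f bounded_linear_Re] absolutely_integrable_linear[OF f bounded_linear_Im]
    by (simp_all add: comp_def)
  have fi: "f integrable_on {x..}" using f by (rule set_lebesgue_integral_eq_integral(1))
  have eq: "(\<lambda>y. f (- y)) = (\<lambda>y. of_real (Re (f (- y))) + \<i> * of_real (Im (f (- y))))"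
    by (auto simp: complex_eq_iff)
  show ai: "(\<lambda>y. f (- y)) absolutely_integrable_on {..- x}"
    unfolding eq using r[OF R] r[OF I]
    by (intro set_integral_add(1) set_integrable_mult_right absint_of_real) auto
  then have fi': "(\<lambda>y. f (- y)) integrable_on {..- x}" by (rule set_lebesgue_integral_eq_integral(1))
  show "integral {..- x} (\<lambda>y. f (- y)) = integral {x..} f"
    using r[OF R] r[OF I] integral_linear[OF fi bounded_linear_Re] integral_linear[OF fi bounded_linear_Im]
      integral_linear[OF fi' bounded_linear_Re] integral_linear[OF fi' bounded_linear_Im]
    by (simp add: complex_eq_iff comp_def)
qed

section \<open>Two-by-two matrices and unit triangular inverses\<close>

lemma mat2_nth [simp]:
  "mat2 a b c d $ 1 $ 1 = a" "mat2 a b c d $ 1 $ 2 = b" "mat2 a b c d $ 2 $ 1 = c" "mat2 a b c d $ 2 $ 2 = d"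
  by (simp_all add: mat2_def)

lemma matrix_mult_2_nth:
  fixes X Y :: "complex^2^2"
  shows "(X ** Y) $ i $ j = X $ i $ 1 * Y $ 1 $ j + X $ i $ 2 * Y $ 2 $ j"
  by (simp add: matrix_matrix_mult_def sum_2)

lemma mat2_eq_iff:
  fixes X Y :: "complex^2^2"
  shows "X = Y \<longleftrightarrow> X$1$1 = Y$1$1 \<and> X$1$2 = Y$1$2 \<and> X$2$1 = Y$2$1 \<and> X$2$2 = Y$2$2"
    (is "_ \<longleftrightarrow> ?R")
proof
  assume ?R
  then have "X $ i $ j = Y $ i $ j" for i j using exhaust_2[of i] exhaust_2[of j] by metis
  then show "X = Y" by (simp add: vec_eq_iff)
qed simp

lemma mat2_mult: "mat2 a b c d ** mat2 a' b' c' d' = mat2 (a*a'+b*c') (a*b'+b*d') (c*a'+d*c') (c*b'+d*d')"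
  by (simp add: mat2_eq_iff matrix_mult_2_nth)

lemma mat2_1: "mat 1 = mat2 1 0 0 1"
  by (simp add: mat2_eq_iff mat_def)

lemma matrix_inv_unique_2:
  fixes X Y :: "complex^2^2"
  assumes "X ** Y = mat 1" "Y ** X = mat 1"
  shows "matrix_inv X = Y"
proof -
  have "X ** matrix_inv X = mat 1 \<and> matrix_inv X ** X = mat 1"
    unfolding matrix_inv_def using assms by (rule_tac someI[of "\<lambda>Z. X ** Z = mat 1 \<and> Z ** X = mat 1" Y]) auto
  then have "matrix_inv X = (Y ** X) ** matrix_inv X" "Y ** (X ** matrix_inv X) = Y" using assms by simp_all
  then show ?thesis by (simp add: matrix_mul_assoc)
qed

lemma matrix_inv_lower: "matrix_inv (mat2 1 0 n 1) = mat2 1 0 (- n) 1"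
  by (rule matrix_inv_unique_2) (simp_all add: mat2_mult mat2_1)

lemma matrix_inv_upper: "matrix_inv (mat2 1 n 0 1) = mat2 1 (- n) 0 1"
  by (rule matrix_inv_unique_2) (simp_all add: mat2_mult mat2_1)

text \<open>
  \<open>bg\<close> is the off-diagonal entry of the background matrices; \<open>kap1\<close> and \<open>kap2\<close> are the off-diagonal
  entries of the background Green functions in a form without the apparent poles at \<open>k = B\<close> and
  \<open>k = - B\<close>.
\<close>

definition bg :: "real \<Rightarrow> real \<Rightarrow> complex \<Rightarrow> real \<Rightarrow> complex" where
  "bg A B k x = of_real A * (of_real (B * sin (2 * B * x)) - \<i> * k * of_real (cos (2 * B * x)))
             / (2 * (k^2 - (of_real B)^2))"

lemma N_minus_bg: "N_minus A B x k = mat2 1 0 (bg A B k x) 1"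
  by (simp add: N_minus_def bg_def)

lemma N_plus_bg: "N_plus A B x k = mat2 1 (bg A B k (- x)) 0 1"
  by (simp add: N_plus_def bg_def minus_divide_left algebra_simps)

definition kap1 :: "real \<Rightarrow> real \<Rightarrow> complex \<Rightarrow> real \<Rightarrow> real \<Rightarrow> complex" where
  "kap1 A B z x y = - of_real A * integral {y..x} (\<lambda>s. wave z (x - s) * of_real (cos (2 * B * s)))"

definition kap2 :: "real \<Rightarrow> real \<Rightarrow> complex \<Rightarrow> real \<Rightarrow> real \<Rightarrow> complex" where
  "kap2 A B z x y = - of_real A * integral {y..x} (\<lambda>s. wave z (s - y) * of_real (cos (2 * B * s)))"

text \<open>An integral anchored at 0. Up to the factor \<open>wave z (- y)\<close> it splits
  \<open>kap2 A B z x y\<close> into a term in \<open>x\<close> and a term in \<open>y\<close>, at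
  every \<open>z\<close>, including the resonances, where the splitting through \<open>bg\<close>
  has a pole.\<close>

definition kprim :: "real \<Rightarrow> real \<Rightarrow> complex \<Rightarrow> real \<Rightarrow> complex" where
  "kprim A B z x = of_real A * integral {x..0} (\<lambda>s. wave z s * of_real (cos (2 * B * s)))"

section \<open>Background Green functions without apparent poles\<close>

lemma wave_minus: "wave (- z) t = wave z (- t)"
  by (simp add: wave_def)

lemma wave_inverse: "wave z t * wave z (- t) = 1"
  by (simp add: wave_add[symmetric])

text \<open>The delays \<open>x - s\<close> and \<open>s - y\<close> add up to \<open>x - y\<close>;
  a wave of that full length converts one kernel into the other at the opposite parameter.\<close>

lemma kap1_kap2: "kap1 A B z x y = wave z (x - y) * kap2 A B (- z) x y"
proof -
  have "integral {y..x} (\<lambda>s. wave z (x - s) * of_real (cos (2 * B * s)))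
     = integral {y..x} (\<lambda>s. wave z (x - y) * (wave (- z) (s - y) * of_real (cos (2 * B * s))))"
    by (rule integral_cong) (simp add: wave_minus mult.assoc[symmetric] wave_add[symmetric])
  then show ?thesis by (simp add: kap1_def kap2_def)
qed

lemma kap2_kprim:
  assumes "y \<le> x" "x \<le> 0"
  shows "kap2 A B z x y = wave z (- y) * (kprim A B z x - kprim A B z y)"
proof -
  have i: "(\<lambda>s. wave z s * of_real (cos (2 * B * s))) integrable_on {y..0}"
    by (intro integrable_continuous_real continuous_intros)
  have "integral {y..x} (\<lambda>s. wave z (s - y) * of_real (cos (2 * B * s)))
     = integral {y..x} (\<lambda>s. wave z (- y) * (wave z s * of_real (cos (2 * B * s))))"
    by (rule integral_cong) (simp add: mult.assoc[symmetric] wave_add[symmetric])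
  then have h: "integral {y..x} (\<lambda>s. wave z (s - y) * of_real (cos (2 * B * s)))
     = wave z (- y) * integral {y..x} (\<lambda>s. wave z s * of_real (cos (2 * B * s)))"
    by (simp only: integral_mult_right)
  have *: "integral {y..x} (\<lambda>s. wave z s * of_real (cos (2 * B * s))) + integral {x..0} (\<lambda>s. wave z s * of_real (cos (2 * B * s)))
      = integral {y..0} (\<lambda>s. wave z s * of_real (cos (2 * B * s)))"
    by (rule Henstock_Kurzweil_Integration.integral_combine[OF assms i])
  then show ?thesis unfolding kap2_def kprim_def h *[symmetric] by (simp add: algebra_simps)
qed

lemma continuous_on_kprim: "continuous_on {..0} (kprim A B z)"
proof -
  have "continuous_on {..0} (\<lambda>x. integral {x..0} (\<lambda>s. wave z s * of_real (cos (2 * B * s))))"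
    unfolding continuous_on_sequentially comp_def
  proof (intro allI ballI impI)
    fix s :: "nat \<Rightarrow> real" and x assume x: "x \<in> {..0}" and s: "(\<forall>n. s n \<in> {..0}) \<and> s \<longlonglongrightarrow> x"
    obtain M where M: "\<And>n. norm (s n) \<le> M"
      using convergent_imp_Bseq[of s] s by (auto simp: convergent_def Bseq_def)
    \<comment> \<open>A convergent sequence is bounded, so it stays in one compact interval, on
      which the indefinite integral is continuous.\<close>
    define a where "a = min x (- M)"
    have "continuous_on {a..0} (\<lambda>x. integral {x..0} (\<lambda>s. wave z s * of_real (cos (2 * B * s))))"
      by (rule indefinite_integral_continuous_1') (intro integrable_continuous_real continuous_intros)
    moreover have "s n \<in> {a..0}" for n using M[of n] s by (auto simp: a_def min_def abs_le_iff)
    moreover have "x \<in> {a..0}" using x by (simp add: a_def)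
    ultimately show "(\<lambda>n. integral {s n..0} (\<lambda>s. wave z s * of_real (cos (2 * B * s)))) \<longlonglongrightarrow>
       integral {x..0} (\<lambda>s. wave z s * of_real (cos (2 * B * s)))"
      using s unfolding continuous_on_sequentially comp_def by blast
  qed
  then show ?thesis unfolding kprim_def by (intro continuous_intros)
qed

text \<open>\<open>bg\<close> solves the background equation
  \<open>n' - 2 \<i> k n = - A cos (2 B s)\<close>. Multiplied by a wave this becomes an exact
  derivative, which is integrated from \<open>y\<close> to \<open>x\<close>. The left side has no
  pole at \<open>k\<^sup>2 = B\<^sup>2\<close>, so the poles on the right cancel.\<close>

lemma kap2_bg:
  assumes k: "k^2 \<noteq> (of_real B)^2" and yx: "y \<le> x"
  shows "kap2 A B (- k) x y = wave (- k) (x - y) * bg A B k x - bg A B k y"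
proof -
  have nz: "k^2 - (of_real B)^2 \<noteq> 0" using k by simp
  define D where "D = 2 * (k^2 - (of_real B)^2)"
  have D: "D \<noteq> 0" using nz by (simp add: D_def)
  have "((\<lambda>s. - of_real A * (wave (- k) (s - y) * of_real (cos (2 * B * s)))) has_integral
      wave (- k) (x - y) * bg A B k x - wave (- k) (y - y) * bg A B k y) {y..x}"
  proof (rule fundamental_theorem_of_calculus[OF yx])
    fix s
    have 1: "((\<lambda>s. wave (- k) (s - y)) has_vector_derivative (- (2 * \<i> * k * wave (- k) (s - y)))) (at s within {y..x})"
      using has_vector_derivative_wave[of "- k" "- y" 1 s] by (simp add: algebra_simps)
    have 2: "(bg A B k has_vector_derivative of_real A * (of_real (2 * B^2 * cos (2 * B * s)) + 2 * \<i> * k * of_real (B * sin (2 * B * s))) / D) (at s within {y..x})"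
    proof -
      have d1: "((\<lambda>s. complex_of_real (B * sin (2 * B * s))) has_vector_derivative of_real (2 * B^2 * cos (2 * B * s))) (at s within {y..x})"
        by (rule has_vector_derivative_of_real) (auto intro!: derivative_eq_intros simp: power2_eq_square)
      have d2: "((\<lambda>s. complex_of_real (cos (2 * B * s))) has_vector_derivative of_real (- 2 * B * sin (2 * B * s))) (at s within {y..x})"
        by (rule has_vector_derivative_of_real) (auto intro!: derivative_eq_intros)
      have m1: "((\<lambda>s. of_real A / D * (complex_of_real (B * sin (2 * B * s)) - \<i> * k * complex_of_real (cos (2 * B * s)))) has_vector_derivative
         of_real A / D * (of_real (2 * B^2 * cos (2 * B * s)) - \<i> * k * of_real (- 2 * B * sin (2 * B * s)))) (at s within {y..x})"
        by (intro has_vector_derivative_mult_right has_vector_derivative_diff d1 d2)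
      have m2: "(\<lambda>s. of_real A / D * (complex_of_real (B * sin (2 * B * s)) - \<i> * k * complex_of_real (cos (2 * B * s)))) = bg A B k"
        by (simp add: bg_def D_def fun_eq_iff)
      have m3: "of_real A / D * (of_real (2 * B^2 * cos (2 * B * s)) - \<i> * k * of_real (- 2 * B * sin (2 * B * s)))
         = of_real A * (of_real (2 * B^2 * cos (2 * B * s)) + 2 * \<i> * k * of_real (B * sin (2 * B * s))) / D"
        by simp
      show ?thesis using m1 unfolding m2 m3 .
    qed
    let ?C = "complex_of_real (cos (2 * B * s))" and ?S = "complex_of_real (sin (2 * B * s))"
    have bgD: "bg A B k s = of_real A * (of_real B * ?S - \<i> * k * ?C) / D"
      by (simp add: bg_def D_def)
    have "of_real A * (of_real (2 * B^2 * cos (2 * B * s)) + 2 * \<i> * k * of_real (B * sin (2 * B * s))) / D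
       - 2 * \<i> * k * bg A B k s = of_real A * (2 * (of_real B)^2 * ?C - 2 * k^2 * ?C) / D"
      unfolding bgD times_divide_eq_right diff_divide_distrib[symmetric]
      by (rule arg_cong[of _ _ "\<lambda>t. t / D"]) (simp add: algebra_simps power2_eq_square)
    also have "of_real A * (2 * (of_real B)^2 * ?C - 2 * k^2 * ?C) = - of_real A * ?C * D"
      by (simp add: D_def algebra_simps)
    finally have key: "of_real A * (of_real (2 * B^2 * cos (2 * B * s)) + 2 * \<i> * k * of_real (B * sin (2 * B * s))) / D
       - 2 * \<i> * k * bg A B k s = - of_real A * ?C" using D by simp
    have "((\<lambda>s. wave (- k) (s - y) * bg A B k s) has_vector_derivative
        wave (- k) (s - y) * (of_real A * (of_real (2 * B^2 * cos (2 * B * s)) + 2 * \<i> * k * of_real (B * sin (2 * B * s))) / D)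
        + (- (2 * \<i> * k * wave (- k) (s - y))) * bg A B k s) (at s within {y..x})"
      by (rule has_vector_derivative_mult[OF 1 2])
    also have "wave (- k) (s - y) * (of_real A * (of_real (2 * B^2 * cos (2 * B * s)) + 2 * \<i> * k * of_real (B * sin (2 * B * s))) / D)
        + (- (2 * \<i> * k * wave (- k) (s - y))) * bg A B k s
       = wave (- k) (s - y) * (of_real A * (of_real (2 * B^2 * cos (2 * B * s)) + 2 * \<i> * k * of_real (B * sin (2 * B * s))) / D
       - 2 * \<i> * k * bg A B k s)" by (simp add: right_diff_distrib mult_ac)
    also have "\<dots> = - of_real A * (wave (- k) (s - y) * ?C)" unfolding key by simp
    finally show "((\<lambda>s. wave (- k) (s - y) * bg A B k s) has_vector_derivative
        - of_real A * (wave (- k) (s - y) * ?C)) (at s within {y..x})" .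
  qed
  then have "integral {y..x} (\<lambda>s. - of_real A * (wave (- k) (s - y) * of_real (cos (2 * B * s))))
     = wave (- k) (x - y) * bg A B k x - wave (- k) (y - y) * bg A B k y"
    by (rule integral_unique)
  then show ?thesis unfolding kap2_def integral_mult_right by simp
qed

lemma isCont_kap2: "isCont (\<lambda>z. kap2 A B (- z) x y) k"
proof -
  have "continuous_on UNIV (\<lambda>z. integral (cbox y x) (\<lambda>s. wave (- z) (s - y) * of_real (cos (2 * B * s))))"
    by (rule integral_continuous_on_param) (auto simp: wave_def case_prod_unfold intro!: continuous_intros)
  then have "continuous_on UNIV (\<lambda>z. kap2 A B (- z) x y)"
    unfolding kap2_def box_real by (intro continuous_intros)
  then show ?thesis by (simp add: continuous_on_eq_continuous_at)
qed

lemma Lim_mat2: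
  assumes "(f1 \<longlongrightarrow> l1) (at k)" "(f2 \<longlongrightarrow> l2) (at k)" "(f3 \<longlongrightarrow> l3) (at k)" "(f4 \<longlongrightarrow> l4) (at (k::complex))"
    and ev: "eventually (\<lambda>z. F z = mat2 (f1 z) (f2 z) (f3 z) (f4 z)) (at k)"
  shows "Lim (at k) F = mat2 l1 l2 l3 l4"
proof (rule tendsto_Lim)
  have "((\<lambda>z. mat2 (f1 z) (f2 z) (f3 z) (f4 z)) \<longlongrightarrow> mat2 l1 l2 l3 l4) (at k)"
  proof (intro vec_tendstoI)
    fix i j :: 2
    show "((\<lambda>z. mat2 (f1 z) (f2 z) (f3 z) (f4 z) $ i $ j) \<longlongrightarrow> mat2 l1 l2 l3 l4 $ i $ j) (at k)"
      using exhaust_2[of i] exhaust_2[of j] assms(1-4) by (elim disjE) simp_all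
  qed
  then show "(F \<longlongrightarrow> mat2 l1 l2 l3 l4) (at k)"
    by (rule Lim_transform_eventually) (use ev in eventually_elim, simp)
qed simp

lemma square_neq: "z \<noteq> of_real B \<Longrightarrow> z \<noteq> - of_real B \<Longrightarrow> z^2 \<noteq> (complex_of_real B)^2"
  by (simp add: power2_eq_iff)

lemma eventually_square_neq: "eventually (\<lambda>z. z^2 \<noteq> (complex_of_real B)^2) (at k)"
proof -
  have "eventually (\<lambda>z. z \<noteq> of_real B) (at k)" "eventually (\<lambda>z. z \<noteq> - of_real B) (at k)"
    by (rule eventually_neq_at_within)+
  then show ?thesis by eventually_elim (simp add: square_neq)
qed

lemma mat2_conj_lower:
  assumes "E * W = E'"
  shows "mat2 1 0 n 1 ** mat2 E' 0 0 E ** mat2 1 0 (- m) 1 = mat2 E' 0 (E * (W * n - m)) E"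
  unfolding assms[symmetric] mat2_mult mat2_eq_iff by (simp add: algebra_simps)

lemma mat2_conj_upper:
  assumes "E * W = E'"
  shows "mat2 1 n 0 1 ** mat2 E 0 0 E' ** mat2 1 (- m) 0 1 = mat2 E (E * (W * n - m)) 0 E'"
  unfolding assms[symmetric] mat2_mult mat2_eq_iff by (simp add: algebra_simps)

text \<open>Off the resonances the matrix product is computed directly, and the background entries
  enter only through \<open>kap2\<close>. As \<open>kap2\<close> is continuous in \<open>k\<close>,
  the limit in the definition of the kernel exists and is given by the same formula.\<close>

lemma G_minus_eq:
  assumes yx: "y \<le> x"
  shows "G_minus A B x y k = mat2 (exp (- (\<i> * k * of_real (x - y)))) 0
     (exp (\<i> * k * of_real (x - y)) * kap2 A B (- k) x y) (exp (\<i> * k * of_real (x - y)))" (is "_ = ?R k")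
proof -
  let ?G = "\<lambda>z. N_minus A B x z ** exp_sigma3 (\<i> * z * of_real (y - x)) ** matrix_inv (N_minus A B y z)"
  have eq: "?G z = ?R z" if "z^2 \<noteq> (of_real B)^2" for z
  proof -
    have e1: "exp (\<i> * z * of_real (x - y)) * wave (- z) (x - y) = exp (- (\<i> * z * of_real (x - y)))"
      by (simp add: wave_def exp_add[symmetric] algebra_simps)
    have e2: "\<i> * z * of_real (y - x) = - (\<i> * z * of_real (x - y))" by (simp add: algebra_simps)
    show ?thesis
      unfolding N_minus_bg exp_sigma3_def matrix_inv_lower kap2_bg[OF that yx] e2 minus_minus
      by (rule mat2_conj_lower[OF e1])
  qed
  show ?thesis
  proof (cases "k = of_real B \<or> k = - of_real B")
    case False
    then show ?thesis using eq[OF square_neq] by (simp add: G_minus_def G_ext_def)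
  next
    case True
    have "Lim (at k) ?G = ?R k"
    proof (rule Lim_mat2)
      show "((\<lambda>z. exp (\<i> * z * of_real (x - y)) * kap2 A B (- z) x y) \<longlongrightarrow> exp (\<i> * k * of_real (x - y)) * kap2 A B (- k) x y) (at k)"
        by (intro tendsto_intros isCont_kap2[unfolded isCont_def])
      show "eventually (\<lambda>z. ?G z = ?R z) (at k)"
        using eventually_square_neq by eventually_elim (rule eq)
    qed (intro tendsto_intros)+
    then show ?thesis using True by (simp add: G_minus_def G_ext_def Let_def)
  qed
qed

lemma G_plus_eq:
  assumes xy: "x \<le> y"
  shows "G_plus A B x y k = mat2 (exp (\<i> * k * of_real (y - x))) (exp (\<i> * k * of_real (y - x)) * kap2 A B (- k) (- x) (- y))
     0 (exp (- (\<i> * k * of_real (y - x))))" (is "_ = ?R k")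
proof -
  let ?G = "\<lambda>z. N_plus A B x z ** exp_sigma3 (\<i> * z * of_real (y - x)) ** matrix_inv (N_plus A B y z)"
  have eq: "?G z = ?R z" if "z^2 \<noteq> (of_real B)^2" for z
  proof -
    have e1: "exp (\<i> * z * of_real (y - x)) * wave (- z) (- x - - y) = exp (- (\<i> * z * of_real (y - x)))"
      by (simp add: wave_def exp_add[symmetric] algebra_simps)
    have yx: "- y \<le> - x" using xy by simp
    show ?thesis
      unfolding N_plus_bg exp_sigma3_def matrix_inv_upper kap2_bg[OF that yx]
      by (rule mat2_conj_upper[OF e1])
  qed
  show ?thesis
  proof (cases "k = of_real B \<or> k = - of_real B")
    case False
    then show ?thesis using eq[OF square_neq] by (simp add: G_plus_def G_ext_def)
  next
    case True
    have "Lim (at k) ?G = ?R k"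
    proof (rule Lim_mat2)
      show "((\<lambda>z. exp (\<i> * z * of_real (y - x)) * kap2 A B (- z) (- x) (- y)) \<longlongrightarrow> exp (\<i> * k * of_real (y - x)) * kap2 A B (- k) (- x) (- y)) (at k)"
        by (intro tendsto_intros isCont_kap2[unfolded isCont_def])
      show "eventually (\<lambda>z. ?G z = ?R z) (at k)"
        using eventually_square_neq by eventually_elim (rule eq)
    qed (intro tendsto_intros)+
    then show ?thesis using True by (simp add: G_plus_def G_ext_def Let_def)
  qed
qed

section \<open>The columns as solutions of the Volterra system\<close>

text \<open>\<open>kap1\<close> and \<open>kap2\<close> integrate waves, with delays between 0 and
  \<open>x - y\<close>, against a cosine. A bound valid for all these delays survives the
  integration and costs the length \<open>x - y\<close> and the factor \<open>A\<close>; this is the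
  origin of the hypothesis on \<open>E22\<close>.\<close>

lemma kap_comb:
  fixes \<theta> :: "real \<Rightarrow> real"
  assumes A: "0 \<le> A" and yx: "y \<le> x" and th: "continuous_on {y..x} \<theta>" "\<And>s. s \<in> {y..x} \<Longrightarrow> 0 \<le> \<theta> s \<and> \<theta> s \<le> x - y"
    and b: "\<And>t. 0 \<le> t \<Longrightarrow> t \<le> x - y \<Longrightarrow> norm (c1 * wave z1 t + c2 * wave z2 t + c3 * wave z3 t) \<le> \<beta>"
  shows "norm (c1 * (- of_real A * integral {y..x} (\<lambda>s. wave z1 (\<theta> s) * of_real (cos (2 * B * s))))
     + c2 * (- of_real A * integral {y..x} (\<lambda>s. wave z2 (\<theta> s) * of_real (cos (2 * B * s))))
     + c3 * (- of_real A * integral {y..x} (\<lambda>s. wave z3 (\<theta> s) * of_real (cos (2 * B * s))))) \<le> \<beta> * (A * (x - y))"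
proof -
  let ?f = "\<lambda>z s. wave z (\<theta> s) * complex_of_real (cos (2 * B * s))"
  have fc: "continuous_on {y..x} (?f z)" for z by (intro continuous_intros th)
  have i: "((\<lambda>s. c * ?f z s) has_integral c * integral {y..x} (?f z)) {y..x}" for c z
    by (intro has_integral_mult_right integrable_integral integrable_continuous_real fc)
  have *: "integral {y..x} (\<lambda>s. c1 * ?f z1 s + c2 * ?f z2 s + c3 * ?f z3 s)
      = c1 * integral {y..x} (?f z1) + c2 * integral {y..x} (?f z2) + c3 * integral {y..x} (?f z3)"
    by (intro integral_unique has_integral_add i)
  have eq: "c1 * (- of_real A * integral {y..x} (?f z1)) + c2 * (- of_real A * integral {y..x} (?f z2))
     + c3 * (- of_real A * integral {y..x} (?f z3)) = - of_real A * integral {y..x} (\<lambda>s. c1 * ?f z1 s + c2 * ?f z2 s + c3 * ?f z3 s)"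
  proof -
    have "c1 * (a * i1) + c2 * (a * i2) + c3 * (a * i3) = a * (c1 * i1 + c2 * i2 + c3 * i3)" for a i1 i2 i3 :: complex
      by (simp add: algebra_simps)
    then show ?thesis unfolding * .
  qed
  have "norm (integral {y..x} (\<lambda>s. c1 * ?f z1 s + c2 * ?f z2 s + c3 * ?f z3 s)) \<le> \<beta> * (x - y)"
  proof (rule integral_bound[OF yx])
    show "continuous_on {y..x} (\<lambda>s. c1 * ?f z1 s + c2 * ?f z2 s + c3 * ?f z3 s)" by (intro continuous_intros th)
    fix s assume s: "s \<in> {y..x}"
    have b0: "0 \<le> \<beta>" using order_trans[OF norm_ge_zero b[of 0]] yx by simp
    have "c1 * ?f z1 s + c2 * ?f z2 s + c3 * ?f z3 s
       = (c1 * wave z1 (\<theta> s) + c2 * wave z2 (\<theta> s) + c3 * wave z3 (\<theta> s)) * complex_of_real (cos (2 * B * s))"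
      by (simp add: distrib_right)
    also have "norm \<dots> \<le> \<beta> * 1"
      unfolding norm_mult using th(2)[OF s] b0 by (intro mult_mono b) auto
    finally show "norm (c1 * ?f z1 s + c2 * ?f z2 s + c3 * ?f z3 s) \<le> \<beta>" by simp
  qed
  from mult_left_mono[OF this A] show ?thesis unfolding eq using A by (simp add: norm_mult mult.left_commute)
qed

lemma absint_atMost_0_of_weighted:
  fixes u :: "real \<Rightarrow> real"
  assumes "(\<lambda>x. x * u x) absolutely_integrable_on {..<a}" "a < 0"
  shows "u absolutely_integrable_on {..<a}"
proof -
  have "(\<lambda>x. (1 / x) * (x * u x)) absolutely_integrable_on {..<a}"
    by (rule absint_continuous_mult_real[OF _ _ _ assms(1), where M = "1 / (- a)"])
       (use assms(2) in \<open>auto intro!: continuous_intros simp: field_simps\<close>)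
  then show ?thesis by (rule absint_eq) (use assms(2) in auto)
qed

section \<open>The initial data and the two scalar systems\<close>

locale scattering_data =
  fixes A B :: real and u0 :: "real \<Rightarrow> real"
  assumes Apos: "0 < A" and Bpos: "0 < B" and adm: "admissible_data A B u0"
begin

text \<open>The lower left entry of \<open>U - U_minus\<close>. On the left half-line it sees the
  data at the reflected point on the right, where the difference from the cosine is integrable but
  has no known moment.\<close>

definition qq :: "real \<Rightarrow> real" where "qq y = A * cos (2 * B * y) - u0 (- y)"

lemma cos_absint: "(\<lambda>x. A * cos (2 * B * x)) absolutely_integrable_on {a..b}"
  by (intro absolutely_integrable_continuous_real continuous_intros)

text \<open>The weight \<open>x\<close> vanishes at 0 and controls the data only away from it. Near
  0 the second integrability condition is used, with the cosine added back.\<close>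

lemma u0_absint: "u0 absolutely_integrable_on {..0}"
proof -
  have w: "(\<lambda>x. x * u0 x) absolutely_integrable_on {..<-1}"
    and p: "(\<lambda>x. u0 x - A * cos (2 * B * x)) absolutely_integrable_on {-2<..}"
    using adm by (auto simp: admissible_data_def)
  have 1: "u0 absolutely_integrable_on {..<-1}" by (rule absint_atMost_0_of_weighted[OF w]) simp
  have "(\<lambda>x. u0 x - A * cos (2 * B * x)) absolutely_integrable_on {-1..0}"
    by (rule set_integrable_subset[OF p]) auto
  from set_integral_add(1)[OF this cos_absint] have 2: "u0 absolutely_integrable_on {-1..0}" by simp
  have "{..<-1} \<union> {-1..0} = {..0::real}" by auto
  then show ?thesis using absolutely_integrable_Un[OF 1 2] by simp
qed

lemma weighted_absint: "(\<lambda>y. y * u0 y) absolutely_integrable_on {..0}"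
proof -
  have "(\<lambda>x. x * u0 x) absolutely_integrable_on {..<1}" using adm by (auto simp: admissible_data_def)
  then show ?thesis by (rule set_integrable_subset) auto
qed

lemma qq_absint: "qq absolutely_integrable_on {..0}"
proof -
  have "(\<lambda>x. u0 x - A * cos (2 * B * x)) absolutely_integrable_on {-1<..}" using adm by (auto simp: admissible_data_def)
  then have "(\<lambda>x. u0 x - A * cos (2 * B * x)) absolutely_integrable_on {0..}"
    by (rule set_integrable_subset) auto
  then have *: "(\<lambda>x. u0 (- x) - A * cos (2 * B * (- x))) absolutely_integrable_on {..0}"
    using has_absolute_integral_reflect_real[of "{..0}" "{0..}" "\<lambda>x. u0 x - A * cos (2 * B * x)"] by auto
  have "(\<lambda>x. (- 1) * (u0 (- x) - A * cos (2 * B * (- x)))) absolutely_integrable_on {..0}"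
    by (intro set_integrable_mult_right) (rule *)
  then show ?thesis by (rule absint_eq) (simp add: qq_def)
qed

lemma wave_cont_left: "continuous_on {..x} (\<lambda>y. wave z (x - y))"
  by (intro continuous_intros)

lemma kap2_cont: "x \<le> 0 \<Longrightarrow> continuous_on {..x} (kap2 A B z x)"
proof -
  assume x: "x \<le> 0"
  have "continuous_on {..x} (\<lambda>y. wave z (- y) * (kprim A B z x - kprim A B z y))"
    using x by (intro continuous_intros continuous_on_subset[OF continuous_on_kprim]) auto
  then show ?thesis by (rule continuous_on_eq) (use x in \<open>simp add: kap2_kprim\<close>)
qed

lemma kap1_cont: "x \<le> 0 \<Longrightarrow> continuous_on {..x} (kap1 A B z x)"
proof -
  assume x: "x \<le> 0"
  have "continuous_on {..x} (\<lambda>y. wave z (x - y) * kap2 A B (- z) x y)"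
    by (rule continuous_on_mult[OF wave_cont_left kap2_cont[OF x]])
  then show ?thesis by (rule continuous_on_eq) (rule kap1_kap2[symmetric])
qed

text \<open>The system of the first column of \<Psi>1, at parameter \<open>k\<close>. The
  exponential to the right of the integrand cancels the oscillation of the upper component and
  doubles that of the lower one, hence the kernels 1 and \<open>wave\<close>.\<close>

sublocale V1: volterra u0 qq A "\<lambda>z x y. 1" "\<lambda>z x y. wave z (x - y)" "kap1 A B"
proof
  show "0 \<le> A" using Apos by simp
  fix z1 z2 z3 :: complex and x y \<beta> and c1 c2 c3 :: complex
  assume yx: "y \<le> x" and x0: "x \<le> 0"
    and b: "\<And>t. 0 \<le> t \<Longrightarrow> t \<le> x - y \<Longrightarrow> norm (c1 * wave z1 t + c2 * wave z2 t + c3 * wave z3 t) \<le> \<beta>"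
  show "norm (c1 * 1 + c2 * 1 + c3 * 1) \<le> \<beta>" using b[of 0] yx by simp
  show "norm (c1 * wave z1 (x - y) + c2 * wave z2 (x - y) + c3 * wave z3 (x - y)) \<le> \<beta>" using b[of "x - y"] yx by simp
  show "norm (c1 * kap1 A B z1 x y + c2 * kap1 A B z2 x y + c3 * kap1 A B z3 x y) \<le> \<beta> * (A * (x - y))"
    unfolding kap1_def
  proof (rule kap_comb[where \<theta> = "\<lambda>s. x - s"])
    show "continuous_on {y..x} (\<lambda>s. x - s)" by (intro continuous_intros)
  qed (use Apos yx b in auto)
qed (rule u0_absint weighted_absint qq_absint continuous_on_const wave_cont_left kap1_cont | assumption)+

text \<open>The system of the second column, run at the parameter \<open>- k\<close> so that the
  closed lower half-plane becomes the closed upper one. The kernels 1 and \<open>wave\<close> have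
  changed places.\<close>

sublocale V2: volterra u0 qq A "\<lambda>z x y. wave z (x - y)" "\<lambda>z x y. 1" "kap2 A B"
proof
  show "0 \<le> A" using Apos by simp
  fix z1 z2 z3 :: complex and x y \<beta> and c1 c2 c3 :: complex
  assume yx: "y \<le> x" and x0: "x \<le> 0"
    and b: "\<And>t. 0 \<le> t \<Longrightarrow> t \<le> x - y \<Longrightarrow> norm (c1 * wave z1 t + c2 * wave z2 t + c3 * wave z3 t) \<le> \<beta>"
  show "norm (c1 * 1 + c2 * 1 + c3 * 1) \<le> \<beta>" using b[of 0] yx by simp
  show "norm (c1 * wave z1 (x - y) + c2 * wave z2 (x - y) + c3 * wave z3 (x - y)) \<le> \<beta>" using b[of "x - y"] yx by simp
  show "norm (c1 * kap2 A B z1 x y + c2 * kap2 A B z2 x y + c3 * kap2 A B z3 x y) \<le> \<beta> * (A * (x - y))"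
    unfolding kap2_def
  proof (rule kap_comb[where \<theta> = "\<lambda>s. s - y"])
    show "continuous_on {y..x} (\<lambda>s. s - y)" by (intro continuous_intros)
  qed (use Apos yx b in auto)
qed (rule u0_absint weighted_absint qq_absint continuous_on_const wave_cont_left kap2_cont | assumption)+

text \<open>
  The scalar form of the integral equations: \<open>raw1\<close> for the first column of \<open>\<Psi>1\<close> and the second
  column of \<open>\<Psi>2\<close>, \<open>raw2\<close> for the other two columns. The equations for \<open>\<Psi>2\<close> coincide with those
  for \<open>\<Psi>1\<close> after \<open>x\<close> is replaced by \<open>- x\<close> and the components are exchanged, which is why
  \<open>\<Psi>2\<close> is expressed through \<open>\<Psi>1\<close> at \<open>x = 0\<close>.
\<close>

definition raw1 :: "complex \<Rightarrow> (real \<Rightarrow> complex) \<Rightarrow> (real \<Rightarrow> complex) \<Rightarrow> bool" where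
  "raw1 k v1 v2 \<longleftrightarrow> (\<forall>x\<le>0.
     (\<lambda>y. of_real (u0 y) * v2 y) absolutely_integrable_on {..x} \<and>
     (\<lambda>y. wave k (x - y) * of_real (qq y) * v1 y + kap1 A B k x y * of_real (u0 y) * v2 y) absolutely_integrable_on {..x} \<and>
     v1 x = 1 + integral {..x} (\<lambda>y. of_real (u0 y) * v2 y) \<and>
     v2 x = bg A B k x + integral {..x} (\<lambda>y. wave k (x - y) * of_real (qq y) * v1 y + kap1 A B k x y * of_real (u0 y) * v2 y))"

definition raw2 :: "complex \<Rightarrow> (real \<Rightarrow> complex) \<Rightarrow> (real \<Rightarrow> complex) \<Rightarrow> bool" where
  "raw2 k u1 u2 \<longleftrightarrow> (\<forall>x\<le>0.
     (\<lambda>y. wave (- k) (x - y) * of_real (u0 y) * u2 y) absolutely_integrable_on {..x} \<and>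
     (\<lambda>y. of_real (qq y) * u1 y + kap2 A B (- k) x y * of_real (u0 y) * u2 y) absolutely_integrable_on {..x} \<and>
     u1 x = integral {..x} (\<lambda>y. wave (- k) (x - y) * of_real (u0 y) * u2 y) \<and>
     u2 x = 1 + integral {..x} (\<lambda>y. of_real (qq y) * u1 y + kap2 A B (- k) x y * of_real (u0 y) * u2 y))"

section \<open>Solutions of the raw equations are bounded and continuous\<close>

lemma bg_cont: "continuous_on S (bg A B k)"
proof -
  have "continuous_on S (\<lambda>x. of_real A / (2 * (k^2 - (of_real B)^2)) *
      (of_real (B * sin (2 * B * x)) - \<i> * k * of_real (cos (2 * B * x))))"
    by (rule continuous_on_mult[OF continuous_on_const]) (intro continuous_intros)
  then show ?thesis by (rule continuous_on_eq) (simp add: bg_def)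
qed

lemma bg_bound: "norm (bg A B k x) \<le> A * (B + norm k) / norm (2 * (k^2 - (of_real B)^2))"
proof -
  have 1: "norm (complex_of_real (B * sin (2 * B * x))) \<le> B"
    unfolding norm_of_real abs_mult using Bpos mult_left_le[of "\<bar>sin (2 * B * x)\<bar>" B] by simp
  have 2: "norm (\<i> * k * complex_of_real (cos (2 * B * x))) \<le> norm k"
    unfolding norm_mult norm_of_real using mult_left_le[of "\<bar>cos (2 * B * x)\<bar>" "norm k"] by simp
  have "norm (complex_of_real (B * sin (2 * B * x)) - \<i> * k * complex_of_real (cos (2 * B * x))) \<le> B + norm k"
    by (rule norm_triangle_le_diff[OF add_mono[OF 1 2]])
  then show ?thesis
    unfolding bg_def norm_divide using Apos by (intro divide_right_mono) (auto simp: norm_mult intro!: mult_left_mono)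
qed

lemma kap1_bg:
  assumes "k^2 \<noteq> (of_real B)^2" "y \<le> x"
  shows "kap1 A B k x y = bg A B k x - wave k (x - y) * bg A B k y"
proof -
  have "a * (b * n - m) = (a * b) * n - a * m" for a b n m :: complex by (simp add: algebra_simps)
  then show ?thesis unfolding kap1_kap2 kap2_bg[OF assms] wave_minus by (simp only: wave_inverse mult_1_left)
qed

text \<open>The raw equations do not assert that their solutions are bounded; membership in the
  uniqueness class is earned here. Off the resonances \<open>bg\<close> is bounded, and
  \<open>kap1\<close> splits into terms in \<open>x\<close> and in \<open>y\<close>, from which
  continuity and bounds are read off, first for \<open>v1\<close> and then for
  \<open>v2\<close>.\<close>

lemma raw1_sol:
  assumes raw: "raw1 k v1 v2" and k: "0 \<le> Im k" and nB: "k^2 \<noteq> (of_real B)^2"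
  shows "V1.sol k (\<lambda>_. 1) (bg A B k) v1 v2"
proof -
  define N where "N = A * (B + norm k) / norm (2 * (k^2 - (of_real B)^2))"
  have bN: "norm (bg A B k x) \<le> N" for x unfolding N_def by (rule bg_bound)
  have N0: "0 \<le> N" using bN[of 0] norm_ge_zero order_trans by blast
  let ?pv = "\<lambda>y. of_real (u0 y) * v2 y"
  have pv: "?pv absolutely_integrable_on {..0}" using raw unfolding raw1_def by blast
  have v1: "v1 x = 1 + integral {..x} ?pv" if "x \<le> 0" for x using raw that unfolding raw1_def by blast
  have v2: "v2 x = bg A B k x + integral {..x} (\<lambda>y. wave k (x - y) * of_real (qq y) * v1 y + kap1 A B k x y * of_real (u0 y) * v2 y)"
    if "x \<le> 0" for x using raw that unfolding raw1_def by blast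
  have "continuous_on {..0} (\<lambda>x. 1 + integral {..x} ?pv)"
    by (intro continuous_intros continuous_on_integral_atMost pv)
  then have v1c: "continuous_on {..0} v1" by (rule continuous_on_eq) (use v1 in auto)
  have absI: "norm (integral {..x} f) \<le> integral {..0} (\<lambda>y. norm (f y))"
    if "f absolutely_integrable_on {..0}" "x \<le> 0" for f :: "real \<Rightarrow> complex" and x
  proof -
    note n = absolutely_integrable_norm_real[OF that(1)]
    have "norm (integral {..x} f) \<le> integral {..x} (\<lambda>y. norm (f y))"
      by (rule norm_integral_atMost_le[OF absint_atMost_mono[OF that] absint_atMost_mono[OF n that(2)]]) simp
    also have "\<dots> \<le> integral {..0} (\<lambda>y. norm (f y))" by (rule integral_atMost_mono_nonneg[OF n that(2)]) auto
    finally show ?thesis .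
  qed
  have v1b: "norm (v1 x) \<le> 1 + integral {..0} (\<lambda>y. norm (?pv y))" if "x \<le> 0" for x
    unfolding v1[OF that] using absI[OF pv that] by (intro norm_triangle_le) auto
  have qv: "(\<lambda>y. v1 y * of_real (qq y)) absolutely_integrable_on {..0}"
    by (rule absint_continuous_mult[OF v1c v1b]) (auto intro: absint_of_real qq_absint)
  define s where "s y = v1 y * of_real (qq y) - bg A B k y * ?pv y" for y
  have si: "s absolutely_integrable_on {..0}"
    unfolding s_def by (intro set_integral_diff(1) qv absint_continuous_mult[where M = N] bg_cont pv) (auto intro: bN)
  define r where "r y = wave k (- y) * s y" for y
  have ri: "r absolutely_integrable_on {..0}"
    unfolding r_def by (rule absint_continuous_mult[where M = 1, OF _ _ _ si])
      (auto intro!: continuous_intros norm_wave_le_1 k)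
  \<comment> \<open>Two forms of one identity. The first keeps the wave inside the integral, where
    its norm is at most 1, and serves the bound. The second pulls out \<open>wave k x\<close>, which
    for \<open>Im k > 0\<close> grows towards minus infinity, and serves continuity.\<close>
  have v2': "v2 x = bg A B k x + (bg A B k x * integral {..x} ?pv + integral {..x} (\<lambda>y. wave k (x - y) * s y))"
    and v2'': "v2 x = bg A B k x + (bg A B k x * integral {..x} ?pv + wave k x * integral {..x} r)" if x: "x \<le> 0" for x
  proof -
    have ei: "(\<lambda>y. wave k (x - y) * s y) absolutely_integrable_on {..x}"
      by (rule absint_continuous_mult[where M = 1, OF _ _ _ absint_atMost_mono[OF si x]])
         (auto intro!: continuous_intros norm_wave_le_1 k)
    have "integral {..x} (\<lambda>y. wave k (x - y) * of_real (qq y) * v1 y + kap1 A B k x y * of_real (u0 y) * v2 y)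
       = integral {..x} (\<lambda>y. bg A B k x * ?pv y + wave k (x - y) * s y)"
      by (rule integral_cong) (auto simp: kap1_bg[OF nB] s_def algebra_simps)
    also have "\<dots> = integral {..x} (\<lambda>y. bg A B k x * ?pv y) + integral {..x} (\<lambda>y. wave k (x - y) * s y)"
      by (intro integral_add set_lebesgue_integral_eq_integral(1) set_integrable_mult_right ei)
         (auto intro: absint_atMost_mono[OF pv x])
    finally show "v2 x = bg A B k x + (bg A B k x * integral {..x} ?pv + integral {..x} (\<lambda>y. wave k (x - y) * s y))"
      using v2[OF x] by simp
    moreover have "integral {..x} (\<lambda>y. wave k (x - y) * s y) = integral {..x} (\<lambda>y. wave k x * r y)"
      by (rule integral_cong) (simp add: r_def mult.assoc[symmetric] wave_add[symmetric])
    ultimately show "v2 x = bg A B k x + (bg A B k x * integral {..x} ?pv + wave k x * integral {..x} r)" by simp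
  qed
  have "continuous_on {..0} (\<lambda>x. bg A B k x + (bg A B k x * integral {..x} ?pv + wave k x * integral {..x} r))"
    by (intro continuous_intros bg_cont continuous_on_integral_atMost pv ri)
  then have v2c: "continuous_on {..0} v2" by (rule continuous_on_eq) (use v2'' in auto)
  have v2b: "norm (v2 x) \<le> N + (N * integral {..0} (\<lambda>y. norm (?pv y)) + integral {..0} (\<lambda>y. norm (s y)))" if x: "x \<le> 0" for x
    unfolding v2'[OF x]
  proof (intro norm_triangle_le add_mono bN)
    show "norm (bg A B k x * integral {..x} ?pv) \<le> N * integral {..0} (\<lambda>y. norm (?pv y))"
      unfolding norm_mult[of "bg A B k x"] by (rule mult_mono[OF bN absI[OF pv x] N0 norm_ge_zero])
    note n = absolutely_integrable_norm_real[OF si]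
    have "norm (integral {..x} (\<lambda>y. wave k (x - y) * s y)) \<le> integral {..x} (\<lambda>y. norm (s y))"
    proof (rule norm_integral_atMost_le[OF _ absint_atMost_mono[OF n x]])
      show "(\<lambda>y. wave k (x - y) * s y) absolutely_integrable_on {..x}"
        by (rule absint_continuous_mult[where M = 1, OF _ _ _ absint_atMost_mono[OF si x]])
           (auto intro!: continuous_intros norm_wave_le_1 k)
      show "norm (wave k (x - y) * s y) \<le> norm (s y)" if "y \<in> {..x}" for y
        unfolding norm_mult using norm_wave_le_1[OF k, of "x - y"] that by (intro mult_left_le_one_le) auto
    qed
    also have "\<dots> \<le> integral {..0} (\<lambda>y. norm (s y))" by (rule integral_atMost_mono_nonneg[OF n x]) auto
    finally show "norm (integral {..x} (\<lambda>y. wave k (x - y) * s y)) \<le> integral {..0} (\<lambda>y. norm (s y))" .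
  qed
  show ?thesis
    unfolding V1.sol_def V1.T1_def V1.T2_def bdd_cont_def
    using v1c v2c v1b v2b v1 v2 by auto
qed

text \<open>At a resonance the product of wave and cosine contains the constant 1/2, which
  integrates to the linear term \<open>- A x / 2\<close>. The remaining oscillation has a bounded
  antiderivative.\<close>

lemma kprim_resonant:
  assumes z: "z = of_real B \<or> z = - of_real B" and x: "x \<le> 0"
  shows "norm (kprim A B z x + of_real (A * x / 2)) \<le> A / (4 * B)"
proof -
  have z0: "z \<noteq> 0" and nz: "norm z = B" and iz: "Im z = 0" using z Bpos by auto
  have c: "wave z s * of_real (cos (2 * B * s)) = (wave z (2 * s) + 1) / 2" for s
  proof -
    have "complex_of_real (cos (2 * B * s)) = (wave z s + wave z (- s)) / 2"
      unfolding cos_of_real[symmetric] cos_exp_eq wave_def using z by (auto simp: mult_ac)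
    then have "wave z s * of_real (cos (2 * B * s)) = (wave z s * wave z s + wave z s * wave z (- s)) / 2"
      by (simp only: times_divide_eq_right distrib_left)
    then show ?thesis by (simp add: wave_add[symmetric])
  qed
  have "((\<lambda>s. (wave z (2 * s) + 1) / 2) has_integral
      (wave z (2 * 0) / (8 * \<i> * z) + of_real 0 / 2) - (wave z (2 * x) / (8 * \<i> * z) + of_real x / 2)) {x..0}"
  proof (rule fundamental_theorem_of_calculus[OF x])
    fix s
    have 1: "((\<lambda>s. wave z (2 * s)) has_vector_derivative (4 * \<i> * z * wave z (2 * s))) (at s within {x..0})"
      using has_vector_derivative_wave[of z 0 2 s] by (simp add: mult_ac)
    have 2: "((\<lambda>s. complex_of_real s) has_vector_derivative 1) (at s within {x..0})"
    proof -
      have "((\<lambda>s. complex_of_real s) has_vector_derivative of_real 1) (at s within {x..0})"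
        by (rule has_vector_derivative_of_real[OF DERIV_ident])
      then show ?thesis by simp
    qed
    have "((\<lambda>s. wave z (2 * s) / (8 * \<i> * z) + of_real s / 2) has_vector_derivative
      (4 * \<i> * z * wave z (2 * s)) / (8 * \<i> * z) + 1 / 2) (at s within {x..0})"
      by (intro has_vector_derivative_add has_vector_derivative_divide 1 2)
    moreover have "(4 * \<i> * z * wave z (2 * s)) / (8 * \<i> * z) + 1 / 2 = (wave z (2 * s) + 1) / 2"
    proof -
      have "(4 * c * u) / (8 * c) + 1 / 2 = (u + 1) / 2" if "c \<noteq> 0" for c u :: complex
        using that by (simp add: add_divide_distrib)
      from this[of "\<i> * z"] z0 show ?thesis by (simp only: mult.assoc) simp
    qed
    ultimately show "((\<lambda>s. wave z (2 * s) / (8 * \<i> * z) + of_real s / 2) has_vector_derivative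
      (wave z (2 * s) + 1) / 2) (at s within {x..0})" by (simp only:)
  qed
  then have "kprim A B z x = of_real A * ((wave z (2 * 0) / (8 * \<i> * z) + of_real 0 / 2) - (wave z (2 * x) / (8 * \<i> * z) + of_real x / 2))"
    unfolding kprim_def c by (rule arg_cong[OF integral_unique])
  moreover have "a * ((1 / D + 0 / 2) - (u / D + v / 2)) + a * v / 2 = a * ((1 - u) / D)" for a D u v :: complex
    by (simp add: right_diff_distrib distrib_left diff_divide_distrib)
  ultimately have eq: "kprim A B z x + of_real (A * x / 2) = of_real A * ((1 - wave z (2 * x)) / (8 * \<i> * z))"
    by simp
  have "norm (of_real A * ((1 - wave z (2 * x)) / (8 * \<i> * z))) = A * (norm (1 - wave z (2 * x)) / (8 * B))"
    using Apos nz by (simp add: norm_mult norm_divide)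
  also have "\<dots> \<le> A * (2 / (8 * B))"
    using Apos Bpos norm_triangle_ineq4[of 1 "wave z (2 * x)"] iz by (intro mult_left_mono divide_right_mono) (auto simp: norm_wave)
  finally show ?thesis unfolding eq by simp
qed

end

lemma norm_integral_atMost_le_total:
  fixes f :: "real \<Rightarrow> complex"
  assumes "f absolutely_integrable_on {..0}" "x \<le> 0"
  shows "norm (integral {..x} f) \<le> integral {..0} (\<lambda>y. norm (f y))"
proof -
  note n = absolutely_integrable_norm_real[OF assms(1)]
  have "norm (integral {..x} f) \<le> integral {..x} (\<lambda>y. norm (f y))"
    by (rule norm_integral_atMost_le[OF absint_atMost_mono[OF assms] absint_atMost_mono[OF n assms(2)]]) simp
  also have "\<dots> \<le> integral {..0} (\<lambda>y. norm (f y))" by (rule integral_atMost_mono_nonneg[OF n assms(2)]) auto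
  finally show ?thesis .
qed

context scattering_data begin

text \<open>Separating \<open>x\<close> from \<open>y\<close> by \<open>kprim\<close> works at every
  \<open>k\<close> and gives the continuity of both components. Bounds are another matter, since
  \<open>kprim\<close> and the wave in front of the integrals may grow.\<close>

lemma raw2_structure:
  assumes raw: "raw2 k u1 u2"
  defines "r \<equiv> \<lambda>y. wave (- k) (- y) * of_real (u0 y) * u2 y"
    and "t \<equiv> \<lambda>y. of_real (qq y) * u1 y - kprim A B (- k) y * (wave (- k) (- y) * of_real (u0 y) * u2 y)"
  shows "r absolutely_integrable_on {..0}" "t absolutely_integrable_on {..0}"
    "\<And>x. x \<le> 0 \<Longrightarrow> u1 x = wave (- k) x * integral {..x} r"
    "\<And>x. x \<le> 0 \<Longrightarrow> u2 x = 1 + (kprim A B (- k) x * integral {..x} r + integral {..x} t)"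
    "continuous_on {..0} u1" "continuous_on {..0} u2"
proof -
  have kp0: "kprim A B (- k) 0 = 0" by (simp add: kprim_def)
  have "(\<lambda>y. wave (- k) (0 - y) * of_real (u0 y) * u2 y) absolutely_integrable_on {..0}"
    using raw unfolding raw2_def by blast
  then show ri: "r absolutely_integrable_on {..0}" by (simp add: r_def)
  have "(\<lambda>y. of_real (qq y) * u1 y + kap2 A B (- k) 0 y * of_real (u0 y) * u2 y) absolutely_integrable_on {..0}"
    using raw unfolding raw2_def by blast
  then show ti: "t absolutely_integrable_on {..0}"
    by (rule absint_eq) (simp add: kap2_kprim kp0 t_def mult_ac)
  show u1: "u1 x = wave (- k) x * integral {..x} r" if x: "x \<le> 0" for x
  proof -
    have "u1 x = integral {..x} (\<lambda>y. wave (- k) (x - y) * of_real (u0 y) * u2 y)"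
      using raw x unfolding raw2_def by blast
    also have "\<dots> = integral {..x} (\<lambda>y. wave (- k) x * r y)"
      unfolding r_def mult.assoc[symmetric] wave_add[symmetric] by simp
    finally show ?thesis by simp
  qed
  show u2: "u2 x = 1 + (kprim A B (- k) x * integral {..x} r + integral {..x} t)" if x: "x \<le> 0" for x
  proof -
    have "u2 x = 1 + integral {..x} (\<lambda>y. of_real (qq y) * u1 y + kap2 A B (- k) x y * of_real (u0 y) * u2 y)"
      using raw x unfolding raw2_def by blast
    also have "integral {..x} (\<lambda>y. of_real (qq y) * u1 y + kap2 A B (- k) x y * of_real (u0 y) * u2 y)
       = integral {..x} (\<lambda>y. kprim A B (- k) x * r y + t y)"
      by (rule integral_cong) (use x in \<open>auto simp: kap2_kprim r_def t_def algebra_simps\<close>)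
    also have "\<dots> = integral {..x} (\<lambda>y. kprim A B (- k) x * r y) + integral {..x} t"
      by (intro integral_add set_lebesgue_integral_eq_integral(1) set_integrable_mult_right)
         (auto intro: absint_atMost_mono[OF ri x] absint_atMost_mono[OF ti x])
    finally show ?thesis by simp
  qed
  have "continuous_on {..0} (\<lambda>x. wave (- k) x * integral {..x} r)"
    by (intro continuous_on_mult continuous_on_wave continuous_on_id continuous_on_integral_atMost ri)
  then show "continuous_on {..0} u1" by (rule continuous_on_eq) (use u1 in auto)
  have "continuous_on {..0} (\<lambda>x. 1 + (kprim A B (- k) x * integral {..x} r + integral {..x} t))"
    by (intro continuous_on_mult continuous_on_add continuous_on_const continuous_on_kprim continuous_on_integral_atMost ri ti)
  then show "continuous_on {..0} u2" by (rule continuous_on_eq) (use u2 in auto)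
qed

text \<open>The factor \<open>wave z x\<close> in front of \<open>u1\<close> grows exponentially
  when \<open>Im z > 0\<close>. Since \<open>u2\<close> is controlled by \<open>u1\<close>, Gronwall
  applies to \<rho>, the integral of \<open>r\<close>, and shows that it decays at exactly the rate
  that compensates the growth.\<close>

lemma raw2_bounded_nonresonant:
  assumes raw: "raw2 k u1 u2" and k: "Im k \<le> 0" and nB: "k^2 \<noteq> (of_real B)^2"
  shows "\<exists>M. \<forall>x\<le>0. norm (u1 x) \<le> M \<and> norm (u2 x) \<le> M"
proof -
  define z where "z = - k"
  have zi: "0 \<le> Im z" using k by (simp add: z_def)
  define r where "r = (\<lambda>y. wave z (- y) * of_real (u0 y) * u2 y)"
  define t where "t = (\<lambda>y. of_real (qq y) * u1 y - kprim A B z y * (wave z (- y) * of_real (u0 y) * u2 y))"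
  note st = raw2_structure[OF raw, folded z_def, folded r_def t_def]
  define N where "N = A * (B + norm k) / norm (2 * (k^2 - (of_real B)^2))"
  have bN: "norm (bg A B k x) \<le> N" for x unfolding N_def by (rule bg_bound)
  have N0: "0 \<le> N" using bN[of 0] norm_ge_zero order_trans by blast
  define s where "s y = of_real (qq y) * u1 y - bg A B k y * of_real (u0 y) * u2 y" for y
  have kap: "kap2 A B z x y = wave z (x - y) * bg A B k x - bg A B k y" if "y \<le> x" for x y
    unfolding z_def by (rule kap2_bg[OF nB that])
  \<comment> \<open>Only whole integrands of the equations are known to be integrable. This
    combination of them turns out to be \<open>s\<close>, the part of the integrand that remains
    when \<open>bg\<close> at \<open>x\<close> is factored out.\<close>
  have "(\<lambda>y. t y - bg A B k 0 * r y) absolutely_integrable_on {..0}"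
    by (intro set_integral_diff(1) set_integrable_mult_right) (use st in auto)
  then have si: "s absolutely_integrable_on {..0}"
  proof (rule absint_eq)
    fix y :: real assume "y \<in> {..0}"
    then have y: "y \<le> 0" by simp
    have "wave z (- y) * (kprim A B z 0 - kprim A B z y) = wave z (- y) * bg A B k 0 - bg A B k y"
      using kap2_kprim[OF y order_refl, of A B z] kap[OF y] by simp
    then have e: "kprim A B z y * wave z (- y) = bg A B k y - wave z (- y) * bg A B k 0"
      by (simp add: kprim_def algebra_simps)
    have "t y = of_real (qq y) * u1 y - (kprim A B z y * wave z (- y)) * (of_real (u0 y) * u2 y)"
      by (simp add: t_def)
    then show "t y - bg A B k 0 * r y = s y"
      unfolding e by (simp add: r_def s_def algebra_simps)
  qed
  have u2: "u2 x = (1 + integral {..x} s) + bg A B k x * u1 x" if x: "x \<le> 0" for x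
  proof -
    have "u2 x = 1 + integral {..x} (\<lambda>y. of_real (qq y) * u1 y + kap2 A B z x y * of_real (u0 y) * u2 y)"
      using raw x unfolding raw2_def z_def by blast
    also have "integral {..x} (\<lambda>y. of_real (qq y) * u1 y + kap2 A B z x y * of_real (u0 y) * u2 y)
       = integral {..x} (\<lambda>y. (bg A B k x * wave z x) * r y + s y)"
    proof (rule integral_cong)
      fix y assume "y \<in> {..x}"
      then have h: "kap2 A B z x y = wave z x * wave z (- y) * bg A B k x - bg A B k y"
        using kap[of y x] wave_add[of z x "- y"] by simp
      show "of_real (qq y) * u1 y + kap2 A B z x y * of_real (u0 y) * u2 y = (bg A B k x * wave z x) * r y + s y"
        unfolding h by (simp add: r_def s_def algebra_simps)
    qed
    also have "\<dots> = integral {..x} (\<lambda>y. (bg A B k x * wave z x) * r y) + integral {..x} s"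
      by (intro integral_add set_lebesgue_integral_eq_integral(1) set_integrable_mult_right)
         (auto intro: absint_atMost_mono[OF st(1) x] absint_atMost_mono[OF si x])
    finally show ?thesis using st(3)[OF x] by simp
  qed
  define T where "T = 1 + integral {..0} (\<lambda>y. norm (s y))"
  have T0: "0 \<le> T" unfolding T_def using integral_nonneg[OF set_lebesgue_integral_eq_integral(1)[OF absolutely_integrable_norm_real[OF si]]] by simp
  have u2b: "norm (u2 x) \<le> T + N * norm (u1 x)" if x: "x \<le> 0" for x
  proof -
    have "norm (1 + integral {..x} s) \<le> T"
      unfolding T_def using norm_integral_atMost_le_total[OF si x] by (intro norm_triangle_le) simp
    moreover have "norm (bg A B k x * u1 x) \<le> N * norm (u1 x)" unfolding norm_mult by (intro mult_right_mono bN) simp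
    ultimately show ?thesis unfolding u2[OF x] by (rule norm_triangle_le[OF add_mono])
  qed
  define \<rho> where "\<rho> x = integral {..x} r" for x
  have rc: "continuous_on {..0} \<rho>" unfolding \<rho>_def by (rule continuous_on_integral_atMost[OF st(1)])
  have rb: "norm (\<rho> x) \<le> integral {..0} (\<lambda>y. norm (r y))" if "x \<le> 0" for x
    unfolding \<rho>_def by (rule norm_integral_atMost_le_total[OF st(1) that])
  have pa: "(\<lambda>y. \<bar>u0 y\<bar>) absolutely_integrable_on {..0}"
    using absolutely_integrable_norm_real[OF u0_absint] by simp
  define P where "P = integral {..0} (\<lambda>y. \<bar>u0 y\<bar>)"
  have P0: "0 \<le> P" unfolding P_def by (rule integral_nonneg[OF set_lebesgue_integral_eq_integral(1)[OF pa]]) simp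
  \<comment> \<open>Gronwall is run separately for each endpoint \<open>x0\<close>: on
    \<open>{..x0}\<close> the factor \<open>exp (2 * Im z * y)\<close> is at most its value at
    \<open>x0\<close>, a constant inhomogeneity that is already as small as the bound sought at
    \<open>x0\<close>.\<close>
  have main: "norm (\<rho> x0) \<le> 2 * exp (2 * (N * P)) * (T * exp (2 * Im z * x0) * P)" if x0: "x0 \<le> 0" for x0
  proof -
    let ?E = "exp (2 * Im z * x0)"
    have wi: "(\<lambda>y. N * \<bar>u0 y\<bar>) absolutely_integrable_on {..x0}"
      by (intro set_integrable_mult_right) (use absint_atMost_mono[OF pa x0] in auto)
    have wD0: "(\<lambda>y. N * \<bar>u0 y\<bar> * norm (\<rho> y)) absolutely_integrable_on {..0}"
    proof -
      have "(\<lambda>y. norm (\<rho> y) * \<bar>u0 y\<bar>) absolutely_integrable_on {..0}"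
        by (rule absint_continuous_mult_real[OF _ _ _ pa, where M = "integral {..0} (\<lambda>y. norm (r y))"])
           (use rb in \<open>auto intro!: continuous_on_norm rc\<close>)
      then have "(\<lambda>y. N * (norm (\<rho> y) * \<bar>u0 y\<bar>)) absolutely_integrable_on {..0}"
        by (intro set_integrable_mult_right)
      then show ?thesis by (simp add: mult_ac)
    qed
    have "norm (\<rho> x0) \<le> 2 * exp (2 * integral {..x0} (\<lambda>y. N * \<bar>u0 y\<bar>)) * (T * ?E * P)"
    proof (rule Gronwall_atMost[where M = "integral {..0} (\<lambda>y. norm (r y))"])
      show "(\<lambda>y. N * \<bar>u0 y\<bar>) absolutely_integrable_on {..x0}" by (rule wi)
      show "0 \<le> N * \<bar>u0 y\<bar>" for y using N0 by simp
      show "0 \<le> T * ?E * P" using T0 P0 by simp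
      fix x assume x: "x \<le> x0"
      then have x': "x \<le> 0" using x0 by simp
      show "norm (\<rho> x) \<le> integral {..0} (\<lambda>y. norm (r y))" by (rule rb[OF x'])
      show wD: "(\<lambda>y. N * \<bar>u0 y\<bar> * norm (\<rho> y)) absolutely_integrable_on {..x}" by (rule absint_atMost_mono[OF wD0 x'])
      have pE: "(\<lambda>y. (T * ?E) * \<bar>u0 y\<bar>) absolutely_integrable_on {..x}"
        by (intro set_integrable_mult_right) (use absint_atMost_mono[OF pa x'] in auto)
      have "norm (\<rho> x) \<le> integral {..x} (\<lambda>y. (T * ?E) * \<bar>u0 y\<bar> + N * \<bar>u0 y\<bar> * norm (\<rho> y))"
        unfolding \<rho>_def[of x]
      proof (rule norm_integral_atMost_le[OF absint_atMost_mono[OF st(1) x'] set_integral_add(1)[OF pE wD]])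
        fix y assume "y \<in> {..x}"
        then have y: "y \<le> x0" "y \<le> 0" using x x0 by auto
        have nw: "norm (wave z (- y)) = exp (2 * Im z * y)" by (simp add: norm_wave)
        have nu1: "norm (u1 y) = exp (- (2 * Im z * y)) * norm (\<rho> y)"
          using st(3)[OF y(2)] by (simp add: \<rho>_def norm_mult norm_wave)
        have "norm (r y) = exp (2 * Im z * y) * \<bar>u0 y\<bar> * norm (u2 y)" by (simp add: r_def norm_mult nw)
        also have "\<dots> \<le> exp (2 * Im z * y) * \<bar>u0 y\<bar> * (T + N * norm (u1 y))"
          using u2b[OF y(2)] by (intro mult_left_mono) auto
        also have "\<dots> = (T * exp (2 * Im z * y)) * \<bar>u0 y\<bar> + N * \<bar>u0 y\<bar> * ((exp (2 * Im z * y) * exp (- (2 * Im z * y))) * norm (\<rho> y))"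
          unfolding nu1 by (simp only: distrib_left mult_ac)
        also have "exp (2 * Im z * y) * exp (- (2 * Im z * y)) = 1" by (simp add: exp_add[symmetric])
        also have "(T * exp (2 * Im z * y)) * \<bar>u0 y\<bar> \<le> (T * ?E) * \<bar>u0 y\<bar>"
          using T0 zi y by (intro mult_right_mono mult_left_mono) (auto intro: mult_left_mono)
        finally show "norm (r y) \<le> (T * ?E) * \<bar>u0 y\<bar> + N * \<bar>u0 y\<bar> * norm (\<rho> y)" by simp
      qed
      also have "\<dots> = (T * ?E) * integral {..x} (\<lambda>y. \<bar>u0 y\<bar>) + integral {..x} (\<lambda>y. N * \<bar>u0 y\<bar> * norm (\<rho> y))"
        using integral_add[OF set_lebesgue_integral_eq_integral(1)[OF pE] set_lebesgue_integral_eq_integral(1)[OF wD]]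
        by (simp only: integral_mult_right)
      also have "\<dots> \<le> T * ?E * P + integral {..x} (\<lambda>y. N * \<bar>u0 y\<bar> * norm (\<rho> y))"
        unfolding P_def using T0 integral_atMost_mono_nonneg[OF pa x'] by (intro add_right_mono mult_left_mono) auto
      finally show "norm (\<rho> x) \<le> T * ?E * P + integral {..x} (\<lambda>y. N * \<bar>u0 y\<bar> * norm (\<rho> y))" .
    qed
    also have "integral {..x0} (\<lambda>y. N * \<bar>u0 y\<bar>) = N * integral {..x0} (\<lambda>y. \<bar>u0 y\<bar>)" by simp
    also have "2 * exp (2 * (N * integral {..x0} (\<lambda>y. \<bar>u0 y\<bar>))) * (T * ?E * P) \<le> 2 * exp (2 * (N * P)) * (T * ?E * P)"
      unfolding P_def[symmetric] using T0 P0 N0 integral_atMost_mono_nonneg[OF pa x0 order_refl]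
      by (intro mult_right_mono mult_left_mono) (auto simp: P_def mult_left_mono)
    finally show ?thesis .
  qed
  define M1 where "M1 = 2 * exp (2 * (N * P)) * (T * P)"
  have u1b: "norm (u1 x) \<le> M1" if x: "x \<le> 0" for x
  proof -
    have "norm (u1 x) = exp (- (2 * Im z * x)) * norm (\<rho> x)"
      using st(3)[OF x] by (simp add: \<rho>_def norm_mult norm_wave)
    also have "\<dots> \<le> exp (- (2 * Im z * x)) * (2 * exp (2 * (N * P)) * (T * exp (2 * Im z * x) * P))"
      by (intro mult_left_mono main[OF x]) simp
    also have "\<dots> = M1 * (exp (- (2 * Im z * x)) * exp (2 * Im z * x))" by (simp only: M1_def mult_ac)
    also have "exp (- (2 * Im z * x)) * exp (2 * Im z * x) = 1" by (simp add: exp_add[symmetric])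
    finally show ?thesis by simp
  qed
  have "norm (u2 x) \<le> T + N * M1" if x: "x \<le> 0" for x
    using u2b[OF x] mult_left_mono[OF u1b[OF x] N0] by linarith
  with u1b have "\<forall>x\<le>0. norm (u1 x) \<le> max M1 (T + N * M1) \<and> norm (u2 x) \<le> max M1 (T + N * M1)"
    by (auto simp: le_max_iff_disj)
  then show ?thesis by blast
qed

text \<open>All waves have modulus 1 here, so \<open>u1\<close> is bounded at once, but
  \<open>kprim\<close> grows linearly. Its norm at \<open>x\<close> exceeds its norm at an earlier
  \<open>y\<close> by at most \<open>2 * c\<close>, so it can be moved into the integral and
  replaced by its value at \<open>y\<close>.\<close>

lemma raw2_bounded_resonant:
  assumes raw: "raw2 k u1 u2" and k: "k = of_real B \<or> k = - of_real B"
  shows "\<exists>M. \<forall>x\<le>0. norm (u1 x) \<le> M \<and> norm (u2 x) \<le> M"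
proof -
  define z where "z = - k"
  have zi: "Im z = 0" and zB: "z = of_real B \<or> z = - of_real B" using k by (auto simp: z_def)
  define r where "r = (\<lambda>y. wave z (- y) * of_real (u0 y) * u2 y)"
  define t where "t = (\<lambda>y. of_real (qq y) * u1 y - kprim A B z y * (wave z (- y) * of_real (u0 y) * u2 y))"
  note st = raw2_structure[OF raw, folded z_def, folded r_def t_def]
  have nw: "norm (wave z y) = 1" for y by (simp add: norm_wave zi)
  define R where "R = integral {..0} (\<lambda>y. norm (r y))"
  have u1b: "norm (u1 x) \<le> R" if x: "x \<le> 0" for x
    using norm_integral_atMost_le_total[OF st(1) x] by (simp add: st(3)[OF x] norm_mult nw R_def)
  have qi: "(\<lambda>y. u1 y * of_real (qq y)) absolutely_integrable_on {..0}"
    by (rule absint_continuous_mult[OF st(5), where M = R]) (auto intro: u1b absint_of_real qq_absint)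
  have "(\<lambda>y. u1 y * of_real (qq y) - t y) absolutely_integrable_on {..0}"
    by (rule set_integral_diff(1)[OF qi st(2)])
  \<comment> \<open>This product is the difference of \<open>qq * u1\<close>, integrable because
    \<open>u1\<close> is bounded, and \<open>t\<close>.\<close>
  then have ci: "(\<lambda>y. kprim A B z y * r y) absolutely_integrable_on {..0}"
    by (rule absint_eq) (simp add: t_def r_def)
  define c where "c = A / (4 * B)"
  have c0: "0 \<le> c" using Apos Bpos by (simp add: c_def)
  have kp: "norm (kprim A B z x) \<le> norm (kprim A B z y) + 2 * c" if "y \<le> x" "x \<le> 0" for x y
  proof -
    have 1: "norm (kprim A B z x) \<le> c + A * \<bar>x\<bar> / 2"
    proof -
      have "norm (complex_of_real (A * x / 2)) = A * \<bar>x\<bar> / 2"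
        unfolding norm_of_real using Apos by (simp add: abs_mult)
      moreover have "norm (kprim A B z x) \<le> norm (kprim A B z x + of_real (A * x / 2)) + norm (complex_of_real (A * x / 2))"
        using norm_triangle_ineq4[of "kprim A B z x + of_real (A * x / 2)" "of_real (A * x / 2)"]
        unfolding add_diff_cancel_right' .
      ultimately show ?thesis using kprim_resonant[OF zB that(2)] unfolding c_def by linarith
    qed
    have 2: "A * \<bar>y\<bar> / 2 \<le> c + norm (kprim A B z y)"
    proof -
      have "norm (complex_of_real (A * y / 2)) \<le> norm (kprim A B z y + of_real (A * y / 2)) + norm (kprim A B z y)"
        using norm_triangle_ineq4[of "kprim A B z y + of_real (A * y / 2)" "kprim A B z y"] by simp
      then show ?thesis
        using kprim_resonant[OF zB, of y] that Apos unfolding norm_of_real by (simp add: c_def abs_mult)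
    qed
    have "A * \<bar>x\<bar> / 2 \<le> A * \<bar>y\<bar> / 2" using that Apos by simp
    then show ?thesis using 1 2 by linarith
  qed
  have u2b: "norm (u2 x) \<le> 1 + (integral {..0} (\<lambda>y. norm (kprim A B z y * r y) + 2 * c * norm (r y))
      + integral {..0} (\<lambda>y. norm (t y)))" if x: "x \<le> 0" for x
  proof -
    note ni = absolutely_integrable_norm_real[OF ci] absolutely_integrable_norm_real[OF st(1)]
    have gi: "(\<lambda>y. norm (kprim A B z y * r y) + 2 * c * norm (r y)) absolutely_integrable_on {..0}"
      by (intro set_integral_add(1) set_integrable_mult_right) (use ni in auto)
    have "norm (kprim A B z x * integral {..x} r) = norm (integral {..x} (\<lambda>y. kprim A B z x * r y))" by simp
    also have "\<dots> \<le> integral {..x} (\<lambda>y. norm (kprim A B z y * r y) + 2 * c * norm (r y))"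
    proof (rule norm_integral_atMost_le[OF _ absint_atMost_mono[OF gi x]])
      show "(\<lambda>y. kprim A B z x * r y) absolutely_integrable_on {..x}"
        by (intro set_integrable_mult_right) (use absint_atMost_mono[OF st(1) x] in auto)
      show "norm (kprim A B z x * r y) \<le> norm (kprim A B z y * r y) + 2 * c * norm (r y)" if "y \<in> {..x}" for y
        using mult_right_mono[OF kp[of y x], of "norm (r y)"] that x by (simp add: norm_mult distrib_right)
    qed
    also have "\<dots> \<le> integral {..0} (\<lambda>y. norm (kprim A B z y * r y) + 2 * c * norm (r y))"
      by (rule integral_atMost_mono_nonneg[OF gi x]) (use c0 in auto)
    finally have "norm (kprim A B z x * integral {..x} r) \<le> \<dots>" .
    moreover have "norm (integral {..x} t) \<le> integral {..0} (\<lambda>y. norm (t y))"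
      by (rule norm_integral_atMost_le_total[OF st(2) x])
    ultimately show ?thesis
      unfolding st(4)[OF x] by (intro norm_triangle_le add_mono) auto
  qed
  define K where "K = 1 + (integral {..0} (\<lambda>y. norm (kprim A B z y * r y) + 2 * c * norm (r y))
      + integral {..0} (\<lambda>y. norm (t y)))"
  have "\<forall>x\<le>0. norm (u1 x) \<le> max R K \<and> norm (u2 x) \<le> max R K"
    using u1b u2b[folded K_def] by (auto simp: le_max_iff_disj)
  then show ?thesis by blast
qed

lemma raw2_sol:
  assumes raw: "raw2 k u1 u2" and k: "Im k \<le> 0"
  shows "V2.sol (- k) (\<lambda>_. 0) (\<lambda>_. 1) u1 u2"
proof -
  have "\<exists>M. \<forall>x\<le>0. norm (u1 x) \<le> M \<and> norm (u2 x) \<le> M"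
    using raw2_bounded_resonant[OF raw] raw2_bounded_nonresonant[OF raw k] square_neq by blast
  then obtain M where M: "\<And>x. x \<le> 0 \<Longrightarrow> norm (u1 x) \<le> M" "\<And>x. x \<le> 0 \<Longrightarrow> norm (u2 x) \<le> M" by blast
  show ?thesis
    unfolding V2.sol_def V2.T1_def V2.T2_def bdd_cont_def
    using raw2_structure(5,6)[OF raw] M raw unfolding raw2_def by auto
qed

end

section \<open>From matrix columns to scalar equations\<close>

lemma mat2_conj_column_lower:
  assumes "e \<noteq> 0"
  shows "mat2 (inverse e) 0 (e * \<kappa>) e ** mat2 0 p q 0 ** P ** mat2 e 0 0 (inverse e) =
    mat2 (p * P $ 2 $ 1) (inverse e * inverse e * p * P $ 2 $ 2)
      (e * e * q * P $ 1 $ 1 + (e * e * \<kappa>) * p * P $ 2 $ 1) (q * P $ 1 $ 2 + \<kappa> * p * P $ 2 $ 2)"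
  using assms by (simp add: mat2_eq_iff matrix_mult_2_nth field_simps)

lemma mat2_conj_column_upper:
  assumes "e \<noteq> 0"
  shows "mat2 e (e * \<kappa>) 0 (inverse e) ** mat2 0 (- q) (- p) 0 ** P ** mat2 (inverse e) 0 0 e =
    mat2 (- (q * P $ 2 $ 1 + \<kappa> * p * P $ 1 $ 1)) (- (e * e * q * P $ 2 $ 2 + (e * e * \<kappa>) * p * P $ 1 $ 2))
      (- (inverse e * inverse e * p * P $ 1 $ 1)) (- (p * P $ 1 $ 2))"
  using assms by (simp add: mat2_eq_iff matrix_mult_2_nth field_simps)

lemma wave_exp: "wave k t = exp (\<i> * k * of_real t) * exp (\<i> * k * of_real t)"
  "wave (- k) t = inverse (exp (\<i> * k * of_real t)) * inverse (exp (\<i> * k * of_real t))"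
  by (simp_all add: wave_def exp_minus[symmetric] exp_add[symmetric] algebra_simps)

lemma integral_column_nth:
  fixes f :: "real \<Rightarrow> complex^2"
  assumes "f absolutely_integrable_on S"
  shows "(\<lambda>y. f y $ i) absolutely_integrable_on S" "integral S f $ i = integral S (\<lambda>y. f y $ i)"
proof -
  show "(\<lambda>y. f y $ i) absolutely_integrable_on S"
    using absolutely_integrable_linear[OF assms bounded_linear_vec_nth[of i]] by (simp add: comp_def)
  show "integral S f $ i = integral S (\<lambda>y. f y $ i)"
    using integral_linear[OF set_lebesgue_integral_eq_integral(1)[OF assms] bounded_linear_vec_nth[of i]]
    by (simp add: comp_def)
qed

context scattering_data begin

lemma potential_minus: "U_mat u0 y - U_minus A B y = mat2 0 (of_real (u0 y)) (of_real (qq y)) 0"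
  by (simp add: mat2_eq_iff U_mat_def U_minus_def qq_def)

lemma potential_plus: "U_mat u0 (- y) - U_plus A B (- y) = mat2 0 (- of_real (qq y)) (- of_real (u0 y)) 0"
  by (simp add: mat2_eq_iff U_mat_def U_plus_def qq_def)

lemma integrand1_eq:
  assumes "y \<le> x"
  shows "integrand1 A B u0 \<Psi> x k y = (let P = \<Psi> y k in
     mat2 (of_real (u0 y) * P $ 2 $ 1) (wave (- k) (x - y) * of_real (u0 y) * P $ 2 $ 2)
      (wave k (x - y) * of_real (qq y) * P $ 1 $ 1 + kap1 A B k x y * of_real (u0 y) * P $ 2 $ 1)
      (of_real (qq y) * P $ 1 $ 2 + kap2 A B (- k) x y * of_real (u0 y) * P $ 2 $ 2))"
  unfolding integrand1_def G_minus_eq[OF assms] potential_minus exp_sigma3_def exp_minus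
    mat2_conj_column_lower[OF exp_not_eq_zero] kap1_kap2 wave_exp(2) Let_def
  unfolding wave_exp(1) ..

lemma integrand2_eq:
  assumes "y \<le> x"
  shows "integrand2 A B u0 \<Psi> (- x) k (- y) = (let P = \<Psi> (- y) k in
     mat2 (- (of_real (qq y) * P $ 2 $ 1 + kap2 A B (- k) x y * of_real (u0 y) * P $ 1 $ 1))
      (- (wave k (x - y) * of_real (qq y) * P $ 2 $ 2 + kap1 A B k x y * of_real (u0 y) * P $ 1 $ 2))
      (- (wave (- k) (x - y) * of_real (u0 y) * P $ 1 $ 1)) (- (of_real (u0 y) * P $ 1 $ 2)))"
proof -
  have le: "- x \<le> - y" using assms by simp
  have "\<i> * k * of_real (- x - - y) = - (\<i> * k * of_real (x - y))" "- y - - x = x - y"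
    by (simp_all add: algebra_simps)
  then show ?thesis
    unfolding integrand2_def G_plus_eq[OF le] potential_plus exp_sigma3_def minus_minus wave_exp(2) Let_def
    unfolding wave_exp(1) kap1_kap2
    by (simp only: exp_minus minus_minus mat2_conj_column_upper[OF exp_not_eq_zero])
qed

lemma solves1_col_1_raw:
  assumes "solves1_col A B u0 \<Psi> 1 k"
  shows "raw1 k (\<lambda>x. \<Psi> x k $ 1 $ 1) (\<lambda>x. \<Psi> x k $ 2 $ 1)"
  unfolding raw1_def
proof (intro allI impI)
  fix x :: real
  let ?f = "\<lambda>y. column 1 (integrand1 A B u0 \<Psi> x k y)"
  have fi: "?f absolutely_integrable_on {..x}" and eq: "column 1 (\<Psi> x k) = column 1 (N_minus A B x k) + integral {..x} ?f"
    using assms unfolding solves1_col_def by blast+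
  note c = integral_column_nth[OF fi]
  have e1: "?f y $ 1 = of_real (u0 y) * \<Psi> y k $ 2 $ 1"
    and e2: "?f y $ 2 = wave k (x - y) * of_real (qq y) * \<Psi> y k $ 1 $ 1 + kap1 A B k x y * of_real (u0 y) * \<Psi> y k $ 2 $ 1"
    if "y \<in> {..x}" for y
    using integrand1_eq[of y x \<Psi> k] that by (simp_all add: column_def Let_def)
  have 1: "\<Psi> x k $ 1 $ 1 = 1 + integral {..x} (\<lambda>y. ?f y $ 1)"
    using arg_cong[OF eq, of "\<lambda>v. v $ 1"] c(2)[of 1] by (simp add: column_def N_minus_bg)
  have 2: "\<Psi> x k $ 2 $ 1 = bg A B k x + integral {..x} (\<lambda>y. ?f y $ 2)"
    using arg_cong[OF eq, of "\<lambda>v. v $ 2"] c(2)[of 2] by (simp add: column_def N_minus_bg)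
  show "(\<lambda>y. of_real (u0 y) * \<Psi> y k $ 2 $ 1) absolutely_integrable_on {..x} \<and>
     (\<lambda>y. wave k (x - y) * of_real (qq y) * \<Psi> y k $ 1 $ 1 + kap1 A B k x y * of_real (u0 y) * \<Psi> y k $ 2 $ 1) absolutely_integrable_on {..x} \<and>
     \<Psi> x k $ 1 $ 1 = 1 + integral {..x} (\<lambda>y. of_real (u0 y) * \<Psi> y k $ 2 $ 1) \<and>
     \<Psi> x k $ 2 $ 1 = bg A B k x + integral {..x} (\<lambda>y. wave k (x - y) * of_real (qq y) * \<Psi> y k $ 1 $ 1 + kap1 A B k x y * of_real (u0 y) * \<Psi> y k $ 2 $ 1)"
    unfolding 1 2
    using absint_eq[OF c(1)[of 1] e1] absint_eq[OF c(1)[of 2] e2]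
      integral_cong[of "{..x}" "\<lambda>y. ?f y $ 1", OF e1] integral_cong[of "{..x}" "\<lambda>y. ?f y $ 2", OF e2] by simp
qed

lemma solves1_col_2_raw:
  assumes "solves1_col A B u0 \<Psi> 2 k"
  shows "raw2 k (\<lambda>x. \<Psi> x k $ 1 $ 2) (\<lambda>x. \<Psi> x k $ 2 $ 2)"
  unfolding raw2_def
proof (intro allI impI)
  fix x :: real
  let ?f = "\<lambda>y. column 2 (integrand1 A B u0 \<Psi> x k y)"
  have fi: "?f absolutely_integrable_on {..x}" and eq: "column 2 (\<Psi> x k) = column 2 (N_minus A B x k) + integral {..x} ?f"
    using assms unfolding solves1_col_def by blast+
  note c = integral_column_nth[OF fi]
  have e1: "?f y $ 1 = wave (- k) (x - y) * of_real (u0 y) * \<Psi> y k $ 2 $ 2"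
    and e2: "?f y $ 2 = of_real (qq y) * \<Psi> y k $ 1 $ 2 + kap2 A B (- k) x y * of_real (u0 y) * \<Psi> y k $ 2 $ 2"
    if "y \<in> {..x}" for y
    using integrand1_eq[of y x \<Psi> k] that by (simp_all add: column_def Let_def)
  have 1: "\<Psi> x k $ 1 $ 2 = integral {..x} (\<lambda>y. ?f y $ 1)"
    using arg_cong[OF eq, of "\<lambda>v. v $ 1"] c(2)[of 1] by (simp add: column_def N_minus_bg)
  have 2: "\<Psi> x k $ 2 $ 2 = 1 + integral {..x} (\<lambda>y. ?f y $ 2)"
    using arg_cong[OF eq, of "\<lambda>v. v $ 2"] c(2)[of 2] by (simp add: column_def N_minus_bg)
  show "(\<lambda>y. wave (- k) (x - y) * of_real (u0 y) * \<Psi> y k $ 2 $ 2) absolutely_integrable_on {..x} \<and>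
     (\<lambda>y. of_real (qq y) * \<Psi> y k $ 1 $ 2 + kap2 A B (- k) x y * of_real (u0 y) * \<Psi> y k $ 2 $ 2) absolutely_integrable_on {..x} \<and>
     \<Psi> x k $ 1 $ 2 = integral {..x} (\<lambda>y. wave (- k) (x - y) * of_real (u0 y) * \<Psi> y k $ 2 $ 2) \<and>
     \<Psi> x k $ 2 $ 2 = 1 + integral {..x} (\<lambda>y. of_real (qq y) * \<Psi> y k $ 1 $ 2 + kap2 A B (- k) x y * of_real (u0 y) * \<Psi> y k $ 2 $ 2)"
    unfolding 1 2
    using absint_eq[OF c(1)[of 1] e1] absint_eq[OF c(1)[of 2] e2]
      integral_cong[of "{..x}" "\<lambda>y. ?f y $ 1", OF e1] integral_cong[of "{..x}" "\<lambda>y. ?f y $ 2", OF e2] by simp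
qed

text \<open>The minus sign in the equation for \<Psi>2 is absorbed into the integrand, so that the
  reflected equation takes the shape of the one for \<Psi>1.\<close>

lemma solves2_col_reflect:
  assumes "solves2_col A B u0 \<Psi> j k"
  shows "(\<lambda>y. - (integrand2 A B u0 \<Psi> (- x) k (- y) $ i $ j)) absolutely_integrable_on {..x}"
    and "\<Psi> (- x) k $ i $ j = N_plus A B (- x) k $ i $ j
           + integral {..x} (\<lambda>y. - (integrand2 A B u0 \<Psi> (- x) k (- y) $ i $ j))"
proof -
  let ?f = "\<lambda>y. column j (integrand2 A B u0 \<Psi> (- x) k y)"
  have fi: "?f absolutely_integrable_on {- x..}" and eq: "column j (\<Psi> (- x) k) = column j (N_plus A B (- x) k) - integral {- x..} ?f"
    using assms unfolding solves2_col_def by blast+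
  note c = integral_column_nth[OF fi, of i]
  note r = has_integral_neg_swap_reflect[OF c(1), unfolded minus_minus]
  have fe: "?f y $ i = integrand2 A B u0 \<Psi> (- x) k y $ i $ j" for y by (simp add: column_def)
  show "(\<lambda>y. - (integrand2 A B u0 \<Psi> (- x) k (- y) $ i $ j)) absolutely_integrable_on {..x}"
  proof -
    have "(\<lambda>y. (- 1) * (?f (- y) $ i)) absolutely_integrable_on {..x}"
      by (intro set_integrable_mult_right) (rule r(1))
    then show ?thesis by (rule absint_eq) (simp add: fe)
  qed
  have "\<Psi> (- x) k $ i $ j = N_plus A B (- x) k $ i $ j - integral {- x..} (\<lambda>y. ?f y $ i)"
    using arg_cong[OF eq, of "\<lambda>v. v $ i"] c(2) by (simp add: column_def)
  also have "integral {- x..} (\<lambda>y. ?f y $ i) = integral {..x} (\<lambda>y. ?f (- y) $ i)" by (rule r(2)[symmetric])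
  finally show "\<Psi> (- x) k $ i $ j = N_plus A B (- x) k $ i $ j
           + integral {..x} (\<lambda>y. - (integrand2 A B u0 \<Psi> (- x) k (- y) $ i $ j))"
    unfolding fe by simp
qed

lemma solves2_col_2_raw:
  assumes "solves2_col A B u0 \<Psi> 2 k"
  shows "raw1 k (\<lambda>x. \<Psi> (- x) k $ 2 $ 2) (\<lambda>x. \<Psi> (- x) k $ 1 $ 2)"
  unfolding raw1_def
proof (intro allI impI)
  fix x :: real
  have e1: "- (integrand2 A B u0 \<Psi> (- x) k (- y) $ 2 $ 2) = of_real (u0 y) * \<Psi> (- y) k $ 1 $ 2"
    and e2: "- (integrand2 A B u0 \<Psi> (- x) k (- y) $ 1 $ 2)
       = wave k (x - y) * of_real (qq y) * \<Psi> (- y) k $ 2 $ 2 + kap1 A B k x y * of_real (u0 y) * \<Psi> (- y) k $ 1 $ 2"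
    if "y \<in> {..x}" for y
    using integrand2_eq[of y x \<Psi> k] that by (simp_all add: Let_def)
  note s = solves2_col_reflect[OF assms, of x]
  have i1: "integral {..x} (\<lambda>y. - (integrand2 A B u0 \<Psi> (- x) k (- y) $ 2 $ 2)) = integral {..x} (\<lambda>y. of_real (u0 y) * \<Psi> (- y) k $ 1 $ 2)"
    by (rule integral_cong) (rule e1)
  have i2: "integral {..x} (\<lambda>y. - (integrand2 A B u0 \<Psi> (- x) k (- y) $ 1 $ 2)) = integral {..x} (\<lambda>y. wave k (x - y) * of_real (qq y) * \<Psi> (- y) k $ 2 $ 2 + kap1 A B k x y * of_real (u0 y) * \<Psi> (- y) k $ 1 $ 2)"
    by (rule integral_cong) (rule e2)
  show "(\<lambda>y. of_real (u0 y) * \<Psi> (- y) k $ 1 $ 2) absolutely_integrable_on {..x} \<and>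
     (\<lambda>y. wave k (x - y) * of_real (qq y) * \<Psi> (- y) k $ 2 $ 2 + kap1 A B k x y * of_real (u0 y) * \<Psi> (- y) k $ 1 $ 2) absolutely_integrable_on {..x} \<and>
     \<Psi> (- x) k $ 2 $ 2 = 1 + integral {..x} (\<lambda>y. of_real (u0 y) * \<Psi> (- y) k $ 1 $ 2) \<and>
     \<Psi> (- x) k $ 1 $ 2 = bg A B k x + integral {..x} (\<lambda>y. wave k (x - y) * of_real (qq y) * \<Psi> (- y) k $ 2 $ 2 + kap1 A B k x y * of_real (u0 y) * \<Psi> (- y) k $ 1 $ 2)"
    unfolding s(2)[of 2] s(2)[of 1] i1 i2
    using absint_eq[OF s(1)[of 2] e1] absint_eq[OF s(1)[of 1] e2]
    by (simp add: N_plus_bg)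
qed

lemma solves2_col_1_raw:
  assumes "solves2_col A B u0 \<Psi> 1 k"
  shows "raw2 k (\<lambda>x. \<Psi> (- x) k $ 2 $ 1) (\<lambda>x. \<Psi> (- x) k $ 1 $ 1)"
  unfolding raw2_def
proof (intro allI impI)
  fix x :: real
  have e1: "- (integrand2 A B u0 \<Psi> (- x) k (- y) $ 2 $ 1) = wave (- k) (x - y) * of_real (u0 y) * \<Psi> (- y) k $ 1 $ 1"
    and e2: "- (integrand2 A B u0 \<Psi> (- x) k (- y) $ 1 $ 1)
       = of_real (qq y) * \<Psi> (- y) k $ 2 $ 1 + kap2 A B (- k) x y * of_real (u0 y) * \<Psi> (- y) k $ 1 $ 1"
    if "y \<in> {..x}" for y
    using integrand2_eq[of y x \<Psi> k] that by (simp_all add: Let_def)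
  note s = solves2_col_reflect[OF assms, of x]
  have i1: "integral {..x} (\<lambda>y. - (integrand2 A B u0 \<Psi> (- x) k (- y) $ 2 $ 1)) = integral {..x} (\<lambda>y. wave (- k) (x - y) * of_real (u0 y) * \<Psi> (- y) k $ 1 $ 1)"
    by (rule integral_cong) (rule e1)
  have i2: "integral {..x} (\<lambda>y. - (integrand2 A B u0 \<Psi> (- x) k (- y) $ 1 $ 1)) = integral {..x} (\<lambda>y. of_real (qq y) * \<Psi> (- y) k $ 2 $ 1 + kap2 A B (- k) x y * of_real (u0 y) * \<Psi> (- y) k $ 1 $ 1)"
    by (rule integral_cong) (rule e2)
  show "(\<lambda>y. wave (- k) (x - y) * of_real (u0 y) * \<Psi> (- y) k $ 1 $ 1) absolutely_integrable_on {..x} \<and>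
     (\<lambda>y. of_real (qq y) * \<Psi> (- y) k $ 2 $ 1 + kap2 A B (- k) x y * of_real (u0 y) * \<Psi> (- y) k $ 1 $ 1) absolutely_integrable_on {..x} \<and>
     \<Psi> (- x) k $ 2 $ 1 = integral {..x} (\<lambda>y. wave (- k) (x - y) * of_real (u0 y) * \<Psi> (- y) k $ 1 $ 1) \<and>
     \<Psi> (- x) k $ 1 $ 1 = 1 + integral {..x} (\<lambda>y. of_real (qq y) * \<Psi> (- y) k $ 2 $ 1 + kap2 A B (- k) x y * of_real (u0 y) * \<Psi> (- y) k $ 1 $ 1)"
    unfolding s(2)[of 2] s(2)[of 1] i1 i2
    using absint_eq[OF s(1)[of 2] e1] absint_eq[OF s(1)[of 1] e2]
    by (simp add: N_plus_bg)
qed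

end

section \<open>Behaviour at infinity and the determinant\<close>

lemma bdd_cont_const: "bdd_cont (\<lambda>_. c)"
  unfolding bdd_cont_def by (auto intro: exI[of _ "norm c"])

lemma bdd_cont_mult: "bdd_cont u \<Longrightarrow> bdd_cont v \<Longrightarrow> bdd_cont (\<lambda>x. u x * v x)"
proof -
  assume "bdd_cont u" "bdd_cont v"
  then obtain M M' where M: "\<And>x. x \<le> 0 \<Longrightarrow> norm (u x) \<le> M" "\<And>x. x \<le> 0 \<Longrightarrow> norm (v x) \<le> M'"
    and c: "continuous_on {..0} u" "continuous_on {..0} v" by (auto simp: bdd_cont_def)
  have "norm (u x * v x) \<le> M * M'" if "x \<le> 0" for x
    unfolding norm_mult using M[OF that] by (intro mult_mono) (auto intro: order_trans[OF norm_ge_zero])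
  then show ?thesis unfolding bdd_cont_def using c by (auto intro!: continuous_on_mult)
qed

lemma (in volterra) sol_cmult:
  assumes "sol z f1 f2 v1 v2"
  shows "sol z (\<lambda>x. c * f1 x) (\<lambda>x. c * f2 x) (\<lambda>x. c * v1 x) (\<lambda>x. c * v2 x)"
  using assms unfolding sol_def T1_cmult T2_cmult
  by (auto intro: bdd_cont_cmult) (simp_all add: distrib_left[symmetric])

lemma wave_split: "wave z x * wave (- z) (x - y) = wave z y" "wave z x = wave z (x - y) * wave z y"
  by (simp_all add: wave_minus wave_add[symmetric])

lemma norm_square_diff_ge:
  assumes "2 * B \<le> norm z" "0 < B"
  shows "3 / 4 * norm z ^ 2 \<le> norm (z^2 - (complex_of_real B)^2)"
proof -
  have "norm (z^2) - norm ((complex_of_real B)^2) \<le> norm (z^2 - (complex_of_real B)^2)" by (rule norm_triangle_ineq2)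
  moreover have "(2 * B)^2 \<le> norm z ^ 2" using assms by (intro power_mono) auto
  ultimately show ?thesis by (simp add: norm_power power_mult_distrib)
qed

lemma norm_bg_large:
  assumes A: "0 < A" and B: "0 < B" and z: "2 * B \<le> norm z"
  shows "norm (bg A B z x) \<le> 2 * A / norm z"
proof -
  have zp: "0 < norm z" using B z by linarith
  have "norm (of_real (B * sin (2 * B * x)) - \<i> * z * of_real (cos (2 * B * x))) \<le> B + norm z"
  proof (rule norm_triangle_le_diff[OF add_mono])
    show "norm (complex_of_real (B * sin (2 * B * x))) \<le> B"
      unfolding norm_of_real abs_mult using B mult_left_le[of "\<bar>sin (2 * B * x)\<bar>" B] by simp
    show "norm (\<i> * z * complex_of_real (cos (2 * B * x))) \<le> norm z"
      unfolding norm_mult norm_of_real using mult_left_le[of "\<bar>cos (2 * B * x)\<bar>" "norm z"] by simp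
  qed
  also have "\<dots> \<le> 2 * norm z" using z B by simp
  finally have 1: "norm (of_real (B * sin (2 * B * x)) - \<i> * z * of_real (cos (2 * B * x))) \<le> 2 * norm z" .
  have 2: "3 / 2 * norm z ^ 2 \<le> norm (2 * (z^2 - (complex_of_real B)^2))"
    unfolding norm_mult using norm_square_diff_ge[OF z B] by simp
  have "norm (bg A B z x) \<le> (A * (2 * norm z)) / (3 / 2 * norm z ^ 2)"
    unfolding bg_def norm_divide norm_mult[of "of_real A"] using A zp 1 2
    by (intro frac_le mult_mono) auto
  also have "\<dots> \<le> 2 * A / norm z"
    using zp A by (simp add: power2_eq_square field_simps)
  finally show ?thesis .
qed

context scattering_data begin

lemma total_p_nonneg: "0 \<le> integral {..0} (\<lambda>y. \<bar>u0 y\<bar>)"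
  using absolutely_integrable_norm_real[OF u0_absint]
  by (intro integral_nonneg) (auto intro: set_lebesgue_integral_eq_integral(1))

text \<open>\<open>stability\<close> is applied to the difference from the pair (1, 0). Its residual
  is the background entry, of order \<open>1 / norm z\<close>, plus the integral of
  \<open>qq\<close> against a wave, which is small uniformly in \<open>x\<close> by
  Riemann-Lebesgue.\<close>

lemma col1_at_infinity:
  assumes "\<epsilon> > 0"
  obtains R where "\<And>z v1 v2. 0 \<le> Im z \<Longrightarrow> R \<le> norm z \<Longrightarrow> V1.sol z (\<lambda>_. 1) (bg A B z) v1 v2 \<Longrightarrow>
     norm (v1 0 - 1) \<le> \<epsilon> \<and> norm (v2 0) \<le> \<epsilon>"
proof -
  define \<eta> where "\<eta> = \<epsilon> / (2 * V1.amp)"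
  have eta: "0 < \<eta>" using assms V1.amp_pos by (simp add: \<eta>_def)
  obtain R1 where R1: "\<And>z x. 0 \<le> Im z \<Longrightarrow> R1 \<le> norm z \<Longrightarrow> x \<le> 0 \<Longrightarrow>
        norm (integral {..x} (\<lambda>y. wave z (x - y) * of_real (qq y))) \<le> \<eta>"
    using Riemann_Lebesgue_atMost[OF qq_absint] eta unfolding RL_def by meson
  show ?thesis
  proof (rule that[of "max R1 (max (2 * B) (2 * A / \<eta>))"])
    fix z v1 v2 assume z: "0 \<le> Im z" and R: "max R1 (max (2 * B) (2 * A / \<eta>)) \<le> norm z"
      and s: "V1.sol z (\<lambda>_. 1) (bg A B z) v1 v2"
    have zp: "0 < norm z" using R Bpos by (auto intro: less_le_trans[of 0 "2 * B"])
    have bc: "bdd_cont v1" "bdd_cont v2" using s by (auto simp: V1.sol_def)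
    have "norm (v1 0 - 1) + norm (v2 0) \<le> V1.amp * (2 * \<eta>)"
    proof (rule V1.stability[OF z, of "\<lambda>x. v1 x - 1" v2 0])
      show "bdd_cont (\<lambda>x. v1 x - 1)" by (rule bdd_cont_diff[OF bc(1) bdd_cont_const])
      fix x :: real assume x: "x \<le> 0"
      have t: "V1.T2 z (\<lambda>x. v1 x - 1) v2 x = V1.T2 z v1 v2 x - V1.T2 z (\<lambda>_. 1) (\<lambda>_. 0) x"
        using V1.T2_diff[OF z x bc(1) bdd_cont_const bc(2) bdd_cont_const, of 1 0] by simp
      have "norm (bg A B z x) \<le> 2 * A / norm z" by (rule norm_bg_large[OF Apos Bpos]) (use R in auto)
      also have "\<dots> \<le> \<eta>" using R eta zp by (simp add: field_simps)
      finally have n1: "norm (bg A B z x) \<le> \<eta>" .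
      have n2: "norm (V1.T2 z (\<lambda>_. 1) (\<lambda>_. 0) x) \<le> \<eta>"
        unfolding V1.T2_def using R1[OF z _ x] R by simp
      have "norm (v1 x - 1 - V1.T1 z v2 x) + norm (v2 x - V1.T2 z (\<lambda>x. v1 x - 1) v2 x)
         = norm (bg A B z x + V1.T2 z (\<lambda>_. 1) (\<lambda>_. 0) x)"
        unfolding t using s x by (simp add: V1.sol_def)
      also have "\<dots> \<le> \<eta> + \<eta>" by (rule norm_triangle_le[OF add_mono[OF n1 n2]])
      finally show "norm (v1 x - 1 - V1.T1 z v2 x) + norm (v2 x - V1.T2 z (\<lambda>x. v1 x - 1) v2 x) \<le> 2 * \<eta>" by simp
    qed (use bc in auto)
    also have "V1.amp * (2 * \<eta>) = \<epsilon>" using V1.amp_pos by (simp add: \<eta>_def)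
    finally show "norm (v1 0 - 1) \<le> \<epsilon> \<and> norm (v2 0) \<le> \<epsilon>"
      using norm_ge_zero[of "v1 0 - 1"] norm_ge_zero[of "v2 0"] by linarith
  qed
qed

text \<open>The comparison pair is (0, 1). The residual consists of \<open>u0\<close> integrated
  against a wave, small by Riemann-Lebesgue, and \<open>u0\<close> integrated against
  \<open>kap2\<close>; the representation through \<open>bg\<close> bounds the latter kernel by
  \<open>4 * A / norm z\<close>, so here the first moment is not spent.\<close>

lemma col2_at_infinity:
  assumes "\<epsilon> > 0"
  obtains R where "\<And>z u1 u2. 0 \<le> Im z \<Longrightarrow> R \<le> norm z \<Longrightarrow> V2.sol z (\<lambda>_. 0) (\<lambda>_. 1) u1 u2 \<Longrightarrow>
     norm (u1 0) \<le> \<epsilon> \<and> norm (u2 0 - 1) \<le> \<epsilon>"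
proof -
  define \<eta> where "\<eta> = \<epsilon> / (2 * V2.amp)"
  have eta: "0 < \<eta>" using assms V2.amp_pos by (simp add: \<eta>_def)
  define P where "P = integral {..0} (\<lambda>y. \<bar>u0 y\<bar>)"
  have P0: "0 \<le> P" unfolding P_def by (rule total_p_nonneg)
  obtain R1 where R1: "\<And>z x. 0 \<le> Im z \<Longrightarrow> R1 \<le> norm z \<Longrightarrow> x \<le> 0 \<Longrightarrow>
        norm (integral {..x} (\<lambda>y. wave z (x - y) * of_real (u0 y))) \<le> \<eta>"
    using Riemann_Lebesgue_atMost[OF u0_absint] eta unfolding RL_def by meson
  show ?thesis
  proof (rule that[of "max R1 (max (2 * B) (4 * A * P / \<eta>))"])
    fix z u1 u2 assume z: "0 \<le> Im z" and R: "max R1 (max (2 * B) (4 * A * P / \<eta>)) \<le> norm z"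
      and s: "V2.sol z (\<lambda>_. 0) (\<lambda>_. 1) u1 u2"
    have zp: "0 < norm z" using R Bpos by (auto intro: less_le_trans[of 0 "2 * B"])
    have bc: "bdd_cont u1" "bdd_cont u2" using s by (auto simp: V2.sol_def)
    have zB: "(- z)^2 \<noteq> (complex_of_real B)^2"
      using norm_square_diff_ge[of B z] R Bpos zp by auto
    have "norm (u1 0) + norm (u2 0 - 1) \<le> V2.amp * (2 * \<eta>)"
    proof (rule V2.stability[OF z, of u1 "\<lambda>x. u2 x - 1" 0])
      show "bdd_cont (\<lambda>x. u2 x - 1)" by (rule bdd_cont_diff[OF bc(2) bdd_cont_const])
      fix x :: real assume x: "x \<le> 0"
      have t1: "V2.T1 z (\<lambda>x. u2 x - 1) x = V2.T1 z u2 x - V2.T1 z (\<lambda>_. 1) x"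
        by (rule V2.T1_diff[OF z x bc(2) bdd_cont_const])
      have t2: "V2.T2 z u1 (\<lambda>x. u2 x - 1) x = V2.T2 z u1 u2 x - V2.T2 z (\<lambda>_. 0) (\<lambda>_. 1) x"
        using V2.T2_diff[OF z x bc(1) bdd_cont_const bc(2) bdd_cont_const, of 0 1] by simp
      have n1: "norm (V2.T1 z (\<lambda>_. 1) x) \<le> \<eta>"
        unfolding V2.T1_def using R1[OF z _ x] R by simp
      have pa: "(\<lambda>y. \<bar>u0 y\<bar>) absolutely_integrable_on {..0}"
        using absolutely_integrable_norm_real[OF u0_absint] by simp
      have ki: "(\<lambda>y. kap2 A B z x y * of_real (u0 y)) absolutely_integrable_on {..x}"
        using V2.integrable_E22[OF z x bdd_cont_const, of 1] by simp
      have "norm (integral {..x} (\<lambda>y. kap2 A B z x y * of_real (u0 y))) \<le> integral {..x} (\<lambda>y. (4 * A / norm z) * \<bar>u0 y\<bar>)"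
      proof (rule norm_integral_atMost_le[OF ki])
        show "(\<lambda>y. (4 * A / norm z) * \<bar>u0 y\<bar>) absolutely_integrable_on {..x}"
          by (intro set_integrable_mult_right) (use absint_atMost_mono[OF pa x] in auto)
        fix y assume y: "y \<in> {..x}"
        have b: "norm (bg A B (- z) t) \<le> 2 * A / norm z" for t
          using norm_bg_large[OF Apos Bpos, of "- z" t] R by simp
        have "kap2 A B z x y = wave z (x - y) * bg A B (- z) x - bg A B (- z) y"
          using kap2_bg[OF zB, of y x A] y by simp
        also have "norm \<dots> \<le> 1 * (2 * A / norm z) + 2 * A / norm z"
        proof (rule norm_triangle_le_diff[OF add_mono[OF _ b]])
          show "norm (wave z (x - y) * bg A B (- z) x) \<le> 1 * (2 * A / norm z)"
            unfolding norm_mult using y by (intro mult_mono norm_wave_le_1 z b) auto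
        qed
        finally have "norm (kap2 A B z x y) \<le> 4 * A / norm z" by simp
        then show "norm (kap2 A B z x y * of_real (u0 y)) \<le> (4 * A / norm z) * \<bar>u0 y\<bar>"
          unfolding norm_mult norm_of_real by (intro mult_right_mono) auto
      qed
      also have "\<dots> = (4 * A / norm z) * integral {..x} (\<lambda>y. \<bar>u0 y\<bar>)" by (rule integral_mult_right)
      also have "\<dots> \<le> (4 * A / norm z) * P"
        unfolding P_def using Apos integral_atMost_mono_nonneg[OF pa x] by (intro mult_left_mono) auto
      also have "\<dots> \<le> \<eta>" using R eta zp by (simp add: field_simps)
      finally have n2: "norm (V2.T2 z (\<lambda>_. 0) (\<lambda>_. 1) x) \<le> \<eta>" unfolding V2.T2_def by simp
      have "norm (u1 x - V2.T1 z (\<lambda>x. u2 x - 1) x) + norm (u2 x - 1 - V2.T2 z u1 (\<lambda>x. u2 x - 1) x)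
         = norm (V2.T1 z (\<lambda>_. 1) x) + norm (V2.T2 z (\<lambda>_. 0) (\<lambda>_. 1) x)"
        unfolding t1 t2 using s x by (simp add: V2.sol_def)
      then show "norm (u1 x - V2.T1 z (\<lambda>x. u2 x - 1) x) + norm (u2 x - 1 - V2.T2 z u1 (\<lambda>x. u2 x - 1) x) \<le> 2 * \<eta>"
        using n1 n2 by simp
    qed (use bc in auto)
    also have "V2.amp * (2 * \<eta>) = \<epsilon>" using V2.amp_pos by (simp add: \<eta>_def)
    finally show "norm (u1 0) \<le> \<epsilon> \<and> norm (u2 0 - 1) \<le> \<epsilon>"
      using norm_ge_zero[of "u2 0 - 1"] norm_ge_zero[of "u1 0"] by linarith
  qed
qed

text \<open>Classically this is Liouville's formula for a trace-free system. Here the columns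
  satisfy only integral equations, so each product in the determinant is integrated by parts.
  Subtracting \<open>bg\<close> times the first row from the second leaves the determinant
  unchanged; with waves inserted whose product is 1, the four entries become the constants 1, 0, 0,
  1 plus integrals from minus infinity.\<close>

lemma det_eq_1:
  assumes k: "Im k = 0" and nB: "k^2 \<noteq> (of_real B)^2"
    and s1: "V1.sol k (\<lambda>_. 1) (bg A B k) v1 v2" and s2: "V2.sol (- k) (\<lambda>_. 0) (\<lambda>_. 1) u1 u2"
  shows "v1 0 * u2 0 - v2 0 * u1 0 = 1"
proof -
  let ?n = "bg A B k"
  have bc: "bdd_cont v1" "bdd_cont v2" "bdd_cont u1" "bdd_cont u2" using s1 s2 by (auto simp: V1.sol_def V2.sol_def)
  have bcw: "bdd_cont (\<lambda>y. wave k y)" "bdd_cont (\<lambda>y. wave k (- y))"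
    unfolding bdd_cont_def using k by (auto simp: norm_wave intro!: continuous_intros exI[of _ 1])
  have bcn: "bdd_cont ?n" unfolding bdd_cont_def using bg_cont bg_bound by blast
  have int: "(\<lambda>y. u y * of_real (f y)) absolutely_integrable_on {..0}"
    if "bdd_cont u" "f absolutely_integrable_on {..0}" for u and f :: "real \<Rightarrow> real"
    using that unfolding bdd_cont_def by (auto intro!: absint_continuous_mult absint_of_real)
  define f1 where "f1 y = v2 y * of_real (u0 y)" for y
  define r where "r y = (wave k (- y) * v1 y) * of_real (qq y) - (wave k (- y) * (?n y * v2 y)) * of_real (u0 y)" for y
  define f2 where "f2 y = (wave k y * u2 y) * of_real (u0 y)" for y
  define s where "s y = u1 y * of_real (qq y) - (?n y * u2 y) * of_real (u0 y)" for y
  have f1i: "f1 absolutely_integrable_on {..0}" and f2i: "f2 absolutely_integrable_on {..0}"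
    and ri: "r absolutely_integrable_on {..0}" and si: "s absolutely_integrable_on {..0}"
    unfolding f1_def f2_def r_def s_def
    by (intro set_integral_diff(1) int bdd_cont_mult bc bcw bcn u0_absint qq_absint)+
  have X1: "v1 x = 1 + integral {..x} f1" if "x \<le> 0" for x
    using s1 that by (simp add: V1.sol_def V1.T1_def f1_def[abs_def] mult.commute)
  have Y1: "wave k x * u1 x = 0 + integral {..x} f2" if x: "x \<le> 0" for x
  proof -
    have "wave k x * u1 x = wave k x * integral {..x} (\<lambda>y. wave (- k) (x - y) * of_real (u0 y) * u2 y)"
      using s2 x by (simp add: V2.sol_def V2.T1_def)
    also have "\<dots> = integral {..x} (\<lambda>y. wave k x * (wave (- k) (x - y) * of_real (u0 y) * u2 y))" by simp
    also have "\<dots> = integral {..x} f2"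
    proof (rule integral_cong)
      fix y
      show "wave k x * (wave (- k) (x - y) * of_real (u0 y) * u2 y) = f2 y"
        unfolding f2_def wave_split(1)[of k x y, symmetric] by (simp add: mult_ac)
    qed
    finally show ?thesis by simp
  qed
  have X2: "wave k (- x) * (v2 x - ?n x * v1 x) = 0 + integral {..x} r" if x: "x \<le> 0" for x
  proof -
    have i: "f1 integrable_on {..x}" "r integrable_on {..x}"
      using absint_atMost_mono[OF f1i x] absint_atMost_mono[OF ri x] by (auto intro: set_lebesgue_integral_eq_integral(1))
    have "v2 x = ?n x + integral {..x} (\<lambda>y. wave k (x - y) * of_real (qq y) * v1 y + kap1 A B k x y * of_real (u0 y) * v2 y)"
      using s1 x by (simp add: V1.sol_def V1.T2_def)
    also have "integral {..x} (\<lambda>y. wave k (x - y) * of_real (qq y) * v1 y + kap1 A B k x y * of_real (u0 y) * v2 y)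
      = integral {..x} (\<lambda>y. ?n x * f1 y + wave k x * r y)"
    proof (rule integral_cong)
      fix y assume y: "y \<in> {..x}"
      have w: "wave k (x - y) = wave k x * wave k (- y)" using wave_add[of k x "- y"] by simp
      show "wave k (x - y) * of_real (qq y) * v1 y + kap1 A B k x y * of_real (u0 y) * v2 y = ?n x * f1 y + wave k x * r y"
      proof -
        have kp: "kap1 A B k x y = ?n x - wave k x * wave k (- y) * ?n y"
          using kap1_bg[OF nB, of y x] y unfolding w by simp
        show ?thesis unfolding kp w by (simp add: f1_def r_def algebra_simps)
      qed
    qed
    also have "\<dots> = ?n x * integral {..x} f1 + wave k x * integral {..x} r"
      using integral_add[OF integrable_on_mult_right[OF i(1)] integrable_on_mult_right[OF i(2)]] by simp
    finally have "v2 x - ?n x * v1 x = wave k x * integral {..x} r"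
      by (simp add: X1[OF x] algebra_simps)
    then show ?thesis using wave_inverse[of k x] by (simp add: mult.assoc[symmetric] mult.commute)
  qed
  have Y2: "u2 x - ?n x * u1 x = 1 + integral {..x} s" if x: "x \<le> 0" for x
  proof -
    have ei: "(\<lambda>y. wave (- k) (x - y) * of_real (u0 y) * u2 y) integrable_on {..x}"
      using V2.integrable_E12[of "- k" x u2] k x bc by (auto intro: set_lebesgue_integral_eq_integral(1))
    have si': "s integrable_on {..x}" using absint_atMost_mono[OF si x] by (auto intro: set_lebesgue_integral_eq_integral(1))
    have "u2 x = 1 + integral {..x} (\<lambda>y. of_real (qq y) * u1 y + kap2 A B (- k) x y * of_real (u0 y) * u2 y)"
      using s2 x by (simp add: V2.sol_def V2.T2_def)
    also have "integral {..x} (\<lambda>y. of_real (qq y) * u1 y + kap2 A B (- k) x y * of_real (u0 y) * u2 y)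
      = integral {..x} (\<lambda>y. ?n x * (wave (- k) (x - y) * of_real (u0 y) * u2 y) + s y)"
    proof (rule integral_cong)
      fix y assume y: "y \<in> {..x}"
      show "of_real (qq y) * u1 y + kap2 A B (- k) x y * of_real (u0 y) * u2 y
        = ?n x * (wave (- k) (x - y) * of_real (u0 y) * u2 y) + s y"
      proof -
        have kp: "kap2 A B (- k) x y = wave (- k) (x - y) * ?n x - ?n y"
          using kap2_bg[OF nB, of y x A] y by simp
        show ?thesis unfolding kp by (simp add: s_def algebra_simps)
      qed
    qed
    also have "\<dots> = ?n x * integral {..x} (\<lambda>y. wave (- k) (x - y) * of_real (u0 y) * u2 y) + integral {..x} s"
      using integral_add[OF integrable_on_mult_right[OF ei] si'] by simp
    also have "integral {..x} (\<lambda>y. wave (- k) (x - y) * of_real (u0 y) * u2 y) = u1 x"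
      using s2 x by (simp add: V2.sol_def V2.T1_def)
    finally show ?thesis by simp
  qed
  have "v1 0 * (u2 0 - ?n 0 * u1 0) = 1 * 1 + integral {..0} (\<lambda>y. f1 y * (u2 y - ?n y * u1 y) + v1 y * s y)"
    by (rule integral_by_parts_atMost(2)[OF f1i si X1 Y2])
  moreover have "(wave k (- 0) * (v2 0 - ?n 0 * v1 0)) * (wave k 0 * u1 0)
     = 0 * 0 + integral {..0} (\<lambda>y. r y * (wave k y * u1 y) + (wave k (- y) * (v2 y - ?n y * v1 y)) * f2 y)"
    by (rule integral_by_parts_atMost(2)[OF ri f2i X2 Y1])
  \<comment> \<open>Both products have the same density, so the integrals cancel in the determinant
    and only the limits at minus infinity, \<open>1 * 1\<close> and \<open>0 * 0\<close>,
    remain.\<close>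
  moreover have "integral {..0} (\<lambda>y. f1 y * (u2 y - ?n y * u1 y) + v1 y * s y)
    = integral {..0} (\<lambda>y. r y * (wave k y * u1 y) + (wave k (- y) * (v2 y - ?n y * v1 y)) * f2 y)"
  proof (rule integral_cong)
    fix y :: real
    have w: "wave k (- y) * wave k y = 1" using wave_inverse[of k y] by (simp add: mult.commute)
    have "r y * (wave k y * u1 y) = (wave k (- y) * wave k y) * (v1 y * of_real (qq y) - ?n y * v2 y * of_real (u0 y)) * u1 y"
      by (simp add: r_def algebra_simps)
    moreover have "(wave k (- y) * (v2 y - ?n y * v1 y)) * f2 y = (wave k (- y) * wave k y) * ((v2 y - ?n y * v1 y) * (u2 y * of_real (u0 y)))"
      by (simp add: f2_def algebra_simps)
    ultimately show "f1 y * (u2 y - ?n y * u1 y) + v1 y * s y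
       = r y * (wave k y * u1 y) + (wave k (- y) * (v2 y - ?n y * v1 y)) * f2 y"
      unfolding w by (simp add: f1_def s_def algebra_simps)
  qed
  ultimately have "v1 0 * (u2 0 - ?n 0 * u1 0) - (v2 0 - ?n 0 * v1 0) * u1 0 = 1" by simp
  then show ?thesis by (simp add: algebra_simps)
qed

end

section \<open>Regularity of the spectral functions\<close>

locale scattering = scattering_data +
  fixes \<Psi>1 \<Psi>2 :: "real \<Rightarrow> complex \<Rightarrow> complex^2^2"
  assumes P1: "is_Psi1 A B u0 \<Psi>1" and P2: "is_Psi2 A B u0 \<Psi>2"
begin

lemma raw1_Psi1: "k \<in> upper_dom B \<Longrightarrow> raw1 k (\<lambda>x. \<Psi>1 x k $ 1 $ 1) (\<lambda>x. \<Psi>1 x k $ 2 $ 1)"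
  using P1 by (auto simp: is_Psi1_def intro: solves1_col_1_raw)

lemma raw2_Psi1: "Im k \<le> 0 \<Longrightarrow> raw2 k (\<lambda>x. \<Psi>1 x k $ 1 $ 2) (\<lambda>x. \<Psi>1 x k $ 2 $ 2)"
  using P1 by (auto simp: is_Psi1_def intro: solves1_col_2_raw)

lemma raw1_Psi2: "k \<in> upper_dom B \<Longrightarrow> raw1 k (\<lambda>x. \<Psi>2 (- x) k $ 2 $ 2) (\<lambda>x. \<Psi>2 (- x) k $ 1 $ 2)"
  using P2 by (auto simp: is_Psi2_def intro: solves2_col_2_raw)

lemma raw2_Psi2: "Im k \<le> 0 \<Longrightarrow> raw2 k (\<lambda>x. \<Psi>2 (- x) k $ 2 $ 1) (\<lambda>x. \<Psi>2 (- x) k $ 1 $ 1)"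
  using P2 by (auto simp: is_Psi2_def intro: solves2_col_1_raw)

lemma upper_domD: "k \<in> upper_dom B \<Longrightarrow> 0 \<le> Im k" "k \<in> upper_dom B \<Longrightarrow> k^2 \<noteq> (of_real B)^2"
  by (auto simp: upper_dom_def square_neq)

lemmas sol1 = raw1_sol[OF raw1_Psi1 upper_domD]
lemmas sol2 = raw2_sol[OF raw2_Psi1]

section \<open>The spectral functions through the columns at the origin\<close>

definition al :: "complex \<Rightarrow> complex" where "al k = \<Psi>1 0 k $ 1 $ 1"
definition be :: "complex \<Rightarrow> complex" where "be k = \<Psi>1 0 k $ 2 $ 1"
definition ga :: "complex \<Rightarrow> complex" where "ga k = \<Psi>1 0 k $ 1 $ 2"
definition de :: "complex \<Rightarrow> complex" where "de k = \<Psi>1 0 k $ 2 $ 2"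

lemma Psi2_upper:
  assumes "k \<in> upper_dom B"
  shows "\<Psi>2 0 k $ 2 $ 2 = al k" "\<Psi>2 0 k $ 1 $ 2 = be k"
  using V1.sol_unique[OF upper_domD(1)[OF assms] raw1_sol[OF raw1_Psi2 upper_domD, OF assms assms assms]
      sol1[OF assms assms assms], of 0]
  by (simp_all add: al_def be_def)

lemma Psi2_lower:
  assumes "Im k \<le> 0"
  shows "\<Psi>2 0 k $ 2 $ 1 = ga k" "\<Psi>2 0 k $ 1 $ 1 = de k"
  using V2.sol_unique[OF _ raw2_sol[OF raw2_Psi2] sol2, of k 0] assms
  by (simp_all add: ga_def de_def)

lemma det_cols_eq: "det_cols v w = v $ 1 * w $ 2 - w $ 1 * v $ 2"
  by (simp add: det_cols_def det_2 transpose_def)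

lemma spec_a1_eq: "k \<in> upper_dom B \<Longrightarrow> spec_a1 \<Psi>1 \<Psi>2 k = al k ^ 2 - be k ^ 2"
  by (simp add: spec_a1_def det_cols_eq column_def Psi2_upper power2_eq_square flip: al_def be_def)

lemma spec_a2_eq: "Im k \<le> 0 \<Longrightarrow> spec_a2 \<Psi>1 \<Psi>2 k = de k ^ 2 - ga k ^ 2"
  by (simp add: spec_a2_def det_cols_eq column_def Psi2_lower power2_eq_square flip: ga_def de_def)

lemma spec_b_eq: "k \<in> upper_dom B \<Longrightarrow> Im k = 0 \<Longrightarrow> spec_b \<Psi>1 \<Psi>2 k = de k * be k - al k * ga k"
  by (simp add: spec_b_def det_cols_eq column_def Psi2_lower flip: al_def be_def)

text \<open>The identity of Brahmagupta for differences of squares, \<open>(al\<^sup>2 - be\<^sup>2)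
  (de\<^sup>2 - ga\<^sup>2) = (al de - be ga)\<^sup>2 - (de be - al ga)\<^sup>2\<close>, in which
  the first square on the right is that of the determinant.\<close>

lemma scattering_relation:
  assumes "k \<in> upper_dom B" "Im k = 0"
  shows "spec_a1 \<Psi>1 \<Psi>2 k * spec_a2 \<Psi>1 \<Psi>2 k = 1 - spec_b \<Psi>1 \<Psi>2 k ^ 2"
proof -
  have d: "al k * de k - be k * ga k = 1"
    using det_eq_1[OF assms(2) upper_domD(2)[OF assms(1)] sol1[OF assms(1) assms(1) assms(1)] sol2[of k]] assms
    by (simp add: al_def be_def ga_def de_def)
  have "(al k ^ 2 - be k ^ 2) * (de k ^ 2 - ga k ^ 2) + (de k * be k - al k * ga k)^2 = (al k * de k - be k * ga k)^2"
    by (simp add: power2_eq_square algebra_simps)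
  then show ?thesis unfolding d using assms by (simp add: spec_a1_eq spec_a2_eq spec_b_eq algebra_simps)
qed

lemma lower_family:
  shows "continuous_on {k. Im k \<le> 0} ga" "continuous_on {k. Im k \<le> 0} de"
    "ga holomorphic_on {k. Im k < 0}" "de holomorphic_on {k. Im k < 0}"
proof -
  interpret F: volterra_family u0 qq A "\<lambda>z x y. wave z (x - y)" "\<lambda>z x y. 1" "kap2 A B"
    "\<lambda>_. 0" "\<lambda>_. 0" "\<lambda>_. 0" "\<lambda>_. 1" "\<lambda>_. 0" "\<lambda>_. 0" 1 "\<lambda>z x. \<Psi>1 x (- z) $ 1 $ 2" "\<lambda>z x. \<Psi>1 x (- z) $ 2 $ 2"
  proof
    show "V2.sol z (\<lambda>x. 0 + z * 0 + z\<^sup>2 * 0) (\<lambda>x. 1 + z * 0 + z\<^sup>2 * 0) (\<lambda>x. \<Psi>1 x (- z) $ 1 $ 2) (\<lambda>x. \<Psi>1 x (- z) $ 2 $ 2)"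
      if "0 \<le> Im z" for z using sol2[of "- z"] that by simp
  qed simp
  have ga: "ga = (\<lambda>z. \<Psi>1 0 (- z) $ 1 $ 2) \<circ> uminus" and de: "de = (\<lambda>z. \<Psi>1 0 (- z) $ 2 $ 2) \<circ> uminus"
    by (auto simp: ga_def de_def)
  show "continuous_on {k. Im k \<le> 0} ga" "continuous_on {k. Im k \<le> 0} de"
    unfolding ga de comp_def
    by (rule continuous_on_compose2[OF F.v_continuous_on(1)] continuous_on_compose2[OF F.v_continuous_on(2)];
        auto intro!: continuous_intros)+
  show "ga holomorphic_on {k. Im k < 0}" "de holomorphic_on {k. Im k < 0}"
    unfolding ga de
    by (rule holomorphic_on_compose_gen[OF _ F.v_holomorphic_on(1)] holomorphic_on_compose_gen[OF _ F.v_holomorphic_on(2)];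
        auto intro!: holomorphic_intros)+
qed

text \<open>
  \<open>(k^2 - B^2)\<close> times the first column of \<open>\<Psi>1\<close> extends to \<open>k = B\<close> and \<open>k = - B\<close>, where the equation for the
  limit is solved by a multiple of the second column. This is what ties the double poles of \<open>a\<^sub>1\<close>
  to the values of \<open>a\<^sub>2\<close> there.
\<close>

definition W1 :: "complex \<Rightarrow> real \<Rightarrow> complex" where
  "W1 z x = (if z^2 = (of_real B)^2 then - (\<i> * of_real A * z / 2) * (wave z x * \<Psi>1 x z $ 1 $ 2) else (z^2 - (of_real B)^2) * \<Psi>1 x z $ 1 $ 1)"

definition W2 :: "complex \<Rightarrow> real \<Rightarrow> complex" where
  "W2 z x = (if z^2 = (of_real B)^2 then - (\<i> * of_real A * z / 2) * (wave z x * \<Psi>1 x z $ 2 $ 2) else (z^2 - (of_real B)^2) * \<Psi>1 x z $ 2 $ 1)"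

lemma bdd_cont_wave_real: "Im z = 0 \<Longrightarrow> bdd_cont (wave z)"
  unfolding bdd_cont_def by (auto simp: norm_wave intro!: continuous_intros exI[of _ 1])

text \<open>Multiplying the second-column system at \<open>- z\<close> by \<open>wave z x\<close>
  produces the kernels of the first-column system at \<open>z\<close>. At a resonance the chosen
  multiple of the second column therefore solves the system with the limiting inhomogeneity, and one
  family covers the whole closed half-plane.\<close>

lemma W_sol:
  assumes z: "0 \<le> Im z"
  shows "V1.sol z (\<lambda>x. - ((of_real B)^2) + z * 0 + z^2 * 1)
     (\<lambda>x. of_real (A * B * sin (2 * B * x) / 2) + z * (- \<i> * of_real (A * cos (2 * B * x) / 2)) + z^2 * 0) (W1 z) (W2 z)"
proof (cases "z^2 = (of_real B)^2")
  case False
  then have u: "z \<in> upper_dom B" using z by (auto simp: upper_dom_def)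
  have f2: "(z^2 - (of_real B)^2) * bg A B z x
      = of_real (A * B * sin (2 * B * x) / 2) + z * (- \<i> * of_real (A * cos (2 * B * x) / 2)) + z^2 * 0" for x
  proof -
    have "c * (a * (s - \<i> * z * t) / (2 * c)) = a * s / 2 + z * (- \<i> * (a * t / 2)) + z^2 * 0" if "c \<noteq> 0" for a s t c :: complex
      using that by (simp add: field_simps)
    from this[of "z^2 - (of_real B)^2" "of_real A" "of_real (B * sin (2 * B * x))" "of_real (cos (2 * B * x))"] False
    show ?thesis by (simp add: bg_def mult.assoc)
  qed
  show ?thesis
    using V1.sol_cmult[OF sol1[OF u u u], of "z^2 - (of_real B)^2"] False
    unfolding f2 by (simp add: W1_def[abs_def] W2_def[abs_def])
next
  case True
  then have zB: "z = of_real B \<or> z = - of_real B" by (simp add: power2_eq_iff)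
  then have zi: "Im z = 0" by auto
  \<comment> \<open>\<open>c * wave z x\<close> is the continuation of
    \<open>(z\<^sup>2 - B\<^sup>2) bg\<close> to the resonance, namely
    \<open>(A / 2) (B sin (2 B x) - \<i> z cos (2 B x))\<close>; Euler's formula identifies the
    two.\<close>
  define c where "c = - (\<i> * of_real A * z / 2)"
  define u1 where "u1 x = \<Psi>1 x z $ 1 $ 2" for x
  define u2 where "u2 x = \<Psi>1 x z $ 2 $ 2" for x
  have s: "V2.sol (- z) (\<lambda>_. 0) (\<lambda>_. 1) u1 u2"
    using sol2[of z] zi by (simp add: u1_def[abs_def] u2_def[abs_def])
  have W: "W1 z = (\<lambda>x. c * (wave z x * u1 x))" "W2 z = (\<lambda>x. c * (wave z x * u2 x))"
    using True by (auto simp: W1_def W2_def c_def u1_def u2_def)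
  have bc: "bdd_cont u1" "bdd_cont u2" using s by (auto simp: V2.sol_def)
  have f2: "of_real (A * B * sin (2 * B * x) / 2) + z * (- \<i> * of_real (A * cos (2 * B * x) / 2)) + z^2 * 0 = c * wave z x" for x
  proof -
    have "wave z x = of_real (cos (2 * B * x)) + \<i> * z / of_real B * of_real (sin (2 * B * x))"
      using zB
    proof
      assume z: "z = of_real B"
      have "wave (of_real B) x = cis (2 * B * x)" by (simp add: wave_def cis_conv_exp mult_ac)
      then show ?thesis unfolding z using Bpos by (simp add: complex_eq_iff)
    next
      assume z: "z = - of_real B"
      have "wave (- of_real B) x = cis (- (2 * B * x))" by (simp add: wave_def cis_conv_exp mult_ac)
      then show ?thesis unfolding z using Bpos by (simp add: complex_eq_iff)
    qed
    then have "c * wave z x = of_real A / 2 * (z^2 / of_real B * of_real (sin (2 * B * x)) - \<i> * z * of_real (cos (2 * B * x)))"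
      by (simp add: c_def power2_eq_square algebra_simps)
    also have "z^2 / of_real B = of_real B" using True Bpos by (simp add: power2_eq_square)
    finally show ?thesis by (simp add: algebra_simps)
  qed
  have e1: "W1 z x = V1.T1 z (W2 z) x" if x: "x \<le> 0" for x
  proof -
    have "W1 z x = (c * wave z x) * V2.T1 (- z) u2 x" using s x by (simp add: W V2.sol_def)
    also have "\<dots> = integral {..x} (\<lambda>y. (c * wave z x) * (wave (- z) (x - y) * of_real (u0 y) * u2 y))"
      by (simp add: V2.T1_def)
    also have "\<dots> = integral {..x} (\<lambda>y. 1 * of_real (u0 y) * W2 z y)"
    proof (rule integral_cong)
      fix y
      show "(c * wave z x) * (wave (- z) (x - y) * of_real (u0 y) * u2 y) = 1 * of_real (u0 y) * W2 z y"
        unfolding W wave_split(1)[of z x y, symmetric] by (simp add: mult_ac)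
    qed
    finally show ?thesis by (simp add: V1.T1_def)
  qed
  have e2: "W2 z x = c * wave z x + V1.T2 z (W1 z) (W2 z) x" if x: "x \<le> 0" for x
  proof -
    have "W2 z x = (c * wave z x) * (1 + V2.T2 (- z) u1 u2 x)" using s x by (simp add: W V2.sol_def)
    also have "\<dots> = c * wave z x + (c * wave z x) * V2.T2 (- z) u1 u2 x" by (simp add: distrib_left)
    also have "(c * wave z x) * V2.T2 (- z) u1 u2 x
      = integral {..x} (\<lambda>y. (c * wave z x) * (1 * of_real (qq y) * u1 y + kap2 A B (- z) x y * of_real (u0 y) * u2 y))"
      by (simp add: V2.T2_def)
    also have "\<dots> = V1.T2 z (W1 z) (W2 z) x"
      unfolding V1.T2_def
    proof (rule integral_cong)
      fix y
      show "(c * wave z x) * (1 * of_real (qq y) * u1 y + kap2 A B (- z) x y * of_real (u0 y) * u2 y)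
         = wave z (x - y) * of_real (qq y) * W1 z y + kap1 A B z x y * of_real (u0 y) * W2 z y"
        unfolding W kap1_kap2 wave_split(2)[of z x y] by (simp add: algebra_simps)
    qed
    finally show ?thesis .
  qed
  have b: "bdd_cont (W1 z)" "bdd_cont (W2 z)"
    unfolding W by (intro bdd_cont_cmult bdd_cont_mult bdd_cont_wave_real zi bc)+
  show ?thesis
    unfolding f2 V1.sol_def using b e1 e2 True by simp
qed

lemma upper_family:
  shows "continuous_on {k. 0 \<le> Im k} (\<lambda>k. W1 k 0)" "continuous_on {k. 0 \<le> Im k} (\<lambda>k. W2 k 0)"
    "(\<lambda>k. W1 k 0) holomorphic_on {k. 0 < Im k}" "(\<lambda>k. W2 k 0) holomorphic_on {k. 0 < Im k}"
proof -
  interpret F: volterra_family u0 qq A "\<lambda>z x y. 1" "\<lambda>z x y. wave z (x - y)" "kap1 A B"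
    "\<lambda>_. - ((of_real B)^2)" "\<lambda>_. 0" "\<lambda>_. 1" "\<lambda>x. of_real (A * B * sin (2 * B * x) / 2)"
    "\<lambda>x. - \<i> * of_real (A * cos (2 * B * x) / 2)" "\<lambda>_. 0" "B^2 + 1 + A * B + A" W1 W2
  proof
    fix x :: real
    have "\<bar>A * B * sin (2 * B * x)\<bar> \<le> A * B" "\<bar>A * cos (2 * B * x)\<bar> \<le> A"
      using mult_left_le[of "\<bar>sin (2 * B * x)\<bar>" "A * B"] mult_left_le[of "\<bar>cos (2 * B * x)\<bar>" A] Apos Bpos
      by (simp_all add: abs_mult)
    moreover have "0 \<le> A * B" "0 \<le> B^2" using Apos Bpos by auto
    moreover have "norm (complex_of_real (A * B * sin (2 * B * x) / 2)) = \<bar>A * B * sin (2 * B * x)\<bar> / 2"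
      "norm (- \<i> * complex_of_real (A * cos (2 * B * x) / 2)) = \<bar>A * cos (2 * B * x)\<bar> / 2"
      unfolding norm_mult norm_minus_cancel norm_of_real by simp_all
    moreover have "norm (- ((complex_of_real B)^2)) = B^2" by (simp add: norm_power)
    ultimately show "norm (- ((complex_of_real B)^2)) \<le> B^2 + 1 + A * B + A \<and> norm (0::complex) \<le> B^2 + 1 + A * B + A \<and>
       norm (1::complex) \<le> B^2 + 1 + A * B + A \<and> norm (complex_of_real (A * B * sin (2 * B * x) / 2)) \<le> B^2 + 1 + A * B + A \<and>
       norm (- \<i> * complex_of_real (A * cos (2 * B * x) / 2)) \<le> B^2 + 1 + A * B + A \<and> norm (0::complex) \<le> B^2 + 1 + A * B + A"
      using Apos norm_zero[where 'a=complex] norm_one[where 'a=complex] by linarith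
  qed (rule W_sol)
  show "continuous_on {k. 0 \<le> Im k} (\<lambda>k. W1 k 0)" "continuous_on {k. 0 \<le> Im k} (\<lambda>k. W2 k 0)"
    "(\<lambda>k. W1 k 0) holomorphic_on {k. 0 < Im k}" "(\<lambda>k. W2 k 0) holomorphic_on {k. 0 < Im k}"
    by (rule F.v_continuous_on F.v_holomorphic_on, simp)+
qed

text \<open>The continuous extension of \<open>(k\<^sup>2 - B\<^sup>2)\<^sup>2 a1\<close> to the
  closed half-plane, resonances included; the square appears because \<open>a1\<close> is quadratic
  in the entries of the column.\<close>

definition a1_reg :: "complex \<Rightarrow> complex" where "a1_reg k = (W1 k 0)^2 - (W2 k 0)^2"

lemma a1_reg_continuous: "continuous_on {k. 0 \<le> Im k} a1_reg"
  unfolding a1_reg_def[abs_def] by (intro continuous_intros upper_family)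

lemma a1_reg_holomorphic: "a1_reg holomorphic_on {k. 0 < Im k}"
  unfolding a1_reg_def[abs_def] by (intro holomorphic_intros upper_family)

lemma a1_reg_eq:
  assumes "k \<in> upper_dom B"
  shows "a1_reg k = (k^2 - (of_real B)^2)^2 * spec_a1 \<Psi>1 \<Psi>2 k"
  using upper_domD(2)[OF assms] unfolding spec_a1_eq[OF assms]
  by (simp add: a1_reg_def W1_def W2_def al_def be_def power_mult_distrib right_diff_distrib)

text \<open>The squared factor \<open>(- \<i> A k / 2)\<^sup>2\<close> equals
  \<open>- A\<^sup>2 B\<^sup>2 / 4\<close>, and its sign turns
  \<open>ga\<^sup>2 - de\<^sup>2\<close> into \<open>de\<^sup>2 - ga\<^sup>2\<close>.\<close>

lemma a1_reg_resonant:
  assumes "k = of_real B \<or> k = - of_real B"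
  shows "a1_reg k = of_real (A^2 * B^2 / 4) * spec_a2 \<Psi>1 \<Psi>2 k"
proof -
  have k2: "k^2 = (of_real B)^2" and "Im k \<le> 0" using assms by auto
  then have "a1_reg k = - ((of_real A)^2 * k^2 / 4) * (ga k ^ 2 - de k ^ 2)"
    by (simp add: a1_reg_def W1_def W2_def ga_def de_def power_mult_distrib power_divide right_diff_distrib)
  also have "\<dots> = of_real (A^2 * B^2 / 4) * (de k ^ 2 - ga k ^ 2)"
  proof -
    have "- (a * b / 4) * (g - d) = (a * b / 4) * (d - g)" for a b d g :: complex by (simp add: field_simps)
    from this[of "(of_real A)^2" "k^2"] show ?thesis by (simp add: k2)
  qed
  finally show ?thesis using \<open>Im k \<le> 0\<close> by (simp add: spec_a2_eq)
qed

section \<open>Regularity of \<open>a2\<close> and limits at infinity\<close>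

lemma a2_continuous: "continuous_on {k. Im k \<le> 0} (spec_a2 \<Psi>1 \<Psi>2)"
proof -
  have "continuous_on {k. Im k \<le> 0} (\<lambda>k. de k ^ 2 - ga k ^ 2)" by (intro continuous_intros lower_family)
  then show ?thesis by (rule continuous_on_eq) (simp add: spec_a2_eq)
qed

lemma a2_holomorphic: "spec_a2 \<Psi>1 \<Psi>2 holomorphic_on {k. Im k < 0}"
proof -
  have "(\<lambda>k. de k ^ 2 - ga k ^ 2) holomorphic_on {k. Im k < 0}" by (intro holomorphic_intros lower_family)
  then show ?thesis by (rule holomorphic_transform) (simp add: spec_a2_eq)
qed

text \<open>The limit is taken within the closed half-plane and is uniform in the direction; closing
  a contour through the half-plane relies on this.\<close>

lemma al_be_at_infinity:
  "(al \<longlongrightarrow> 1) (inf at_infinity (principal (upper_dom B)))" "(be \<longlongrightarrow> 0) (inf at_infinity (principal (upper_dom B)))"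
proof -
  have "eventually (\<lambda>k. dist (al k) 1 < e \<and> dist (be k) 0 < e) (inf at_infinity (principal (upper_dom B)))" if e: "0 < e" for e
  proof -
    obtain R where R: "\<And>z v1 v2. 0 \<le> Im z \<Longrightarrow> R \<le> norm z \<Longrightarrow> V1.sol z (\<lambda>_. 1) (bg A B z) v1 v2 \<Longrightarrow>
     norm (v1 0 - 1) \<le> e / 2 \<and> norm (v2 0) \<le> e / 2" using col1_at_infinity[of "e / 2"] e by auto
    show ?thesis
      unfolding eventually_inf_principal eventually_at_infinity
    proof (intro exI[of _ R] allI impI)
      fix k assume k: "R \<le> norm k" "k \<in> upper_dom B"
      show "dist (al k) 1 < e \<and> dist (be k) 0 < e"
        using R[OF upper_domD(1)[OF k(2)] k(1) sol1[OF k(2) k(2) k(2)]] e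
        by (simp add: al_def be_def dist_norm)
    qed
  qed
  note ev = this
  show "(al \<longlongrightarrow> 1) (inf at_infinity (principal (upper_dom B)))"
    by (rule tendstoI, rule eventually_mono[OF ev], assumption, blast)
  show "(be \<longlongrightarrow> 0) (inf at_infinity (principal (upper_dom B)))"
    by (rule tendstoI, rule eventually_mono[OF ev], assumption, blast)
qed

lemma ga_de_at_infinity:
  "(ga \<longlongrightarrow> 0) (inf at_infinity (principal {k. Im k \<le> 0}))" "(de \<longlongrightarrow> 1) (inf at_infinity (principal {k. Im k \<le> 0}))"
proof -
  have "eventually (\<lambda>k. dist (ga k) 0 < e \<and> dist (de k) 1 < e) (inf at_infinity (principal {k. Im k \<le> 0}))" if e: "0 < e" for e
  proof -
    obtain R where R: "\<And>z u1 u2. 0 \<le> Im z \<Longrightarrow> R \<le> norm z \<Longrightarrow> V2.sol z (\<lambda>_. 0) (\<lambda>_. 1) u1 u2 \<Longrightarrow>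
     norm (u1 0) \<le> e / 2 \<and> norm (u2 0 - 1) \<le> e / 2" using col2_at_infinity[of "e / 2"] e by auto
    show ?thesis
      unfolding eventually_inf_principal eventually_at_infinity
    proof (intro exI[of _ R] allI impI)
      fix k assume k: "R \<le> norm k" "k \<in> {k. Im k \<le> 0}"
      show "dist (ga k) 0 < e \<and> dist (de k) 1 < e"
        using R[OF _ _ sol2[of k]] k e by (simp add: ga_def de_def dist_norm)
    qed
  qed
  note ev = this
  show "(ga \<longlongrightarrow> 0) (inf at_infinity (principal {k. Im k \<le> 0}))"
    by (rule tendstoI, rule eventually_mono[OF ev], assumption, blast)
  show "(de \<longlongrightarrow> 1) (inf at_infinity (principal {k. Im k \<le> 0}))"
    by (rule tendstoI, rule eventually_mono[OF ev], assumption, blast)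
qed

lemma a1_at_infinity: "(spec_a1 \<Psi>1 \<Psi>2 \<longlongrightarrow> 1) (inf at_infinity (principal (upper_dom B)))"
proof -
  have "((\<lambda>k. al k ^ 2 - be k ^ 2) \<longlongrightarrow> 1 ^ 2 - 0 ^ 2) (inf at_infinity (principal (upper_dom B)))"
    by (intro tendsto_intros al_be_at_infinity)
  then show ?thesis
    unfolding power_one power2_eq_square[of "0::complex"] mult_zero_left diff_zero
    by (rule Lim_transform_eventually)
       (simp add: eventually_inf_principal spec_a1_eq)
qed

lemma a2_at_infinity: "(spec_a2 \<Psi>1 \<Psi>2 \<longlongrightarrow> 1) (inf at_infinity (principal {k. Im k \<le> 0}))"
proof -
  have "((\<lambda>k. de k ^ 2 - ga k ^ 2) \<longlongrightarrow> 1 ^ 2 - 0 ^ 2) (inf at_infinity (principal {k. Im k \<le> 0}))"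
    by (intro tendsto_intros ga_de_at_infinity)
  then show ?thesis
    unfolding power_one power2_eq_square[of "0::complex"] mult_zero_left diff_zero
    by (rule Lim_transform_eventually)
       (simp add: eventually_inf_principal spec_a2_eq)
qed

end

section \<open>Logarithms and Cauchy integrals in the half-plane\<close>

abbreviation HP :: "complex set" where "HP \<equiv> {z. 0 \<le> Im z}"

abbreviation at_inf :: "complex set \<Rightarrow> complex filter" where
  "at_inf S \<equiv> inf at_infinity (principal S)"

lemma interior_HP: "interior HP = {z. 0 < Im z}"
  using interior_halfspace_ge[of \<i> 0] by simp

lemma at_inf_bound:
  assumes "(f \<longlongrightarrow> (0::complex)) (at_inf S)" "\<epsilon> > 0"
  obtains R where "R > 0" "\<And>z. z \<in> S \<Longrightarrow> R \<le> norm z \<Longrightarrow> norm (f z) < \<epsilon>"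
proof -
  have "eventually (\<lambda>z. norm (f z) < \<epsilon>) (at_inf S)"
    using tendstoD[OF assms] by simp
  then obtain R where "\<And>z. R \<le> norm z \<Longrightarrow> z \<in> S \<Longrightarrow> norm (f z) < \<epsilon>"
    by (auto simp: eventually_inf_principal eventually_at_infinity)
  then show ?thesis by (intro that[of "max R 1"]) auto
qed

text \<open>The segment from \<open>- R\<close> to \<open>R\<close> is closed by two straight sides
  with apex \<open>\<i> R\<close>. On them \<open>norm (w - k)\<close> is at least
  \<open>R / 4\<close> while each has length at most \<open>2 * R\<close>, so decay of
  \<open>l\<close> at any rate removes their contribution. The value of the closed integral is a
  hypothesis, so that \<open>k\<close> above and \<open>k\<close> below the line share the
  estimate.\<close>

lemma half_plane_line_integral:
  assumes lc: "continuous_on HP l" and l0: "(l \<longlongrightarrow> 0) (at_inf HP)" and k: "Im k \<noteq> 0"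
    and tri: "\<And>R. R > \<bar>Re k\<bar> + \<bar>Im k\<bar> \<Longrightarrow> ((\<lambda>w. l w / (w - k)) has_contour_integral C)
        (linepath (of_real (- R)) (of_real R) +++ linepath (of_real R) (\<i> * of_real R) +++ linepath (\<i> * of_real R) (of_real (- R)))"
  shows "((\<lambda>R. integral {- R..R} (\<lambda>x. l (of_real x) / (of_real x - k))) \<longlongrightarrow> C) at_top"
proof (rule tendstoI)
  let ?f = "\<lambda>w. l w / (w - k)"
  fix e :: real assume e: "e > 0"
  \<comment> \<open>Each slanted side contributes at most \<open>8 * \<eta>\<close>, hence
    \<open>16 * \<eta>\<close> in all; 17 makes the final inequality strict.\<close>
  define \<eta> where "\<eta> = e / 17"
  have eta: "\<eta> > 0" using e by (simp add: \<eta>_def)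
  obtain R0 where R0: "R0 > 0" "\<And>z. z \<in> HP \<Longrightarrow> R0 \<le> norm z \<Longrightarrow> norm (l z) < \<eta>" using at_inf_bound[OF l0 eta] by blast
  have "dist (integral {- R..R} (\<lambda>x. l (of_real x) / (of_real x - k))) C < e"
    if R: "R \<ge> 2 * R0 + 4 * norm k + \<bar>Re k\<bar> + \<bar>Im k\<bar> + 1" for R
  proof -
    have Rp: "R > 0" "R > \<bar>Re k\<bar> + \<bar>Im k\<bar>" using R R0(1) norm_ge_zero[of k] by linarith+
    let ?p1 = "linepath (complex_of_real (- R)) (complex_of_real R)" and ?p2 = "linepath (complex_of_real R) (\<i> * complex_of_real R)"
      and ?p3 = "linepath (\<i> * complex_of_real R) (complex_of_real (- R))"
    have h: "(?f has_contour_integral C) (?p1 +++ ?p2 +++ ?p3)" by (rule tri[OF Rp(2)])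
    have ci: "?f contour_integrable_on ?p1" "?f contour_integrable_on ?p2" "?f contour_integrable_on ?p3"
      using h[THEN has_contour_integral_integrable] by (simp_all add: contour_integrable_join)
    have C: "C = contour_integral ?p1 ?f + contour_integral ?p2 ?f + contour_integral ?p3 ?f"
      using h[THEN contour_integral_unique] ci by (simp add: contour_integrable_join add.assoc)
    have side: "norm (contour_integral (linepath a b) ?f) \<le> (\<eta> / (R / 4)) * norm (b - a)"
      if ab: "(a = complex_of_real R \<and> b = \<i> * complex_of_real R) \<or> (a = \<i> * complex_of_real R \<and> b = complex_of_real (- R))"
        and fi: "?f contour_integrable_on linepath a b" for a b
    proof (rule contour_integral_bound_linepath[OF fi])
      show "0 \<le> \<eta> / (R / 4)" using eta Rp by simp
      fix w assume "w \<in> closed_segment a b"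
      then obtain t where t: "0 \<le> t" "t \<le> 1" and w: "w = (1 - t) *\<^sub>R a + t *\<^sub>R b" by (auto simp: closed_segment_def)
      have w2: "Im w \<ge> 0 \<and> \<bar>Re w\<bar> + \<bar>Im w\<bar> \<ge> R"
        using ab t Rp(1) unfolding w
        by (elim disjE) (auto simp: abs_mult algebra_simps)
      have "\<bar>Re w\<bar> + \<bar>Im w\<bar> \<le> 2 * norm w" using abs_Re_le_cmod[of w] abs_Im_le_cmod[of w] by simp
      then have nw: "R / 2 \<le> norm w" using w2 by linarith
      have "norm w - norm k \<le> norm (w - k)" by (rule norm_triangle_ineq2)
      moreover have "norm k \<le> R / 4" using R R0(1) by simp
      ultimately have wk: "R / 4 \<le> norm (w - k)" using nw by linarith
      have "R0 \<le> norm w" using nw R R0(1) norm_ge_zero[of k] by linarith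
      then have "norm (l w) \<le> \<eta>" using R0(2)[of w] w2 by simp
      then show "norm (?f w) \<le> \<eta> / (R / 4)"
        unfolding norm_divide using wk Rp eta by (intro frac_le) auto
    qed
    have len: "norm (\<i> * complex_of_real R - complex_of_real R) \<le> 2 * R" "norm (complex_of_real (- R) - \<i> * complex_of_real R) \<le> 2 * R"
      using norm_triangle_ineq4[of "\<i> * complex_of_real R" "complex_of_real R"]
        norm_triangle_ineq4[of "complex_of_real (- R)" "\<i> * complex_of_real R"] Rp by (simp_all add: norm_mult)
    have "norm (contour_integral ?p2 ?f) \<le> (\<eta> / (R / 4)) * (2 * R)"
      using eta Rp by (intro order_trans[OF side[OF _ ci(2)]] mult_left_mono len) auto
    moreover have "norm (contour_integral ?p3 ?f) \<le> (\<eta> / (R / 4)) * (2 * R)"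
      using eta Rp by (intro order_trans[OF side[OF _ ci(3)]] mult_left_mono len) auto
    moreover have "(\<eta> / (R / 4)) * (2 * R) = 8 * \<eta>" using Rp by simp
    moreover have "contour_integral ?p1 ?f = integral {- R..R} (\<lambda>x. l (of_real x) / (of_real x - k))"
      using contour_integral_linepath_Reals_eq[of "of_real (- R)" "of_real R" ?f] Rp by simp
    moreover have "norm (u - (u + a + b)) \<le> norm a + norm b" for u a b :: complex
      using norm_triangle_ineq4[of "- a" b] by simp
    ultimately have "dist (integral {- R..R} (\<lambda>x. l (of_real x) / (of_real x - k))) C \<le> 16 * \<eta>"
      unfolding C dist_norm by (smt (verit))
    then show ?thesis using e by (simp add: \<eta>_def)
  qed
  then show "eventually (\<lambda>R. dist (integral {- R..R} (\<lambda>x. l (of_real x) / (of_real x - k))) C < e) at_top"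
    by (auto simp: eventually_at_top_linorder)
qed

lemma triangle_in_HP:
  assumes "R > 0"
  shows "path_image (linepath (of_real (- R)) (of_real R) +++ linepath (of_real R) (\<i> * of_real R) +++ linepath (\<i> * of_real R) (of_real (- R))) \<subseteq> HP"
proof -
  have c: "convex HP" by (rule convex_halfspace_Im_ge)
  have "closed_segment a b \<subseteq> HP" if "a \<in> HP" "b \<in> HP" for a b
    by (rule closed_segment_subset[OF that c])
  then show ?thesis using assms by (intro path_image_join_subset order_trans[OF path_image_join_subset] Un_least) auto
qed

lemma half_plane_lower:
  assumes lc: "continuous_on HP l" and lh: "l holomorphic_on {z. 0 < Im z}" and l0: "(l \<longlongrightarrow> 0) (at_inf HP)" and k: "Im k < 0"
  shows "((\<lambda>R. integral {- R..R} (\<lambda>x. l (of_real x) / (of_real x - k))) \<longlongrightarrow> 0) at_top"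
proof (rule half_plane_line_integral[OF lc l0])
  fix R assume R: "R > \<bar>Re k\<bar> + \<bar>Im k\<bar>"
  have nz: "w \<noteq> k" if "0 \<le> Im w" for w using that k by auto
  show "((\<lambda>w. l w / (w - k)) has_contour_integral 0)
        (linepath (of_real (- R)) (of_real R) +++ linepath (of_real R) (\<i> * of_real R) +++ linepath (\<i> * of_real R) (of_real (- R)))"
  proof (rule Cauchy_theorem_convex[where S = HP and K = "{}"])
    show "continuous_on HP (\<lambda>w. l w / (w - k))" using nz by (intro continuous_intros lc) auto
    show "(\<lambda>w. l w / (w - k)) field_differentiable at x" if "x \<in> interior HP - {}" for x
    proof -
      have x: "0 < Im x" using that by (simp add: interior_HP)
      have "open {z. 0 < Im z}" by (rule open_halfspace_Im_gt)
      then have "l field_differentiable at x" using lh x holomorphic_on_imp_differentiable_at by blast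
      then show ?thesis using nz[of x] x by (intro derivative_intros field_differentiable_divide) auto
    qed
    show "path_image (linepath (complex_of_real (- R)) (of_real R) +++ linepath (of_real R) (\<i> * of_real R) +++ linepath (\<i> * of_real R) (of_real (- R))) \<subseteq> HP"
      by (rule triangle_in_HP) (use R in linarith)
  qed (auto intro!: convex_halfspace_Im_ge)
qed (use k in auto)

lemma half_plane_upper:
  assumes lc: "continuous_on HP l" and lh: "l holomorphic_on {z. 0 < Im z}" and l0: "(l \<longlongrightarrow> 0) (at_inf HP)" and k: "0 < Im k"
  shows "((\<lambda>R. integral {- R..R} (\<lambda>x. l (of_real x) / (of_real x - k))) \<longlongrightarrow> 2 * of_real pi * \<i> * l k) at_top"
proof (rule half_plane_line_integral[OF lc l0])
  fix R assume R: "R > \<bar>Re k\<bar> + \<bar>Im k\<bar>"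
  then have Rp: "R > 0" by linarith
  let ?g = "linepath (complex_of_real (- R)) (of_real R) +++ linepath (of_real R) (\<i> * of_real R) +++ linepath (\<i> * of_real R) (of_real (- R))"
  have nc: "\<not> collinear {complex_of_real (- R), of_real R, \<i> * of_real R}"
  proof
    assume "collinear {complex_of_real (- R), of_real R, \<i> * of_real R}"
    then have "\<i> * of_real R \<in> affine hull {complex_of_real (- R), of_real R}"
      using collinear_3_imp_in_affine_hull[of "complex_of_real (- R)" "of_real R" "\<i> * of_real R"] Rp
      by (auto simp: complex_eq_iff)
    then obtain u v where "u + v = 1" "\<i> * of_real R = u *\<^sub>R complex_of_real (- R) + v *\<^sub>R complex_of_real R"
      by (auto simp: affine_hull_2)
    then show False using Rp by (simp add: complex_eq_iff)
  qed
  \<comment> \<open>Barycentric coordinates of \<open>k\<close>: the apex gets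
    \<open>Im k / R\<close>, and the rest is shared according to \<open>Re k\<close>. They are
    positive because \<open>R\<close> exceeds
    \<open>\<bar>Re k\<bar> + \<bar>Im k\<bar>\<close>.\<close>
  have int: "k \<in> interior (convex hull {complex_of_real (- R), of_real R, \<i> * of_real R})"
    unfolding interior_convex_hull_3_minimal[OF nc DIM_complex]
  proof (rule CollectI, intro exI conjI)
    have "(Im k + \<bar>Re k\<bar>) / R < 1" using R Rp k by simp
    moreover have "Re k / R \<le> \<bar>Re k\<bar> / R" "- Re k / R \<le> \<bar>Re k\<bar> / R" using Rp by (intro divide_right_mono; simp)+
    ultimately have "Im k / R + Re k / R < 1" "Im k / R - Re k / R < 1" by (simp_all add: add_divide_distrib)
    then show "0 < (1 - Im k / R - Re k / R) / 2" "0 < (1 - Im k / R + Re k / R) / 2" "0 < Im k / R"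
      using Rp k by auto
    show "((1 - Im k / R - Re k / R) / 2) *\<^sub>R complex_of_real (- R) + ((1 - Im k / R + Re k / R) / 2) *\<^sub>R complex_of_real R
      + (Im k / R) *\<^sub>R (\<i> * of_real R) = k"
      using Rp by (simp add: complex_eq_iff field_simps)
  qed (simp add: field_simps)
  have w: "winding_number ?g k = 1"
    unfolding winding_number_triangle[OF int] using Rp k by simp
  have "path_image ?g \<subseteq> HP - {k}"
  proof -
    have "k \<notin> path_image ?g"
    proof -
      have "k \<notin> frontier (convex hull {complex_of_real (- R), of_real R, \<i> * of_real R})" using int by (simp add: frontier_def)
      then show ?thesis by (auto simp: frontier_of_triangle path_image_join)
    qed
    then show ?thesis using triangle_in_HP[OF Rp] by blast
  qed
  note pim = this
  have "((\<lambda>w. l w / (w - k)) has_contour_integral (2 * pi * \<i> * winding_number ?g k * l k)) ?g"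
  proof (rule Cauchy_integral_formula_weak[where S = HP and k = "{}"])
    show "l field_differentiable at x" if "x \<in> interior HP - {}" for x
      using that by (auto simp: interior_HP intro!: holomorphic_on_imp_differentiable_at[OF lh open_halfspace_Im_gt])
  qed (use lc k pim in \<open>auto simp: interior_HP intro!: convex_halfspace_Im_ge\<close>)
  then show "((\<lambda>w. l w / (w - k)) has_contour_integral 2 * of_real pi * \<i> * l k) ?g" unfolding w by simp
qed (use k in auto)

text \<open>Contractibility of the half-plane gives a continuous logarithm, holomorphic inside
  because near \<open>z\<close> it is a constant plus the principal logarithm of
  \<open>f w / f z\<close>. Far out, its difference from \<open>Ln (f z)\<close> is continuous with
  values in a discrete set on a connected set, hence a constant, which is subtracted.\<close>

lemma half_plane_log:
  assumes fc: "continuous_on HP f" and fh: "f holomorphic_on {z. 0 < Im z}" and f1: "(f \<longlongrightarrow> 1) (at_inf HP)"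
    and nz: "\<And>z. 0 \<le> Im z \<Longrightarrow> f z \<noteq> 0"
  obtains l where "continuous_on HP l" "l holomorphic_on {z. 0 < Im z}" "(l \<longlongrightarrow> 0) (at_inf HP)" "\<And>z. 0 \<le> Im z \<Longrightarrow> exp (l z) = f z"
proof -
  have "contractible HP" by (rule convex_imp_contractible[OF convex_halfspace_Im_ge])
  then obtain g where gc: "continuous_on HP g" and g: "\<And>z. z \<in> HP \<Longrightarrow> f z = exp (g z)"
    using continuous_logarithm_on_contractible[OF fc] nz by auto
  have op: "open {z. 0 < Im z}" by (rule open_halfspace_Im_gt)
  have gh: "g holomorphic_on {z. 0 < Im z}"
    unfolding holomorphic_on_def
  proof
    fix z assume "z \<in> {z. 0 < Im z}"
    then have z: "0 < Im z" by simp
    have "isCont g z" using continuous_on_interior[OF gc] z by (simp add: interior_HP)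
    then obtain d where d: "d > 0" "\<And>w. dist w z < d \<Longrightarrow> dist (g w) (g z) < 1"
      unfolding continuous_at_eps_delta using zero_less_one by blast
    define S where "S = ball z d \<inter> {z. 0 < Im z}"
    have S: "open S" "z \<in> S" using d z op by (auto simp: S_def)
    have eq: "g z + Ln (f w / f z) = g w" if "w \<in> S" for w
    proof -
      have w: "dist (g w) (g z) < 1" "0 < Im w" using that d by (auto simp: S_def dist_commute)
      have "\<bar>Im (g w - g z)\<bar> < 1" using w(1) abs_Im_le_cmod[of "g w - g z"] by (simp add: dist_norm)
      then have "Ln (exp (g w - g z)) = g w - g z" using pi_gt3 by (intro Ln_exp) auto
      moreover have "exp (g w - g z) = f w / f z" using g[of w] g[of z] w z by (simp add: exp_diff)
      ultimately show ?thesis by simp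
    qed
    have "(\<lambda>w. g z + Ln (f w / f z)) field_differentiable at z"
    proof (intro field_differentiable_add field_differentiable_const)
      have "(\<lambda>w. f w / f z) field_differentiable at z"
        using holomorphic_on_imp_differentiable_at[OF fh op, of z] z nz[of z]
        by (intro field_differentiable_divide field_differentiable_const) auto
      moreover have "Ln field_differentiable at (f z / f z)"
        using nz[of z] z by (intro field_differentiable_at_Ln) auto
      ultimately show "(\<lambda>w. Ln (f w / f z)) field_differentiable at z"
        using field_differentiable_compose[of "\<lambda>w. f w / f z" z Ln] by (simp add: comp_def)
    qed
    then obtain D where "((\<lambda>w. g z + Ln (f w / f z)) has_field_derivative D) (at z)" by (auto simp: field_differentiable_def)
    then have "(g has_field_derivative D) (at z)"
      by (rule has_field_derivative_transform_within_open[OF _ S]) (use eq in auto)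
    then show "g field_differentiable at z within {z. 0 < Im z}"
      by (auto simp: field_differentiable_def intro: has_field_derivative_at_within)
  qed
  have "((\<lambda>z. f z - 1) \<longlongrightarrow> 0) (at_inf HP)" using f1 by (rule LIM_zero)
  then obtain R where R: "R > 0" "\<And>z. z \<in> HP \<Longrightarrow> R \<le> norm z \<Longrightarrow> norm (f z - 1) < 1 / 2"
    using at_inf_bound[of "\<lambda>z. f z - 1" HP "1/2"] by auto
  \<comment> \<open>The half-plane outside a disc, on which \<open>f\<close> avoids the branch cut.
    It is connected as the image of a product of intervals under polar coordinates.\<close>
  define S where "S = {z \<in> HP. R \<le> norm z}"
  have nr: "f z \<notin> \<real>\<^sub>\<le>\<^sub>0" if "z \<in> S" for z
  proof -
    have "norm (f z - 1) < 1 / 2" using R that by (auto simp: S_def)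
    then have "\<bar>Re (f z - 1)\<bar> < 1 / 2" using abs_Re_le_cmod[of "f z - 1"] by linarith
    then have "- (1 / 2) < Re (f z - 1)" by linarith
    then have "0 < Re (f z)" by simp
    then show ?thesis by (auto simp: complex_nonpos_Reals_iff)
  qed
  have conS: "connected S"
  proof -
    have "S = (\<lambda>(r, t). of_real r * cis t) ` ({R..} \<times> {0..pi})"
    proof (intro equalityI subsetI)
      fix z assume z: "z \<in> S"
      then have "0 \<le> Im z" "z \<noteq> 0" "R \<le> norm z" using R by (auto simp: S_def)
      then have "0 \<le> Arg z \<and> Arg z \<le> pi" using Arg_le_pi[of z] Arg_less_0[of z] by auto
      moreover have "z = of_real (norm z) * cis (Arg z)" using \<open>z \<noteq> 0\<close> by (simp add: Arg_eq cis_conv_exp)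
      ultimately show "z \<in> (\<lambda>(r, t). of_real r * cis t) ` ({R..} \<times> {0..pi})"
        using \<open>R \<le> norm z\<close> by (intro image_eqI[of _ _ "(norm z, Arg z)"]) auto
    next
      fix z assume "z \<in> (\<lambda>(r, t). of_real r * cis t) ` ({R..} \<times> {0..pi})"
      then obtain r t where "z = of_real r * cis t" "R \<le> r" "0 \<le> t" "t \<le> pi" by auto
      then show "z \<in> S" using R(1) by (auto simp: S_def norm_mult sin_ge_zero)
    qed
    moreover have "connected ((\<lambda>(r, t). complex_of_real r * cis t) ` ({R..} \<times> {0..pi}))"
      unfolding cis_conv_exp case_prod_unfold
      by (intro connected_continuous_image continuous_intros connected_Times) auto
    ultimately show ?thesis by simp
  qed
  have hc: "continuous_on S (\<lambda>z. g z - Ln (f z))"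
    using nr by (intro continuous_intros continuous_on_subset[OF gc] continuous_on_subset[OF fc]) (auto simp: S_def)
  have h: "\<exists>n::int. g z - Ln (f z) = of_int (2 * n) * of_real pi * \<i>" if "z \<in> S" for z
  proof -
    have "exp (g z - Ln (f z)) = 1" using g[of z] nz[of z] that by (auto simp: S_def exp_diff)
    then obtain n :: int where n: "Re (g z - Ln (f z)) = 0" "Im (g z - Ln (f z)) = of_int (2 * n) * pi"
      unfolding exp_eq_1 by blast
    have "g z - Ln (f z) = of_int (2 * n) * of_real pi * \<i>"
      by (rule complex_eqI) (use n in simp_all)
    then show ?thesis by blast
  qed
  have "(\<lambda>z. g z - Ln (f z)) constant_on S"
  proof (rule continuous_discrete_range_constant[OF conS hc])
    fix x assume x: "x \<in> S"
    show "\<exists>e>0. \<forall>y. y \<in> S \<and> g y - Ln (f y) \<noteq> g x - Ln (f x) \<longrightarrow> e \<le> norm (g y - Ln (f y) - (g x - Ln (f x)))"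
    proof (intro exI[of _ 1] conjI allI impI)
      fix y assume y: "y \<in> S \<and> g y - Ln (f y) \<noteq> g x - Ln (f x)"
      obtain m n :: int where mn: "g x - Ln (f x) = of_int (2 * m) * of_real pi * \<i>" "g y - Ln (f y) = of_int (2 * n) * of_real pi * \<i>"
        using h x y by blast
      then have "m \<noteq> n" using y by auto
      have "g y - Ln (f y) - (g x - Ln (f x)) = of_real (2 * pi * of_int (n - m)) * \<i>" unfolding mn by (simp add: algebra_simps)
      then have "norm (g y - Ln (f y) - (g x - Ln (f x))) = 2 * pi * \<bar>of_int (n - m)\<bar>"
        by (simp only: norm_mult norm_of_real norm_ii) (simp add: abs_mult)
      moreover have "1 \<le> \<bar>real_of_int (n - m)\<bar>" using \<open>m \<noteq> n\<close> by linarith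
      moreover have "2 * pi * 1 \<le> 2 * pi * \<bar>real_of_int (n - m)\<bar>" using calculation(2) by (intro mult_left_mono) auto
      ultimately show "1 \<le> norm (g y - Ln (f y) - (g x - Ln (f x)))" using pi_gt3 by linarith
    qed simp
  qed
  then obtain c where c: "\<And>z. z \<in> S \<Longrightarrow> g z - Ln (f z) = c" by (auto simp: constant_on_def)
  have "of_real R * \<i> \<in> S" using R by (simp add: S_def norm_mult)
  then obtain m :: int where "c = of_int (2 * m) * of_real pi * \<i>" using c h by metis
  then have expc: "exp c = 1" by (auto simp: exp_eq_1)
  show ?thesis
  proof (rule that[of "\<lambda>z. g z - c"])
    show "continuous_on HP (\<lambda>z. g z - c)" by (intro continuous_intros gc)
    show "(\<lambda>z. g z - c) holomorphic_on {z. 0 < Im z}" by (intro holomorphic_intros gh)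
    show "exp (g z - c) = f z" if "0 \<le> Im z" for z using g[of z] that expc by (simp add: exp_diff)
    have "((\<lambda>z. Ln (f z)) \<longlongrightarrow> Ln 1) (at_inf HP)" by (rule tendsto_Ln[OF f1]) auto
    then have "((\<lambda>z. Ln (f z)) \<longlongrightarrow> 0) (at_inf HP)" by simp
    then show "((\<lambda>z. g z - c) \<longlongrightarrow> 0) (at_inf HP)"
    proof (rule Lim_transform_eventually)
      show "eventually (\<lambda>z. Ln (f z) = g z - c) (at_inf HP)"
        unfolding eventually_inf_principal eventually_at_infinity
        by (rule exI[of _ R]) (use c in \<open>auto simp: S_def algebra_simps\<close>)
    qed
  qed
qed

section \<open>Principal values at a boundary point\<close>

lemma contour_integral_linepath_translate:
  "contour_integral (linepath (a + v) (b + v)) f = contour_integral (linepath a b) (\<lambda>w. f (w + v))"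
proof -
  have "linepath (a + v) (b + v) x = linepath a b x + v" for x by (simp add: linepath_def algebra_simps)
  then show ?thesis by (simp add: contour_integral_integral)
qed

text \<open>The substitution \<open>w = c + exp s\<close> turns \<open>dw / (w - c)\<close> into
  \<open>ds\<close> and the half-plane into the strip \<open>0 \<le> Im s \<le> pi\<close>. The two
  parts of the truncated integral become horizontal sides of a quadrilateral, to which Cauchy's
  theorem applies without indentation. The vertical side stands for the small semicircle and yields
  half of the residue.\<close>

lemma half_plane_pv:
  assumes lc: "continuous_on HP l" and lh: "l holomorphic_on {z. 0 < Im z}" and l0: "(l \<longlongrightarrow> 0) (at_inf HP)"
  obtains I where "\<And>R. R > \<bar>c\<bar> \<Longrightarrow> ((\<lambda>\<epsilon>. integral {- R..c - \<epsilon>} (\<lambda>x. l (of_real x) / of_real (x - c))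
      + integral {c + \<epsilon>..R} (\<lambda>x. l (of_real x) / of_real (x - c))) \<longlongrightarrow> I R) (at_right 0)"
    and "(I \<longlongrightarrow> \<i> * of_real pi * l (of_real c)) at_top"
proof -
  define f where "f x = l (complex_of_real x) / complex_of_real (x - c)" for x
  define G where "G s = l (of_real c + exp s)" for s
  define ST where "ST = {s. 0 \<le> Im s \<and> Im s \<le> pi}"
  have conv: "convex ST"
  proof -
    have "ST = {s. 0 \<le> Im s} \<inter> {s. Im s \<le> pi}" by (auto simp: ST_def)
    then show ?thesis by (simp add: convex_Int convex_halfspace_Im_ge convex_halfspace_Im_le)
  qed
  have inHP: "of_real c + exp s \<in> HP" if "s \<in> ST" for s
    using that by (auto simp: ST_def Im_exp intro!: mult_nonneg_nonneg sin_ge_zero)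
  have Gc: "continuous_on ST G"
    unfolding G_def by (rule continuous_on_compose2[OF lc]) (use inHP in \<open>auto intro!: continuous_intros\<close>)
  have Gd: "G field_differentiable at s" if "s \<in> interior ST - {}" for s
  proof -
    have "ST \<subseteq> {s. 0 \<le> Im s}" "ST \<subseteq> {s. Im s \<le> pi}" by (auto simp: ST_def)
    then have "interior ST \<subseteq> interior {s. 0 \<le> Im s}" "interior ST \<subseteq> interior {s. Im s \<le> pi}"
      by (auto dest: interior_mono)
    moreover have "interior {s. Im s \<le> pi} = {s. Im s < pi}" using interior_halfspace_le[of \<i> pi] by simp
    ultimately have s: "0 < Im s" "Im s < pi" using that interior_HP by auto
    then have "0 < Im (of_real c + exp s)" by (simp add: Im_exp sin_gt_zero)
    then have "l field_differentiable at (of_real c + exp s)"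
      using holomorphic_on_imp_differentiable_at[OF lh open_halfspace_Im_gt] by simp
    moreover have "(\<lambda>s. of_real c + exp s) field_differentiable at s"
      by (intro field_differentiable_add field_differentiable_const field_differentiable_within_exp)
    ultimately show ?thesis
      using field_differentiable_compose[of "\<lambda>s. of_real c + exp s" s l] by (simp add: comp_def G_def[abs_def])
  qed
  have seg: "closed_segment a b \<subseteq> ST" if "a \<in> ST" "b \<in> ST" for a b by (rule closed_segment_subset[OF that conv])
  have Gi: "G contour_integrable_on linepath a b" if "a \<in> ST" "b \<in> ST" for a b
    by (rule contour_integrable_continuous_linepath) (rule continuous_on_subset[OF Gc seg[OF that]])
  \<comment> \<open>The outer side is slanted because the ends \<open>R\<close> and
    \<open>- R\<close> have different distances \<open>R - c\<close> and \<open>R + c\<close> from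
    \<open>c\<close>.\<close>
  define J where "J R = contour_integral (linepath (of_real (ln (R - c))) (of_real (ln (R + c)) + \<i> * of_real pi)) G" for R
  define K where "K \<epsilon> = contour_integral (linepath (of_real (ln \<epsilon>)) (of_real (ln \<epsilon>) + \<i> * of_real pi)) G" for \<epsilon>
  have main: "integral {- R..c - \<epsilon>} f + integral {c + \<epsilon>..R} f = K \<epsilon> - J R"
    if R: "R > \<bar>c\<bar>" and e: "0 < \<epsilon>" "\<epsilon> < R - \<bar>c\<bar>" for R \<epsilon>
  proof -
    define a where "a = ln \<epsilon>"
    define b where "b = ln (R - c)"
    define b' where "b' = ln (R + c)"
    have ab: "a < b" "a < b'" using e R by (auto simp: a_def b_def b'_def)
    have ex: "exp a = \<epsilon>" "exp b = R - c" "exp b' = R + c" using e R by (auto simp: a_def b_def b'_def)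
    let ?a = "complex_of_real a" and ?b = "complex_of_real b" and ?d = "complex_of_real b' + \<i> * of_real pi" and ?e = "complex_of_real a + \<i> * of_real pi"
    have S: "?a \<in> ST" "?b \<in> ST" "?d \<in> ST" "?e \<in> ST" by (auto simp: ST_def)
    have pim: "path_image (linepath ?a ?b +++ linepath ?b ?d +++ linepath ?d ?e +++ linepath ?e ?a) \<subseteq> ST"
      by (intro path_image_join_subset[THEN order_trans] Un_least) (simp_all only: path_image_linepath seg S)
    have "(G has_contour_integral 0) (linepath ?a ?b +++ linepath ?b ?d +++ linepath ?d ?e +++ linepath ?e ?a)"
      by (rule Cauchy_theorem_convex[OF Gc conv finite.emptyI Gd _ pim]) auto
    note cu = contour_integral_unique[OF this]
    have zero: "contour_integral (linepath ?a ?b) G + contour_integral (linepath ?b ?d) G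
       + contour_integral (linepath ?d ?e) G + contour_integral (linepath ?e ?a) G = 0"
      using cu Gi[OF S(1,2)] Gi[OF S(2,3)] Gi[OF S(3,4)] Gi[OF S(4,1)]
      by (simp add: contour_integrable_join add.assoc)
    have fc: "continuous_on {x..y} f" if "c \<notin> {x..y}" for x y
      unfolding f_def using that
      by (intro continuous_intros continuous_on_compose2[OF lc]) auto
    have i1: "contour_integral (linepath ?a ?b) G = integral {c + \<epsilon>..R} f"
    proof -
      have "((\<lambda>\<sigma>. exp \<sigma> *\<^sub>R f (c + exp \<sigma>)) has_integral integral {c + exp a..c + exp b} f) {a..b}"
      proof (rule has_integral_substitution[where c = "c + \<epsilon>" and d = R])
        show "(\<lambda>x. c + exp x) ` {a..b} \<subseteq> {c + \<epsilon>..R}"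
        proof -
          have "\<epsilon> \<le> exp x \<and> exp x \<le> R - c" if "x \<in> {a..b}" for x
            using that ex(1,2) exp_le_cancel_iff[of a x] exp_le_cancel_iff[of x b] by auto
          then show ?thesis by fastforce
        qed
        show "continuous_on {c + \<epsilon>..R} f" by (rule fc) (use e in auto)
      qed (use ab in \<open>auto intro!: derivative_eq_intros\<close>)
      then have "integral {a..b} (\<lambda>\<sigma>. exp \<sigma> *\<^sub>R f (c + exp \<sigma>)) = integral {c + \<epsilon>..R} f"
        using ex by (simp add: integral_unique)
      moreover have "exp \<sigma> *\<^sub>R f (c + exp \<sigma>) = G (of_real \<sigma>)" for \<sigma>
        by (simp add: f_def G_def scaleR_conv_of_real exp_of_real)
      moreover have "contour_integral (linepath ?a ?b) G = integral {a..b} (\<lambda>\<sigma>. G (of_real \<sigma>))"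
        using contour_integral_linepath_Reals_eq[of ?a ?b G] ab by simp
      ultimately show ?thesis by simp
    qed
    have i2: "contour_integral (linepath ?e ?d) G = - integral {- R..c - \<epsilon>} f"
    proof -
      have hi: "((\<lambda>\<sigma>. (- exp \<sigma>) *\<^sub>R f (c - exp \<sigma>)) has_integral integral {c - exp a..c - exp b'} f - integral {c - exp b'..c - exp a} f) {a..b'}"
      proof (rule has_integral_substitution_general[where c = "- R" and d = "c - \<epsilon>" and s = "{}"])
        show "(\<lambda>x. c - exp x) ` {a..b'} \<subseteq> {- R..c - \<epsilon>}"
        proof -
          have "\<epsilon> \<le> exp x \<and> exp x \<le> R + c" if "x \<in> {a..b'}" for x
            using that ex(1,3) exp_le_cancel_iff[of a x] exp_le_cancel_iff[of x b'] by auto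
          then show ?thesis by fastforce
        qed
        show "continuous_on {- R..c - \<epsilon>} f" by (rule fc) (use e in auto)
      qed (use ab in \<open>auto intro!: derivative_eq_intros continuous_intros\<close>)
      have em: "{c - exp a..c - exp b'} = {}" "c - exp b' = - R" "c - exp a = c - \<epsilon>"
        using exp_less_cancel_iff[of a b'] ab ex by auto
      have "integral {a..b'} (\<lambda>\<sigma>. (- exp \<sigma>) *\<^sub>R f (c - exp \<sigma>)) = - integral {- R..c - \<epsilon>} f"
        unfolding integral_unique[OF hi] em(1) unfolding em(2,3) by simp
      moreover have "(- exp \<sigma>) *\<^sub>R f (c - exp \<sigma>) = G (of_real \<sigma> + \<i> * of_real pi)" for \<sigma>
        by (simp add: f_def G_def scaleR_conv_of_real exp_add exp_of_real)
      moreover have "contour_integral (linepath ?e ?d) G = integral {a..b'} (\<lambda>\<sigma>. G (of_real \<sigma> + \<i> * of_real pi))"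
        using contour_integral_linepath_Reals_eq[of ?a "of_real b'" "\<lambda>w. G (w + \<i> * of_real pi)"] ab
        by (simp add: contour_integral_linepath_translate)
      ultimately show ?thesis by (simp only:)
    qed
    have r: "contour_integral (linepath ?d ?e) G = - contour_integral (linepath ?e ?d) G"
      "contour_integral (linepath ?e ?a) G = - contour_integral (linepath ?a ?e) G"
      by (rule contour_integral_reverse_linepath, rule continuous_on_subset[OF Gc seg], fact S, fact S)+
    show ?thesis
      using zero unfolding i1 r i2 by (simp add: J_def K_def a_def b_def b'_def algebra_simps)
  qed
  have Klim: "(K \<longlongrightarrow> \<i> * of_real pi * l (of_real c)) (at_right 0)"
  proof (rule tendstoI)
    fix e :: real assume e: "e > 0"
    have e4: "0 < e / 4" using e by simp
    obtain d where d: "d > 0" "\<And>z. z \<in> HP \<Longrightarrow> dist z (of_real c) < d \<Longrightarrow> dist (l z) (l (of_real c)) < e / 4"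
      using lc[unfolded continuous_on_iff, rule_format, of "of_real c" "e / 4"] e4 by auto
    have "dist (K \<epsilon>) (\<i> * of_real pi * l (of_real c)) < e" if eps: "0 < \<epsilon>" "\<epsilon> < d" for \<epsilon>
    proof -
      let ?a = "complex_of_real (ln \<epsilon>)"
      let ?e = "?a + \<i> * of_real pi"
      have S: "?a \<in> ST" "?e \<in> ST" by (auto simp: ST_def)
      have "((\<lambda>w. G w - l (of_real c)) has_contour_integral (K \<epsilon> - l (of_real c) * (?e - ?a))) (linepath ?a ?e)"
        unfolding K_def
        by (intro has_contour_integral_diff has_contour_integral_integral Gi S has_contour_integral_const_linepath)
      moreover have "norm (G w - l (of_real c)) \<le> e / 4" if wseg: "w \<in> closed_segment ?a ?e" for w
      proof -
        have w: "w \<in> ST" using seg[OF S] wseg by blast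
        obtain t where "w = (1 - t) *\<^sub>R ?a + t *\<^sub>R ?e" using wseg unfolding closed_segment_def by blast
        then have "Re w = ln \<epsilon>" by (simp add: algebra_simps)
        then have "norm (exp w) = \<epsilon>" using eps by simp
        then show ?thesis using d(2)[OF inHP[OF w]] eps by (simp add: G_def dist_norm less_imp_le)
      qed
      ultimately have "norm (K \<epsilon> - l (of_real c) * (?e - ?a)) \<le> e / 4 * norm (?e - ?a)"
        using e by (intro has_contour_integral_bound_linepath) auto
      also have "norm (?e - ?a) = pi" by (simp add: norm_mult)
      also have "e / 4 * pi < e" using e pi_less_4 by simp
      finally show ?thesis by (simp add: dist_norm mult_ac)
    qed
    then show "eventually (\<lambda>\<epsilon>. dist (K \<epsilon>) (\<i> * of_real pi * l (of_real c)) < e) (at_right 0)"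
      unfolding eventually_at_right_field using d(1) by (intro exI[of _ d]) auto
  qed
  have Jlim: "(J \<longlongrightarrow> 0) at_top"
  proof (rule tendstoI)
    fix e :: real assume e: "e > 0"
    obtain R0 where R0: "R0 > 0" "\<And>z. z \<in> HP \<Longrightarrow> R0 \<le> norm z \<Longrightarrow> norm (l z) < e / 10"
      using at_inf_bound[OF l0, of "e / 10"] e by auto
    have "dist (J R) 0 < e" if R: "R \<ge> R0 + 2 * \<bar>c\<bar> + 1" for R
    proof -
      have Rc: "0 < R - \<bar>c\<bar>" using R R0(1) by linarith
      let ?b = "complex_of_real (ln (R - c))" and ?d = "complex_of_real (ln (R + c)) + \<i> * of_real pi"
      have S: "?b \<in> ST" "?d \<in> ST" by (auto simp: ST_def)
      have lnge: "ln (R - \<bar>c\<bar>) \<le> ln (R - c)" "ln (R - \<bar>c\<bar>) \<le> ln (R + c)" using Rc by auto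
      \<comment> \<open>For these \<open>R\<close> the two distances differ by a factor of at most
        3, so the outer side has bounded length and the decay of \<open>l\<close> suffices.\<close>
      have "ln (R - c) \<le> ln (3 * (R - \<bar>c\<bar>))" "ln (R + c) \<le> ln (3 * (R - \<bar>c\<bar>))" using Rc R R0(1) by auto
      moreover have "ln (3 * (R - \<bar>c\<bar>)) \<le> 2 + ln (R - \<bar>c\<bar>)"
      proof -
        have "ln (3 * (R - \<bar>c\<bar>)) = ln 3 + ln (R - \<bar>c\<bar>)" by (rule ln_mult_pos) (simp, fact Rc)
        then show ?thesis using ln_le_minus_one[of "3::real"] by linarith
      qed
      ultimately have "\<bar>ln (R + c) - ln (R - c)\<bar> \<le> 2" using lnge by linarith
      moreover have "norm (?d - ?b) \<le> \<bar>ln (R + c) - ln (R - c)\<bar> + pi"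
        using norm_triangle_ineq[of "complex_of_real (ln (R + c) - ln (R - c))" "\<i> * of_real pi"]
        unfolding norm_of_real by (simp add: norm_mult algebra_simps)
      ultimately have len: "norm (?d - ?b) \<le> 6" using pi_less_4 by linarith
      have "norm (contour_integral (linepath ?b ?d) G) \<le> e / 10 * norm (?d - ?b)"
      proof (rule contour_integral_bound_linepath[OF Gi[OF S]])
        fix w assume wseg: "w \<in> closed_segment ?b ?d"
        then have w: "w \<in> ST" using seg[OF S] by blast
        obtain t where t: "0 \<le> t" "t \<le> 1" "w = (1 - t) *\<^sub>R ?b + t *\<^sub>R ?d" using wseg unfolding closed_segment_def by blast
        have "(1 - t) * ln (R - \<bar>c\<bar>) + t * ln (R - \<bar>c\<bar>) \<le> (1 - t) * ln (R - c) + t * ln (R + c)"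
          using t lnge by (intro add_mono mult_left_mono) auto
        moreover have "Re w = (1 - t) * ln (R - c) + t * ln (R + c)" unfolding t(3) by simp
        moreover have "(1 - t) * x + t * x = x" for x :: real by (simp add: algebra_simps)
        ultimately have "ln (R - \<bar>c\<bar>) \<le> Re w" by simp
        then have "exp (ln (R - \<bar>c\<bar>)) \<le> exp (Re w)" by (simp only: exp_le_cancel_iff)
        then have "R - \<bar>c\<bar> \<le> exp (Re w)" unfolding exp_ln[OF Rc] .
        then have "R - \<bar>c\<bar> \<le> norm (exp w)" by simp
        moreover have "norm (exp w) - norm (complex_of_real c) \<le> norm (of_real c + exp w)"
          by (metis add.commute norm_diff_ineq)
        ultimately have "R0 \<le> norm (of_real c + exp w)" using R by (simp add: norm_of_real)
        then show "norm (G w) \<le> e / 10" using R0(2)[OF inHP[OF w]] by (simp add: G_def less_imp_le)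
      qed (use e in simp)
      also have "\<dots> \<le> e / 10 * 6" using len e by (intro mult_left_mono) auto
      finally show ?thesis using e by (simp add: J_def)
    qed
    then show "eventually (\<lambda>R. dist (J R) 0 < e) at_top" by (auto simp: eventually_at_top_linorder)
  qed
  show ?thesis
  proof (rule that[of "\<lambda>R. \<i> * of_real pi * l (of_real c) - J R"])
    fix R assume R: "R > \<bar>c\<bar>"
    have "((\<lambda>\<epsilon>. K \<epsilon> - J R) \<longlongrightarrow> \<i> * of_real pi * l (of_real c) - J R) (at_right 0)"
      by (intro tendsto_diff Klim tendsto_const)
    then have "((\<lambda>\<epsilon>. integral {- R..c - \<epsilon>} f + integral {c + \<epsilon>..R} f) \<longlongrightarrow> \<i> * of_real pi * l (of_real c) - J R) (at_right 0)"
    proof (rule Lim_transform_eventually)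
      show "eventually (\<lambda>\<epsilon>. K \<epsilon> - J R = integral {- R..c - \<epsilon>} f + integral {c + \<epsilon>..R} f) (at_right 0)"
        unfolding eventually_at_right_field using R main[OF R] by (intro exI[of _ "R - \<bar>c\<bar>"]) auto
    qed
    then show "((\<lambda>\<epsilon>. integral {- R..c - \<epsilon>} (\<lambda>x. l (of_real x) / of_real (x - c))
      + integral {c + \<epsilon>..R} (\<lambda>x. l (of_real x) / of_real (x - c))) \<longlongrightarrow> \<i> * of_real pi * l (of_real c) - J R) (at_right 0)"
      by (simp add: f_def[abs_def])
  next
    show "((\<lambda>R. \<i> * of_real pi * l (of_real c) - J R) \<longlongrightarrow> \<i> * of_real pi * l (of_real c)) at_top"
      using tendsto_diff[OF tendsto_const Jlim, of "\<i> * of_real pi * l (of_real c)"] by simp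
  qed
qed

section \<open>Recovery from boundary values and division by zeros\<close>

text \<open>Two candidates differ by a continuous function whose exponential is 1 off two points,
  hence everywhere by density. Its values are discrete, so it is constant, and it vanishes at
  infinity.\<close>

lemma log_branch_eqI:
  assumes L: "continuous_on UNIV L"
    and eL: "\<And>\<zeta>. \<zeta> \<noteq> B \<Longrightarrow> \<zeta> \<noteq> - B \<Longrightarrow>
           exp (L \<zeta>) = of_real (((\<zeta>^2 - B^2) / (\<zeta>^2 + 1))^2) * (1 - (b (of_real \<zeta>))^2)"
    and lim: "(L \<longlongrightarrow> 0) at_infinity"
  shows "log_branch B b = L"
  unfolding log_branch_def
proof (rule the_equality)
  show "continuous_on UNIV L \<and>
        (\<forall>\<zeta>. \<zeta> \<noteq> B \<and> \<zeta> \<noteq> - B \<longrightarrow>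
           exp (L \<zeta>) = of_real (((\<zeta>^2 - B^2) / (\<zeta>^2 + 1))^2) * (1 - (b (of_real \<zeta>))^2)) \<and>
        (L \<longlongrightarrow> 0) at_infinity" using L eL lim by blast
  fix L' assume L': "continuous_on UNIV L' \<and>
        (\<forall>\<zeta>. \<zeta> \<noteq> B \<and> \<zeta> \<noteq> - B \<longrightarrow>
           exp (L' \<zeta>) = of_real (((\<zeta>^2 - B^2) / (\<zeta>^2 + 1))^2) * (1 - (b (of_real \<zeta>))^2)) \<and>
        (L' \<longlongrightarrow> 0) at_infinity"
  define D where "D \<zeta> = L' \<zeta> - L \<zeta>" for \<zeta>
  have Dc: "continuous_on UNIV D" unfolding D_def using L L' by (intro continuous_intros) auto
  have Dl: "(D \<longlongrightarrow> 0) at_infinity" unfolding D_def using tendsto_diff[of L' 0 at_infinity L 0] L' lim by simp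
  have e1: "exp (D \<zeta>) = 1" if "\<zeta> \<in> UNIV - {B, - B}" for \<zeta>
  proof -
    have "exp (L' \<zeta>) = exp (L \<zeta>)" using L' eL[of \<zeta>] that by simp
    then show ?thesis by (simp add: D_def exp_diff)
  qed
  have e: "exp (D \<zeta>) = 1" for \<zeta>
  proof (rule continuous_constant_on_closure[where S = "UNIV - {B, - B}" and f = "\<lambda>\<zeta>. exp (D \<zeta>)" and a = 1])
    have cl: "closure (UNIV - {B, - B}) = (UNIV :: real set)" by (simp add: closure_complement empty_interior_finite flip: Compl_eq_Diff_UNIV)
    show "continuous_on (closure (UNIV - {B, - B})) (\<lambda>\<zeta>. exp (D \<zeta>))" unfolding cl by (intro continuous_intros Dc)
    show "\<zeta> \<in> closure (UNIV - {B, - B})" unfolding cl by simp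
  qed (use e1 in auto)
  have h: "\<exists>n::int. D \<zeta> = of_int (2 * n) * of_real pi * \<i>" for \<zeta>
  proof -
    obtain n :: int where n: "Re (D \<zeta>) = 0" "Im (D \<zeta>) = of_int (2 * n) * pi"
      using e[of \<zeta>] unfolding exp_eq_1 by blast
    have "D \<zeta> = of_int (2 * n) * of_real pi * \<i>" by (rule complex_eqI) (use n in simp_all)
    then show ?thesis by blast
  qed
  have "D constant_on UNIV"
  proof (rule continuous_discrete_range_constant[OF connected_UNIV Dc])
    fix x
    show "\<exists>e>0. \<forall>y. y \<in> UNIV \<and> D y \<noteq> D x \<longrightarrow> e \<le> norm (D y - D x)"
    proof (intro exI[of _ 1] conjI allI impI)
      fix y assume y: "y \<in> UNIV \<and> D y \<noteq> D x"
      obtain m n :: int where mn: "D x = of_int (2 * m) * of_real pi * \<i>" "D y = of_int (2 * n) * of_real pi * \<i>"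
        using h by blast
      then have "m \<noteq> n" using y by auto
      have "D y - D x = of_real (2 * pi * of_int (n - m)) * \<i>" unfolding mn by (simp add: algebra_simps)
      then have "norm (D y - D x) = 2 * pi * \<bar>of_int (n - m)\<bar>"
        by (simp only: norm_mult norm_of_real norm_ii) (simp add: abs_mult)
      moreover have "1 \<le> \<bar>real_of_int (n - m)\<bar>" using \<open>m \<noteq> n\<close> by linarith
      moreover have "2 * pi * 1 \<le> 2 * pi * \<bar>real_of_int (n - m)\<bar>" using calculation(2) by (intro mult_left_mono) auto
      ultimately show "1 \<le> norm (D y - D x)" using pi_gt3 by linarith
    qed simp
  qed
  then obtain c where c: "\<And>x. D x = c" by (auto simp: constant_on_def)
  then have "D = (\<lambda>_. c)" by auto
  then have "c = 0" using Dl tendsto_unique[OF _ Dl, of c] trivial_limit_at_infinity[where 'a=real] by (simp add: tendsto_const)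
  then show "L' = L" using c by (auto simp: D_def fun_eq_iff)
qed

lemma at_inf_of_real: "filterlim complex_of_real (at_inf HP) at_infinity"
  unfolding filterlim_inf filterlim_principal
  using filterlim_norm_at_top[where 'a = real, unfolded real_norm_def[abs_def]] by (auto simp: filterlim_at_infinity_conv_norm_at_top)

text \<open>On the line the logarithm is \<open>l1 x + l2 (- x)\<close>; the first summand continues
  to the upper, the second to the lower half-plane. The Cauchy integral selects \<open>l1 k\<close>
  above and \<open>- l2 (- k)\<close> below, the other summand integrating to 0. At \<open>B\<close>
  each summand contributes half of a residue, with opposite signs, which gives the quotient.\<close>

lemma phi_formulas:
  assumes B: "0 < B"
    and f: "continuous_on HP f" "f holomorphic_on {z. 0 < Im z}" "(f \<longlongrightarrow> 1) (at_inf HP)" "\<And>z. 0 \<le> Im z \<Longrightarrow> f z \<noteq> 0"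
    and g: "continuous_on HP g" "g holomorphic_on {z. 0 < Im z}" "(g \<longlongrightarrow> 1) (at_inf HP)" "\<And>z. 0 \<le> Im z \<Longrightarrow> g z \<noteq> 0"
    and rel: "\<And>\<zeta>::real. \<zeta> \<noteq> B \<Longrightarrow> \<zeta> \<noteq> - B \<Longrightarrow>
       f (of_real \<zeta>) * g (- of_real \<zeta>) = of_real (((\<zeta>^2 - B^2) / (\<zeta>^2 + 1))^2) * (1 - (b (of_real \<zeta>))^2)"
  shows "0 < Im k \<Longrightarrow> exp (phi B b k) = f k"
    and "Im k < 0 \<Longrightarrow> exp (- phi B b k) = g (- k)"
    and "exp (phi_1 B b) = f (of_real B) / g (- of_real B)"
proof -
  obtain l1 where l1: "continuous_on HP l1" "l1 holomorphic_on {z. 0 < Im z}" "(l1 \<longlongrightarrow> 0) (at_inf HP)" "\<And>z. 0 \<le> Im z \<Longrightarrow> exp (l1 z) = f z"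
    using half_plane_log[OF f] by blast
  obtain l2 where l2: "continuous_on HP l2" "l2 holomorphic_on {z. 0 < Im z}" "(l2 \<longlongrightarrow> 0) (at_inf HP)" "\<And>z. 0 \<le> Im z \<Longrightarrow> exp (l2 z) = g z"
    using half_plane_log[OF g] by blast
  define L where "L x = l1 (complex_of_real x) + l2 (- complex_of_real x)" for x
  have c1: "continuous_on S (\<lambda>x. l1 (complex_of_real x))" for S by (rule continuous_on_compose2[OF l1(1)]) (auto intro!: continuous_intros)
  have c2: "continuous_on S (\<lambda>x. l2 (- complex_of_real x))" for S by (rule continuous_on_compose2[OF l2(1)]) (auto intro!: continuous_intros)
  have c3: "continuous_on S (\<lambda>x. l2 (complex_of_real x))" for S by (rule continuous_on_compose2[OF l2(1)]) (auto intro!: continuous_intros)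
  have lb: "log_branch B b = L"
  proof (rule log_branch_eqI)
    show "continuous_on UNIV L" unfolding L_def by (intro continuous_intros c1 c2)
    show "exp (L \<zeta>) = of_real (((\<zeta>^2 - B^2) / (\<zeta>^2 + 1))^2) * (1 - (b (of_real \<zeta>))^2)" if "\<zeta> \<noteq> B" "\<zeta> \<noteq> - B" for \<zeta>
      using rel[OF that] l1(4)[of "of_real \<zeta>"] l2(4)[of "- of_real \<zeta>"] by (simp add: L_def exp_add)
    have "((\<lambda>x. l1 (complex_of_real x)) \<longlongrightarrow> 0) at_infinity" by (rule filterlim_compose[OF l1(3) at_inf_of_real])
    moreover have um: "filterlim (\<lambda>x::real. - x) at_infinity at_infinity"
      using filterlim_norm_at_top[where 'a = real, unfolded real_norm_def[abs_def]] by (simp add: filterlim_at_infinity_conv_norm_at_top)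
    moreover have "((\<lambda>x. l2 (complex_of_real (- x))) \<longlongrightarrow> 0) at_infinity"
      by (rule filterlim_compose[OF filterlim_compose[OF l2(3) at_inf_of_real] um])
    ultimately show "(L \<longlongrightarrow> 0) at_infinity" unfolding L_def
      using tendsto_add[of "\<lambda>x. l1 (complex_of_real x)" 0 at_infinity "\<lambda>x. l2 (complex_of_real (- x))" 0] by simp
  qed
  have phi_lim: "((\<lambda>R. integral {- R..R} (\<lambda>x. L x / (of_real x - k))) \<longlongrightarrow> C1 - C2) at_top"
    if k: "Im k \<noteq> 0" and 1: "((\<lambda>R. integral {- R..R} (\<lambda>x. l1 (of_real x) / (of_real x - k))) \<longlongrightarrow> C1) at_top"
      and 2: "((\<lambda>R. integral {- R..R} (\<lambda>x. l2 (of_real x) / (of_real x - (- k)))) \<longlongrightarrow> C2) at_top" for k C1 C2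
  proof -
    have nz: "complex_of_real x - k \<noteq> 0" "complex_of_real x + k \<noteq> 0" for x using k by (auto simp: complex_eq_iff)
    have "integral {- R..R} (\<lambda>x. L x / (of_real x - k)) = integral {- R..R} (\<lambda>x. l1 (of_real x) / (of_real x - k))
       - integral {- R..R} (\<lambda>x. l2 (of_real x) / (of_real x - (- k)))" for R
    proof -
      have i1: "(\<lambda>x. l1 (of_real x) / (of_real x - k)) integrable_on {- R..R}"
        by (intro integrable_continuous_real continuous_intros c1) (use nz in auto)
      have i2: "(\<lambda>x. l2 (- of_real x) / (of_real x - k)) integrable_on {- R..R}"
        by (intro integrable_continuous_real continuous_intros c2) (use nz in auto)
      have "integral {- R..R} (\<lambda>x. L x / (of_real x - k)) = integral {- R..R} (\<lambda>x. l1 (of_real x) / (of_real x - k))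
         + integral {- R..R} (\<lambda>x. l2 (- of_real x) / (of_real x - k))"
        unfolding L_def add_divide_distrib by (rule integral_add[OF i1 i2])
      also have "integral {- R..R} (\<lambda>x. l2 (- of_real x) / (of_real x - k))
         = integral {- R..R} (\<lambda>x. - (l2 (of_real x) / (of_real x - (- k))))"
      proof -
        have "l2 (- of_real x) / (of_real x - k) = - (l2 (of_real (- x)) / (of_real (- x) - (- k)))" for x
        proof -
          have "of_real (- x) - (- k) = - (of_real x - k)" by simp
          then show ?thesis by (simp only: divide_minus_right minus_minus of_real_minus)
        qed
        then have "integral {- R..R} (\<lambda>x. l2 (- of_real x) / (of_real x - k))
            = integral {- R..R} (\<lambda>x. - (l2 (of_real (- x)) / (of_real (- x) - (- k))))" by (simp only:)
        then show ?thesis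
          using Henstock_Kurzweil_Integration.integral_reflect_real[of R "- R" "\<lambda>x. - (l2 (of_real x) / (of_real x - (- k)))"]
          by (simp only: minus_minus)
      qed
      finally show ?thesis by (simp only: integral_neg diff_conv_add_uminus)
    qed
    then show ?thesis using tendsto_diff[OF 1 2] by simp
  qed
  show "exp (phi B b k) = f k" if k: "0 < Im k"
  proof -
    have "((\<lambda>R. integral {- R..R} (\<lambda>x. L x / (of_real x - k))) \<longlongrightarrow> 2 * of_real pi * \<i> * l1 k - 0) at_top"
      using k by (intro phi_lim half_plane_upper half_plane_lower l1 l2) auto
    then have "line_integral (\<lambda>x. L x / (of_real x - k)) = 2 * of_real pi * \<i> * l1 k"
      unfolding line_integral_def by (intro tendsto_Lim) auto
    then have "phi B b k = l1 k" by (simp add: phi_def lb)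
    then show ?thesis using l1(4) k by simp
  qed
  show "exp (- phi B b k) = g (- k)" if k: "Im k < 0"
  proof -
    have "((\<lambda>R. integral {- R..R} (\<lambda>x. L x / (of_real x - k))) \<longlongrightarrow> 0 - 2 * of_real pi * \<i> * l2 (- k)) at_top"
      using k by (intro phi_lim half_plane_upper half_plane_lower l1 l2) auto
    then have "line_integral (\<lambda>x. L x / (of_real x - k)) = - (2 * of_real pi * \<i> * l2 (- k))"
      unfolding line_integral_def by (intro tendsto_Lim) auto
    then have "phi B b k = - l2 (- k)" by (simp add: phi_def lb)
    then show ?thesis using l2(4) k by simp
  qed
  show "exp (phi_1 B b) = f (of_real B) / g (- of_real B)"
  proof -
    obtain I1 where I1: "\<And>R. R > \<bar>B\<bar> \<Longrightarrow> ((\<lambda>\<epsilon>. integral {- R..B - \<epsilon>} (\<lambda>x. l1 (of_real x) / of_real (x - B))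
      + integral {B + \<epsilon>..R} (\<lambda>x. l1 (of_real x) / of_real (x - B))) \<longlongrightarrow> I1 R) (at_right 0)"
      and I1l: "(I1 \<longlongrightarrow> \<i> * of_real pi * l1 (of_real B)) at_top"
      using half_plane_pv[OF l1(1-3), of B] by blast
    obtain I2 where I2: "\<And>R. R > \<bar>- B\<bar> \<Longrightarrow> ((\<lambda>\<epsilon>. integral {- R..- B - \<epsilon>} (\<lambda>x. l2 (of_real x) / of_real (x - (- B)))
      + integral {- B + \<epsilon>..R} (\<lambda>x. l2 (of_real x) / of_real (x - (- B)))) \<longlongrightarrow> I2 R) (at_right 0)"
      and I2l: "(I2 \<longlongrightarrow> \<i> * of_real pi * l2 (of_real (- B))) at_top"
      using half_plane_pv[OF l2(1-3), of "- B"] by blast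
    let ?F = "\<lambda>x. L x / of_real (x - B)"
    \<comment> \<open>Reflection carries \<open>l2 (- x) / (x - B)\<close> to
      \<open>- l2 x / (x + B)\<close> and the gap around \<open>B\<close> to a gap around
      \<open>- B\<close>, so that the statement on principal values applies to \<open>l2\<close> at
      \<open>- B\<close>.\<close>
    have dec: "integral {x..y} ?F = integral {x..y} (\<lambda>x. l1 (of_real x) / of_real (x - B))
        - integral {- y..- x} (\<lambda>x. l2 (of_real x) / of_real (x - (- B)))" if "B \<notin> {x..y}" for x y
    proof -
      have i1: "(\<lambda>x. l1 (of_real x) / of_real (x - B)) integrable_on {x..y}"
        by (intro integrable_continuous_real continuous_intros c1) (use that in auto)
      have i2: "(\<lambda>x. l2 (- of_real x) / of_real (x - B)) integrable_on {x..y}"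
        by (intro integrable_continuous_real continuous_intros c2) (use that in auto)
      have "integral {x..y} ?F = integral {x..y} (\<lambda>x. l1 (of_real x) / of_real (x - B))
         + integral {x..y} (\<lambda>x. l2 (- of_real x) / of_real (x - B))"
        unfolding L_def add_divide_distrib by (rule integral_add[OF i1 i2])
      also have "integral {x..y} (\<lambda>x. l2 (- of_real x) / of_real (x - B))
         = integral {- y..- x} (\<lambda>x. - (l2 (of_real x) / of_real (x - (- B))))"
      proof -
        have "l2 (- of_real x) / of_real (x - B) = - (l2 (of_real (- x)) / of_real (- x - (- B)))" for x
        proof -
          have "complex_of_real (- x - (- B)) = - of_real (x - B)" by simp
          then show ?thesis by (simp only: divide_minus_right minus_minus of_real_minus)
        qed
        then have "integral {x..y} (\<lambda>x. l2 (- of_real x) / of_real (x - B))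
            = integral {x..y} (\<lambda>x. - (l2 (of_real (- x)) / of_real (- x - (- B))))" by (simp only:)
        then show ?thesis
          using Henstock_Kurzweil_Integration.integral_reflect_real[of "- x" "- y" "\<lambda>x. - (l2 (of_real x) / of_real (x - (- B)))"]
          by (simp only: minus_minus)
      qed
      finally show ?thesis by (simp only: integral_neg diff_conv_add_uminus)
    qed
    have S: "((\<lambda>\<epsilon>. integral {- R..B - \<epsilon>} ?F + integral {B + \<epsilon>..R} ?F) \<longlongrightarrow> I1 R - I2 R) (at_right 0)" if R: "R > B" for R
    proof (rule Lim_transform_eventually[OF tendsto_diff[OF I1 I2]])
      show "R > \<bar>B\<bar>" "R > \<bar>- B\<bar>" using R B by auto
      have "integral {- R..B - \<epsilon>} (\<lambda>x. l1 (of_real x) / of_real (x - B)) + integral {B + \<epsilon>..R} (\<lambda>x. l1 (of_real x) / of_real (x - B)) -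
          (integral {- R..- B - \<epsilon>} (\<lambda>x. l2 (of_real x) / of_real (x - (- B))) + integral {- B + \<epsilon>..R} (\<lambda>x. l2 (of_real x) / of_real (x - (- B))))
         = integral {- R..B - \<epsilon>} ?F + integral {B + \<epsilon>..R} ?F" if "0 < \<epsilon>" for \<epsilon>
      proof -
        have m: "- (B - \<epsilon>) = - B + \<epsilon>" "- (B + \<epsilon>) = - B - \<epsilon>" "- (- R) = R" by simp_all
        have gen: "p1 + p2 - (q2 + q1) = x1 + x2" if "x1 = p1 - q1" "x2 = p2 - q2" for x1 x2 p1 p2 q1 q2 :: complex
          using that by simp
        show ?thesis
          by (rule gen[OF dec[of "- R" "B - \<epsilon>", unfolded m] dec[of "B + \<epsilon>" R, unfolded m]]) (use that in auto)
      qed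
      then show "eventually (\<lambda>\<epsilon>. integral {- R..B - \<epsilon>} (\<lambda>x. l1 (of_real x) / of_real (x - B)) + integral {B + \<epsilon>..R} (\<lambda>x. l1 (of_real x) / of_real (x - B)) -
          (integral {- R..- B - \<epsilon>} (\<lambda>x. l2 (of_real x) / of_real (x - (- B))) + integral {- B + \<epsilon>..R} (\<lambda>x. l2 (of_real x) / of_real (x - (- B))))
         = integral {- R..B - \<epsilon>} ?F + integral {B + \<epsilon>..R} ?F) (at_right 0)"
        unfolding eventually_at_right_field by (intro exI[of _ 1]) auto
    qed
    have "Lim (at_right 0) (\<lambda>\<epsilon>. integral {- R..B - \<epsilon>} ?F + integral {B + \<epsilon>..R} ?F) = I1 R - I2 R" if "R > B" for R
      by (rule tendsto_Lim[OF _ S[OF that]]) simp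
    then have ev: "eventually (\<lambda>R. I1 R - I2 R = Lim (at_right 0) (\<lambda>\<epsilon>. integral {- R..B - \<epsilon>} ?F + integral {B + \<epsilon>..R} ?F)) at_top"
      unfolding eventually_at_top_dense by (intro exI[of _ B]) auto
    have "pv_integral B ?F = \<i> * of_real pi * l1 (of_real B) - \<i> * of_real pi * l2 (of_real (- B))"
      unfolding pv_integral_def
      by (rule tendsto_Lim[OF _ Lim_transform_eventually[OF tendsto_diff[OF I1l I2l] ev]]) simp
    then have "phi_1 B b = l1 (of_real B) - l2 (- of_real B)"
      by (simp add: phi_1_def lb field_simps)
    then show ?thesis using l1(4)[of "of_real B"] l2(4)[of "- of_real B"] by (simp add: exp_diff)
  qed
qed

section \<open>Division of a holomorphic function by its zeros\<close>

lemma zero_quotient: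
  assumes F: "F holomorphic_on S" and S: "open S" "connected S" and z: "z \<in> S" and nc: "\<exists>w\<in>S. F w \<noteq> 0"
    and ord: "zorder F z = int n"
  obtains g where "g holomorphic_on S" "\<And>w. w \<in> S \<Longrightarrow> F w = (w - z)^n * g w" "g z \<noteq> 0"
proof -
  obtain r where r: "r > 0" "cball z r \<subseteq> S" "zor_poly F z holomorphic_on cball z r"
    "\<And>w. w \<in> cball z r \<Longrightarrow> F w = zor_poly F z w * (w - z)^n \<and> zor_poly F z w \<noteq> 0"
    using zorder_exist_zero[OF F S z nc] ord by auto
  \<comment> \<open>Near \<open>z\<close> the local factor \<open>zor_poly\<close>, elsewhere the
    plain quotient; the two agree wherever both apply.\<close>
  define g where "g w = (if w \<in> ball z r then zor_poly F z w else F w / (w - z)^n)" for w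
  have eq: "F w = (w - z)^n * g w" if "w \<in> S" for w
    using r(4)[of w] r(1) by (auto simp: g_def mult.commute)
  have "zor_poly F z holomorphic_on ball z r" by (rule holomorphic_on_subset[OF r(3)]) auto
  then have h1: "g holomorphic_on ball z r" by (rule holomorphic_transform) (simp add: g_def)
  have "(\<lambda>w. F w / (w - z)^n) holomorphic_on S - {z}"
    by (intro holomorphic_intros holomorphic_on_subset[OF F]) auto
  then have h2: "g holomorphic_on S - {z}"
    by (rule holomorphic_transform) (use eq in \<open>auto simp: field_simps\<close>)
  have "ball z r \<union> (S - {z}) = S" using r(1,2) z by auto
  then have "g holomorphic_on S"
    using holomorphic_on_Un[OF h1 h2] S(1) by (simp add: open_delete)
  moreover have "g z \<noteq> 0" using r(1) r(4)[of z] by (simp add: g_def)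
  ultimately show ?thesis using that eq by blast
qed

text \<open>Admitting \<open>p = q\<close> lets two simple zeros and one double zero share the rest
  of the argument.\<close>

lemma two_zeros_quotient:
  assumes F: "F holomorphic_on S" and S: "open S" "connected S" and nc: "\<exists>w\<in>S. F w \<noteq> 0"
    and zs: "{w \<in> S. F w = 0} = {p, q}"
    and ord: "if p = q then zorder F p = 2 else zorder F p = 1 \<and> zorder F q = 1"
  obtains h where "h holomorphic_on S" "\<And>w. w \<in> S \<Longrightarrow> F w = (w - p) * (w - q) * h w" "\<And>w. w \<in> S \<Longrightarrow> h w \<noteq> 0"
proof (cases "p = q")
  case True
  have p: "p \<in> S" using zs by auto
  obtain g where g: "g holomorphic_on S" "\<And>w. w \<in> S \<Longrightarrow> F w = (w - p)^2 * g w" "g p \<noteq> 0"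
    using zero_quotient[OF F S p nc, of 2] ord True by auto
  have "g w \<noteq> 0" if "w \<in> S" for w
    using g zs that True by (cases "w = p") auto
  then show ?thesis using that[of g] g True by (auto simp: power2_eq_square)
next
  case False
  have pq: "p \<in> S" "q \<in> S" using zs by auto
  obtain g1 where g1: "g1 holomorphic_on S" "\<And>w. w \<in> S \<Longrightarrow> F w = (w - p) * g1 w" "g1 p \<noteq> 0"
    using zero_quotient[OF F S pq(1) nc, of 1] ord False by auto
  obtain g2 where g2: "g2 holomorphic_on S" "\<And>w. w \<in> S \<Longrightarrow> F w = (w - q) * g2 w" "g2 q \<noteq> 0"
    using zero_quotient[OF F S pq(2) nc, of 1] ord False by auto
  \<comment> \<open>partial fractions of \<open>1 / ((w - p) * (w - q))\<close>\<close>
  define h where "h w = (g1 w - g2 w) / (p - q)" for w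
  have "h holomorphic_on S" unfolding h_def using False by (intro holomorphic_intros g1 g2) auto
  moreover have Fh: "F w = (w - p) * (w - q) * h w" if w: "w \<in> S" for w
  proof -
    have "(w - p) * (w - q) * (g1 w - g2 w) = (w - q) * ((w - p) * g1 w) - (w - p) * ((w - q) * g2 w)"
      by (simp add: algebra_simps)
    also have "\<dots> = (w - q) * F w - (w - p) * F w" by (simp only: g1(2)[OF w, symmetric] g2(2)[OF w, symmetric])
    also have "\<dots> = (p - q) * F w" by (simp add: algebra_simps)
    finally show ?thesis using False by (simp add: h_def)
  qed
  moreover have "h w \<noteq> 0" if w: "w \<in> S" for w
  proof -
    have "F p = 0" "F q = 0" using zs by blast+
    then have z: "g2 p = 0" "g1 q = 0" using g2(2)[OF pq(1)] g1(2)[OF pq(2)] False by simp_all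
    consider "w = p" | "w = q" | "F w \<noteq> 0" using zs w by blast
    then show ?thesis
    proof cases
      case 1
      then show ?thesis using z g1(3) False by (simp add: h_def)
    next
      case 2
      then show ?thesis using z g2(3) False by (simp add: h_def)
    next
      case 3
      then show ?thesis using Fh[OF w] by auto
    qed
  qed
  ultimately show ?thesis using that by blast
qed

section \<open>Factorization and the location of the zeros\<close>

lemma resonance_factor_nonzero:
  assumes "k \<in> upper_dom B"
  shows "(k^2 - (of_real B)^2)^2 \<noteq> 0"
proof -
  have "k \<noteq> of_real B" "k \<noteq> - of_real B" using assms by (auto simp: upper_dom_def)
  then have "k^2 \<noteq> (of_real B)^2" by (simp add: power2_eq_iff)
  then show ?thesis by simp
qed

lemma tendsto_shift_ratio:
  fixes a b :: complex
  shows "((\<lambda>k. (k - a) / (k - b)) \<longlongrightarrow> 1) at_infinity"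
proof -
  have "filterlim (\<lambda>k. - b + k) at_infinity at_infinity"
    by (rule tendsto_add_filterlim_at_infinity[OF tendsto_const filterlim_ident])
  then have "((\<lambda>k. (b - a) / (- b + k)) \<longlongrightarrow> 0) at_infinity" by (rule tendsto_divide_0[OF tendsto_const])
  then have l: "((\<lambda>k. 1 + (b - a) / (- b + k)) \<longlongrightarrow> 1) at_infinity"
    using tendsto_add[OF tendsto_const, of "\<lambda>k. (b - a) / (- b + k)" 0 at_infinity 1] by simp
  have eq: "1 + (b - a) / (- b + k) = (k - a) / (k - b)" if "k \<noteq> b" for k
    using that by (simp add: field_simps)
  show ?thesis
    by (rule Lim_transform_eventually[OF l eventually_mono[OF eventually_not_equal_at_infinity eq]])
qed

lemma filterlim_uminus_at_inf: "filterlim uminus (at_inf {k. Im k \<le> 0}) (at_inf HP)"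
proof -
  have "filterlim (\<lambda>k::complex. - k) at_infinity at_infinity"
    using filterlim_norm_at_top[where 'a = complex]
    by (simp add: filterlim_at_infinity_conv_norm_at_top)
  then have "filterlim uminus at_infinity (at_inf HP)"
    by (rule filterlim_mono) auto
  moreover have "eventually (\<lambda>k. - k \<in> {k. Im k \<le> 0}) (at_inf HP)"
    unfolding eventually_inf_principal by simp
  ultimately show ?thesis unfolding filterlim_inf filterlim_principal by simp
qed

context scattering
begin

lemma spec_a1_holomorphic: "spec_a1 \<Psi>1 \<Psi>2 holomorphic_on {k. 0 < Im k}"
proof (rule holomorphic_transform)
  have ud: "k \<in> upper_dom B" if "0 < Im k" for k using that by (auto simp: upper_dom_def)
  show "(\<lambda>k. a1_reg k / (k^2 - (of_real B)^2)^2) holomorphic_on {k. 0 < Im k}"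
    by (intro holomorphic_intros a1_reg_holomorphic) (use ud resonance_factor_nonzero in blast)
  show "a1_reg k / (k^2 - (of_real B)^2)^2 = spec_a1 \<Psi>1 \<Psi>2 k" if "k \<in> {k. 0 < Im k}" for k
    using a1_reg_eq[OF ud] resonance_factor_nonzero[OF ud] that by simp
qed

text \<open>The factors \<open>(k - p) (k - q)\<close> are divided out of \<open>a1\<close> and
  multiplied into \<open>a2\<close>, so that they cancel in \<open>f \<zeta> * g (- \<zeta>)\<close>
  on the line. The factors \<open>(k + \<i>)\<^sup>2\<close> restore the limit 1 at infinity without
  zeros or poles in the closed upper half-plane, and are the origin of
  \<open>\<zeta>\<^sup>2 + 1\<close> under the logarithm.\<close>

lemma factorization:
  assumes pq: "0 < Im p" "0 < Im q"
    and zs: "{k \<in> upper_dom B. spec_a1 \<Psi>1 \<Psi>2 k = 0} = {p, q}"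
    and ord: "if p = q then zorder (spec_a1 \<Psi>1 \<Psi>2) p = 2
              else zorder (spec_a1 \<Psi>1 \<Psi>2) p = 1 \<and> zorder (spec_a1 \<Psi>1 \<Psi>2) q = 1"
    and a2: "\<And>k. Im k \<le> 0 \<Longrightarrow> spec_a2 \<Psi>1 \<Psi>2 k \<noteq> 0"
  shows "0 < Im k \<Longrightarrow> spec_a1 \<Psi>1 \<Psi>2 k
           = (k - p) * (k - q) * (k + \<i>)^2 / (k^2 - (of_real B)^2)^2 * exp (phi B (spec_b \<Psi>1 \<Psi>2) k)"
    and "Im k < 0 \<Longrightarrow> spec_a2 \<Psi>1 \<Psi>2 k = (k - \<i>)^2 / ((k - p) * (k - q)) * exp (- phi B (spec_b \<Psi>1 \<Psi>2) k)"
    and "exp (phi_1 B (spec_b \<Psi>1 \<Psi>2))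
           = of_real (A^2 * B^2 / 4) * (of_real B - \<i>)^2 / ((of_real B + \<i>)^2 * ((of_real B - p) * (of_real B - q))^2)"
proof -
  let ?a1 = "spec_a1 \<Psi>1 \<Psi>2" and ?a2 = "spec_a2 \<Psi>1 \<Psi>2" and ?b = "spec_b \<Psi>1 \<Psi>2"
  let ?U = "{k. 0 < Im k}"
  have ud: "k \<in> upper_dom B" if "0 < Im k" for k using that by (auto simp: upper_dom_def)
  have U: "open ?U" "connected ?U"
    by (auto simp: open_halfspace_Im_gt convex_halfspace_Im_gt intro: convex_connected)
  have zU: "{k \<in> ?U. ?a1 k = 0} = {p, q}" using zs pq ud by blast
  have nc: "\<exists>k\<in>?U. ?a1 k \<noteq> 0"
  proof -
    have "\<i> * of_real (Im p + Im q) \<in> ?U" "\<i> * of_real (Im p + Im q) \<notin> {p, q}"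
      using pq by (auto simp: complex_eq_iff)
    then show ?thesis using zU by blast
  qed
  obtain h where h: "h holomorphic_on ?U" "\<And>w. w \<in> ?U \<Longrightarrow> ?a1 w = (w - p) * (w - q) * h w" "\<And>w. w \<in> ?U \<Longrightarrow> h w \<noteq> 0"
    using two_zeros_quotient[OF spec_a1_holomorphic U nc zU ord] by blast
  have i0: "k + \<i> \<noteq> 0" if "0 \<le> Im k" for k using that by (auto simp: complex_eq_iff)
  have p0: "k + p \<noteq> 0" "k + q \<noteq> 0" if "0 \<le> Im k" for k using that pq by (auto simp: complex_eq_iff)
  \<comment> \<open>Two formulas for one function: through \<open>h\<close> it is regular at
    \<open>p\<close> and \<open>q\<close>, through \<open>a1_reg\<close> on the real line including
    the resonances.\<close>
  define f where "f k = (if 0 < Im k then (k^2 - (of_real B)^2)^2 * h k / (k + \<i>)^2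
      else a1_reg k / ((k - p) * (k - q) * (k + \<i>)^2))" for k
  define g where "g k = ?a2 (- k) * ((k + p) * (k + q)) / (k + \<i>)^2" for k
  have feq: "f k = a1_reg k / ((k - p) * (k - q) * (k + \<i>)^2)" if "k \<in> HP - {p, q}" for k
  proof (cases "0 < Im k")
    case True
    have "a1_reg k = (k - p) * (k - q) * ((k^2 - (of_real B)^2)^2 * h k)"
      using a1_reg_eq[OF ud[OF True]] h(2)[of k] True by simp
    then show ?thesis using that True by (simp add: f_def)
  qed (simp add: f_def)
  have f2: "f holomorphic_on ?U"
  proof (rule holomorphic_transform)
    show "(\<lambda>k. (k^2 - (of_real B)^2)^2 * h k / (k + \<i>)^2) holomorphic_on ?U"
      by (intro holomorphic_intros h(1)) (use i0 in auto)
  qed (simp add: f_def)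
  have f1: "continuous_on HP f"
  proof -
    have "continuous_on (HP - {p, q}) (\<lambda>k. a1_reg k / ((k - p) * (k - q) * (k + \<i>)^2))"
      by (intro continuous_intros continuous_on_subset[OF a1_reg_continuous]) (use i0 in auto)
    then have c2: "continuous_on (HP - {p, q}) f" by (rule continuous_on_eq) (simp add: feq)
    have e: "HP = ?U \<union> (HP - {p, q})" using pq by auto
    have "openin (top_of_set HP) ?U" by (rule open_subset) (use U in auto)
    moreover have "openin (top_of_set HP) (HP - {p, q})"
      by (auto simp: openin_open intro!: exI[of _ "- {p, q}"] finite_imp_closed)
    ultimately have "continuous_on (?U \<union> (HP - {p, q})) f"
      using e by (intro continuous_on_Un_local_open holomorphic_on_imp_continuous_on[OF f2] c2) simp_all
    then show ?thesis using e by simp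
  qed
  have evne: "eventually (\<lambda>k. k \<noteq> c) (at_inf HP)" for c
    by (rule filter_leD[OF inf_le1 eventually_not_equal_at_infinity])
  have evud: "eventually (\<lambda>k. k \<in> upper_dom B) (at_inf HP)"
    using evne[of "of_real B"] evne[of "- of_real B"]
    unfolding eventually_inf_principal by eventually_elim (auto simp: upper_dom_def)
  have ratio: "((\<lambda>k. (k - a) / (k - b)) \<longlongrightarrow> 1) (at_inf HP)" for a b
    by (rule tendsto_mono[OF inf_le1 tendsto_shift_ratio])
  have f3: "(f \<longlongrightarrow> 1) (at_inf HP)"
  proof -
    have "(?a1 \<longlongrightarrow> 1) (at_inf HP)"
      by (rule tendsto_mono[OF _ a1_at_infinity]) (use evud in \<open>simp add: le_principal\<close>)
    then have "((\<lambda>k. ?a1 k * ((k - of_real B) / (k - p) * ((k - of_real B) / (k - q))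
        * ((k - - of_real B) / (k - - \<i>) * ((k - - of_real B) / (k - - \<i>))))) \<longlongrightarrow> 1 * (1 * 1 * (1 * 1))) (at_inf HP)"
      by (intro tendsto_mult ratio)
    then have l: "((\<lambda>k. ?a1 k * ((k - of_real B) / (k - p) * ((k - of_real B) / (k - q))
        * ((k - - of_real B) / (k - - \<i>) * ((k - - of_real B) / (k - - \<i>))))) \<longlongrightarrow> 1) (at_inf HP)" by simp
    have ev: "eventually (\<lambda>k. ?a1 k * ((k - of_real B) / (k - p) * ((k - of_real B) / (k - q))
        * ((k - - of_real B) / (k - - \<i>) * ((k - - of_real B) / (k - - \<i>)))) = f k) (at_inf HP)"
      using evud evne[of p] evne[of q]
    proof eventually_elim
      case (elim k)
      have "k \<in> HP - {p, q}" using elim by (auto simp: upper_dom_def)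
      note fk = feq[OF this, unfolded a1_reg_eq[OF elim(1)]]
      have "a * ((k - B') / x * ((k - B') / y) * ((k - - B') / (k - - i) * ((k - - B') / (k - - i))))
          = (k^2 - B'^2)^2 * a / (x * y * (k + i)^2)" for a B' x y i :: complex
        by (simp add: power2_eq_square square_diff_square_factored)
      then show ?case unfolding fk .
    qed
    show ?thesis by (rule Lim_transform_eventually[OF l ev])
  qed
  have f4: "f k \<noteq> 0" if "0 \<le> Im k" for k
  proof (cases "0 < Im k")
    case True
    then show ?thesis using h(3)[of k] resonance_factor_nonzero[OF ud[OF True]] i0[OF that] by (simp add: f_def)
  next
    case False
    then have k: "Im k = 0" "k \<in> HP - {p, q}" using that pq by auto
    have "a1_reg k \<noteq> 0"
    proof (cases "k \<in> upper_dom B")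
      case True
      then have "?a1 k \<noteq> 0" using zs k by blast
      then show ?thesis using a1_reg_eq[OF True] resonance_factor_nonzero[OF True] by simp
    next
      case False
      \<comment> \<open>At the resonances the hypothesis on the zeros of \<open>a1\<close> says
        nothing; there the value is a positive multiple of that of \<open>a2\<close>, which does not
        vanish.\<close>
      then have "k = of_real B \<or> k = - of_real B" using k by (auto simp: upper_dom_def)
      then show ?thesis using a1_reg_resonant[of k] a2[of k] k Apos Bpos by auto
    qed
    then show ?thesis using feq[OF k(2)] k i0[OF that] by simp
  qed
  have g1: "continuous_on HP g" unfolding g_def
    by (intro continuous_intros continuous_on_compose2[OF a2_continuous]) (use i0 in auto)
  have g2: "g holomorphic_on ?U" unfolding g_def
  proof (intro holomorphic_intros)
    have "(?a2 \<circ> uminus) holomorphic_on ?U"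
      by (rule holomorphic_on_compose_gen[OF _ a2_holomorphic]) (auto intro: holomorphic_intros)
    then show "(\<lambda>k. ?a2 (- k)) holomorphic_on ?U" by (simp add: comp_def)
  qed (use i0 in auto)
  have g3: "(g \<longlongrightarrow> 1) (at_inf HP)"
  proof -
    have "((\<lambda>k. ?a2 (- k) * ((k - - p) / (k - - \<i>) * ((k - - q) / (k - - \<i>)))) \<longlongrightarrow> 1 * (1 * 1)) (at_inf HP)"
      by (intro tendsto_mult ratio filterlim_compose[OF a2_at_infinity filterlim_uminus_at_inf])
    moreover have "?a2 (- k) * ((k - - p) / (k - - \<i>) * ((k - - q) / (k - - \<i>))) = g k" for k
      by (simp add: g_def power2_eq_square)
    ultimately show ?thesis by simp
  qed
  have g4: "g k \<noteq> 0" if "0 \<le> Im k" for k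
    using a2[of "- k"] that p0[OF that] i0[OF that] by (simp add: g_def)
  have rel: "f (of_real \<zeta>) * g (- of_real \<zeta>) = of_real (((\<zeta>^2 - B^2) / (\<zeta>^2 + 1))^2) * (1 - (?b (of_real \<zeta>))^2)"
    if z: "\<zeta> \<noteq> B" "\<zeta> \<noteq> - B" for \<zeta> :: real
  proof -
    let ?z = "complex_of_real \<zeta>"
    have zud: "?z \<in> upper_dom B" using z unfolding upper_dom_def
      by (auto simp del: of_real_minus simp add: of_real_minus[symmetric])
    have hp: "?z \<in> HP - {p, q}" using pq by auto
    have nz: "?z - p \<noteq> 0" "?z - q \<noteq> 0" using hp by auto
    have conj: "- ?z + \<i> = - (?z - \<i>)" "- ?z + p = - (?z - p)" "- ?z + q = - (?z - q)" by simp_all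
    have "f ?z * g (- ?z) = ((?z^2 - (of_real B)^2)^2 * ?a1 ?z) / ((?z - p) * (?z - q) * (?z + \<i>)^2)
        * (?a2 ?z * ((?z - p) * (?z - q)) / (?z - \<i>)^2)"
      unfolding feq[OF hp] a1_reg_eq[OF zud] g_def conj by (simp only: minus_minus minus_mult_minus power2_minus)
    also have "\<dots> = (?z^2 - (of_real B)^2)^2 / ((?z + \<i>) * (?z - \<i>))^2 * (?a1 ?z * ?a2 ?z)"
    proof -
      have "d * a / (x * y * u^2) * (a' * (x * y) / v^2) = d / (u * v)^2 * (a * a')" if "x \<noteq> 0" "y \<noteq> 0"
        for d a x y u a' v :: complex using that by (simp add: power_mult_distrib)
      from this[OF nz] show ?thesis .
    qed
    also have "?a1 ?z * ?a2 ?z = 1 - (?b ?z)^2" using scattering_relation[OF zud] by simp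
    also have "(?z + \<i>) * (?z - \<i>) = ?z^2 + 1" by (simp add: power2_eq_square algebra_simps)
    also have "(?z^2 - (of_real B)^2)^2 / (?z^2 + 1)^2 = of_real (((\<zeta>^2 - B^2) / (\<zeta>^2 + 1))^2)"
      by (simp add: power_divide)
    finally show ?thesis .
  qed
  have pf: "\<And>k. 0 < Im k \<Longrightarrow> exp (phi B ?b k) = f k" "\<And>k. Im k < 0 \<Longrightarrow> exp (- phi B ?b k) = g (- k)"
    "exp (phi_1 B ?b) = f (of_real B) / g (- of_real B)"
    by (rule phi_formulas[OF Bpos f1 f2 f3 f4 g1 g2 g3 g4 rel]; assumption)+
  show "?a1 k = (k - p) * (k - q) * (k + \<i>)^2 / (k^2 - (of_real B)^2)^2 * exp (phi B ?b k)" if k: "0 < Im k"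
  proof -
    have "exp (phi B ?b k) = (k^2 - (of_real B)^2)^2 * h k / (k + \<i>)^2"
      using pf(1)[OF k] k by (simp add: f_def)
    then show ?thesis using h(2)[of k] k resonance_factor_nonzero[OF ud[OF k]] i0[of k] by simp
  qed
  show "?a2 k = (k - \<i>)^2 / ((k - p) * (k - q)) * exp (- phi B ?b k)" if k: "Im k < 0"
  proof -
    have conj: "- k + \<i> = - (k - \<i>)" "- k + p = - (k - p)" "- k + q = - (k - q)" by simp_all
    have "exp (- phi B ?b k) = ?a2 k * ((k - p) * (k - q)) / (k - \<i>)^2"
      unfolding pf(2)[OF k] g_def conj by (simp only: minus_minus minus_mult_minus power2_minus)
    moreover have "k - p \<noteq> 0" "k - q \<noteq> 0" "k - \<i> \<noteq> 0" using k pq by (auto simp: complex_eq_iff)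
    ultimately show ?thesis by simp
  qed
  show "exp (phi_1 B ?b)
      = of_real (A^2 * B^2 / 4) * (of_real B - \<i>)^2 / ((of_real B + \<i>)^2 * ((of_real B - p) * (of_real B - q))^2)"
  proof -
    let ?B = "complex_of_real B"
    have hp: "?B \<in> HP - {p, q}" using pq by auto
    have conj: "- ?B + \<i> = - (?B - \<i>)" "- ?B + p = - (?B - p)" "- ?B + q = - (?B - q)" by simp_all
    \<comment> \<open>The unknown value of \<open>a2\<close> at \<open>B\<close> now occurs in both
      \<open>f\<close> and \<open>g\<close> and cancels, leaving an equation for \<open>p\<close>
      and \<open>q\<close> alone.\<close>
    have aB: "a1_reg ?B = of_real (A^2 * B^2 / 4) * ?a2 ?B" using a1_reg_resonant by blast
    have "f ?B / g (- ?B) = of_real (A^2 * B^2 / 4) * ?a2 ?B / ((?B - p) * (?B - q) * (?B + \<i>)^2)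
        / (?a2 ?B * ((?B - p) * (?B - q)) / (?B - \<i>)^2)"
      unfolding feq[OF hp] g_def conj aB by (simp only: minus_minus minus_mult_minus power2_minus)
    also have "\<dots> = of_real (A^2 * B^2 / 4) * (?B - \<i>)^2 / ((?B + \<i>)^2 * ((?B - p) * (?B - q))^2)"
    proof -
      have "r * a / (x * y * u^2) / (a * (x * y) / v^2) = r * v^2 / (u^2 * (x * y)^2)" if "a \<noteq> 0"
        for r a x y u v :: complex using that by (simp add: power2_eq_square)
      moreover have "?a2 ?B \<noteq> 0" using a2 by simp
      ultimately show ?thesis .
    qed
    finally show ?thesis using pf(3) by simp
  qed
qed

end

text \<open>Here \<open>Q\<close> is \<open>(B - p) (B - q)\<close> with
  \<open>p + q = 2 \<i> m\<close> and \<open>p q = - n\<close>. Since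
  \<open>(B + \<i>)\<^sup>4 / (B\<^sup>2 + 1)\<^sup>2\<close> is the square of
  \<open>(B + \<i>) / (B - \<i>)\<close>, the angle \<phi>2 is set up so that
  \<open>Q\<^sup>2\<close> has phase \<open>- \<phi>2\<close>. The formulas for \<open>d1\<close>
  and \<open>d2\<close> are the imaginary and real parts of \<open>Q\<close> rewritten by half-angle
  identities.\<close>

lemma parameters_of_zeros:
  fixes A B m n :: real and \<phi>1 :: complex and \<phi>2 d1 d2 :: real
  assumes pos: "0 < A" "0 < B" "0 < m"
    and e1: "exp \<phi>1 = of_real (A^2 * B^2 / 4) * (of_real B - \<i>)^2
              / ((of_real B + \<i>)^2 * (of_real (B^2 - n) - \<i> * of_real (2 * m * B))^2)"
    and e2: "exp (\<i> * of_real \<phi>2) = (of_real B + \<i>)^4 / (of_real (B^2 + 1))^2 * exp (\<i> * of_real (Im \<phi>1))"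
    and range: "0 \<le> \<phi>2" "\<phi>2 < 2 * pi"
    and d1: "d1 = A / 8 * sqrt (2 * (1 - cos \<phi>2)) * exp (- Re (\<phi>1 / 2))"
    and d2: "\<phi>2 \<noteq> 0 \<Longrightarrow> d2 = d1^2 - B^2
               + sqrt 2 * A * B * exp (- Re (\<phi>1 / 2)) / (4 * sqrt (1 - cos \<phi>2)) * sin \<phi>2"
  shows "\<phi>2 \<noteq> 0" and "d1 = m" and "d2 = m^2 - n"
proof -
  define \<rho> where "\<rho> = exp (- Re (\<phi>1 / 2))"
  define s where "s = sin (\<phi>2 / 2)"
  define c where "c = cos (\<phi>2 / 2)"
  define Q where "Q = complex_of_real (B^2 - n) - \<i> * of_real (2 * m * B)"
  \<comment> \<open>The square root with modulus \<open>A B exp (- Re \<phi>1 / 2) / 2\<close> and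
    phase \<open>- \<phi>2 / 2\<close>.\<close>
  define W where "W = of_real (A * B / 2 * \<rho>) * (of_real c - \<i> * of_real s)"
  have \<rho>: "0 < \<rho>" by (simp add: \<rho>_def)
  have Q0: "Q \<noteq> 0" using pos by (auto simp: Q_def complex_eq_iff)
  have B0: "of_real B + \<i> \<noteq> 0" "of_real B - \<i> \<noteq> 0" by (auto simp: complex_eq_iff)
  have BB: "complex_of_real (B^2 + 1) = (of_real B + \<i>) * (of_real B - \<i>)"
    by (simp add: power2_eq_square algebra_simps)
  have "Q^2 = W^2"
  proof -
    have "exp (\<i> * of_real \<phi>2) * exp (of_real (Re \<phi>1))
        = (of_real B + \<i>)^4 / (of_real (B^2 + 1))^2 * (exp (of_real (Re \<phi>1)) * exp (\<i> * of_real (Im \<phi>1)))"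
      unfolding e2 by simp
    also have "exp (of_real (Re \<phi>1)) * exp (\<i> * of_real (Im \<phi>1)) = exp \<phi>1"
      unfolding exp_add[symmetric] by (simp add: complex_eq[symmetric])
    also have "(of_real B + \<i>)^4 / (of_real (B^2 + 1))^2 * exp \<phi>1 = of_real (A^2 * B^2 / 4) / Q^2"
    proof -
      have "x^4 / (x * y)^2 * (r * y^2 / (x^2 * z^2)) = r / z^2" if "x \<noteq> 0" "y \<noteq> 0" for x y z r :: complex
        using that by (simp add: field_simps power2_eq_square power4_eq_xxxx)
      from this[OF B0] show ?thesis unfolding e1 BB Q_def .
    qed
    finally have Q2: "exp (\<i> * of_real \<phi>2) * exp (of_real (Re \<phi>1)) = of_real (A^2 * B^2 / 4) / Q^2" .
    have r2: "complex_of_real (\<rho>^2) * exp (of_real (Re \<phi>1)) = 1"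
    proof -
      have "\<rho>^2 = exp (- Re \<phi>1)" by (simp add: \<rho>_def power2_eq_square exp_add[symmetric])
      then show ?thesis by (simp add: exp_of_real exp_minus flip: of_real_mult)
    qed
    have w: "(of_real c - \<i> * of_real s)^2 * exp (\<i> * of_real \<phi>2) = 1"
    proof -
      have "of_real c - \<i> * of_real s = exp (- (\<i> * of_real (\<phi>2 / 2)))"
        by (rule complex_eqI) (simp_all add: c_def s_def Re_exp Im_exp)
      then show ?thesis by (simp add: power2_eq_square exp_add[symmetric])
    qed
    have "W^2 * (exp (\<i> * of_real \<phi>2) * exp (of_real (Re \<phi>1)))
        = of_real (A^2 * B^2 / 4) * (complex_of_real (\<rho>^2) * exp (of_real (Re \<phi>1)))
          * ((of_real c - \<i> * of_real s)^2 * exp (\<i> * of_real \<phi>2))"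
    proof -
      have "(complex_of_real (A * B / 2 * \<rho>))^2 = of_real (A^2 * B^2 / 4) * of_real (\<rho>^2)"
        by (simp add: power2_eq_square)
      then show ?thesis unfolding W_def power_mult_distrib by simp
    qed
    then have "W^2 * (of_real (A^2 * B^2 / 4) / Q^2) = of_real (A^2 * B^2 / 4)"
      unfolding Q2 r2 w by simp
    moreover have "complex_of_real (A^2 * B^2 / 4) \<noteq> 0" using pos by simp
    moreover have "Q^2 = W^2" if "W^2 * (r / Q^2) = r" "r \<noteq> 0" for r
      using that Q0 by (simp add: field_simps)
    ultimately show ?thesis by blast
  qed
  \<comment> \<open>The range of \<phi>2 puts \<open>\<phi>2 / 2\<close> between 0 and
    \<open>pi\<close>, where the sine is nonnegative; so \<open>- W\<close> cannot have negative
    imaginary part.\<close>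
  then have "Q = W \<or> Q = - W" by (simp add: power2_eq_iff)
  moreover have "0 \<le> s" unfolding s_def using range by (intro sin_ge_zero) auto
  moreover have "Im Q < 0" using pos by (simp add: Q_def)
  moreover have "Im W = - (A * B / 2 * \<rho> * s)" by (simp add: W_def)
  moreover have "0 \<le> A * B / 2 * \<rho> * s" using \<open>0 \<le> s\<close> pos \<rho> by simp
  ultimately have QW: "Q = W" by auto
  have im: "2 * m * B = A * B / 2 * \<rho> * s" using arg_cong[OF QW, of Im] by (simp add: Q_def W_def)
  have re: "B^2 - n = A * B / 2 * \<rho> * c" using arg_cong[OF QW, of Re] by (simp add: Q_def W_def)
  have m: "m = A * \<rho> * s / 4"
  proof -
    have "B * m = B * (A * \<rho> * s / 4)" using im by (simp add: mult_ac)
    then show ?thesis using pos by simp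
  qed
  \<comment> \<open>Strictness comes from \<open>0 < m\<close>, that is, from zeros above the real
    line; it is what excludes \<open>\<phi>2 = 0\<close>.\<close>
  have s: "0 < s"
  proof (rule ccontr)
    assume "\<not> 0 < s"
    then have "A * \<rho> * s \<le> 0" using pos \<rho> by (simp add: mult_le_0_iff)
    then show False using m pos by simp
  qed
  show ne: "\<phi>2 \<noteq> 0" using s by (auto simp: s_def)
  have cos2: "1 - cos \<phi>2 = 2 * s^2" using cos_double_sin[of "\<phi>2 / 2"] by (simp add: s_def)
  have sin2: "sin \<phi>2 = 2 * s * c" using sin_double[of "\<phi>2 / 2"] by (simp add: s_def c_def)
  have "sqrt (2 * (1 - cos \<phi>2)) = 2 * s"
    unfolding cos2 using s by (intro real_sqrt_unique) (auto simp: power_mult_distrib)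
  then show dm: "d1 = m" unfolding d1 m \<rho>_def[symmetric] by simp
  have "sqrt (1 - cos \<phi>2) = sqrt 2 * s" unfolding cos2 using s by (simp add: real_sqrt_mult)
  then have t: "sqrt 2 * A * B * \<rho> / (4 * sqrt (1 - cos \<phi>2)) * sin \<phi>2 = A * B / 2 * \<rho> * c"
    unfolding sin2 using s by (simp add: field_simps)
  show "d2 = m^2 - n" using d2[OF ne] re unfolding dm \<rho>_def[symmetric] t by linarith
qed

text \<open>As \<open>norm (B + \<i>)\<^sup>4 = (B\<^sup>2 + 1)\<^sup>2\<close>, the prefactor is
  the pure phase \<open>exp (4 \<i> Arg (B + \<i>))\<close>. Another branch of the argument would
  shift the angle by a multiple of \<open>8 pi\<close>, to which the quantifier over
  \<open>n\<close> is insensitive.\<close>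

lemma nonzero_angle_iff:
  fixes B \<phi>2 :: real and \<phi>1 :: complex
  assumes e: "exp (\<i> * of_real \<phi>2) = (of_real B + \<i>)^4 / (of_real (B^2 + 1))^2 * exp (\<i> * of_real (Im \<phi>1))"
    and range: "0 \<le> \<phi>2" "\<phi>2 < 2 * pi"
  shows "\<phi>2 \<noteq> 0 \<longleftrightarrow> (\<forall>n::int. 4 * Arg (of_real B + \<i>) + Im \<phi>1 \<noteq> 2 * pi * of_int n)"
proof -
  let ?z = "complex_of_real B + \<i>"
  have z: "?z \<noteq> 0" by (auto simp: complex_eq_iff)
  have "B^2 + 1 \<noteq> 0" by (smt (verit) zero_le_power2)
  then have B1: "complex_of_real (B^2 + 1) \<noteq> 0" by (simp only: of_real_eq_0_iff not_False_eq_True)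
  have nz: "norm ?z^2 = B^2 + 1" by (simp add: cmod_power2)
  have "?z^4 = (of_real (norm ?z) * exp (\<i> * Arg ?z))^4" using Arg_eq[OF z] by simp
  also have "\<dots> = of_real ((norm ?z^2)^2) * exp (\<i> * of_real (4 * Arg ?z))"
    by (simp add: power_mult_distrib exp_of_nat_mult[symmetric] mult_ac flip: power_mult)
  finally have "?z^4 / (of_real (B^2 + 1))^2 = exp (\<i> * of_real (4 * Arg ?z))"
    unfolding nz of_real_power by (simp only: nonzero_mult_div_cancel_left[OF power_not_zero[OF B1]])
  then have E: "exp (\<i> * of_real \<phi>2) = exp (\<i> * of_real (4 * Arg ?z + Im \<phi>1))"
    unfolding e by (simp add: exp_add distrib_left)
  have one: "exp (\<i> * of_real x) = 1 \<longleftrightarrow> (\<exists>n::int. x = 2 * pi * of_int n)" for x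
    unfolding exp_eq_1 by (simp add: mult_ac)
  have "\<phi>2 = 0 \<longleftrightarrow> exp (\<i> * of_real \<phi>2) = 1"
  proof
    assume "exp (\<i> * of_real \<phi>2) = 1"
    then obtain n :: int where n: "\<phi>2 = 2 * pi * of_int n" unfolding one by blast
    have "0 \<le> real_of_int n" using range(1) unfolding n by (simp add: zero_le_mult_iff not_le[THEN iffD2, OF pi_gt_zero])
    moreover have "real_of_int n < 1" using range(2) unfolding n by simp
    ultimately show "\<phi>2 = 0" using n by simp
  qed simp
  then show ?thesis unfolding E one by blast
qed

theorem proposition2p4:
  fixes A B :: real
    and u0 :: "real \<Rightarrow> real"
    and \<Psi>1 \<Psi>2 :: "real \<Rightarrow> complex \<Rightarrow> complex^2^2"
    and a1 a2 b :: "complex \<Rightarrow> complex"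
    and \<phi>1 :: complex and \<phi>2 d1 d2 :: real
  assumes "A > 0" and "B > 0"
    and "admissible_data A B u0"
    and "is_Psi1 A B u0 \<Psi>1" and "is_Psi2 A B u0 \<Psi>2"
    and a1: "a1 = spec_a1 \<Psi>1 \<Psi>2" and a2: "a2 = spec_a2 \<Psi>1 \<Psi>2" and b: "b = spec_b \<Psi>1 \<Psi>2"
    and \<phi>1: "\<phi>1 = phi_1 B b"
    and \<phi>2: "exp (\<i> * of_real \<phi>2) =
               (of_real B + \<i>)^4 / (of_real (B^2 + 1))^2 * exp (\<i> * of_real (Im \<phi>1))"
            "0 \<le> \<phi>2" "\<phi>2 < 2 * pi"
    and d1: "d1 = A / 8 * sqrt (2 * (1 - cos \<phi>2)) * exp (- Re (\<phi>1 / 2))"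
    and d2: "\<phi>2 \<noteq> 0 \<Longrightarrow>
               d2 = d1^2 - B^2
                    + sqrt 2 * A * B * exp (- Re (\<phi>1 / 2)) / (4 * sqrt (1 - cos \<phi>2)) * sin \<phi>2"
  shows
    "((\<exists>k1 k2. case_I B a1 a2 k1 k2) \<or> (\<exists>p1. case_II B a1 a2 p1) \<or> (\<exists>l1. case_III B a1 a2 l1)
        \<longrightarrow> \<phi>2 \<noteq> 0 \<and>
            (\<phi>2 \<noteq> 0 \<longleftrightarrow>
              (\<forall>n::int. 4 * Arg (of_real B + \<i>) + Im \<phi>1 \<noteq> 2 * pi * of_int n)))
     \<and> (\<forall>k1 k2. case_I B a1 a2 k1 k2 \<longrightarrow>
          0 < d2 \<and> d2 < d1^2 \<and>
          k1 = d1 - sqrt d2 \<and> k2 = d1 + sqrt d2 \<and>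
          (\<forall>k. Im k > 0 \<longrightarrow>
             a1 k = (k - \<i> * of_real k1) * (k - \<i> * of_real k2) * (k + \<i>)^2
                    / (k^2 - (of_real B)^2)^2 * exp (phi B b k)) \<and>
          (\<forall>k. Im k < 0 \<longrightarrow>
             a2 k = (k - \<i>)^2 / ((k - \<i> * of_real k1) * (k - \<i> * of_real k2))
                    * exp (- phi B b k)))
     \<and> (\<forall>p1. case_II B a1 a2 p1 \<longrightarrow>
          d2 < 0 \<and>
          p1 = - of_real (sqrt (- d2)) + \<i> * of_real d1 \<and>
          (\<forall>k. Im k > 0 \<longrightarrow>
             a1 k = (k - p1) * (k + cnj p1) * (k + \<i>)^2
                    / (k^2 - (of_real B)^2)^2 * exp (phi B b k)) \<and>
          (\<forall>k. Im k < 0 \<longrightarrow>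
             a2 k = (k - \<i>)^2 / ((k - p1) * (k + cnj p1)) * exp (- phi B b k)))
     \<and> (\<forall>l1. case_III B a1 a2 l1 \<longrightarrow>
          d2 = 0 \<and>
          l1 = d1 \<and>
          (\<forall>k. Im k > 0 \<longrightarrow>
             a1 k = (k - \<i> * of_real l1)^2 * (k + \<i>)^2
                    / (k^2 - (of_real B)^2)^2 * exp (phi B b k)) \<and>
          (\<forall>k. Im k < 0 \<longrightarrow>
             a2 k = (k - \<i>)^2 / (k - \<i> * of_real l1)^2 * exp (- phi B b k)))"
proof -
  interpret scattering A B u0 \<Psi>1 \<Psi>2
    using assms(1-5) by unfold_locales
  \<comment> \<open>The zeros enter only through their sum and product. As roots they are
    \<open>\<i> m\<close> plus or minus \<open>\<i>\<close> times a square root of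
    \<open>m\<^sup>2 - n\<close>, so \<open>d2\<close> is the discriminant whose sign separates the
    three cases.\<close>
  have core: "\<phi>2 \<noteq> 0 \<and> d1 = m \<and> d2 = m^2 - n
      \<and> (\<forall>k. 0 < Im k \<longrightarrow> a1 k = (k - p) * (k - q) * (k + \<i>)^2 / (k^2 - (of_real B)^2)^2 * exp (phi B b k))
      \<and> (\<forall>k. Im k < 0 \<longrightarrow> a2 k = (k - \<i>)^2 / ((k - p) * (k - q)) * exp (- phi B b k))"
    if sym: "p + q = \<i> * of_real (2 * m)" "p * q = - of_real n"
      and im: "0 < m" "0 < Im p" "0 < Im q"
      and zs: "{k \<in> upper_dom B. a1 k = 0} = {p, q}"
      and ord: "if p = q then zorder a1 p = 2 else zorder a1 p = 1 \<and> zorder a1 q = 1"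
      and nz: "\<forall>k. Im k \<le> 0 \<longrightarrow> a2 k \<noteq> 0"
    for p q :: complex and m n :: real
  proof -
    note fz = factorization[OF im(2,3) zs[unfolded a1] ord[unfolded a1] nz[unfolded a2, rule_format],
        folded a1 a2 b]
    have "(of_real B - p) * (of_real B - q) = (of_real B)^2 - of_real B * (p + q) + p * q"
      by (simp add: power2_eq_square algebra_simps)
    also have "\<dots> = of_real (B^2 - n) - \<i> * of_real (2 * m * B)" unfolding sym by simp
    finally have Q: "(of_real B - p) * (of_real B - q) = of_real (B^2 - n) - \<i> * of_real (2 * m * B)" .
    have e1: "exp \<phi>1 = of_real (A^2 * B^2 / 4) * (of_real B - \<i>)^2
        / ((of_real B + \<i>)^2 * (of_real (B^2 - n) - \<i> * of_real (2 * m * B))^2)"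
      using fz(3) unfolding \<phi>1 Q by simp
    show ?thesis
      using parameters_of_zeros[OF assms(1,2) im(1) e1 \<phi>2 d1 d2] fz(1,2) by blast
  qed
  have I: "\<phi>2 \<noteq> 0 \<and> 0 < d2 \<and> d2 < d1^2 \<and> k1 = d1 - sqrt d2 \<and> k2 = d1 + sqrt d2
      \<and> (\<forall>k. 0 < Im k \<longrightarrow> a1 k = (k - \<i> * of_real k1) * (k - \<i> * of_real k2) * (k + \<i>)^2
            / (k^2 - (of_real B)^2)^2 * exp (phi B b k))
      \<and> (\<forall>k. Im k < 0 \<longrightarrow> a2 k = (k - \<i>)^2 / ((k - \<i> * of_real k1) * (k - \<i> * of_real k2)) * exp (- phi B b k))"
    if "case_I B a1 a2 k1 k2" for k1 k2
  proof -
    have k: "0 < k1" "k1 < k2" using that by (auto simp: case_I_def)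
    have sym: "\<i> * of_real k1 + \<i> * of_real k2 = \<i> * of_real (2 * ((k1 + k2) / 2))"
      "\<i> * of_real k1 * (\<i> * of_real k2) = - of_real (k1 * k2)"
      by (simp_all add: complex_eq_iff)
    have c: "\<phi>2 \<noteq> 0 \<and> d1 = (k1 + k2) / 2 \<and> d2 = ((k1 + k2) / 2)^2 - k1 * k2
      \<and> (\<forall>k. 0 < Im k \<longrightarrow> a1 k = (k - \<i> * of_real k1) * (k - \<i> * of_real k2) * (k + \<i>)^2
            / (k^2 - (of_real B)^2)^2 * exp (phi B b k))
      \<and> (\<forall>k. Im k < 0 \<longrightarrow> a2 k = (k - \<i>)^2 / ((k - \<i> * of_real k1) * (k - \<i> * of_real k2)) * exp (- phi B b k))"
      by (rule core[OF sym]) (use that k in \<open>auto simp: case_I_def\<close>)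
    then have d: "d1 = (k1 + k2) / 2" "d2 = ((k1 + k2) / 2)^2 - k1 * k2" by blast+
    have d2': "d2 = ((k2 - k1) / 2)^2" unfolding d(2) by (simp add: power2_eq_square field_simps)
    have "sqrt d2 = (k2 - k1) / 2" unfolding d2' using k by simp
    then have "k1 = d1 - sqrt d2" "k2 = d1 + sqrt d2" unfolding d(1) by (simp_all add: field_simps)
    moreover have "d2 < d1^2" unfolding d using k by simp
    moreover have "0 < d2" using d2' k by simp
    ultimately show ?thesis using c by blast
  qed
  have II: "\<phi>2 \<noteq> 0 \<and> d2 < 0 \<and> p1 = - of_real (sqrt (- d2)) + \<i> * of_real d1
      \<and> (\<forall>k. 0 < Im k \<longrightarrow> a1 k = (k - p1) * (k + cnj p1) * (k + \<i>)^2 / (k^2 - (of_real B)^2)^2 * exp (phi B b k))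
      \<and> (\<forall>k. Im k < 0 \<longrightarrow> a2 k = (k - \<i>)^2 / ((k - p1) * (k + cnj p1)) * exp (- phi B b k))"
    if "case_II B a1 a2 p1" for p1
  proof -
    have p: "Re p1 < 0" "0 < Im p1" using that by (auto simp: case_II_def)
    have "p1 \<noteq> - cnj p1" using p by (auto simp: complex_eq_iff)
    have sym: "p1 + - cnj p1 = \<i> * of_real (2 * Im p1)" "p1 * - cnj p1 = - of_real ((Re p1)^2 + (Im p1)^2)"
      by (simp_all add: complex_eq_iff power2_eq_square)
    have c: "\<phi>2 \<noteq> 0 \<and> d1 = Im p1 \<and> d2 = (Im p1)^2 - ((Re p1)^2 + (Im p1)^2)
      \<and> (\<forall>k. 0 < Im k \<longrightarrow> a1 k = (k - p1) * (k - - cnj p1) * (k + \<i>)^2 / (k^2 - (of_real B)^2)^2 * exp (phi B b k))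
      \<and> (\<forall>k. Im k < 0 \<longrightarrow> a2 k = (k - \<i>)^2 / ((k - p1) * (k - - cnj p1)) * exp (- phi B b k))"
      by (rule core[OF sym]) (use that p \<open>p1 \<noteq> - cnj p1\<close> in \<open>auto simp: case_II_def\<close>)
    then have d: "d1 = Im p1" "d2 = (Im p1)^2 - ((Re p1)^2 + (Im p1)^2)" by blast+
    have d2': "d2 = - ((Re p1)^2)" unfolding d(2) by simp
    \<comment> \<open>The sign reflects that \<open>p1\<close> names the zero in the left
      half-plane.\<close>
    have "sqrt (- d2) = - Re p1" unfolding d2' using p by simp
    then have "p1 = - of_real (sqrt (- d2)) + \<i> * of_real d1" unfolding d(1) by (simp add: complex_eq_iff)
    moreover have "d2 < 0" unfolding d2' using p by simp
    ultimately show ?thesis using c unfolding diff_minus_eq_add by blast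
  qed
  have III: "\<phi>2 \<noteq> 0 \<and> d2 = 0 \<and> l1 = d1
      \<and> (\<forall>k. 0 < Im k \<longrightarrow> a1 k = (k - \<i> * of_real l1)^2 * (k + \<i>)^2 / (k^2 - (of_real B)^2)^2 * exp (phi B b k))
      \<and> (\<forall>k. Im k < 0 \<longrightarrow> a2 k = (k - \<i>)^2 / (k - \<i> * of_real l1)^2 * exp (- phi B b k))"
    if "case_III B a1 a2 l1" for l1
  proof -
    have sym: "\<i> * of_real l1 + \<i> * of_real l1 = \<i> * of_real (2 * l1)"
      "\<i> * of_real l1 * (\<i> * of_real l1) = - of_real (l1^2)"
      by (simp_all add: complex_eq_iff power2_eq_square)
    have c: "\<phi>2 \<noteq> 0 \<and> d1 = l1 \<and> d2 = l1^2 - l1^2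
      \<and> (\<forall>k. 0 < Im k \<longrightarrow> a1 k = (k - \<i> * of_real l1) * (k - \<i> * of_real l1) * (k + \<i>)^2
            / (k^2 - (of_real B)^2)^2 * exp (phi B b k))
      \<and> (\<forall>k. Im k < 0 \<longrightarrow> a2 k = (k - \<i>)^2 / ((k - \<i> * of_real l1) * (k - \<i> * of_real l1)) * exp (- phi B b k))"
      by (rule core[OF sym]) (use that in \<open>auto simp: case_III_def\<close>)
    then have "d1 = l1" "d2 = l1^2 - l1^2" by blast+
    then show ?thesis using c unfolding power2_eq_square by simp
  qed
  show ?thesis
    using I II III nonzero_angle_iff[OF \<phi>2] by blast
qed

end
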